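(* Let $\alpha>0$ and let $q_0\in\mathcal M(\mathbb R^2)$. Then there exists a unique global weak solution $(\eta^\alpha,u^\alpha,q)$ of the system $$\partial_t q+u^\alpha\cdot\operatorname{grad} q=0,\qquad u^\alpha=K^\alpha*q,\qquad q(0)=q_0,$$ with $$\eta^\alpha\in C^1(\mathbb R;\mathcal G),\qquad u^\alpha\in C^0(\mathbb R;C^0_{\mathrm{div}}(\mathbb R^2,\mathbb R^2)),\qquad q\in C^0(\mathbb R;\mathcal M(\mathbb R^2)).$$ As a consequence, the co-Adjoint action and the weak co-adjoint action are conserved: $\operatorname{Ad}^*_{\eta^\alpha_t}(q_t)=q_t\circ\eta^\alpha_t=q_0$ for all $t\in\mathbb R$, and $\operatorname{w-ad}^*_{u^\alpha}(q)=0$.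
   Context: $\mathcal M(\mathbb R^2)$ is the space of finite signed Radon measures on $\mathbb R^2$ with total variation norm $\|\cdot\|_{\mathcal M}$; weak convergence in $\mathcal M(\mathbb R^2)$ means convergence tested against continuous functions on $\mathbb R^2$ vanishing at infinity, and $C^0(\mathbb R;\mathcal M(\mathbb R^2))$ denotes curves continuous in this weak topology. $\mathcal G$ is the group of all homeomorphisms of $\mathbb R^2$ preserving Lebesgue measure; $e\in\mathcal G$ is the identity. $\eta\in C^1(\mathbb R;\mathcal G)$ means that $\eta_t=\eta(\cdot,t)\in\mathcal G$ for every $t$, that $(\eta_{t+h}-\eta_t)/h$ converges uniformly on $\mathbb R^2$ as $h\to0$ to a limit $\partial_t\eta_t$, and that $\partial_t\eta_t$ is continuous in $t$ with respect to the distance $\sup_{x}|\cdot|$. $C^0_{\mathrm{div}}(\mathbb R^2,\mathbb R^2)$ is the space of continuous vector fields on $\mathbb R^2$ that are divergence-free in the sense of distributions; $C^0(\mathbb R;C^0_{\mathrm{div}})$ denotes curves in it that are continuous in $t$ with respect to the distance $\sup_x|\cdot|$. The kernel is $K^\alpha(x,y)=\nabla_x^\perp G^\alpha(|x-y|)$, where $\nabla^\perp=(-\partial_2,\partial_1)$, $$G^\alpha(r)=\frac1{2\pi}K_0\Big(\frac r\alpha\Big)+\frac1{2\pi}\ln r,$$ and $K_0$ is the modified Bessel function of the second kind of order zero; $K^\alpha$ extends continuously by $K^\alpha(x,x)=0$. It is the integral kernel of the inverse of $(1-\alpha^2\Delta)\operatorname{curl}_{2D}$ with values in divergence-free fields.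 $(K^\alpha*q)(x)=\int_{\mathbb R^2}K^\alpha(x,y)\,dq(y)$. A (global) weak solution is a triple $(\eta^\alpha,u^\alpha,q)$ such that $q(0)=q_0$, $u^\alpha(\cdot,t)=K^\alpha*q_t$ for all $t$, $\eta^\alpha$ is the flow map of $u^\alpha$, i.e. $\partial_t\eta^\alpha(x,t)=u^\alpha(\eta^\alpha(x,t),t)$ and $\eta^\alpha(x,0)=x$, and $$\int_{\mathbb R}\int_{\mathbb R^2}\big(\partial_t\phi+u^\alpha\cdot\operatorname{grad}\phi\big)\,dq_t(x)\,dt=0\quad\text{for all }\phi\in C_0^\infty(\mathbb R\times\mathbb R^2),$$ where $C_0^\infty$ denotes smooth compactly supported functions. For $\eta\in\mathcal G$ and $q\in\mathcal M(\mathbb R^2)$, $\operatorname{Ad}^*_\eta(q)=q\circ\eta$ is the measure with $\int\phi\,d(q\circ\eta)=\int\phi\circ\eta^{-1}\,dq$ (composition of the density with $\eta$ when $q$ has a density). The weak co-adjoint action $\operatorname{w-ad}^*_u(q)$ is the distribution on $\mathbb R\times\mathbb R^2$ given by $$\langle\operatorname{w-ad}^*_u(q),\phi\rangle=\int_{\mathbb R}\int_{\mathbb R^2}(\partial_t\phi+u\cdot\operatorname{grad}\phi)\,dq_t(x)\,dt,\quad\phi\in C_0^\infty(\mathbb R\times\mathbb R^2).$$ *)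

theory Defs
  imports "HOL-Analysis.Analysis"
begin

type_synonym plane = "real^2"

text \<open>
  A signed measure is a real-valued (hence finite) countably additive function on the Borel sets.
  It is set to 0 off the Borel sets, so that equality of signed measures is equality of functions.
\<close>

definition is_signed_measure :: "(plane set \<Rightarrow> real) \<Rightarrow> bool" where
  "is_signed_measure \<mu> \<longleftrightarrow>
     \<mu> {} = 0 \<and>
     (\<forall>A::nat \<Rightarrow> plane set. range A \<subseteq> sets borel \<and> disjoint_family A \<longrightarrow>
        (\<lambda>n. \<mu> (A n)) sums \<mu> (\<Union>n. A n)) \<and>
     (\<forall>A. A \<notin> sets borel \<longrightarrow> \<mu> A = 0)"

text \<open>
  The Jordan decomposition: the upper variation of \<open>A\<close> is the supremum of \<open>\<mu> B\<close> over Borel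
  \<open>B \<subseteq> A\<close>. As \<open>ennreal\<close> sends negative reals to 0 and \<open>B = {}\<close> is admitted, nothing is lost by
  taking the supremum in \<open>ennreal\<close>.
\<close>

definition pos_part :: "(plane set \<Rightarrow> real) \<Rightarrow> plane measure" where
  "pos_part \<mu> = measure_of UNIV (sets borel) (\<lambda>A. SUP B\<in>{B \<in> sets borel. B \<subseteq> A}. ennreal (\<mu> B))"

definition neg_part :: "(plane set \<Rightarrow> real) \<Rightarrow> plane measure" where
  "neg_part \<mu> = pos_part (\<lambda>A. - \<mu> A)"

definition variation :: "(plane set \<Rightarrow> real) \<Rightarrow> plane set \<Rightarrow> ennreal" where
  "variation \<mu> A = emeasure (pos_part \<mu>) A + emeasure (neg_part \<mu>) A"

definition radon_measures :: "(plane set \<Rightarrow> real) set" where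
  "radon_measures =
     {\<mu>. is_signed_measure \<mu> \<and>
         (\<forall>A\<in>sets borel. \<forall>\<epsilon>>0. \<exists>C. compact C \<and> C \<subseteq> A \<and> variation \<mu> (A - C) < ennreal \<epsilon>)}"

definition sint :: "(plane set \<Rightarrow> real) \<Rightarrow> (plane \<Rightarrow> 'b::{banach, second_countable_topology}) \<Rightarrow> 'b" where
  "sint \<mu> f = (LINT x|pos_part \<mu>. f x) - (LINT x|neg_part \<mu>. f x)"

definition C0_vanishing :: "(plane \<Rightarrow> real) set" where
  "C0_vanishing = {\<phi>. continuous_on UNIV \<phi> \<and> (\<phi> \<longlongrightarrow> 0) at_infinity}"

definition weakly_continuous_curve :: "(real \<Rightarrow> plane set \<Rightarrow> real) \<Rightarrow> bool" where
  "weakly_continuous_curve q \<longleftrightarrow>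
     (\<forall>t. q t \<in> radon_measures) \<and>
     (\<forall>\<phi>\<in>C0_vanishing. continuous_on UNIV (\<lambda>t. sint (q t) \<phi>))"

primrec C_k :: "nat \<Rightarrow> ('a::euclidean_space \<Rightarrow> real) \<Rightarrow> bool" where
  "C_k 0 f \<longleftrightarrow> continuous_on UNIV f"
| "C_k (Suc k) f \<longleftrightarrow>
     (\<forall>x. f differentiable (at x)) \<and> (\<forall>b\<in>Basis. C_k k (\<lambda>x. frechet_derivative f (at x) b))"

definition test_functions :: "('a::euclidean_space \<Rightarrow> real) set" where
  "test_functions = {\<phi>. (\<forall>k. C_k k \<phi>) \<and> compact (closure {x. \<phi> x \<noteq> 0})}"

definition partial :: "2 \<Rightarrow> (plane \<Rightarrow> real) \<Rightarrow> plane \<Rightarrow> real" where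
  "partial i f x = frechet_derivative f (at x) (axis i 1)"

definition grad :: "(plane \<Rightarrow> real) \<Rightarrow> plane \<Rightarrow> plane" where
  "grad f x = vector [partial 1 f x, partial 2 f x]"

definition perp_grad :: "(plane \<Rightarrow> real) \<Rightarrow> plane \<Rightarrow> plane" where
  "perp_grad f x = vector [- partial 2 f x, partial 1 f x]"

definition C0_div :: "(plane \<Rightarrow> plane) set" where
  "C0_div = {v. continuous_on UNIV v \<and>
                (\<forall>\<phi>\<in>test_functions. (LINT x|lborel. v x \<bullet> grad \<phi> x) = 0)}"

text \<open>
  \<open>uniform_limit UNIV\<close> is convergence with respect to the (possibly infinite) sup-distance.
\<close>

definition C0_curve_div :: "(real \<Rightarrow> plane \<Rightarrow> plane) \<Rightarrow> bool" where
  "C0_curve_div u \<longleftrightarrow> (\<forall>t. u t \<in> C0_div) \<and> (\<forall>t. uniform_limit UNIV u (u t) (at t))"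

definition vol_homeos :: "(plane \<Rightarrow> plane) set" where
  "vol_homeos = {\<eta>. (\<exists>\<xi>. homeomorphism UNIV UNIV \<eta> \<xi>) \<and> distr lborel lborel \<eta> = lborel}"

definition C1_curve_homeos :: "(real \<Rightarrow> plane \<Rightarrow> plane) \<Rightarrow> bool" where
  "C1_curve_homeos \<eta> \<longleftrightarrow>
     (\<forall>t. \<eta> t \<in> vol_homeos) \<and>
     (\<exists>\<eta>'. (\<forall>t. uniform_limit UNIV (\<lambda>h x. (\<eta> (t + h) x - \<eta> t x) /\<^sub>R h) (\<eta>' t) (at 0)) \<and>
           (\<forall>t. uniform_limit UNIV \<eta>' (\<eta>' t) (at t)))"

text \<open>
  The modified Bessel function of the second kind of order zero, for \<open>z > 0\<close>, by its standard
  integral representation.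
\<close>

definition bessel_K0 :: "real \<Rightarrow> real" where
  "bessel_K0 z = (LBINT t:{0..}. exp (- z * cosh t))"

definition G_alpha :: "real \<Rightarrow> real \<Rightarrow> real" where
  "G_alpha \<alpha> r = 1 / (2 * pi) * bessel_K0 (r / \<alpha>) + 1 / (2 * pi) * ln r"

definition K_alpha :: "real \<Rightarrow> plane \<Rightarrow> plane \<Rightarrow> plane" where
  "K_alpha \<alpha> x y = (if x = y then 0 else perp_grad (\<lambda>z. G_alpha \<alpha> (norm (z - y))) x)"

definition K_conv :: "real \<Rightarrow> (plane set \<Rightarrow> real) \<Rightarrow> plane \<Rightarrow> plane" where
  "K_conv \<alpha> q x = sint q (\<lambda>y. K_alpha \<alpha> x y)"

definition Ad_star :: "(plane \<Rightarrow> plane) \<Rightarrow> (plane set \<Rightarrow> real) \<Rightarrow> plane set \<Rightarrow> real" where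
  "Ad_star \<eta> q =
     (THE \<nu>. \<nu> \<in> radon_measures \<and> (\<forall>\<phi>\<in>C0_vanishing. sint \<nu> \<phi> = sint q (\<phi> \<circ> inv \<eta>)))"

definition w_ad_star ::
  "(real \<Rightarrow> plane \<Rightarrow> plane) \<Rightarrow> (real \<Rightarrow> plane set \<Rightarrow> real) \<Rightarrow> (real \<times> plane \<Rightarrow> real) \<Rightarrow> real" where
  "w_ad_star u q \<phi> =
     (LINT t|lborel. sint (q t)
        (\<lambda>x. deriv (\<lambda>s. \<phi> (s, x)) t + u t x \<bullet> grad (\<lambda>y. \<phi> (t, y)) x))"

definition flow_map :: "(real \<Rightarrow> plane \<Rightarrow> plane) \<Rightarrow> (real \<Rightarrow> plane \<Rightarrow> plane) \<Rightarrow> bool" where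
  "flow_map u \<eta> \<longleftrightarrow>
     (\<forall>x. \<eta> 0 x = x) \<and>
     (\<forall>x t. ((\<lambda>s. \<eta> s x) has_vector_derivative u t (\<eta> t x)) (at t))"

definition weak_solution ::
  "real \<Rightarrow> (plane set \<Rightarrow> real) \<Rightarrow>
   (real \<Rightarrow> plane \<Rightarrow> plane) \<Rightarrow> (real \<Rightarrow> plane \<Rightarrow> plane) \<Rightarrow> (real \<Rightarrow> plane set \<Rightarrow> real) \<Rightarrow> bool" where
  "weak_solution \<alpha> q0 \<eta> u q \<longleftrightarrow>
     (\<forall>t. q t \<in> radon_measures) \<and>
     q 0 = q0 \<and>
     (\<forall>t. u t = K_conv \<alpha> (q t)) \<and>
     flow_map u \<eta> \<and>
     (\<forall>\<phi>\<in>test_functions.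
        (LINT t|lborel. sint (q t)
           (\<lambda>x. deriv (\<lambda>s. \<phi> (s, x)) t + u t x \<bullet> grad (\<lambda>y. \<phi> (t, y)) x)) = 0)"

end

theory Submission
  imports Defs
begin

text \<open>Substituting in \<open>K\<^sub>1\<close> writes the kernel as a superposition of Gaussian vortices,
  \<open>K\<^sup>\<alpha>(x, y) = c \<integral> w(v) exp (- v |x - y|\<^sup>2 / (4 \<alpha>\<^sup>2)) (x - y)\<^sup>\<bottom> dv\<close> with \<open>0 \<le> w(v) \<le> min (1, 1 / v)\<close>. Cutting the
  integral at \<open>v = 1 / e\<^sup>2\<close> costs \<open>O(e)\<close> and leaves a divergence-free field with derivative
  \<open>O(1 - ln e)\<close>, so \<open>K\<^sup>\<alpha>\<close> is bounded and log-Lipschitz.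

  Existence: the particle displacement \<open>\<xi>\<^sub>t = \<eta>\<^sub>t - id\<close> solves an ordinary differential equation with
  log-Lipschitz right-hand side \<open>\<xi> \<mapsto> \<integral> K\<^sup>\<alpha>(x + \<xi>(x), y + \<xi>(y)) dq\<^sub>0(y)\<close> in the Banach space of bounded continuous
  fields. Euler's method with the cut kernels converges. Each Euler step changes volumes by a factor
  \<open>1 + O(h\<^sup>2 (1 - ln h)\<^sup>2)\<close>, so the limit flow preserves Lebesgue measure, and \<open>q\<^sub>t\<close> is the push-forward of
  \<open>q\<^sub>0\<close>.

  Uniqueness: let \<open>(\<eta>, u, q)\<close> be a weak solution and \<open>\<psi>\<^sub>t = f \<circ> \<eta>\<^sub>s \<circ> \<eta>\<^sub>t\<^sup>-\<^sup>1\<close> with \<open>f\<close> Lipschitz. The time derivative of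
  \<open>\<integral> (\<psi>\<^sub>t * \<rho>\<^sub>e) dq\<^sub>t\<close> is a commutator. For short times \<open>\<psi>\<^sub>t\<close> is Hoelder continuous of exponent \<open>1/2\<close>, so
  the commutator is \<open>O(e\<^sup>1\<^sup>/\<^sup>2 (1 - ln e))\<close>. Hence \<open>q\<^sub>t\<close> is transported by \<open>\<eta>\<^sub>t\<close>, the displacement of \<open>\<eta>\<close> solves
  the equation above, and Osgood's criterion applies.\<close>

section \<open>Signed measures and their Jordan decomposition\<close>

text \<open>The kernel just misses being Lipschitz, and this shapes every step. A contraction
  argument is not at hand, and bounded sets of displacements are not compact, so existence rests on
  comparing the Euler schemes of steps \<open>(1/2) ^ j\<close> and \<open>(1/2) ^ Suc j\<close>.
  The kernel is cut at the step size \<open>h\<close> itself: the cut then costs no more than a step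
  does, and the O(1 / h) steps up to a fixed time change volumes by a total factor 1 + O(h (1 - ln
  h)^2). The limit flow need not be differentiable, so volumes are compared through the schemes, and
  only by an inequality; the inverse flow, which belongs to the transported vorticity, supplies the
  converse.

  In the uniqueness part \<psi> is never differentiated: the equation is tested with bumps centred
  on moving particles and integrated over the particle labels, so only the oscillation of \<psi> on
  the scale of the bumps enters, and the divergence-free \<open>u\<close> gives the resulting kernel
  mean zero. A weak solution carries no explicit bound on total variations; local bounds come from
  weak continuity and uniform boundedness.\<close>

lemma signed_measure_empty: "is_signed_measure \<mu> \<Longrightarrow> \<mu> {} = 0"
  by (simp add: is_signed_measure_def)

lemma signed_measure_sums:
  "is_signed_measure \<mu> \<Longrightarrow> range A \<subseteq> sets borel \<Longrightarrow> disjoint_family A \<Longrightarrow>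
     (\<lambda>n. \<mu> (A n)) sums \<mu> (\<Union>n. A n)" for A :: "nat \<Rightarrow> plane set"
  by (simp add: is_signed_measure_def)

lemma signed_measure_Un:
  assumes "is_signed_measure \<mu>" "A \<in> sets borel" "B \<in> sets borel" "A \<inter> B = {}"
  shows "\<mu> (A \<union> B) = \<mu> A + \<mu> B"
proof -
  have "(\<lambda>n. \<mu> (binaryset A B n)) sums \<mu> (\<Union>n. binaryset A B n)"
    using assms by (intro signed_measure_sums)
      (auto simp: range_binaryset_eq disjoint_family_on_def binaryset_def)
  moreover have "(\<lambda>n. \<mu> (binaryset A B n)) sums (\<mu> A + \<mu> B)"
    using signed_measure_empty[OF assms(1)] by (rule binaryset_sums)
  ultimately show ?thesis
    by (simp add: UN_binaryset_eq sums_unique2)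
qed

lemma signed_measure_Diff:
  assumes "is_signed_measure \<mu>" "A \<in> sets borel" "B \<in> sets borel" "B \<subseteq> A"
  shows "\<mu> (A - B) = \<mu> A - \<mu> B"
  using signed_measure_Un[of \<mu> B "A - B"] assms by (simp add: Un_absorb1 Diff_partition)

lemma signed_measure_uminus:
  assumes "is_signed_measure \<mu>" shows "is_signed_measure (\<lambda>A. - \<mu> A)"
  using assms unfolding is_signed_measure_def by (auto intro: sums_minus)

lemma signed_measure_eqI:
  assumes "is_signed_measure \<mu>" "is_signed_measure \<nu>" "\<And>A. A \<in> sets borel \<Longrightarrow> \<mu> A = \<nu> A"
  shows "\<mu> = \<nu>"
proof
  show "\<mu> A = \<nu> A" for A
    using assms by (cases "A \<in> sets borel") (auto simp: is_signed_measure_def)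
qed

text \<open>The set function inside \<open>pos_part\<close>. It has a name of its own because
  \<open>measure_of\<close> returns it as a measure only once countable additivity is known
  (\<open>emeasure_pos_part\<close>).\<close>

definition upper_var :: "(plane set \<Rightarrow> real) \<Rightarrow> plane set \<Rightarrow> ennreal" where
  "upper_var \<mu> A = (SUP B\<in>{B \<in> sets borel. B \<subseteq> A}. ennreal (\<mu> B))"

lemma upper_var_mono: "A \<subseteq> B \<Longrightarrow> upper_var \<mu> A \<le> upper_var \<mu> B"
  unfolding upper_var_def by (rule SUP_subset_mono) auto

text \<open>Terms of either sign are allowed: \<open>ennreal\<close> replaces a negative term by 0,
  which can only raise the partial sums.\<close>

lemma ennreal_sums_le:
  assumes "f sums s" shows "ennreal s \<le> (\<Sum>n. ennreal (f n))"
proof (cases "(\<Sum>n. ennreal (f n)) = top")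
  case False
  then obtain S where S: "S \<ge> 0" "(\<Sum>n. ennreal (f n)) = ennreal S"
    using False by (cases "\<Sum>n. ennreal (f n)") auto
  have "(\<Sum>i<n. f i) \<le> S" for n
  proof -
    have "ennreal (\<Sum>i<n. f i) \<le> (\<Sum>i<n. ennreal (f i))"
    proof (induction n)
      case (Suc n)
      let ?s = "\<Sum>i<n. f i"
      have "ennreal (?s + f n) \<le> ennreal (max 0 ?s + max 0 (f n))"
        by (intro ennreal_leI) auto
      also have "\<dots> = ennreal ?s + ennreal (f n)"
        by (subst ennreal_plus) (auto simp: ennreal_max_0)
      also have "\<dots> \<le> (\<Sum>i<n. ennreal (f i)) + ennreal (f n)"
        using Suc by (rule add_right_mono)
      finally show ?case by simp
    qed simp
    also have "\<dots> \<le> ennreal S"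
      unfolding S(2)[symmetric] by (rule sum_le_suminf) auto
    finally show ?thesis using S by (simp add: ennreal_le_iff)
  qed
  then have "s \<le> S"
    using assms LIMSEQ_le_const2 unfolding sums_def by blast
  then show ?thesis using S by (simp add: ennreal_leI)
qed simp

context
  fixes \<mu> :: "plane set \<Rightarrow> real"
  assumes sm: "is_signed_measure \<mu>"
begin

lemma upper_var_super:
  assumes "A \<in> sets borel" "B \<in> sets borel" "A \<inter> B = {}"
  shows "upper_var \<mu> A + upper_var \<mu> B \<le> upper_var \<mu> (A \<union> B)"
proof -
  have *: "ennreal (\<mu> C) + ennreal (\<mu> D) \<le> upper_var \<mu> (A \<union> B)"
    if "C \<in> sets borel" "C \<subseteq> A" "D \<in> sets borel" "D \<subseteq> B" for C D
  proof -
    have le: "ennreal (\<mu> E) \<le> upper_var \<mu> (A \<union> B)" if "E \<in> sets borel" "E \<subseteq> A \<union> B" for E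
      unfolding upper_var_def using that by (intro SUP_upper) auto
    show ?thesis
    \<comment> \<open>A negative value becomes 0 in \<open>ennreal\<close>, and then the other set
      alone is a competitor for \<open>A \<union> B\<close>.\<close>
    proof (cases "\<mu> C \<ge> 0 \<and> \<mu> D \<ge> 0")
      case True
      then have "ennreal (\<mu> C) + ennreal (\<mu> D) = ennreal (\<mu> (C \<union> D))"
        using that assms by (subst signed_measure_Un[OF sm]) auto
      then show ?thesis using le[of "C \<union> D"] that by auto
    next
      case False
      then show ?thesis
        using le[of C] le[of D] that by (auto simp: ennreal_neg le_infI1 le_supI1 le_supI2)
    qed
  qed
  have ne: "{B \<in> sets borel. B \<subseteq> A} \<noteq> {}" for A :: "plane set" by auto
  have "upper_var \<mu> A + ennreal (\<mu> D) \<le> upper_var \<mu> (A \<union> B)"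
    if "D \<in> sets borel" "D \<subseteq> B" for D
    unfolding upper_var_def[of \<mu> A] ennreal_SUP_add_left[OF ne, symmetric]
    using * that by (intro SUP_least) auto
  then show ?thesis
    unfolding upper_var_def[of \<mu> B] ennreal_SUP_add_right[OF ne]
    by (intro SUP_least) auto
qed

text \<open>Superadditivity on finite unions gives one inequality; for the other, a competitor
  \<open>B\<close> for the union is split into the pieces \<open>A n \<inter> B\<close>.\<close>

lemma upper_var_countably_additive: "countably_additive (sets borel) (upper_var \<mu>)"
  unfolding countably_additive_def
proof (intro allI impI antisym)
  fix A :: "nat \<Rightarrow> plane set"
  assume A: "range A \<subseteq> sets borel" "disjoint_family A" "(\<Union>i. A i) \<in> sets borel"
  have fin: "(\<Sum>i<n. upper_var \<mu> (A i)) \<le> upper_var \<mu> (\<Union>i<n. A i)" for n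
  proof (induction n)
    case (Suc n)
    have "A i \<inter> A n = {}" if "i < n" for i
      using A(2) that unfolding disjoint_family_on_def by (metis UNIV_I less_irrefl)
    then have "(\<Union>i<n. A i) \<inter> A n = {}" by auto
    then have "upper_var \<mu> (\<Union>i<n. A i) + upper_var \<mu> (A n) \<le> upper_var \<mu> ((\<Union>i<n. A i) \<union> A n)"
      using A by (intro upper_var_super) auto
    also have "(\<Union>i<n. A i) \<union> A n = (\<Union>i<Suc n. A i)"
      by (auto simp: less_Suc_eq)
    finally have "upper_var \<mu> (\<Union>i<n. A i) + upper_var \<mu> (A n) \<le> upper_var \<mu> (\<Union>i<Suc n. A i)" .
    with add_right_mono[OF Suc] show ?case unfolding sum.lessThan_Suc by (rule order_trans)
  qed simp
  have "(\<Sum>i<n. upper_var \<mu> (A i)) \<le> upper_var \<mu> (\<Union>i. A i)" for n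
    using fin[of n] upper_var_mono[of "\<Union>i<n. A i" "\<Union>i. A i" \<mu>] by (meson UN_mono order_trans subset_UNIV order_refl)
  then show "(\<Sum>i. upper_var \<mu> (A i)) \<le> upper_var \<mu> (\<Union>i. A i)"
    by (intro suminf_le_const summableI)
  show "upper_var \<mu> (\<Union>i. A i) \<le> (\<Sum>i. upper_var \<mu> (A i))"
    unfolding upper_var_def[of \<mu> "\<Union>i. A i"]
  proof (rule SUP_least)
    fix B assume B: "B \<in> {B \<in> sets borel. B \<subseteq> (\<Union>i. A i)}"
    have "(\<lambda>n. \<mu> (A n \<inter> B)) sums \<mu> (\<Union>n. A n \<inter> B)"
      using A B by (intro signed_measure_sums[OF sm]) (auto simp: disjoint_family_on_def)
    moreover have "(\<Union>n. A n \<inter> B) = B" using B by auto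
    ultimately have "ennreal (\<mu> B) \<le> (\<Sum>n. ennreal (\<mu> (A n \<inter> B)))"
      using ennreal_sums_le by metis
    also have "\<dots> \<le> (\<Sum>n. upper_var \<mu> (A n))"
    proof (rule suminf_le)
      show "ennreal (\<mu> (A n \<inter> B)) \<le> upper_var \<mu> (A n)" for n
        using A B unfolding upper_var_def by (intro SUP_upper) auto
    qed (rule summableI)+
    finally show "ennreal (\<mu> B) \<le> (\<Sum>n. upper_var \<mu> (A n))" .
  qed
qed

lemma sets_pos_part[simp, measurable_cong]: "sets (pos_part \<mu>) = sets borel"
  and space_pos_part[simp]: "space (pos_part \<mu>) = UNIV"
  unfolding pos_part_def
  using sets.sets_measure_of_eq[of "borel :: plane measure"] sets.space_measure_of_eq[of "borel :: plane measure"]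
  by simp_all

lemma emeasure_pos_part:
  assumes "A \<in> sets borel"
  shows "emeasure (pos_part \<mu>) A = upper_var \<mu> A"
proof -
  have eq: "pos_part \<mu> = measure_of UNIV (sets borel) (upper_var \<mu>)"
    by (simp add: pos_part_def upper_var_def[abs_def])
  show ?thesis unfolding eq
  proof (rule emeasure_measure_of_sigma)
    show "sigma_algebra UNIV (sets (borel :: plane measure))"
      using sets.sigma_algebra_axioms[of borel] by simp
    have "{B \<in> sets borel. B \<subseteq> {}} = {{} :: plane set}" by auto
    then show "positive (sets borel) (upper_var \<mu>)"
      unfolding positive_def upper_var_def by (simp add: signed_measure_empty[OF sm])
  qed (use assms upper_var_countably_additive in auto)
qed

text \<open>If the upper variation were infinite, repeatedly splitting off a set on which
  \<open>\<bar>\<mu>\<bar> \<ge> 1\<close> and keeping a part of infinite variation would contradict \<open>\<sigma>\<close>-additivity.\<close>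

lemma upper_var_finite: "upper_var \<mu> UNIV < \<infinity>"
proof (rule ccontr)
  assume "\<not> upper_var \<mu> UNIV < \<infinity>"
  then have inf: "upper_var \<mu> UNIV = \<infinity>" by (simp add: less_top[symmetric])
  let ?P = "\<lambda>E. E \<in> sets borel \<and> upper_var \<mu> E = \<infinity>"
  have "\<exists>E. \<forall>n. ?P (E n) \<and> (E (Suc n) \<subseteq> E n \<and> \<bar>\<mu> (E n - E (Suc n))\<bar> \<ge> 1)"
  proof (rule dependent_nat_choice)
    show "\<exists>E. ?P E" using inf by (intro exI[of _ UNIV]) auto
    fix E :: "plane set" and n :: nat assume E: "?P E"
    \<comment> \<open>With this threshold both \<mu> B and \<mu> (E - B) are at least 1 in absolute
      value, so whichever of \<open>B\<close> and \<open>E - B\<close> keeps infinite variation, the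
      other can be split off.\<close>
    then have "ennreal (\<bar>\<mu> E\<bar> + 1) < upper_var \<mu> E" by simp
    then obtain B where B: "B \<in> sets borel" "B \<subseteq> E" "ennreal (\<bar>\<mu> E\<bar> + 1) < ennreal (\<mu> B)"
      unfolding upper_var_def less_SUP_iff by auto
    then have gt: "\<mu> B > \<bar>\<mu> E\<bar> + 1"
      by (metis abs_ge_zero add_nonneg_nonneg ennreal_less_iff zero_le_one)
    have EB: "\<mu> (E - B) = \<mu> E - \<mu> B" using B E by (intro signed_measure_Diff[OF sm]) auto
    have "upper_var \<mu> E = upper_var \<mu> B + upper_var \<mu> (E - B)"
    proof -
      have "emeasure (pos_part \<mu>) E = emeasure (pos_part \<mu>) B + emeasure (pos_part \<mu>) (E - B)"
        using B E by (subst plus_emeasure) (auto simp: Diff_partition Un_absorb1)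
      then show ?thesis using B E by (simp add: emeasure_pos_part sets.Diff)
    qed
    then consider "upper_var \<mu> B = \<infinity>" | "upper_var \<mu> (E - B) = \<infinity>"
      using E by (metis ennreal_add_eq_top infinity_ennreal_def)
    then show "\<exists>E'. ?P E' \<and> (E' \<subseteq> E \<and> \<bar>\<mu> (E - E')\<bar> \<ge> 1)"
    proof cases
      case 1
      then show ?thesis using B E EB gt by (intro exI[of _ B]) auto
    next
      case 2
      moreover have "E - (E - B) = B" using B by auto
      ultimately show ?thesis using B E EB gt by (intro exI[of _ "E - B"]) auto
    qed
  qed
  then obtain E where E: "\<And>n. ?P (E n)" "\<And>n. E (Suc n) \<subseteq> E n"
    "\<And>n. \<bar>\<mu> (E n - E (Suc n))\<bar> \<ge> 1" by blast
  have dec: "decseq E" using E(2) by (rule decseq_SucI)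
  have "disjoint_family (\<lambda>n. E n - E (Suc n))"
    unfolding disjoint_family_on_def
  proof (intro ballI impI)
    fix m n :: nat assume "m \<noteq> n"
    then show "(E m - E (Suc m)) \<inter> (E n - E (Suc n)) = {}"
    proof (induction m n rule: linorder_wlog)
      case (le a b)
      then have "E b \<subseteq> E (Suc a)" using decseqD[OF dec, of "Suc a" b] by auto
      then show ?case by auto
    qed auto
  qed
  then have "(\<lambda>n. \<mu> (E n - E (Suc n))) sums \<mu> (\<Union>n. E n - E (Suc n))"
    using E(1) by (intro signed_measure_sums[OF sm]) auto
  then have "(\<lambda>n. \<mu> (E n - E (Suc n))) \<longlonglongrightarrow> 0"
    using sums_summable summable_LIMSEQ_zero by blast
  from tendstoD[OF this, of 1] have "eventually (\<lambda>n. \<bar>\<mu> (E n - E (Suc n))\<bar> < 1) sequentially"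
    by (simp add: dist_real_def)
  then show False using E(3) by (auto simp: eventually_sequentially not_less[symmetric])
qed

lemma finite_pos_part: "finite_measure (pos_part \<mu>)"
  by (rule finite_measureI) (use upper_var_finite in \<open>auto simp: emeasure_pos_part\<close>)

lemma upper_var_le:
  assumes "A \<in> sets borel" shows "\<mu> A \<le> measure (pos_part \<mu>) A"
proof -
  have "ennreal (\<mu> A) \<le> emeasure (pos_part \<mu>) A"
    using assms by (auto simp: emeasure_pos_part upper_var_def intro: SUP_upper)
  then show ?thesis
    by (simp add: finite_measure.emeasure_eq_measure[OF finite_pos_part] ennreal_le_iff)
qed

lemma pos_part_approx:
  assumes "A \<in> sets borel" "e > 0"
  obtains B where "B \<in> sets borel" "B \<subseteq> A" "\<mu> B > measure (pos_part \<mu>) A - e"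
proof (cases "measure (pos_part \<mu>) A - e < 0")
  case True
  then show ?thesis using that[of "{}"] by (simp add: signed_measure_empty[OF sm])
next
  case False
  then have "ennreal (measure (pos_part \<mu>) A - e) < upper_var \<mu> A"
    using assms emeasure_pos_part[OF assms(1)]
    by (simp add: finite_measure.emeasure_eq_measure[OF finite_pos_part] ennreal_less_iff flip: emeasure_pos_part)
  then obtain B where "B \<in> sets borel" "B \<subseteq> A" "ennreal (measure (pos_part \<mu>) A - e) < ennreal (\<mu> B)"
    unfolding upper_var_def less_SUP_iff by auto
  then show ?thesis using that[of B] False by (auto simp: ennreal_less_iff)
qed

end

lemma sets_neg_part[simp, measurable_cong]: "is_signed_measure \<mu> \<Longrightarrow> sets (neg_part \<mu>) = sets borel"
  and space_neg_part[simp]: "is_signed_measure \<mu> \<Longrightarrow> space (neg_part \<mu>) = UNIV"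
  and finite_neg_part: "is_signed_measure \<mu> \<Longrightarrow> finite_measure (neg_part \<mu>)"
  unfolding neg_part_def
  using signed_measure_uminus finite_pos_part by auto

text \<open>No Hahn set is constructed. A subset \<open>B\<close> of \<open>A\<close> that nearly
  attains the variation of one sign is removed, and on \<open>A - B\<close> the measure is bounded
  by the variation of the other sign; the defect \<open>e\<close> is arbitrary.\<close>

lemma signed_measure_Jordan:
  assumes sm: "is_signed_measure \<mu>" and A: "A \<in> sets borel"
  shows "\<mu> A = measure (pos_part \<mu>) A - measure (neg_part \<mu>) A"
proof (rule antisym)
  note sm' = signed_measure_uminus[OF sm]
  note le = upper_var_le[OF sm] upper_var_le[OF sm', folded neg_part_def]
  show "\<mu> A \<le> measure (pos_part \<mu>) A - measure (neg_part \<mu>) A"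
  proof (rule field_le_epsilon)
    fix e :: real assume "e > 0"
    from pos_part_approx[OF sm' A this] obtain B
      where B: "B \<in> sets borel" "B \<subseteq> A" "- \<mu> B > measure (neg_part \<mu>) A - e"
      unfolding neg_part_def by blast
    have "\<mu> (A - B) \<le> measure (pos_part \<mu>) (A - B)" using A B by (intro le) auto
    also have "\<dots> \<le> measure (pos_part \<mu>) A"
      using A B sm by (intro finite_measure.finite_measure_mono finite_pos_part) auto
    finally show "\<mu> A \<le> measure (pos_part \<mu>) A - measure (neg_part \<mu>) A + e"
      using signed_measure_Diff[OF sm A B(1,2)] B by simp
  qed
  show "measure (pos_part \<mu>) A - measure (neg_part \<mu>) A \<le> \<mu> A"
  proof (rule field_le_epsilon)
    fix e :: real assume "e > 0"
    from pos_part_approx[OF sm A this] obtain B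
      where B: "B \<in> sets borel" "B \<subseteq> A" "\<mu> B > measure (pos_part \<mu>) A - e"
      by blast
    have "- \<mu> (A - B) \<le> measure (neg_part \<mu>) (A - B)" using A B by (intro le) auto
    also have "\<dots> \<le> measure (neg_part \<mu>) A"
      using A B sm by (intro finite_measure.finite_measure_mono finite_neg_part) auto
    finally show "measure (pos_part \<mu>) A - measure (neg_part \<mu>) A \<le> \<mu> A + e"
      using signed_measure_Diff[OF sm A B(1,2)] B by simp
  qed
qed

section \<open>Integration against signed measures\<close>

text \<open>Boundedness keeps every integral below away from the junk value 0 of the Bochner integral.\<close>

definition bounded_borel :: "(plane \<Rightarrow> 'b::euclidean_space) \<Rightarrow> bool" where
  "bounded_borel f \<longleftrightarrow> f \<in> borel_measurable borel \<and> (\<exists>B. \<forall>x. norm (f x) \<le> B)"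

lemma bounded_borelI:
  "f \<in> borel_measurable borel \<Longrightarrow> (\<And>x. norm (f x) \<le> B) \<Longrightarrow> bounded_borel f"
  unfolding bounded_borel_def by blast

lemma bounded_borel_continuous:
  "continuous_on UNIV f \<Longrightarrow> (\<And>x. norm (f x) \<le> B) \<Longrightarrow> bounded_borel f"
  by (intro bounded_borelI borel_measurable_continuous_onI)

lemma bounded_borel_const[simp]: "bounded_borel (\<lambda>x. c)"
  by (rule bounded_borelI[of _ "norm c"]) auto

lemma bounded_borel_add:
  assumes "bounded_borel f" "bounded_borel g" shows "bounded_borel (\<lambda>x. f x + g x)"
proof -
  obtain A B where "\<forall>x. norm (f x) \<le> A" "\<forall>x. norm (g x) \<le> B"
    using assms unfolding bounded_borel_def by blast
  then show ?thesis
    using assms by (intro bounded_borelI[of _ "A + B"])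
      (auto simp: bounded_borel_def intro: norm_triangle_le add_mono)
qed

lemma bounded_borel_linear:
  assumes "bounded_linear L" "bounded_borel f" shows "bounded_borel (\<lambda>x. L (f x))"
proof -
  obtain B where B: "\<forall>x. norm (f x) \<le> B"
    using assms unfolding bounded_borel_def by blast
  obtain K where K: "\<And>x. norm (L x) \<le> norm x * K" "K \<ge> 0"
    using bounded_linear.nonneg_bounded[OF assms(1)] by blast
  have "norm (L (f x)) \<le> B * K" for x
    using K(1)[of "f x"] B K(2) by (meson mult_right_mono order_trans)
  moreover have "L \<in> borel_measurable borel"
    using assms(1) by (intro borel_measurable_continuous_onI linear_continuous_on)
  ultimately show ?thesis
    using assms by (intro bounded_borelI) (auto simp: bounded_borel_def intro: measurable_compose)
qed

lemma bounded_borel_diff: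
  "bounded_borel f \<Longrightarrow> bounded_borel g \<Longrightarrow> bounded_borel (\<lambda>x. f x - g x)"
  using bounded_borel_add[of f "\<lambda>x. - g x"] bounded_borel_linear[of uminus g]
  by (simp add: bounded_linear_minus)

lemma bounded_borel_compose:
  "bounded_borel f \<Longrightarrow> \<eta> \<in> borel_measurable borel \<Longrightarrow> bounded_borel (\<lambda>x. f (\<eta> x))"
  unfolding bounded_borel_def by (auto intro: measurable_compose)

lemma bounded_borel_integrable:
  assumes "finite_measure M" "sets M = sets borel" "bounded_borel f"
  shows "integrable M f"
proof -
  obtain B where "\<forall>x. norm (f x) \<le> B" using assms(3) unfolding bounded_borel_def by blast
  then show ?thesis
    using assms by (intro finite_measure.integrable_const_bound[of M f B])
      (auto simp: bounded_borel_def cong: measurable_cong_sets)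
qed

lemma integrable_pos_part: "is_signed_measure \<mu> \<Longrightarrow> bounded_borel f \<Longrightarrow> integrable (pos_part \<mu>) f"
  and integrable_neg_part: "is_signed_measure \<mu> \<Longrightarrow> bounded_borel f \<Longrightarrow> integrable (neg_part \<mu>) f"
  by (simp_all add: bounded_borel_integrable finite_pos_part finite_neg_part)

text \<open>The subtraction-free form of the statement that p - n = P - N as set functions carries
  over to integrals; it suits \<open>ennreal\<close>, where differences do not cancel.\<close>

lemma nn_integral_four_measures:
  fixes f :: "plane \<Rightarrow> ennreal"
  assumes f: "f \<in> borel_measurable borel"
    and [measurable_cong, simp]: "sets P = sets borel" "sets N = sets borel" "sets p = sets borel" "sets n = sets borel"
    and eq: "\<And>A. A \<in> sets borel \<Longrightarrow> emeasure p A + emeasure N A = emeasure n A + emeasure P A"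
  shows "(\<integral>\<^sup>+x. f x \<partial>p) + (\<integral>\<^sup>+x. f x \<partial>N) = (\<integral>\<^sup>+x. f x \<partial>n) + (\<integral>\<^sup>+x. f x \<partial>P)"
  using f
proof (induction rule: borel_measurable_induct)
  case (cong f g)
  then have "f = g" by (auto simp: fun_eq_iff)
  then show ?case using cong by simp
next
  case (set A)
  then show ?case using eq[of A] by simp
next
  case (mult u c)
  then show ?case by (simp add: nn_integral_cmult distrib_left[symmetric])
next
  case (add u v)
  then show ?case by (simp add: nn_integral_add) (metis (no_types, lifting) add.assoc add.left_commute)
next
  case (seq U)
  have sup: "(\<integral>\<^sup>+x. (SUP i. U i x) \<partial>M) = (SUP i. \<integral>\<^sup>+x. U i x \<partial>M)" if "sets M = sets borel" for M
    using seq that by (intro nn_integral_monotone_convergence_SUP) (auto cong: measurable_cong_sets)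
  have inc: "incseq (\<lambda>i. \<integral>\<^sup>+x. U i x \<partial>M)" for M
    using seq by (auto simp: incseq_def le_fun_def intro!: nn_integral_mono)
  have "(SUP i. U i) x = (SUP i. U i x)" for x by (simp add: Sup_fun_def image_image)
  then show ?case
    using seq by (simp add: sup ennreal_SUP_add[symmetric] inc)
qed

text \<open>Makes \<open>sint\<close> computable after a push-forward, where the images of the
  Jordan parts give a decomposition that need not be the Jordan one. Nonnegative integrands come
  first, real ones follow by adding a constant, vectors by components.\<close>

lemma sint_eq_diff:
  fixes f :: "plane \<Rightarrow> 'b::euclidean_space"
  assumes sm: "is_signed_measure \<mu>" and f: "bounded_borel f"
    and fin: "finite_measure P" "finite_measure N"
    and sets: "sets P = sets borel" "sets N = sets borel"
    and eq: "\<And>A. A \<in> sets borel \<Longrightarrow> \<mu> A = measure P A - measure N A"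
  shows "sint \<mu> f = (LINT x|P. f x) - (LINT x|N. f x)"
proof -
  let ?p = "pos_part \<mu>" and ?n = "neg_part \<mu>"
  note [simp] = sets sm
  note fins = fin finite_pos_part[OF sm] finite_neg_part[OF sm]
  have meq: "measure ?p A + measure N A = measure ?n A + measure P A" if "A \<in> sets borel" for A
    using eq[OF that] signed_measure_Jordan[OF sm that] by simp
  have eeq: "emeasure ?p A + emeasure N A = emeasure ?n A + emeasure P A" if "A \<in> sets borel" for A
    using meq[OF that] by (simp add: finite_measure.emeasure_eq_measure fins ennreal_plus[symmetric] del: ennreal_plus)
  have nonneg: "(LINT x|?p. g x) + (LINT x|N. g x) = (LINT x|?n. g x) + (LINT x|P. g x)"
    if g: "bounded_borel g" "\<And>x. 0 \<le> g x" for g :: "plane \<Rightarrow> real"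
  proof -
    have gm: "g \<in> borel_measurable borel" using g by (simp add: bounded_borel_def)
    have e: "(\<integral>\<^sup>+x. ennreal (g x) \<partial>M) = ennreal (LINT x|M. g x)"
      if "finite_measure M" "sets M = sets borel" for M
      using g that by (intro nn_integral_eq_integral bounded_borel_integrable) auto
    have "ennreal (LINT x|?p. g x) + ennreal (LINT x|N. g x) = ennreal (LINT x|?n. g x) + ennreal (LINT x|P. g x)"
      using nn_integral_four_measures[of "\<lambda>x. ennreal (g x)" P N ?p ?n] gm eeq
      by (simp add: e fins)
    then show ?thesis
      using g(2) by (simp add: ennreal_plus[symmetric] del: ennreal_plus)
  qed
  have real: "(LINT x|?p. g x) + (LINT x|N. g x) = (LINT x|?n. g x) + (LINT x|P. g x)"
    if g: "bounded_borel g" for g :: "plane \<Rightarrow> real"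
  proof -
    obtain B where B: "\<And>x. norm (g x) \<le> B" using g unfolding bounded_borel_def by blast
    have 1: "bounded_borel (\<lambda>x. g x + B)" using g by (intro bounded_borel_add) auto
    have 2: "0 \<le> g x + B" for x using B[of x] by (simp add: abs_le_iff)
    have s: "(LINT x|M. g x + B) = (LINT x|M. g x) + measure M UNIV * B"
      if "finite_measure M" "sets M = sets borel" for M
    proof -
      have "space M = UNIV" using sets_eq_imp_space_eq[OF that(2)] by simp
      then show ?thesis
        using g that by (subst Bochner_Integration.integral_add)
          (auto intro!: bounded_borel_integrable)
    qed
    have "measure ?p UNIV * B + measure N UNIV * B = measure ?n UNIV * B + measure P UNIV * B"
      using meq[of UNIV] by (simp add: distrib_right[symmetric])
    with nonneg[OF 1 2] show ?thesis by (simp add: s fins)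
  qed
  have "(LINT x|?p. f x) + (LINT x|N. f x) = (LINT x|?n. f x) + (LINT x|P. f x)"
  proof (rule euclidean_eqI)
    fix b :: 'b assume "b \<in> Basis"
    have "bounded_borel (\<lambda>x. f x \<bullet> b)"
      using f by (intro bounded_borel_linear[OF bounded_linear_inner_left])
    note real[OF this]
    moreover have "(LINT x|M. f x) \<bullet> b = (LINT x|M. f x \<bullet> b)"
      if "finite_measure M" "sets M = sets borel" for M
      using f that by (simp add: bounded_borel_integrable)
    ultimately show "((LINT x|?p. f x) + (LINT x|N. f x)) \<bullet> b = ((LINT x|?n. f x) + (LINT x|P. f x)) \<bullet> b"
      by (simp add: inner_add_left fins)
  qed
  then show ?thesis unfolding sint_def by (simp add: algebra_simps)
qed

definition tv :: "(plane set \<Rightarrow> real) \<Rightarrow> real" where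
  "tv \<mu> = measure (pos_part \<mu>) UNIV + measure (neg_part \<mu>) UNIV"

lemma tv_nonneg: "tv \<mu> \<ge> 0" by (simp add: tv_def)

lemma tv_uminus: "tv (\<lambda>A. - \<mu> A) = tv \<mu>"
  by (simp add: tv_def neg_part_def)

lemma sint_uminus: "sint (\<lambda>A. - \<mu> A) f = - sint \<mu> f"
  by (simp add: sint_def neg_part_def)

context
  fixes \<mu> :: "plane set \<Rightarrow> real"
  assumes sm: "is_signed_measure \<mu>"
begin

lemma sint_add: "bounded_borel f \<Longrightarrow> bounded_borel g \<Longrightarrow> sint \<mu> (\<lambda>x. f x + g x) = sint \<mu> f + sint \<mu> g"
  by (simp add: sint_def integrable_pos_part integrable_neg_part sm)

lemma sint_diff: "bounded_borel f \<Longrightarrow> bounded_borel g \<Longrightarrow> sint \<mu> (\<lambda>x. f x - g x) = sint \<mu> f - sint \<mu> g"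
  by (simp add: sint_def integrable_pos_part integrable_neg_part sm)

lemma sint_linear:
  assumes "bounded_linear L" "bounded_borel f" shows "sint \<mu> (\<lambda>x. L (f x)) = L (sint \<mu> f)"
  unfolding sint_def
  by (simp add: integral_bounded_linear[OF assms(1)] integrable_pos_part integrable_neg_part sm assms
      linear_diff[OF bounded_linear.linear[OF assms(1)]])

lemma sint_norm_le:
  assumes "bounded_borel f" "\<And>x. norm (f x) \<le> B" shows "norm (sint \<mu> f) \<le> tv \<mu> * B"
proof -
  have le: "norm (LINT x|M. f x) \<le> measure M UNIV * B" if "finite_measure M" "sets M = sets borel" for M
  proof -
    have sp: "space M = UNIV" using sets_eq_imp_space_eq[OF that(2)] by simp
    have "norm (LINT x|M. f x) \<le> (LINT x|M. norm (f x))" by (rule integral_norm_bound)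
    also have "\<dots> \<le> (LINT x|M. B)"
      using assms that by (intro integral_mono finite_measure.integrable_const integrable_norm bounded_borel_integrable) auto
    finally show ?thesis by (simp add: sp)
  qed
  have "norm (sint \<mu> f) \<le> norm (LINT x|pos_part \<mu>. f x) + norm (LINT x|neg_part \<mu>. f x)"
    unfolding sint_def by (rule norm_triangle_ineq4)
  also have "\<dots> \<le> measure (pos_part \<mu>) UNIV * B + measure (neg_part \<mu>) UNIV * B"
    by (intro add_mono le) (auto simp: sm finite_pos_part finite_neg_part)
  finally show ?thesis by (simp add: tv_def distrib_right)
qed

lemma sint_tendsto:
  fixes f :: "nat \<Rightarrow> plane \<Rightarrow> 'b::euclidean_space"
  assumes "\<And>n. f n \<in> borel_measurable borel" "\<And>n x. norm (f n x) \<le> B"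
    and "\<And>x. (\<lambda>n. f n x) \<longlonglongrightarrow> g x"
  shows "(\<lambda>n. sint \<mu> (f n)) \<longlonglongrightarrow> sint \<mu> g"
proof -
  have gm: "g \<in> borel_measurable borel"
    by (rule borel_measurable_LIMSEQ_metric[OF assms(1,3)])
  have "(\<lambda>n. LINT x|M. f n x) \<longlonglongrightarrow> (LINT x|M. g x)" if "finite_measure M" "sets M = sets borel" for M
    using assms gm that
    by (intro integral_dominated_convergence[where w = "\<lambda>_. B"] finite_measure.integrable_const)
      (auto cong: measurable_cong_sets)
  then show ?thesis
    unfolding sint_def by (intro tendsto_diff) (auto simp: sm finite_pos_part finite_neg_part)
qed

text \<open>Finite Borel measures on the plane are inner regular: each Jordan part has its own
  compact set, and the union serves both.\<close>

lemma signed_measure_radon: "\<mu> \<in> radon_measures"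
  unfolding radon_measures_def
proof (intro CollectI conjI ballI allI impI sm)
  fix A :: "plane set" and e :: real assume A: "A \<in> sets borel" and e: "e > 0"
  have ex: "\<exists>K. K \<subseteq> A \<and> compact K \<and> measure M (A - K) < e / 2"
    if M: "finite_measure M" "sets M = sets borel" for M
  proof -
    interpret finite_measure M by fact
    have "emeasure M A = (SUP K\<in>{K. K \<subseteq> A \<and> compact K}. emeasure M K)"
      using A M by (intro inner_regular) auto
    moreover have "\<exists>K. K \<subseteq> A \<and> compact K \<and> measure M K > measure M A - e / 2"
    proof (cases "measure M A - e / 2 < 0")
      case True
      then show ?thesis by (intro exI[of _ "{}"]) auto
    next
      case False
      then have "ennreal (measure M A - e / 2) < emeasure M A"
        using e by (simp add: emeasure_eq_measure ennreal_less_iff)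
      then obtain K where "K \<subseteq> A" "compact K" "ennreal (measure M A - e / 2) < emeasure M K"
        unfolding calculation less_SUP_iff by auto
      then show ?thesis using False by (auto simp: emeasure_eq_measure ennreal_less_iff)
    qed
    then obtain K where K: "K \<subseteq> A" "compact K" "measure M K > measure M A - e / 2" by blast
    then have "measure M (A - K) = measure M A - measure M K"
      using A M by (intro finite_measure_Diff) (auto intro: borel_compact)
    then show ?thesis using K by auto
  qed
  from ex[of "pos_part \<mu>"] ex[of "neg_part \<mu>"]
  obtain K1 K2 where K: "K1 \<subseteq> A" "compact K1" "measure (pos_part \<mu>) (A - K1) < e / 2"
      "K2 \<subseteq> A" "compact K2" "measure (neg_part \<mu>) (A - K2) < e / 2"
    by (auto simp: sm finite_pos_part finite_neg_part)
  have m: "A - K1 \<in> sets borel" "A - K2 \<in> sets borel"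
    using A borel_compact[OF K(2)] borel_compact[OF K(5)] by auto
  have *: "measure (pos_part \<mu>) (A - (K1 \<union> K2)) \<le> measure (pos_part \<mu>) (A - K1)"
    "measure (neg_part \<mu>) (A - (K1 \<union> K2)) \<le> measure (neg_part \<mu>) (A - K2)"
    using m by (auto intro!: finite_measure.finite_measure_mono finite_pos_part finite_neg_part sm
        simp: sm)
  show "\<exists>C. compact C \<and> C \<subseteq> A \<and> variation \<mu> (A - C) < ennreal e"
  proof (intro exI conjI)
    show "compact (K1 \<union> K2)" "K1 \<union> K2 \<subseteq> A" using K by auto
    have "variation \<mu> (A - (K1 \<union> K2)) = ennreal (measure (pos_part \<mu>) (A - (K1 \<union> K2)) + measure (neg_part \<mu>) (A - (K1 \<union> K2)))"
      unfolding variation_def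
      by (simp add: finite_measure.emeasure_eq_measure finite_pos_part finite_neg_part sm ennreal_plus)
    also have "\<dots> < ennreal e" using * K e by (intro ennreal_lessI) auto
    finally show "variation \<mu> (A - (K1 \<union> K2)) < ennreal e" .
  qed
qed

end

lemma radon_iff_signed_measure: "\<mu> \<in> radon_measures \<longleftrightarrow> is_signed_measure \<mu>"
  using signed_measure_radon by (auto simp: radon_measures_def)

definition pushforward :: "(plane \<Rightarrow> plane) \<Rightarrow> (plane set \<Rightarrow> real) \<Rightarrow> plane set \<Rightarrow> real" where
  "pushforward \<eta> \<mu> A = (if A \<in> sets borel then \<mu> (\<eta> -` A) else 0)"

lemma vimage_borel: "\<eta> \<in> borel_measurable borel \<Longrightarrow> A \<in> sets borel \<Longrightarrow> \<eta> -` A \<in> sets borel"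
  for \<eta> :: "plane \<Rightarrow> plane"
  using measurable_sets[of \<eta> borel borel A] by simp

lemma signed_measure_pushforward:
  assumes sm: "is_signed_measure \<mu>" and \<eta>: "\<eta> \<in> borel_measurable borel"
  shows "is_signed_measure (pushforward \<eta> \<mu>)"
  unfolding is_signed_measure_def
proof (intro conjI allI impI)
  show "pushforward \<eta> \<mu> {} = 0" by (simp add: pushforward_def signed_measure_empty[OF sm])
  show "pushforward \<eta> \<mu> A = 0" if "A \<notin> sets borel" for A using that by (simp add: pushforward_def)
  fix A :: "nat \<Rightarrow> plane set" assume A: "range A \<subseteq> sets borel \<and> disjoint_family A"
  then have "(\<lambda>n. \<mu> (\<eta> -` A n)) sums \<mu> (\<Union>n. \<eta> -` A n)"
    using \<eta> by (intro signed_measure_sums[OF sm])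
      (auto simp: vimage_borel disjoint_family_on_vimageI)
  moreover have "(\<Union>n. A n) \<in> sets borel" "\<And>n. A n \<in> sets borel" using A by auto
  ultimately show "(\<lambda>n. pushforward \<eta> \<mu> (A n)) sums pushforward \<eta> \<mu> (\<Union>n. A n)"
    by (simp add: pushforward_def vimage_UN)
qed

lemma pushforward_compose:
  assumes "is_signed_measure \<mu>" "\<eta> \<in> borel_measurable borel" "\<xi> \<in> borel_measurable borel"
  shows "pushforward \<xi> (pushforward \<eta> \<mu>) = pushforward (\<lambda>x. \<xi> (\<eta> x)) \<mu>"
  using assms by (auto simp: pushforward_def fun_eq_iff vimage_borel vimage_def[of \<xi>] vimage_def[of \<eta>]
      intro: arg_cong[where f = \<mu>] dest: vimage_borel)

lemma pushforward_id: "is_signed_measure \<mu> \<Longrightarrow> pushforward (\<lambda>x. x) \<mu> = \<mu>"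
  by (auto simp: pushforward_def is_signed_measure_def)

lemma pushforward_uminus: "pushforward \<eta> (\<lambda>A. - \<mu> A) = (\<lambda>A. - pushforward \<eta> \<mu> A)"
  by (auto simp: pushforward_def)

lemma sint_pushforward:
  fixes f :: "plane \<Rightarrow> 'b::euclidean_space"
  assumes sm: "is_signed_measure \<mu>" and \<eta>: "\<eta> \<in> borel_measurable borel" and f: "bounded_borel f"
  shows "sint (pushforward \<eta> \<mu>) f = sint \<mu> (\<lambda>x. f (\<eta> x))"
proof -
  note fin = finite_pos_part[OF sm] finite_neg_part[OF sm]
  have m: "\<eta> \<in> measurable M borel" if "sets M = sets borel" for M
    using \<eta> that by (simp cong: measurable_cong_sets)
  have sp: "space M = UNIV" if "sets M = sets (borel :: plane measure)" for M :: "plane measure"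
    using sets_eq_imp_space_eq[OF that] by simp
  have "sint (pushforward \<eta> \<mu>) f
      = (LINT x|distr (pos_part \<mu>) borel \<eta>. f x) - (LINT x|distr (neg_part \<mu>) borel \<eta>. f x)"
  proof (rule sint_eq_diff)
    show "pushforward \<eta> \<mu> A = measure (distr (pos_part \<mu>) borel \<eta>) A - measure (distr (neg_part \<mu>) borel \<eta>) A"
      if "A \<in> sets borel" for A
      using that \<eta> sm by (simp add: measure_distr m sp pushforward_def signed_measure_Jordan vimage_borel)
  qed (use sm \<eta> f in \<open>auto intro!: signed_measure_pushforward finite_measure.finite_measure_distr fin m\<close>)
  also have "\<dots> = sint \<mu> (\<lambda>x. f (\<eta> x))"
    using f sm unfolding sint_def bounded_borel_def by (simp add: integral_distr m)
  finally show ?thesis .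
qed

text \<open>The preimage of a competitor is a competitor. Equality can fail, since \<eta> may merge
  positive and negative mass.\<close>

lemma tv_pushforward_le:
  assumes sm: "is_signed_measure \<mu>" and \<eta>: "\<eta> \<in> borel_measurable borel"
  shows "tv (pushforward \<eta> \<mu>) \<le> tv \<mu>"
proof -
  have le: "measure (pos_part (pushforward \<eta> \<mu>)) UNIV \<le> measure (pos_part \<mu>) UNIV"
    if sm: "is_signed_measure \<mu>" for \<mu>
  proof -
    note sm' = signed_measure_pushforward[OF sm \<eta>]
    have "upper_var (pushforward \<eta> \<mu>) UNIV \<le> upper_var \<mu> UNIV"
      unfolding upper_var_def[of "pushforward \<eta> \<mu>"]
    proof (rule SUP_least)
      fix B assume "B \<in> {B \<in> sets (borel :: plane measure). B \<subseteq> UNIV}"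
      then show "ennreal (pushforward \<eta> \<mu> B) \<le> upper_var \<mu> UNIV"
        using vimage_borel[OF \<eta>] unfolding upper_var_def by (auto simp: pushforward_def intro!: SUP_upper)
    qed
    then have "emeasure (pos_part (pushforward \<eta> \<mu>)) UNIV \<le> emeasure (pos_part \<mu>) UNIV"
      by (simp add: emeasure_pos_part sm sm')
    then show ?thesis
      by (simp add: finite_measure.emeasure_eq_measure finite_pos_part sm sm')
  qed
  from le[OF sm] le[OF signed_measure_uminus[OF sm]] show ?thesis
    unfolding tv_def neg_part_def pushforward_uminus by simp
qed

section \<open>Duality with continuous functions vanishing at infinity\<close>

text \<open>Continuous approximations of the indicator of a closed set. The empty set is treated
  apart because \<open>infdist x {} = 0\<close> would produce the constant 1.\<close>

definition cutoff :: "plane set \<Rightarrow> nat \<Rightarrow> plane \<Rightarrow> real" where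
  "cutoff C n x = (if C = {} then 0 else max 0 (1 - real n * infdist x C))"

lemma continuous_cutoff: "continuous_on UNIV (cutoff C n)"
  unfolding cutoff_def by (cases "C = {}") (auto intro!: continuous_intros)

lemma cutoff_bounds: "0 \<le> cutoff C n x" "cutoff C n x \<le> 1"
  by (auto simp: cutoff_def infdist_nonneg)

lemma cutoff_tendsto:
  assumes "closed C" shows "(\<lambda>n. cutoff C n x) \<longlonglongrightarrow> indicator C x"
proof (cases "x \<in> C")
  case True
  then have "cutoff C n x = 1" for n by (auto simp: cutoff_def)
  then show ?thesis using True by simp
next
  case False
  show ?thesis
  proof (cases "C = {}")
    case False
    then have d: "infdist x C > 0"
      using \<open>x \<notin> C\<close> assms by (intro infdist_pos_not_in_closed)
    obtain N :: nat where N: "1 / infdist x C < real N" using reals_Archimedean2 by blast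
    have "cutoff C n x = 0" if "n \<ge> N" for n
    proof -
      have "1 < real N * infdist x C" using N d by (simp add: divide_less_eq)
      also have "\<dots> \<le> real n * infdist x C" using that d by (intro mult_right_mono) auto
      finally show ?thesis by (simp add: cutoff_def)
    qed
    then show ?thesis using \<open>x \<notin> C\<close>
      by (intro tendsto_eventually) (auto simp: eventually_sequentially)
  qed (auto simp: cutoff_def)
qed

lemma C0_vanishingI_compact_support:
  assumes "continuous_on UNIV f" "\<And>x. norm x > R \<Longrightarrow> f x = 0"
  shows "f \<in> C0_vanishing"
proof -
  have "eventually (\<lambda>x. f x = 0) at_infinity"
    unfolding eventually_at_infinity using assms(2) by (intro exI[of _ "R + 1"]) auto
  then show ?thesis
    using assms(1) by (auto simp: C0_vanishing_def intro: tendsto_eventually)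
qed

lemma cutoff_C0:
  assumes "compact C" "n > 0" shows "cutoff C n \<in> C0_vanishing"
proof (cases "C = {}")
  case False
  obtain R where R: "\<And>c. c \<in> C \<Longrightarrow> norm c \<le> R"
    using assms(1) compact_imp_bounded bounded_iff by metis
  show ?thesis
  proof (rule C0_vanishingI_compact_support[OF continuous_cutoff])
    fix x :: plane assume x: "norm x > R + 1"
    have "1 \<le> infdist x C"
      unfolding infdist_def using False
    proof (simp, intro cINF_greatest)
      fix c assume "c \<in> C"
      then show "1 \<le> dist x c" using R[of c] x norm_triangle_ineq2[of x c] by (simp add: dist_norm)
    qed auto
    then have "1 \<le> real n * infdist x C"
      using assms(2) mult_mono[of 1 "real n" 1 "infdist x C"] by simp
    then show "cutoff C n x = 0" by (simp add: cutoff_def)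
  qed
next
  case True
  then have "cutoff C n = (\<lambda>_. 0)" by (simp add: cutoff_def fun_eq_iff)
  then show ?thesis by (simp add: C0_vanishing_def)
qed

lemma cutoff_bounded_borel: "bounded_borel (cutoff C n)"
  using cutoff_bounds by (intro bounded_borel_continuous[OF continuous_cutoff, of _ _ 1]) (auto simp: abs_le_iff intro: order_trans[of _ 0])

lemma C0_vanishing_bounded_borel:
  assumes "f \<in> C0_vanishing" shows "bounded_borel f"
proof -
  have c: "continuous_on UNIV f" and l: "(f \<longlongrightarrow> 0) at_infinity"
    using assms by (auto simp: C0_vanishing_def)
  from tendstoD[OF l, of 1] obtain R where R: "\<And>x. norm x \<ge> R \<Longrightarrow> norm (f x) < 1"
    unfolding eventually_at_infinity by auto
  have "compact (f ` cball 0 R)"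
    using c by (intro compact_continuous_image) (auto intro: continuous_on_subset)
  then obtain B where B: "\<And>x. x \<in> cball 0 R \<Longrightarrow> norm (f x) \<le> B"
    by (metis bounded_iff compact_imp_bounded image_eqI)
  show ?thesis
  proof (rule bounded_borel_continuous[OF c, of "max 1 B"])
    show "norm (f x) \<le> max 1 B" for x
      using R[of x] B[of x] by (cases "norm x \<ge> R") (auto simp: le_max_iff_disj)
  qed
qed

lemma sint_cutoff_tendsto:
  assumes sm: "is_signed_measure \<mu>" and C: "compact C"
  shows "(\<lambda>n. sint \<mu> (cutoff C n)) \<longlonglongrightarrow> \<mu> C"
proof -
  have Cb: "C \<in> sets borel" using C by (rule borel_compact)
  have "(\<lambda>n. sint \<mu> (cutoff C n)) \<longlonglongrightarrow> sint \<mu> (indicator C :: plane \<Rightarrow> real)"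
    using cutoff_bounds cutoff_bounded_borel
    by (intro sint_tendsto[OF sm, of _ 1] cutoff_tendsto compact_imp_closed C)
      (auto simp: bounded_borel_def abs_le_iff intro: order_trans[of _ 0])
  also have "sint \<mu> (indicator C :: plane \<Rightarrow> real) = \<mu> C"
    using signed_measure_Jordan[OF sm Cb] by (simp add: sint_def sm Cb)
  finally show ?thesis .
qed

text \<open>Closed sets are exhausted by their intersections with balls, and they form a generator
  of the Borel sets that is stable under intersection.\<close>

lemma signed_measure_eqI_compact:
  assumes sm: "is_signed_measure \<mu>" "is_signed_measure \<nu>"
    and eq: "\<And>C. compact C \<Longrightarrow> \<mu> C = \<nu> C"
  shows "\<mu> = \<nu>"
proof (rule signed_measure_eqI[OF sm])
  have closed_eq: "\<mu> S = \<nu> S" if S: "closed S" for S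
  proof -
    have lim: "(\<lambda>n. \<mu> (S \<inter> cball 0 (real n))) \<longlonglongrightarrow> \<mu> S" if sm: "is_signed_measure \<mu>" for \<mu>
    proof -
      have *: "(\<lambda>n. measure M (S \<inter> cball 0 (real n))) \<longlonglongrightarrow> measure M S"
        if "finite_measure M" "sets M = sets borel" for M :: "plane measure"
      proof -
        have "incseq (\<lambda>n. S \<inter> cball 0 (real n))"
          unfolding incseq_def by (intro allI impI Int_mono subset_cball) simp_all
        then have "(\<lambda>n. measure M (S \<inter> cball 0 (real n))) \<longlonglongrightarrow> measure M (\<Union>n. S \<inter> cball 0 (real n))"
          using S by (intro finite_measure.finite_Lim_measure_incseq[OF that(1)]) (auto simp: that(2))
        also have "(\<Union>n. S \<inter> cball 0 (real n)) = S"
          by (auto intro: real_arch_simple)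
        finally show ?thesis .
      qed
      have "S \<inter> cball 0 (real n) \<in> sets borel" for n using S by auto
      moreover have "(\<lambda>n. measure (pos_part \<mu>) (S \<inter> cball 0 (real n)) - measure (neg_part \<mu>) (S \<inter> cball 0 (real n)))
          \<longlonglongrightarrow> measure (pos_part \<mu>) S - measure (neg_part \<mu>) S"
        by (intro tendsto_diff *) (auto simp: sm finite_pos_part finite_neg_part)
      ultimately show ?thesis using S by (simp add: signed_measure_Jordan[OF sm])
    qed
    have "\<mu> (S \<inter> cball 0 (real n)) = \<nu> (S \<inter> cball 0 (real n))" for n
      using S by (intro eq closed_Int_compact compact_cball)
    then have "(\<lambda>n. \<nu> (S \<inter> cball 0 (real n))) \<longlonglongrightarrow> \<mu> S" using lim[OF sm(1)] by simp
    from LIMSEQ_unique[OF this lim[OF sm(2)]] show ?thesis .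
  qed
  have gen: "sets (borel :: plane measure) = sigma_sets UNIV (Collect closed)"
    by (simp add: borel_eq_closed)
  fix A :: "plane set" assume "A \<in> sets borel"
  then have A: "A \<in> sigma_sets UNIV (Collect closed)" by (simp add: gen)
  have "Int_stable (Collect closed :: plane set set)" "Collect closed \<subseteq> Pow (UNIV :: plane set)"
    by (auto simp: Int_stable_def)
  from this A show "\<mu> A = \<nu> A"
  proof (induction rule: sigma_sets_induct_disjoint)
    case (compl A)
    then have "A \<in> sets borel" by (simp add: gen)
    then show ?case
      using compl closed_eq[of UNIV] signed_measure_Diff[OF sm(1), of UNIV A] signed_measure_Diff[OF sm(2), of UNIV A] by simp
  next
    case (union A)
    then have "range A \<subseteq> sets borel" by (simp add: gen)
    then have "(\<lambda>n. \<mu> (A n)) sums \<mu> (\<Union>n. A n)" "(\<lambda>n. \<nu> (A n)) sums \<nu> (\<Union>n. A n)"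
      using signed_measure_sums[OF sm(1) _ union(1)] signed_measure_sums[OF sm(2) _ union(1)] by auto
    then show ?case using union by (simp add: sums_unique2)
  qed (auto simp: closed_eq signed_measure_empty sm)
qed

text \<open>Equality is asked only on compactly supported Lipschitz functions, the class for which
  the transport estimate is available. The cutoffs of compact sets lie in it, with Lipschitz
  constant \<open>n\<close>.\<close>

lemma signed_measure_eqI_C0:
  assumes sm: "is_signed_measure \<mu>" "is_signed_measure \<nu>"
    and eq: "\<And>f R B. continuous_on UNIV f \<Longrightarrow> (\<And>x. norm x > R \<Longrightarrow> f x = 0) \<Longrightarrow>
      (\<And>x y. \<bar>f x - f y\<bar> \<le> B * norm (x - y)) \<Longrightarrow> sint \<mu> f = sint \<nu> f"
  shows "\<mu> = \<nu>"
proof (rule signed_measure_eqI_compact[OF sm])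
  fix C :: "plane set" assume C: "compact C"
  \<comment> \<open>For nonempty \<open>C\<close> the function \<open>cutoff C 0\<close> is
    constantly 1, so compact support requires \<open>n > 0\<close>.\<close>
  have "sint \<mu> (cutoff C n) = sint \<nu> (cutoff C n)" if n: "n > 0" for n
  proof (cases "C = {}")
    case False
    obtain R where R: "\<And>c. c \<in> C \<Longrightarrow> norm c \<le> R"
      using C compact_imp_bounded bounded_iff by metis
    show ?thesis
    proof (rule eq[OF continuous_cutoff, where R = "R + 1" and B = "real n"])
      fix x y :: plane
      have "\<bar>infdist x C - infdist y C\<bar> \<le> norm (x - y)"
        using infdist_triangle[of x C y] infdist_triangle[of y C x] by (simp add: dist_norm norm_minus_commute abs_le_iff)
      then have "real n * \<bar>infdist x C - infdist y C\<bar> \<le> real n * norm (x - y)"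
        by (rule mult_left_mono) simp
      moreover have "\<bar>cutoff C n x - cutoff C n y\<bar> \<le> real n * \<bar>infdist x C - infdist y C\<bar>"
        using False by (auto simp: cutoff_def max_def abs_mult[of "real n", simplified, symmetric] right_diff_distrib)
      ultimately show "\<bar>cutoff C n x - cutoff C n y\<bar> \<le> real n * norm (x - y)" by linarith
    next
      fix x :: plane assume x: "norm x > R + 1"
      have "1 \<le> infdist x C"
        unfolding infdist_def using False
      proof (simp, intro cINF_greatest)
        fix c assume "c \<in> C"
        then show "1 \<le> dist x c" using R[of c] x norm_triangle_ineq2[of x c] by (simp add: dist_norm)
      qed auto
      then have "1 \<le> real n * infdist x C"
        using n mult_mono[of 1 "real n" 1 "infdist x C"] by simp
      then show "cutoff C n x = 0" by (simp add: cutoff_def)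
    qed
  qed (simp add: cutoff_def sint_def)
  then have "eventually (\<lambda>n. sint \<mu> (cutoff C n) = sint \<nu> (cutoff C n)) sequentially"
    by (auto simp: eventually_sequentially intro: exI[of _ 1])
  with sint_cutoff_tendsto[OF sm(1) C] have "(\<lambda>n. sint \<nu> (cutoff C n)) \<longlonglongrightarrow> \<mu> C"
    by (rule Lim_transform_eventually)
  from LIMSEQ_unique[OF this sint_cutoff_tendsto[OF sm(2) C]] show "\<mu> C = \<nu> C" .
qed

text \<open>A set \<open>B\<close> that nearly attains the positive variation carries little
  negative mass, and its complement little positive mass. The difference of two cutoffs, for compact
  sets nearly filling \<open>B\<close> and its complement, then almost realises the norm.\<close>

lemma tv_dual:
  assumes sm: "is_signed_measure \<mu>" and e: "e > 0"
  obtains f where "f \<in> C0_vanishing" "\<And>x. \<bar>f x\<bar> \<le> 1" "sint \<mu> f > tv \<mu> - e"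
proof -
  note fin = finite_pos_part[OF sm] finite_neg_part[OF sm]
  let ?p = "measure (pos_part \<mu>)" and ?n = "measure (neg_part \<mu>)"
  obtain B where B: "B \<in> sets borel" "\<mu> B > ?p UNIV - e / 8"
    using pos_part_approx[OF sm, of UNIV "e / 8"] e by auto
  have split: "measure M UNIV = measure M B + measure M (- B)" if "finite_measure M" "sets M = sets borel" for M
  proof -
    have "measure M (B \<union> - B) = measure M B + measure M (- B)"
      using B that by (intro finite_measure.finite_measure_Union) auto
    then show ?thesis by simp
  qed
  have rad: "\<mu> \<in> radon_measures" using sm by (rule signed_measure_radon)
  have ex: "\<exists>C. compact C \<and> C \<subseteq> A \<and> ?p (A - C) + ?n (A - C) < e / 8" if A: "A \<in> sets borel" for A
  proof -
    have "e / 8 > 0" using e by simp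
    then obtain C where C: "compact C" "C \<subseteq> A" "variation \<mu> (A - C) < ennreal (e / 8)"
      using rad A unfolding radon_measures_def by blast
    have "variation \<mu> (A - C) = ennreal (?p (A - C) + ?n (A - C))"
      unfolding variation_def by (simp add: finite_measure.emeasure_eq_measure fin ennreal_plus)
    with C(3) e have "?p (A - C) + ?n (A - C) < e / 8" by (simp add: ennreal_less_iff del: ennreal_plus)
    then show ?thesis using C by blast
  qed
  obtain C where C: "compact C" "C \<subseteq> B" "?p (B - C) + ?n (B - C) < e / 8" using ex[OF B(1)] by auto
  obtain D where D: "compact D" "D \<subseteq> - B" "?p (- B - D) + ?n (- B - D) < e / 8"
    using ex[of "- B"] B(1) by auto
  have d: "measure M C = measure M B - measure M (B - C)" "measure M D = measure M (- B) - measure M (- B - D)"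
    if "finite_measure M" "sets M = sets borel" for M
    using that C D B by (auto simp: finite_measure.finite_measure_Diff borel_compact)
  have d4: "?p C = ?p B - ?p (B - C)" "?n C = ?n B - ?n (B - C)"
    "?p D = ?p (- B) - ?p (- B - D)" "?n D = ?n (- B) - ?n (- B - D)"
    using d fin sm by auto
  have sp: "?p UNIV = ?p B + ?p (- B)" "?n UNIV = ?n B + ?n (- B)"
    using split fin sm by auto
  have J: "\<mu> A = ?p A - ?n A" if "A \<in> sets borel" for A by (rule signed_measure_Jordan[OF sm that])
  have "\<mu> C - \<mu> D > tv \<mu> - e"
    using J[OF B(1)] J[OF borel_compact[OF C(1)]] J[OF borel_compact[OF D(1)]]
      d4 C(3) D(3) B(2) sp
      measure_nonneg[of "pos_part \<mu>" "B - C"] measure_nonneg[of "neg_part \<mu>" "B - C"]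
      measure_nonneg[of "pos_part \<mu>" "- B - D"] measure_nonneg[of "neg_part \<mu>" "- B - D"]
      measure_nonneg[of "pos_part \<mu>" "- B"] measure_nonneg[of "neg_part \<mu>" "B"] e
    unfolding tv_def by linarith
  moreover have "(\<lambda>n. sint \<mu> (cutoff C n) - sint \<mu> (cutoff D n)) \<longlonglongrightarrow> \<mu> C - \<mu> D"
    by (intro tendsto_diff sint_cutoff_tendsto[OF sm] C D)
  ultimately have "eventually (\<lambda>n. sint \<mu> (cutoff C n) - sint \<mu> (cutoff D n) > tv \<mu> - e) sequentially"
    by (auto dest: order_tendstoD)
  then obtain n where n: "n > 0" "sint \<mu> (cutoff C n) - sint \<mu> (cutoff D n) > tv \<mu> - e"
    unfolding eventually_sequentially by (metis less_Suc_eq_le linorder_le_cases zero_less_Suc Suc_leD)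
  show ?thesis
  proof (rule that[of "\<lambda>x. cutoff C n x - cutoff D n x"])
    show "(\<lambda>x. cutoff C n x - cutoff D n x) \<in> C0_vanishing"
      using cutoff_C0[OF C(1) n(1)] cutoff_C0[OF D(1) n(1)]
      by (auto simp: C0_vanishing_def intro!: continuous_intros tendsto_eq_intros)
    show "\<bar>cutoff C n x - cutoff D n x\<bar> \<le> 1" for x
      using cutoff_bounds[of C n x] cutoff_bounds[of D n x] by (simp add: abs_le_iff)
    show "sint \<mu> (\<lambda>x. cutoff C n x - cutoff D n x) > tv \<mu> - e"
      using n by (simp add: sint_diff[OF sm] cutoff_bounded_borel)
  qed
qed

text \<open>Sokal's elementary proof of uniform boundedness: a series of small bumps along which the
  functionals grow.\<close>

lemma tv_bounded_sequence:
  assumes sm: "\<And>n. is_signed_measure (\<mu> n)"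
    and bdd: "\<And>f. f \<in> C0_vanishing \<Longrightarrow> \<exists>B. \<forall>n. \<bar>sint (\<mu> n) f\<bar> \<le> B"
  shows "\<exists>B. \<forall>n. tv (\<mu> n) \<le> B"
proof (rule ccontr)
  assume "\<not> ?thesis"
  \<comment> \<open>The bump of size 3^-k makes the k-th functional at least 2/3 of 3^-k times its
    norm; all later bumps together take back at most 1/2 of that product. The remaining sixth
    exceeds (4/3)^k.\<close>
  then have "\<forall>k::nat. \<exists>n. tv (\<mu> n) > 6 * 4 ^ k" by (metis not_less)
  then obtain N where N: "\<And>k. tv (\<mu> (N k)) > 6 * 4 ^ k" by metis
  let ?T = "\<lambda>k. sint (\<mu> (N k)) :: (plane \<Rightarrow> real) \<Rightarrow> real" and ?r = "\<lambda>k. (1/3::real) ^ k"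
  let ?P = "\<lambda>k g. g \<in> C0_vanishing"
  have bb: "bounded_borel g" if "g \<in> C0_vanishing" for g :: "plane \<Rightarrow> real"
    using that by (rule C0_vanishing_bounded_borel)
  have lin: "(\<lambda>x. g x + c * h x) \<in> C0_vanishing" if "g \<in> C0_vanishing" "h \<in> C0_vanishing" for g h and c :: real
    using that by (auto simp: C0_vanishing_def intro!: continuous_intros tendsto_eq_intros)
  have "\<exists>g. \<forall>k. ?P k (g k) \<and> ((\<forall>x. \<bar>g (Suc k) x - g k x\<bar> \<le> ?r k) \<and>
      \<bar>?T k (g (Suc k))\<bar> \<ge> ?r k * (2/3) * tv (\<mu> (N k)))"
  proof (rule dependent_nat_choice)
    show "\<exists>g. ?P 0 g" by (rule exI[of _ "\<lambda>_. 0"]) (auto simp: C0_vanishing_def)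
    fix g k assume g: "?P k g"
    have "tv (\<mu> (N k)) > 0" using N[of k] by (meson less_trans mult_pos_pos zero_less_numeral zero_less_power)
    then obtain f where f: "f \<in> C0_vanishing" "\<And>x. \<bar>f x\<bar> \<le> 1" "?T k f > tv (\<mu> (N k)) - tv (\<mu> (N k)) / 3"
      using tv_dual[OF sm, of "tv (\<mu> (N k)) / 3" "N k"] by auto
    have T: "?T k (\<lambda>x. g x + c * f x) = ?T k g + c * ?T k f" for c
      using bounded_borel_linear[OF bounded_linear_mult_right[of c] bb[OF f(1)]]
        sint_linear[OF sm bounded_linear_mult_right[of c] bb[OF f(1)]]
      by (simp add: sint_add[OF sm bb[OF g]])
    have "?r k * ((2/3) * tv (\<mu> (N k))) \<le> ?r k * ?T k f" using f(3) by (intro mult_left_mono) auto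
    \<comment> \<open>The two values differ by twice \<open>?r k * ?T k f\<close>, so for one of the
      signs the absolute value is at least that product.\<close>
    then have "\<bar>?T k g + ?r k * ?T k f\<bar> \<ge> ?r k * (2/3) * tv (\<mu> (N k)) \<or>
        \<bar>?T k g + (- ?r k) * ?T k f\<bar> \<ge> ?r k * (2/3) * tv (\<mu> (N k))"
      unfolding mult.assoc mult_minus_left by linarith
    then obtain c where c: "\<bar>c\<bar> = ?r k" "\<bar>?T k (\<lambda>x. g x + c * f x)\<bar> \<ge> ?r k * (2/3) * tv (\<mu> (N k))"
    proof
      assume "\<bar>?T k g + ?r k * ?T k f\<bar> \<ge> ?r k * (2/3) * tv (\<mu> (N k))"
      then show ?thesis by (intro that[of "?r k"]) (simp_all only: T, simp)
    next
      assume "\<bar>?T k g + (- ?r k) * ?T k f\<bar> \<ge> ?r k * (2/3) * tv (\<mu> (N k))"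
      then show ?thesis by (intro that[of "- ?r k"]) (simp_all only: T, simp)
    qed
    show "\<exists>g'. ?P (Suc k) g' \<and> ((\<forall>x. \<bar>g' x - g x\<bar> \<le> ?r k) \<and> \<bar>?T k g'\<bar> \<ge> ?r k * (2/3) * tv (\<mu> (N k)))"
    proof (intro exI[of _ "\<lambda>x. g x + c * f x"] conjI allI)
      show "\<bar>g x + c * f x - g x\<bar> \<le> ?r k" for x
        using f(2)[of x] c(1) mult_left_mono[of "\<bar>f x\<bar>" 1 "?r k"] by (simp add: abs_mult)
    qed (use lin g f c in auto)
  qed
  then obtain g where g: "\<And>k. g k \<in> C0_vanishing" "\<And>k x. \<bar>g (Suc k) x - g k x\<bar> \<le> ?r k"
    "\<And>k. \<bar>?T k (g (Suc k))\<bar> \<ge> ?r k * (2/3) * tv (\<mu> (N k))" by blast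
  have step: "\<bar>g (k + m) x - g k x\<bar> \<le> (3/2) * (?r k - ?r (k + m))" for k m x
  proof (induction m)
    case (Suc m)
    have "\<bar>g (k + Suc m) x - g k x\<bar> \<le> \<bar>g (Suc (k + m)) x - g (k + m) x\<bar> + \<bar>g (k + m) x - g k x\<bar>" by simp
    also have "\<dots> \<le> ?r (k + m) + (3/2) * (?r k - ?r (k + m))" using g(2) Suc by (intro add_mono)
    also have "\<dots> = (3/2) * (?r k - ?r (k + Suc m))" by (simp add: field_simps)
    finally show ?case .
  qed simp
  have step': "\<bar>g n x - g k x\<bar> \<le> (3/2) * ?r k" if "n \<ge> k" for n k x
  proof -
    have "?r n \<ge> 0" by simp
    with step[of k "n - k" x] that show ?thesis by (simp del: zero_le_power)
  qed
  have r0: "?r \<longlonglongrightarrow> 0" by (intro LIMSEQ_power_zero) auto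
  have "uniformly_Cauchy_on UNIV g"
    unfolding uniformly_Cauchy_on_def
  proof (intro allI impI)
    fix e :: real assume "e > 0"
    then have "e / 3 > 0" by simp
    from LIMSEQ_D[OF r0 this] obtain M where M: "\<And>n. n \<ge> M \<Longrightarrow> ?r n < e / 3" by auto
    have "dist (g m x) (g n x) < e" if "m \<ge> M" "n \<ge> M" for m n x
      using step'[OF that(1), of x] step'[OF that(2), of x] M[OF order_refl]
      unfolding dist_real_def by linarith
    then show "\<exists>M. \<forall>x\<in>UNIV. \<forall>m\<ge>M. \<forall>n\<ge>M. dist (g m x) (g n x) < e" by blast
  qed
  then obtain G where G: "uniform_limit UNIV g G sequentially"
    using Cauchy_uniformly_convergent uniformly_convergent_on_def by blast
  have lim: "(\<lambda>n. g n x) \<longlonglongrightarrow> G x" for x using G by (rule tendsto_uniform_limitI) simp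
  have Gk: "\<bar>G x - g k x\<bar> \<le> (3/2) * ?r k" for k x
  proof (rule tendsto_upperbound)
    show "(\<lambda>n. \<bar>g n x - g k x\<bar>) \<longlonglongrightarrow> \<bar>G x - g k x\<bar>" by (intro tendsto_intros lim)
    show "\<forall>\<^sub>F n in sequentially. \<bar>g n x - g k x\<bar> \<le> (3/2) * ?r k"
      using step' by (auto simp: eventually_sequentially)
  qed simp
  have GC: "G \<in> C0_vanishing"
    unfolding C0_vanishing_def
  proof (intro CollectI conjI)
    show "continuous_on UNIV G"
      using G g(1) by (intro uniform_limit_theorem[OF _ G]) (auto simp: C0_vanishing_def)
    show "(G \<longlongrightarrow> 0) at_infinity"
    proof (rule tendstoI)
      fix e :: real assume e: "e > 0"
      then have "e / 3 > 0" by simp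
      from LIMSEQ_D[OF r0 this] obtain M where M: "?r M < e / 3" by auto
      have "(g M \<longlongrightarrow> 0) at_infinity" using g(1) by (auto simp: C0_vanishing_def)
      moreover have "e / 2 > 0" using e by simp
      ultimately have "\<forall>\<^sub>F x in at_infinity. dist (g M x) 0 < e / 2" by (rule tendstoD)
      then show "\<forall>\<^sub>F x in at_infinity. dist (G x) 0 < e"
      proof (elim eventually_mono)
        show "dist (G x) 0 < e" if "dist (g M x) 0 < e / 2" for x
          using Gk[of x M] M that unfolding dist_real_def by linarith
      qed
    qed
  qed
  obtain B where B: "\<And>n. \<bar>sint (\<mu> n) G\<bar> \<le> B" using bdd[OF GC] by blast
  have "B \<ge> (4/3) ^ k" for k
  proof -
    have "\<bar>?T k G - ?T k (g (Suc k))\<bar> \<le> tv (\<mu> (N k)) * ((3/2) * ?r (Suc k))"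
      using sint_norm_le[OF sm bounded_borel_diff[OF bb[OF GC] bb[OF g(1)]], of "Suc k" "(3/2) * ?r (Suc k)" "N k"] Gk[of _ "Suc k"]
      by (simp add: sint_diff[OF sm bb[OF GC] bb[OF g(1)]])
    moreover have "tv (\<mu> (N k)) * ((3/2) * ?r (Suc k)) = (?r k * tv (\<mu> (N k))) / 2" by simp
    moreover have "?r k * (2/3) * tv (\<mu> (N k)) = (2/3) * (?r k * tv (\<mu> (N k)))" by simp
    ultimately have "?r k * tv (\<mu> (N k)) / 6 \<le> B"
      using g(3)[of k] B[of "N k"] by linarith
    moreover have "?r k * (6 * 4 ^ k) \<le> ?r k * tv (\<mu> (N k))"
      using N[of k] by (intro mult_left_mono) auto
    ultimately show ?thesis by (simp add: field_simps power_divide)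
  qed
  moreover have "\<exists>k. B < (4/3::real) ^ k" by (rule real_arch_pow) simp
  ultimately show False by (metis not_less)
qed

text \<open>Each pairing with a fixed function is bounded on the compact interval; uniform
  boundedness turns this into a bound on the norms, which the definition of the curve does not
  mention.\<close>

lemma weakly_continuous_curve_tv_bounded:
  assumes "weakly_continuous_curve q"
  obtains B where "\<And>t. t \<in> {a..b} \<Longrightarrow> tv (q t) \<le> B"
proof -
  have "\<exists>B. \<forall>t\<in>{a..b}. tv (q t) \<le> B"
  proof (rule ccontr)
    assume "\<not> ?thesis"
    then have "\<forall>n::nat. \<exists>t\<in>{a..b}. tv (q t) > real n" by (metis not_less)
    then obtain s where s: "\<And>n. s n \<in> {a..b}" "\<And>n. tv (q (s n)) > real n" by metis
    have "\<exists>B. \<forall>n. tv (q (s n)) \<le> B"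
    proof (rule tv_bounded_sequence)
      show "is_signed_measure (q (s n))" for n
        using assms by (auto simp: weakly_continuous_curve_def radon_iff_signed_measure)
      fix f assume "f \<in> C0_vanishing"
      then have "continuous_on {a..b} (\<lambda>t. sint (q t) f)"
        using assms unfolding weakly_continuous_curve_def by (meson continuous_on_subset subset_UNIV)
      then have "bounded ((\<lambda>t. sint (q t) f) ` {a..b})"
        by (intro compact_imp_bounded compact_continuous_image) auto
      then obtain B where "\<And>t. t \<in> {a..b} \<Longrightarrow> norm (sint (q t) f) \<le> B"
        unfolding bounded_iff by blast
      then show "\<exists>B. \<forall>n. \<bar>sint (q (s n)) f\<bar> \<le> B" using s(1) by auto
    qed
    then obtain B where "\<And>n. tv (q (s n)) \<le> B" by blast
    moreover obtain n where "B < real n" using reals_Archimedean2 by blast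
    ultimately show False using s(2)[of n] by (metis less_trans not_less order_refl)
  qed
  then show ?thesis using that by blast
qed

text \<open>Differentiation under the integral sign. The domination is imposed on the increments of
  the integrand, so dominated convergence applies directly to difference quotients; measurability
  and the bound of \<open>D\<close> are inherited from the same quotients.\<close>

lemma has_derivative_integral:
  fixes f :: "'a::euclidean_space \<Rightarrow> 'b \<Rightarrow> 'c::euclidean_space"
  assumes r: "r > 0"
    and der: "\<And>y. ((\<lambda>x. f x y) has_derivative D y) (at x0)"
    and int: "\<And>x. x \<in> ball x0 r \<Longrightarrow> integrable M (f x)"
    and lip: "\<And>x y. x \<in> ball x0 r \<Longrightarrow> norm (f x y - f x0 y) \<le> B y * norm (x - x0)"
    and B: "integrable M B"
  shows "((\<lambda>x. LINT y|M. f x y) has_derivative (\<lambda>h. LINT y|M. D y h)) (at x0)"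
    and "integrable M (\<lambda>y. D y h)"
    and "norm (D y h) \<le> B y * norm h"
proof -
  have x0: "x0 \<in> ball x0 r" using r by simp
  \<comment> \<open>The shift \<open>N\<close>, chosen later in dependence on \<open>h\<close>,
    keeps all evaluation points in the ball where \<open>int\<close> and \<open>lip\<close>
    hold.\<close>
  have quot: "(\<lambda>n. real (Suc n + N) *\<^sub>R (f (x0 + h /\<^sub>R real (Suc n + N)) y - f x0 y)) \<longlonglongrightarrow> D y h" for h y N
  proof -
    have "((\<lambda>t. f (x0 + t *\<^sub>R h) y) has_vector_derivative D y h) (at 0)"
    proof -
      have "((\<lambda>x. f x y) has_derivative D y) (at (x0 + (0::real) *\<^sub>R h))" using der[of y] by simp
      moreover have "((\<lambda>t::real. x0 + t *\<^sub>R h) has_derivative (\<lambda>t. t *\<^sub>R h)) (at 0)"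
        by (auto intro!: derivative_eq_intros)
      ultimately have "((\<lambda>x. f x y) \<circ> (\<lambda>t::real. x0 + t *\<^sub>R h) has_derivative D y \<circ> (\<lambda>t. t *\<^sub>R h)) (at 0)"
        by (intro diff_chain_at)
      moreover have "D y (t *\<^sub>R h) = t *\<^sub>R D y h" for t
        using der[of y] by (simp add: linear_scale has_derivative_linear)
      ultimately show ?thesis by (simp add: has_vector_derivative_def o_def)
    qed
    then have "((\<lambda>t. norm (f (x0 + t *\<^sub>R h) y - f x0 y - t *\<^sub>R D y h) / norm t) \<longlongrightarrow> 0) (at 0)"
      by (simp add: has_vector_derivative_def has_derivative_at)
    then have "((\<lambda>t. norm ((f (x0 + t *\<^sub>R h) y - f x0 y) /\<^sub>R t - D y h)) \<longlongrightarrow> 0) (at 0)"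
    proof (rule Lim_transform_eventually)
      have "norm (f (x0 + t *\<^sub>R h) y - f x0 y - t *\<^sub>R D y h) / norm t
          = norm ((f (x0 + t *\<^sub>R h) y - f x0 y) /\<^sub>R t - D y h)" if "t \<noteq> 0" for t
      proof -
        have "(f (x0 + t *\<^sub>R h) y - f x0 y) /\<^sub>R t - D y h = (f (x0 + t *\<^sub>R h) y - f x0 y - t *\<^sub>R D y h) /\<^sub>R t"
          using that by (simp add: scaleR_diff_right)
        then show ?thesis by (simp add: divide_inverse mult.commute)
      qed
      then show "\<forall>\<^sub>F t in at 0. norm (f (x0 + t *\<^sub>R h) y - f x0 y - t *\<^sub>R D y h) / norm t
          = norm ((f (x0 + t *\<^sub>R h) y - f x0 y) /\<^sub>R t - D y h)"
        by (simp add: eventually_at_filter)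
    qed
    then have "((\<lambda>t. (f (x0 + t *\<^sub>R h) y - f x0 y) /\<^sub>R t) \<longlongrightarrow> D y h) (at 0)"
      using Lim_null tendsto_norm_zero_iff by blast
    moreover have "filterlim (\<lambda>n. 1 / real (Suc n + N)) (at 0) sequentially"
      unfolding filterlim_at
      using LIMSEQ_ignore_initial_segment[OF lim_1_over_n, of "Suc N"] by (auto simp: add_ac)
    ultimately have "(\<lambda>n. (f (x0 + (1 / real (Suc n + N)) *\<^sub>R h) y - f x0 y) /\<^sub>R (1 / real (Suc n + N))) \<longlonglongrightarrow> D y h"
      by (rule filterlim_compose)
    then show ?thesis by (simp add: inverse_eq_divide)
  qed
  have N: "\<exists>N. \<forall>n. x0 + h /\<^sub>R real (Suc n + N) \<in> ball x0 r" for h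
  proof -
    obtain N :: nat where N: "norm h / r < real N" using reals_Archimedean2 by blast
    have "norm h / real (Suc n + N) < r" for n
    proof -
      have "norm h < real N * r" using N r by (simp add: divide_less_eq)
      also have "\<dots> \<le> real (Suc n + N) * r" using r by (intro mult_right_mono) auto
      finally show ?thesis by (simp add: divide_less_eq mult.commute)
    qed
    then show ?thesis by (intro exI[of _ N]) (auto simp: dist_norm divide_inverse mult.commute)
  qed
  have Dm: "(\<lambda>y. D y h) \<in> borel_measurable M" for h
  proof -
    obtain N where N: "\<And>n. x0 + h /\<^sub>R real (Suc n + N) \<in> ball x0 r" using N by blast
    show ?thesis
      using borel_measurable_integrable[OF int[OF N]] borel_measurable_integrable[OF int[OF x0]]
      by (intro borel_measurable_LIMSEQ_metric[OF _ quot[of N h]] borel_measurable_scaleR borel_measurable_diff) auto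
  qed
  show Db: "norm (D y h) \<le> B y * norm h" for y h
  proof -
    obtain N where N: "\<And>n. x0 + h /\<^sub>R real (Suc n + N) \<in> ball x0 r" using N by blast
    have "norm (real (Suc n + N) *\<^sub>R (f (x0 + h /\<^sub>R real (Suc n + N)) y - f x0 y)) \<le> B y * norm h" for n
    proof -
      have "real (Suc n + N) * norm (f (x0 + h /\<^sub>R real (Suc n + N)) y - f x0 y)
          \<le> real (Suc n + N) * (B y * norm (h /\<^sub>R real (Suc n + N)))"
        using lip[OF N, of n y] by (intro mult_left_mono) auto
      also have "\<dots> = B y * norm h" by (simp del: of_nat_Suc add: field_simps)
      finally show ?thesis by simp
    qed
    then show ?thesis using quot[of N h y] by (intro LIMSEQ_le_const2[OF tendsto_norm]) auto
  qed
  show Di: "integrable M (\<lambda>y. D y h)" for h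
  proof (rule Bochner_Integration.integrable_bound)
    show "integrable M (\<lambda>y. B y * norm h)" using B by simp
    show "AE y in M. norm (D y h) \<le> norm (B y * norm h)"
      using Db by (intro AE_I2) (metis abs_ge_self order_trans real_norm_def)
  qed (rule Dm)
  have lin: "D y (a + b) = D y a + D y b" "D y (s *\<^sub>R a) = s *\<^sub>R D y a" for y a b s
    using has_derivative_linear[OF der[of y]] by (auto simp: linear_add linear_scale)
  show "((\<lambda>x. LINT y|M. f x y) has_derivative (\<lambda>h. LINT y|M. D y h)) (at x0)"
    unfolding has_derivative_at
  proof
    show "bounded_linear (\<lambda>h. LINT y|M. D y h)"
    proof (rule bounded_linear_intro)
      show "norm (LINT y|M. D y h) \<le> norm h * (LINT y|M. B y)" for h
      proof -
        have "norm (LINT y|M. D y h) \<le> (LINT y|M. norm (D y h))" by (rule integral_norm_bound)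
        also have "\<dots> \<le> (LINT y|M. B y * norm h)"
          using Db B Di by (intro integral_mono) auto
        finally show ?thesis by (simp add: mult.commute)
      qed
    qed (simp_all add: lin Di)
    let ?Q = "\<lambda>h y. (f (x0 + h) y - f x0 y - D y h) /\<^sub>R norm h"
    have "((\<lambda>h. LINT y|M. ?Q h y) \<longlongrightarrow> 0) (at 0)"
      unfolding tendsto_at_iff_sequentially
    proof (intro allI impI)
      fix X :: "nat \<Rightarrow> 'a" assume X: "\<forall>i. X i \<in> UNIV - {0}" "X \<longlonglongrightarrow> 0"
      obtain N where N: "\<And>n. n \<ge> N \<Longrightarrow> norm (X n) < r"
        using LIMSEQ_D[OF X(2) r] by auto
      define Y where "Y n = X (n + N)" for n
      have Y: "Y n \<noteq> 0" "x0 + Y n \<in> ball x0 r" "Y \<longlonglongrightarrow> 0" for n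
        using X N[of "n + N"] unfolding Y_def by (auto simp: dist_norm LIMSEQ_ignore_initial_segment)
      have "(\<lambda>n. LINT y|M. ?Q (Y n) y) \<longlonglongrightarrow> (LINT y|M. 0)"
      proof (rule integral_dominated_convergence[where w = "\<lambda>y. 2 * B y"])
        show "integrable M (\<lambda>y. 2 * B y)" using B by simp
        show "(\<lambda>y. ?Q (Y n) y) \<in> borel_measurable M" for n
          using int[OF Y(2)] int[OF x0] Dm by (intro borel_measurable_scaleR borel_measurable_diff) auto
        show "AE y in M. norm (?Q (Y n) y) \<le> 2 * B y" for n
        proof (rule AE_I2)
          fix y
          have *: "norm (f (x0 + Y n) y - f x0 y - D y (Y n)) \<le> B y * norm (Y n) + B y * norm (Y n)"
            using lip[OF Y(2), of n y] Db[of y "Y n"]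
              norm_triangle_ineq4[of "f (x0 + Y n) y - f x0 y" "D y (Y n)"] by simp
          have "norm (?Q (Y n) y) = norm (f (x0 + Y n) y - f x0 y - D y (Y n)) / norm (Y n)"
            by (simp add: divide_inverse mult.commute)
          also have "\<dots> \<le> (B y * norm (Y n) + B y * norm (Y n)) / norm (Y n)"
            by (intro divide_right_mono *) auto
          also have "\<dots> = 2 * B y" using Y(1)[of n] by (simp add: add_divide_distrib)
          finally show "norm (?Q (Y n) y) \<le> 2 * B y" .
        qed
        show "AE y in M. (\<lambda>n. ?Q (Y n) y) \<longlonglongrightarrow> 0"
        proof (rule AE_I2)
          fix y
          have "((\<lambda>h. norm (f (x0 + h) y - f x0 y - D y h) / norm h) \<longlongrightarrow> 0) (at 0)"
            using der[of y] by (simp add: has_derivative_at)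
          then have "((\<lambda>h. ?Q h y) \<longlongrightarrow> 0) (at 0)"
            by (subst tendsto_norm_zero_iff[symmetric]) (simp add: divide_inverse mult.commute)
          then show "(\<lambda>n. ?Q (Y n) y) \<longlonglongrightarrow> 0"
            using Y by (auto simp: tendsto_at_iff_sequentially o_def)
        qed
      qed simp
      then have "(\<lambda>n. ((\<lambda>h. LINT y|M. ?Q h y) \<circ> X) (n + N)) \<longlonglongrightarrow> 0"
        by (simp add: Y_def)
      then show "((\<lambda>h. LINT y|M. ?Q h y) \<circ> X) \<longlonglongrightarrow> 0"
        by (rule LIMSEQ_offset)
    qed
    then have "((\<lambda>h. norm (LINT y|M. ?Q h y)) \<longlongrightarrow> 0) (at 0)"
      by (rule tendsto_norm_zero)
    moreover have "eventually (\<lambda>h. norm (LINT y|M. ?Q h y) =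
        norm ((LINT y|M. f (x0 + h) y) - (LINT y|M. f x0 y) - (LINT y|M. D y h)) / norm h) (at 0)"
      unfolding eventually_at
    proof (intro exI[of _ r] conjI r ballI impI)
      fix h :: 'a assume "h \<noteq> 0 \<and> dist h 0 < r"
      then have "x0 + h \<in> ball x0 r" by (simp add: dist_norm)
      then show "norm (LINT y|M. ?Q h y) =
        norm ((LINT y|M. f (x0 + h) y) - (LINT y|M. f x0 y) - (LINT y|M. D y h)) / norm h"
        using int[OF x0] int Di by (simp add: divide_inverse mult.commute)
    qed
    ultimately show "(\<lambda>h. norm ((LINT y|M. f (x0 + h) y) - (LINT y|M. f x0 y) - (LINT y|M. D y h)) / norm h) \<midarrow>0\<rightarrow> 0"
      by (rule Lim_transform_eventually)
  qed
qed

section \<open>The kernel as a superposition of Gaussian vortices\<close>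

definition perp :: "plane \<Rightarrow> plane" where "perp z = vector [- (z $ 2), z $ 1]"

lemma perp_nth[simp]: "perp z $ 1 = - (z $ 2)" "perp z $ 2 = z $ 1"
  by (simp_all add: perp_def)

lemma linear_perp: "linear perp"
  by (auto intro!: linearI simp: vec_eq_iff forall_2)

lemma bounded_linear_perp: "bounded_linear perp"
  using linear_perp by (simp add: linear_conv_bounded_linear)

lemma perp_zero[simp]: "perp 0 = 0"
  by (rule linear_0[OF linear_perp])

lemma norm_perp[simp]: "norm (perp z) = norm z"
  by (simp add: norm_eq_sqrt_inner inner_vec_def sum_2 add.commute)

text \<open>For z > 0 the number 1 / z is z / 4 times the integral of exp (- z^2 v / 4) over v > 0,
  and \<open>bessel_K1 z\<close> is the same with the extra factor exp (- 1 / v) under the integral.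
  The derivative of \<open>G_alpha\<close> contains their difference; the decay 1 / v of the weight
  expresses that the singularities cancel.\<close>

definition vortex_weight :: "real \<Rightarrow> real" where
  "vortex_weight v = (if v > 0 then 1 - exp (- 1 / v) else 0)"

lemma vortex_weight_bounds:
  "0 \<le> vortex_weight v" "vortex_weight v \<le> 1" "v > 0 \<Longrightarrow> vortex_weight v \<le> 1 / v"
  using exp_ge_add_one_self[of "- 1 / v"] by (auto simp: vortex_weight_def)

lemma vortex_weight_measurable[measurable]: "vortex_weight \<in> borel_measurable borel"
  unfolding vortex_weight_def[abs_def] by measurable

definition gauss_rot :: "real \<Rightarrow> plane \<Rightarrow> plane" where
  "gauss_rot a x = exp (- (a * (x \<bullet> x))) *\<^sub>R perp x"

definition gauss_rot_deriv :: "real \<Rightarrow> plane \<Rightarrow> plane \<Rightarrow> plane" where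
  "gauss_rot_deriv a x h = exp (- (a * (x \<bullet> x))) *\<^sub>R (perp h - (2 * a * (x \<bullet> h)) *\<^sub>R perp x)"

lemma gauss_rot_has_derivative: "(gauss_rot a has_derivative gauss_rot_deriv a x) (at x)"
proof -
  have 1: "((\<lambda>x. exp (- (a * (x \<bullet> x)))) has_derivative
      (\<lambda>h. - (exp (- (a * (x \<bullet> x))) * (2 * a * (x \<bullet> h))))) (at x)"
    by (auto intro!: derivative_eq_intros simp: inner_commute algebra_simps)
  have "((\<lambda>x. exp (- (a * (x \<bullet> x))) *\<^sub>R perp x) has_derivative
      (\<lambda>h. exp (- (a * (x \<bullet> x))) *\<^sub>R perp h + (- (exp (- (a * (x \<bullet> x))) * (2 * a * (x \<bullet> h)))) *\<^sub>R perp x)) (at x)"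
    by (rule has_derivative_scaleR[OF 1 bounded_linear.has_derivative[OF bounded_linear_perp has_derivative_ident]])
  then show ?thesis
    unfolding gauss_rot_def[abs_def] gauss_rot_deriv_def[abs_def] by (simp add: scaleR_diff_right)
qed

text \<open>The bound is uniform in \<open>a\<close>: with s = a |x|^2 the derivative is at most (1
  + 2 s) exp (- s) times |h|, and 1 + 2 s \<le> 2 exp s.\<close>

lemma gauss_rot_deriv_le:
  assumes "a \<ge> 0" shows "norm (gauss_rot_deriv a x h) \<le> 2 * norm h"
proof -
  let ?s = "a * (x \<bullet> x)"
  have s: "?s \<ge> 0" using assms by simp
  have "norm (perp h - (2 * a * (x \<bullet> h)) *\<^sub>R perp x) \<le> norm h + 2 * a * \<bar>x \<bullet> h\<bar> * norm x"
    using norm_triangle_ineq4[of "perp h" "(2 * a * (x \<bullet> h)) *\<^sub>R perp x"] assms by (simp add: abs_mult)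
  also have "\<dots> \<le> norm h + 2 * a * (norm x * norm h) * norm x"
    using assms Cauchy_Schwarz_ineq2[of x h] by (intro add_left_mono mult_right_mono mult_left_mono) auto
  also have "\<dots> = (1 + 2 * ?s) * norm h"
    by (simp add: algebra_simps dot_square_norm power2_eq_square)
  finally have "norm (gauss_rot_deriv a x h) \<le> exp (- ?s) * ((1 + 2 * ?s) * norm h)"
    unfolding gauss_rot_deriv_def by (simp add: mult_left_mono)
  also have "\<dots> \<le> exp (- ?s) * ((2 * exp ?s) * norm h)"
  proof -
    have "1 + 2 * ?s \<le> 2 * exp ?s" using exp_ge_add_one_self[of ?s] by linarith
    then show ?thesis by (intro mult_left_mono mult_right_mono) auto
  qed
  also have "\<dots> = 2 * norm h" by (simp add: exp_minus field_simps)
  finally show ?thesis .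
qed

lemma gauss_rot_lipschitz:
  assumes "a \<ge> 0" shows "norm (gauss_rot a x - gauss_rot a y) \<le> 2 * norm (x - y)"
proof (rule differentiable_bound[of UNIV])
  show "(gauss_rot a has_derivative gauss_rot_deriv a x) (at x within UNIV)" for x
    using gauss_rot_has_derivative by simp
  show "onorm (gauss_rot_deriv a x) \<le> 2" for x
    using gauss_rot_deriv_le[OF assms] by (intro onorm_le) auto
qed auto

text \<open>Incompressibility of a Gaussian vortex: the speed depends on the radius only and the
  direction is tangential.\<close>

lemma gauss_rot_deriv_trace: "gauss_rot_deriv a x (axis 1 1) $ 1 + gauss_rot_deriv a x (axis 2 1) $ 2 = 0"
  unfolding gauss_rot_deriv_def by (simp add: inner_axis) (simp add: axis_def)

lemma gauss_rot_le:
  assumes "a > 0" shows "norm (gauss_rot a x) \<le> 1 / sqrt a"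
proof -
  let ?s = "sqrt a * norm x"
  have "?s \<le> 1 + ?s\<^sup>2"
  proof (cases "?s \<le> 1")
    case True
    then show ?thesis by (rule order_trans) simp
  next
    case False
    then have "?s * 1 \<le> ?s * ?s" by (intro mult_left_mono) auto
    then show ?thesis by (simp add: power2_eq_square)
  qed
  also have "\<dots> \<le> exp (?s\<^sup>2)" by (rule exp_ge_add_one_self)
  also have "?s\<^sup>2 = a * (x \<bullet> x)" using assms by (simp add: power_mult_distrib dot_square_norm)
  finally have "exp (- (a * (x \<bullet> x))) * norm x * sqrt a \<le> 1" by (simp add: exp_minus field_simps)
  then show ?thesis using assms by (simp add: gauss_rot_def field_simps)
qed

lemma gauss_rot_measurable: "(\<lambda>v. gauss_rot (c * v) x) \<in> borel_measurable borel"
  unfolding gauss_rot_def by (intro borel_measurable_continuous_onI continuous_intros)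

section \<open>Bessel functions and the Laplace representation of the kernel\<close>

lemma nonneg_has_integral_lborel:
  fixes f :: "real \<Rightarrow> real"
  assumes f: "f \<in> borel_measurable borel" and S: "S \<in> sets borel"
    and nn: "\<And>x. x \<in> S \<Longrightarrow> 0 \<le> f x" and I: "(f has_integral I) S"
  shows "set_integrable lborel S f" and "(LINT x:S|lborel. f x) = I"
proof -
  have "f absolutely_integrable_on S"
    using I nn by (intro nonnegative_absolutely_integrable_1) auto
  moreover have "(\<lambda>x. indicator S x *\<^sub>R f x) \<in> borel_measurable lborel" using f S by measurable
  ultimately show i: "set_integrable lborel S f"
    unfolding set_integrable_def by (simp add: integrable_completion)
  show "(LINT x:S|lborel. f x) = I"
    using set_borel_integral_eq_integral(2)[OF i] I by (simp add: integral_unique)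
qed

lemma cosh_ge_half: "t \<ge> 0 \<Longrightarrow> t / 2 \<le> cosh (t::real)"
proof -
  have "t / 2 \<le> exp t / 2" using exp_ge_add_one_self[of t] by linarith
  also have "\<dots> \<le> cosh t" by (simp add: cosh_def)
  finally show ?thesis .
qed

text \<open>Half of the exponent absorbs the factor \<open>cosh t\<close>; the other half decays
  exponentially because cosh t \<ge> t / 2.\<close>

lemma cosh_exp_integrable:
  fixes a :: real assumes a: "a > 0"
  shows "set_integrable lborel {0..} (\<lambda>t. cosh t * exp (- a * cosh t))"
proof -
  have e: "set_integrable lborel {0..} (\<lambda>t. exp (- (a / 4) * t))"
    using a has_integral_exp_minus_to_infinity[of "a/4" 0]
    by (intro nonneg_has_integral_lborel(1)) auto
  have "(\<lambda>t. cosh t * exp (- a * cosh t)) \<in> borel_measurable borel"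
    by (intro borel_measurable_continuous_onI continuous_intros)
  then have m: "(\<lambda>t. indicator {0..} t *\<^sub>R (cosh t * exp (- a * cosh t))) \<in> borel_measurable lborel"
    by measurable
  have le: "cosh t * exp (- a * cosh t) \<le> (2 / a) * exp (- (a / 4) * t)" if "t \<ge> 0" for t
  proof -
    have "a / 2 * cosh t \<le> exp (a / 2 * cosh t)"
      using exp_ge_add_one_self[of "a / 2 * cosh t"] by linarith
    then have "cosh t \<le> 2 / a * exp (a / 2 * cosh t)" using a by (simp add: field_simps)
    then have "cosh t * exp (- a * cosh t) \<le> 2 / a * exp (a / 2 * cosh t) * exp (- a * cosh t)"
      by (intro mult_right_mono) auto
    also have "\<dots> = 2 / a * exp (- (a / 2) * cosh t)"
      by (simp add: mult_exp_exp field_simps)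
    also have "\<dots> \<le> 2 / a * exp (- (a / 4) * t)"
    proof -
      have "a / 4 * t \<le> a / 2 * cosh t"
        using a mult_left_mono[OF cosh_ge_half[OF that], of "a / 2"] by simp
      then have "exp (- (a / 2) * cosh t) \<le> exp (- (a / 4) * t)" by simp
      then show ?thesis using a by (intro mult_left_mono) auto
    qed
    finally show ?thesis .
  qed
  show ?thesis
    unfolding set_integrable_def
  proof (rule Bochner_Integration.integrable_bound[OF _ m])
    show "integrable lborel (\<lambda>t. (2 / a) * (indicator {0..} t *\<^sub>R exp (- (a / 4) * t)))"
      using e unfolding set_integrable_def by simp
    show "AE t in lborel. norm (indicator {0..} t *\<^sub>R (cosh t * exp (- a * cosh t)))
        \<le> norm (2 / a * (indicator {0..} t *\<^sub>R exp (- (a / 4) * t)))"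
      using le a cosh_real_nonneg by (intro AE_I2) (auto simp: indicator_def abs_mult)
  qed
qed

lemma exp_cosh_integrable:
  fixes a :: real assumes a: "a > 0"
  shows "set_integrable lborel {0..} (\<lambda>t. exp (- a * cosh t))"
  unfolding set_integrable_def
proof (rule Bochner_Integration.integrable_bound)
  show "integrable lborel (\<lambda>t. indicator {0..} t *\<^sub>R (cosh t * exp (- a * cosh t)))"
    using cosh_exp_integrable[OF a] unfolding set_integrable_def .
  have "(\<lambda>t. exp (- a * cosh t)) \<in> borel_measurable borel"
    by (intro borel_measurable_continuous_onI continuous_intros)
  then show "(\<lambda>t. indicator {0..} t *\<^sub>R exp (- a * cosh t)) \<in> borel_measurable lborel"
    by measurable
  show "AE t in lborel. norm (indicator {0..} t *\<^sub>R exp (- a * cosh t))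
      \<le> norm (indicator {0..} t *\<^sub>R (cosh t * exp (- a * cosh t)))"
    using cosh_real_ge_1 by (intro AE_I2) (auto simp: indicator_def abs_mult order_trans[of 0 1])
qed

definition bessel_K1 :: "real \<Rightarrow> real" where
  "bessel_K1 z = (LINT t:{0..}|lborel. cosh t * exp (- z * cosh t))"

lemma bessel_K0_has_derivative:
  assumes z: "z > 0"
  shows "(bessel_K0 has_real_derivative - bessel_K1 z) (at z)"
proof -
  let ?f = "\<lambda>x t. indicator {0..} t *\<^sub>R exp (- x * cosh t) :: real"
  let ?D = "\<lambda>t h. indicator {0..} t *\<^sub>R (- (cosh t * exp (- z * cosh t))) * h :: real"
  have "((\<lambda>x. LINT t|lborel. ?f x t) has_derivative (\<lambda>h. LINT t|lborel. ?D t h)) (at z)"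
  proof (rule has_derivative_integral(1)[where r = "z / 2" and
      B = "\<lambda>t. indicator {0..} t *\<^sub>R (cosh t * exp (- (z / 2) * cosh t))"])
    show "((\<lambda>x. ?f x t) has_derivative ?D t) (at z)" for t
      by (auto intro!: derivative_eq_intros simp: fun_eq_iff)
    have ge: "x \<ge> z / 2" if "x \<in> ball z (z / 2)" for x
      using that unfolding mem_ball dist_real_def by linarith
    show "integrable lborel (?f x)" if "x \<in> ball z (z / 2)" for x
      using exp_cosh_integrable[of x] ge[OF that] z unfolding set_integrable_def by simp
    show "integrable lborel (\<lambda>t. indicator {0..} t *\<^sub>R (cosh t * exp (- (z / 2) * cosh t)))"
      using cosh_exp_integrable[of "z / 2"] z unfolding set_integrable_def by simp
    fix x t assume x: "x \<in> ball z (z / 2)"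
    have "norm (exp (- x * cosh t) - exp (- z * cosh t)) \<le> (cosh t * exp (- (z / 2) * cosh t)) * norm (x - z)"
    proof (rule field_differentiable_bound[where S = "{z / 2..}" and f' = "\<lambda>x. - (cosh t * exp (- x * cosh t))"])
      show "norm (- (cosh t * exp (- y * cosh t))) \<le> cosh t * exp (- (z / 2) * cosh t)" if "y \<in> {z / 2..}" for y
        using that cosh_real_nonneg[of t] mult_right_mono[of "z/2" y "cosh t"]
        by (auto simp: abs_mult intro!: mult_left_mono)
    qed (use ge[OF x] z in \<open>auto intro!: derivative_eq_intros\<close>)
    then show "norm (?f x t - ?f z t) \<le> indicator {0..} t *\<^sub>R (cosh t * exp (- (z / 2) * cosh t)) * norm (x - z)"
      by (auto simp: indicator_def)
  qed (use z in auto)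
  moreover have "(\<lambda>h. LINT t|lborel. ?D t h) = (*) (- bessel_K1 z)"
    unfolding bessel_K1_def set_lebesgue_integral_def by (simp add: fun_eq_iff)
  ultimately show ?thesis
    unfolding has_field_derivative_def bessel_K0_def[abs_def] set_lebesgue_integral_def by simp
qed

lemma exp_quadratic_integrable:
  fixes z :: real assumes z: "z > 0"
  shows "set_integrable lborel {0<..} (\<lambda>v. exp (- (z * v)))"
    and "(LINT v:{0<..}|lborel. exp (- (z * v))) = 1 / z"
proof -
  have "((\<lambda>v. exp (- (z * v))) has_integral 1 / z) {0..}"
    using has_integral_exp_minus_to_infinity[OF z, of 0] by simp
  then have "((\<lambda>v. exp (- (z * v))) has_integral 1 / z) {0<..}"
    by (subst has_integral_spike_set_eq[where T = "{0..}"])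
      (auto intro: negligible_subset[OF negligible_sing[of 0]])
  then show "set_integrable lborel {0<..} (\<lambda>v. exp (- (z * v)))"
    "(LINT v:{0<..}|lborel. exp (- (z * v))) = 1 / z"
    by (auto intro!: nonneg_has_integral_lborel)
qed

text \<open>The substitution \<open>v = (2 / z) exp (\<plusminus> t)\<close> turns \<open>K\<^sub>1\<close> into a Laplace transform in \<open>z\<^sup>2\<close>.\<close>

lemma bessel_K1_Laplace:
  assumes z: "z > 0"
  shows "set_integrable lborel {0<..} (\<lambda>v. exp (- (1 / v) - z\<^sup>2 * v / 4))"
    and "bessel_K1 z = z / 4 * (LINT v:{0<..}|lborel. exp (- (1 / v) - z\<^sup>2 * v / 4))"
proof -
  let ?F = "\<lambda>v. exp (- (1 / v) - z\<^sup>2 * v / 4)"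
  \<comment> \<open>\<open>s\<close> is the sign in the substitution: s = 1 covers v \<ge> 2 / z and
    s = -1 covers 0 < v \<le> 2 / z. On both halves the exponent becomes - z cosh t, and the two
    Jacobians add up to (4 / z) cosh t.\<close>
  let ?E = "\<lambda>s t. 2 / z * exp (s * t) * exp (- z * cosh t)"
  have Eint: "set_integrable lborel {0..} (?E s)" if "s = 1 \<or> s = -1" for s
    unfolding set_integrable_def
  proof (rule Bochner_Integration.integrable_bound)
    show "integrable lborel (\<lambda>t. (4 / z) * (indicator {0..} t *\<^sub>R (cosh t * exp (- z * cosh t))))"
      using cosh_exp_integrable[OF z] unfolding set_integrable_def by simp
    have "?E s \<in> borel_measurable borel"
      by (intro borel_measurable_continuous_onI continuous_intros)
    then show "(\<lambda>t. indicator {0..} t *\<^sub>R ?E s t) \<in> borel_measurable lborel" by measurable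
    have *: "exp (s * t) \<le> 2 * cosh t" for t using that by (auto simp: cosh_def)
    have "?E s t \<le> 4 / z * (cosh t * exp (- z * cosh t))" for t
      using mult_right_mono[OF mult_left_mono[OF *[of t], of "2 / z"], of "exp (- z * cosh t)"] z
      by (simp add: mult.assoc)
    then show "AE t in lborel. norm (indicator {0..} t *\<^sub>R ?E s t)
        \<le> norm (4 / z * (indicator {0..} t *\<^sub>R (cosh t * exp (- z * cosh t))))"
      using z cosh_real_nonneg by (intro AE_I2) (auto simp: indicator_def abs_mult)
  qed
  have FE: "\<bar>s * (2 / z * exp (s * t))\<bar> * ?F (2 / z * exp (s * t)) = ?E s t" if "s = 1 \<or> s = -1" for s t
  proof -
    have c: "cosh t = (exp (s * t) + 1 / exp (s * t)) / 2"
      using that by (elim disjE) (simp_all add: cosh_field_def exp_minus inverse_eq_divide)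
    have "- (1 / (2 / z * E)) - z\<^sup>2 * (2 / z * E) / 4 = - z * ((E + 1 / E) / 2)" if "E \<noteq> 0" for E
      using z that by (simp add: field_simps power2_eq_square)
    then have "- (1 / (2 / z * exp (s * t))) - z\<^sup>2 * (2 / z * exp (s * t)) / 4 = - z * cosh t"
      unfolding c by simp
    moreover have "\<bar>s * (2 / z * exp (s * t))\<bar> = 2 / z * exp (s * t)" using that z by (auto simp: abs_mult)
    ultimately show ?thesis by simp
  qed
  have cov: "?F absolutely_integrable_on (\<lambda>t. 2 / z * exp (s * t)) ` {0..} \<and>
      integral ((\<lambda>t. 2 / z * exp (s * t)) ` {0..}) ?F = integral {0..} (?E s)" if s: "s = 1 \<or> s = -1" for s
  proof -
    have E: "?E s absolutely_integrable_on {0..}"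
      using Eint[OF s] unfolding set_integrable_def by (rule integrable_completion[THEN iffD2, rotated]) (use Eint[OF s] in \<open>auto simp: set_integrable_def dest: borel_measurable_integrable\<close>)
    have der: "((\<lambda>t. 2 / z * exp (s * t)) has_field_derivative s * (2 / z * exp (s * t))) (at t within {0..})" for t
      using z by (auto intro!: derivative_eq_intros)
    have inj: "inj_on (\<lambda>t. 2 / z * exp (s * t)) {0..}"
    proof (rule inj_onI)
      fix x y assume "2 / z * exp (s * x) = 2 / z * exp (s * y)"
      then have "s * x = s * y" using z by simp
      then show "x = y" using s by auto
    qed
    have eq: "(\<lambda>t. \<bar>s * (2 / z * exp (s * t))\<bar> * ?F (2 / z * exp (s * t))) = ?E s"
      by (rule ext) (rule FE[OF s])
    have L: "{0::real..} \<in> sets lebesgue" by simp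
    note iff = has_absolute_integral_change_of_variables_1'[OF L der inj, of ?F "integral {0..} (?E s)", unfolded eq]
    show ?thesis by (rule iffD1[OF iff conjI[OF E refl]])
  qed
  have im1: "(\<lambda>t. 2 / z * exp (1 * t)) ` {0..} = {2 / z..}"
  proof (intro equalityI subsetI)
    fix v assume "v \<in> {2 / z..}"
    then have v: "v * z / 2 \<ge> 1" using z by (simp add: field_simps)
    then have "v = 2 / z * exp (1 * ln (v * z / 2))" using z by simp
    moreover have "ln (v * z / 2) \<ge> 0" using v by simp
    ultimately show "v \<in> (\<lambda>t. 2 / z * exp (1 * t)) ` {0..}" by (intro image_eqI) auto
  qed (use z in \<open>auto simp: field_simps\<close>)
  have im2: "(\<lambda>t. 2 / z * exp (-1 * t)) ` {0..} = {0<..2 / z}"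
  proof (intro equalityI subsetI)
    fix v assume "v \<in> {0<..2 / z}"
    then have v: "v * z / 2 \<le> 1" "v * z / 2 > 0" using z by (auto simp: field_simps)
    then have "v = 2 / z * exp (-1 * (- ln (v * z / 2)))" using z by simp
    moreover have "- ln (v * z / 2) \<ge> 0" using v by simp
    ultimately show "v \<in> (\<lambda>t. 2 / z * exp (-1 * t)) ` {0..}"
      by (intro image_eqI[of _ _ "- ln (v * z / 2)"]) auto
  qed (use z in \<open>auto simp: field_simps\<close>)
  note c1 = cov[of 1, unfolded im1] and c2 = cov[of "-1", unfolded im2]
  have un: "{0<..} = {0<..2 / z} \<union> {2 / z..}" using z by (auto simp: not_le) (meson divide_pos_pos less_le_trans zero_less_numeral)
  show Fint: "set_integrable lborel {0<..} ?F"
    unfolding set_integrable_def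
  proof (rule Bochner_Integration.integrable_bound)
    show "integrable lborel (\<lambda>v. indicator {0<..} v *\<^sub>R exp (- (z\<^sup>2 / 4 * v)))"
      using exp_quadratic_integrable(1)[of "z\<^sup>2 / 4"] z unfolding set_integrable_def by simp
    show "(\<lambda>v. indicator {0<..} v *\<^sub>R ?F v) \<in> borel_measurable lborel" by measurable
    show "AE v in lborel. norm (indicator {0<..} v *\<^sub>R ?F v) \<le> norm (indicator {0<..} v *\<^sub>R exp (- (z\<^sup>2 / 4 * v)))"
      by (intro AE_I2) (auto simp: indicator_def)
  qed
  have "(LINT v:{0<..}|lborel. ?F v) = integral {0<..} ?F"
    using Fint by (rule set_borel_integral_eq_integral)
  also have "\<dots> = integral {0<..2 / z} ?F + integral {2 / z..} ?F"
    unfolding un using c1 c2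
    by (intro integral_Un) (auto intro: set_lebesgue_integral_eq_integral(1) negligible_subset[OF negligible_sing[of "2 / z"]])
  also have "\<dots> = integral {0..} (?E (-1)) + integral {0..} (?E 1)" using c1 c2 by simp
  also have "\<dots> = (LINT t:{0..}|lborel. ?E (-1) t) + (LINT t:{0..}|lborel. ?E 1 t)"
    using set_borel_integral_eq_integral(2)[OF Eint[OF disjI1[OF refl]]]
      set_borel_integral_eq_integral(2)[OF Eint[OF disjI2[OF refl]]] by (simp only:)
  also have "\<dots> = (LINT t:{0..}|lborel. ?E (-1) t + ?E 1 t)"
    by (rule set_integral_add(2)[OF Eint[OF disjI2[OF refl]] Eint[OF disjI1[OF refl]], symmetric])
  also have "\<dots> = (LINT t:{0..}|lborel. 4 / z * (cosh t * exp (- z * cosh t)))"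
    using z by (intro arg_cong[where f = "\<lambda>f. LINT t:{0..}|lborel. f t"]) (auto simp: fun_eq_iff cosh_def field_simps)
  also have "\<dots> = 4 / z * bessel_K1 z" by (simp add: bessel_K1_def)
  finally show "bessel_K1 z = z / 4 * (LINT v:{0<..}|lborel. ?F v)" using z by simp
qed

text \<open>With c = 1 / (4 \<alpha>^2) this is, up to the factor 1 / (8 pi \<alpha>^2), the angular
  velocity that the kernel produces at distance \<open>r\<close>.\<close>

definition vortex_profile :: "real \<Rightarrow> real \<Rightarrow> real" where
  "vortex_profile c r = (LINT v|lborel. vortex_weight v * exp (- (c * v * r\<^sup>2)))"

lemma inverse_minus_bessel_K1:
  assumes z: "z > 0"
  shows "1 / z - bessel_K1 z = z / 4 * vortex_profile (1 / 4) z"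
proof -
  have z4: "z\<^sup>2 / 4 > 0" using z by simp
  note e = exp_quadratic_integrable[OF z4] and K = bessel_K1_Laplace[OF z]
  have "vortex_profile (1 / 4) z = (LINT v:{0<..}|lborel. exp (- (z\<^sup>2 / 4 * v)) - exp (- (1 / v) - z\<^sup>2 * v / 4))"
    unfolding vortex_profile_def set_lebesgue_integral_def
    by (intro Bochner_Integration.integral_cong refl)
      (auto simp: vortex_weight_def indicator_def algebra_simps exp_add[symmetric] exp_diff exp_minus field_simps)
  also have "\<dots> = 1 / (z\<^sup>2 / 4) - 4 / z * bessel_K1 z"
  proof -
    have "(LINT v:{0<..}|lborel. exp (- (1 / v) - z\<^sup>2 * v / 4)) = 4 / z * bessel_K1 z"
      using K(2) z by (simp add: field_simps)
    then show ?thesis by (simp only: set_integral_diff(2)[OF e(1) K(1)] e(2))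
  qed
  finally show ?thesis using z by (simp add: field_simps power2_eq_square)
qed

lemma G_alpha_has_derivative:
  assumes \<alpha>: "\<alpha> > 0" and r: "r > 0"
  shows "(G_alpha \<alpha> has_real_derivative r * (vortex_profile (1 / (4 * \<alpha>\<^sup>2)) r / (8 * pi * \<alpha>\<^sup>2))) (at r)"
proof -
  have z: "r / \<alpha> > 0" using assms by simp
  have "((\<lambda>r. bessel_K0 (r / \<alpha>)) has_real_derivative - bessel_K1 (r / \<alpha>) * (1 / \<alpha>)) (at r)"
    by (rule DERIV_chain2[where f = bessel_K0 and g = "\<lambda>r. r / \<alpha>", OF bessel_K0_has_derivative[OF z]])
      (use \<alpha> in \<open>auto intro!: derivative_eq_intros\<close>)
  then have "(G_alpha \<alpha> has_real_derivative
      1 / (2 * pi) * (- bessel_K1 (r / \<alpha>) * (1 / \<alpha>)) + 1 / (2 * pi) * (1 / r)) (at r)"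
    unfolding G_alpha_def[abs_def] using r
    by (intro DERIV_add DERIV_cmult DERIV_ln_divide)
  moreover have "1 / (2 * pi) * (- bessel_K1 (r / \<alpha>) * (1 / \<alpha>)) + 1 / (2 * pi) * (1 / r)
      = 1 / (2 * pi * \<alpha>) * (1 / (r / \<alpha>) - bessel_K1 (r / \<alpha>))"
    using assms by (simp add: field_simps)
  moreover have "vortex_profile (1 / 4) (r / \<alpha>) = vortex_profile (1 / (4 * \<alpha>\<^sup>2)) r"
    by (simp add: vortex_profile_def power_divide field_simps)
  ultimately have "(G_alpha \<alpha> has_real_derivative
      1 / (2 * pi * \<alpha>) * (r / \<alpha> / 4 * vortex_profile (1 / (4 * \<alpha>\<^sup>2)) r)) (at r)"
    by (simp only: inverse_minus_bessel_K1[OF z])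
  moreover have "1 / (2 * pi * \<alpha>) * (r / \<alpha> / 4 * V) = r * (V / (8 * pi * \<alpha>\<^sup>2))" for V
    using assms by (simp add: power2_eq_square)
  ultimately show ?thesis by (simp only:)
qed

text \<open>The weight is a parameter so that the kernel and its cut versions share the same
  integrability and size bounds.\<close>

definition kern_at :: "real \<Rightarrow> (real \<Rightarrow> real) \<Rightarrow> plane \<Rightarrow> plane" where
  "kern_at \<alpha> w x = (1 / (8 * pi * \<alpha>\<^sup>2)) *\<^sub>R (LINT v|lborel. w v *\<^sub>R gauss_rot (v / (4 * \<alpha>\<^sup>2)) x)"

definition kern :: "real \<Rightarrow> plane \<Rightarrow> plane" where
  "kern \<alpha> = kern_at \<alpha> vortex_weight"

text \<open>A vortex with parameter \<open>v\<close> has width of order \<alpha> / sqrt v; the cut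
  removes those narrower than about \<alpha> e.\<close>

definition cut_weight :: "real \<Rightarrow> real \<Rightarrow> real" where
  "cut_weight e v = indicator {..1 / e\<^sup>2} v * vortex_weight v"

definition log_mod :: "real \<Rightarrow> real" where "log_mod e = 1 - ln e"

lemma log_mod_ge_1: "0 < e \<Longrightarrow> e \<le> 1 \<Longrightarrow> log_mod e \<ge> 1"
  by (simp add: log_mod_def)

lemma cut_weight_measurable[measurable]: "cut_weight e \<in> borel_measurable borel"
  unfolding cut_weight_def[abs_def] by measurable

lemma vortex_profile_integrable:
  assumes p: "p > 0"
  shows "integrable lborel (\<lambda>v. vortex_weight v * exp (- (p * v)))"
proof (rule Bochner_Integration.integrable_bound)
  show "integrable lborel (\<lambda>v. indicator {0<..} v *\<^sub>R exp (- (p * v)))"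
    using exp_quadratic_integrable(1)[OF p] unfolding set_integrable_def .
  have "norm (vortex_weight v * exp (- (p * v))) \<le> norm (indicator {0<..} v *\<^sub>R exp (- (p * v)))" for v
    using vortex_weight_bounds[of v] by (auto simp: indicator_def vortex_weight_def[of v] abs_mult)
  then show "AE v in lborel. norm (vortex_weight v * exp (- (p * v))) \<le> norm (indicator {0<..} v *\<^sub>R exp (- (p * v)))"
    by (rule AE_I2)
qed measurable

text \<open>The perpendicular gradient of a radial function is G' (r) / r times the rotated vector,
  and G' (r) / r is the Gaussian superposition. On the diagonal both sides are 0.\<close>

lemma K_alpha_eq_kern:
  assumes \<alpha>: "\<alpha> > 0"
  shows "K_alpha \<alpha> x y = kern \<alpha> (x - y)"
proof (cases "x = y")
  case True
  then show ?thesis by (simp add: K_alpha_def kern_def kern_at_def gauss_rot_def)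
next
  case False
  define z where "z = x - y"
  have z: "norm z > 0" using False by (simp add: z_def)
  let ?G = "norm z * (vortex_profile (1 / (4 * \<alpha>\<^sup>2)) (norm z) / (8 * pi * \<alpha>\<^sup>2))"
  have "((\<lambda>w. norm (w - y)) has_derivative (\<lambda>h. h \<bullet> sgn z)) (at x)"
  proof -
    have "((\<lambda>w. w - y) has_derivative (\<lambda>h. h)) (at x)"
      by (auto intro!: derivative_eq_intros)
    moreover have "(norm has_derivative (\<lambda>h. h \<bullet> sgn (x - y))) (at (x - y))"
      using False by (intro has_derivative_norm) auto
    ultimately show ?thesis
      using diff_chain_at[of "\<lambda>w. w - y" "\<lambda>h. h" x norm] by (simp add: o_def z_def)
  qed
  from has_derivative_compose[OF this G_alpha_has_derivative[OF \<alpha> z, unfolded z_def has_field_derivative_def]]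
  have der: "((\<lambda>w. G_alpha \<alpha> (norm (w - y))) has_derivative (\<lambda>h. ?G * (h \<bullet> sgn z))) (at x)"
    by (simp add: z_def)
  have p: "partial i (\<lambda>w. G_alpha \<alpha> (norm (w - y))) x = vortex_profile (1 / (4 * \<alpha>\<^sup>2)) (norm z) / (8 * pi * \<alpha>\<^sup>2) * z $ i" for i
    unfolding partial_def frechet_derivative_at[OF der, symmetric]
    using z by (simp add: sgn_div_norm inner_commute[of "axis i 1"] inner_axis)
  have "perp_grad (\<lambda>w. G_alpha \<alpha> (norm (w - y))) x = (vortex_profile (1 / (4 * \<alpha>\<^sup>2)) (norm z) / (8 * pi * \<alpha>\<^sup>2)) *\<^sub>R perp z"
    unfolding perp_grad_def p perp_def by (simp add: vec_eq_iff forall_2)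
  moreover have "kern \<alpha> z = (vortex_profile (1 / (4 * \<alpha>\<^sup>2)) (norm z) / (8 * pi * \<alpha>\<^sup>2)) *\<^sub>R perp z"
  proof -
    have p: "1 / (4 * \<alpha>\<^sup>2) * (norm z)\<^sup>2 > 0" using z \<alpha> by simp
    have "(LINT v|lborel. vortex_weight v *\<^sub>R gauss_rot (v / (4 * \<alpha>\<^sup>2)) z)
        = (LINT v|lborel. (vortex_weight v * exp (- (1 / (4 * \<alpha>\<^sup>2) * (norm z)\<^sup>2 * v))) *\<^sub>R perp z)"
      by (simp add: gauss_rot_def dot_square_norm mult_ac)
    also have "\<dots> = (LINT v|lborel. vortex_weight v * exp (- (1 / (4 * \<alpha>\<^sup>2) * (norm z)\<^sup>2 * v))) *\<^sub>R perp z"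
      by (rule integral_scaleR_left) (rule vortex_profile_integrable[OF p])
    also have "\<dots> = vortex_profile (1 / (4 * \<alpha>\<^sup>2)) (norm z) *\<^sub>R perp z"
      unfolding vortex_profile_def by (simp add: mult_ac)
    finally show ?thesis unfolding kern_def kern_at_def by simp
  qed
  ultimately show ?thesis using False by (simp add: K_alpha_def z_def)
qed

section \<open>Size, modulus and incompressibility of the cut kernels\<close>

lemma integrable_half_tail:
  assumes a: "a > 0"
  shows "set_integrable lborel {a..} (\<lambda>v::real. 1 / (v * sqrt v))"
    and "(LINT v:{a..}|lborel. 1 / (v * sqrt v)) = 2 / sqrt a"
proof -
  have "((\<lambda>v. v powr (-3/2)) has_integral - (a powr (-3/2 + 1)) / (-3/2 + 1)) {a..}"
    using a by (intro has_integral_powr_to_inf) auto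
  also have "- (a powr (-3/2 + 1)) / (-3/2 + 1) = 2 / sqrt a"
    using a by (simp add: powr_minus_divide powr_half_sqrt)
  finally have "((\<lambda>v. 1 / (v * sqrt v)) has_integral 2 / sqrt a) {a..}"
  proof (rule has_integral_eq[rotated])
    fix v assume "v \<in> {a..}"
    then have v: "v > 0" using a by simp
    have "v powr (3/2) = v * sqrt v" using powr_add[of v 1 "1/2"] v by (simp add: powr_half_sqrt)
    then show "v powr (-3/2) = 1 / (v * sqrt v)"
      using v by (simp add: powr_minus_divide)
  qed
  then show "set_integrable lborel {a..} (\<lambda>v::real. 1 / (v * sqrt v))"
    "(LINT v:{a..}|lborel. 1 / (v * sqrt v)) = 2 / sqrt a"
    using a by (auto intro!: nonneg_has_integral_lborel)
qed

lemma integrable_half_head: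
  "set_integrable lborel {0<..<1} (\<lambda>v::real. 1 / sqrt v)"
proof -
  have "((\<lambda>v. v powr (-1/2)) has_integral (1 powr (-1/2 + 1)) / (-1/2 + 1)) {0..1::real}"
    by (intro has_integral_powr_from_0) auto
  then have "((\<lambda>v. v powr (-1/2)) has_integral 2) {0<..<1::real}"
    by (simp add: has_integral_Icc_iff_Ioo)
  then have "((\<lambda>v. 1 / sqrt v) has_integral 2) {0<..<1::real}"
    by (rule has_integral_eq[rotated]) (simp add: powr_minus_divide powr_half_sqrt)
  then show ?thesis by (auto intro!: nonneg_has_integral_lborel)
qed

context
  fixes \<alpha> :: real
  assumes \<alpha>: "\<alpha> > 0"
begin

lemma gauss_rot_scaled_le:
  assumes "v > 0" shows "norm (gauss_rot (v / (4 * \<alpha>\<^sup>2)) x) \<le> 2 * \<alpha> / sqrt v"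
proof -
  have "1 / sqrt (v / (4 * \<alpha>\<^sup>2)) = 2 * \<alpha> / sqrt v"
    using \<alpha> by (simp add: real_sqrt_divide real_sqrt_mult)
  then show ?thesis using gauss_rot_le[of "v / (4 * \<alpha>\<^sup>2)" x] assms \<alpha> by simp
qed

text \<open>Product of the bound 2 \<alpha> / sqrt v for a Gaussian vortex and the bound min (1, 1 /
  v) for the weight: v^(-1/2) near 0 and v^(-3/2) at infinity, both integrable.\<close>

definition kern_dom :: "real \<Rightarrow> real" where
  "kern_dom v = (2 * \<alpha>) * (indicator {0<..<1} v * (1 / sqrt v) + indicator {1..} v * (1 / (v * sqrt v)))"

lemma kern_dom_integrable: "integrable lborel kern_dom"
  using integrable_half_head integrable_half_tail(1)[of 1]
  unfolding kern_dom_def[abs_def] set_integrable_def by simp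

lemma kern_integrand_le: "norm (vortex_weight v *\<^sub>R gauss_rot (v / (4 * \<alpha>\<^sup>2)) x) \<le> kern_dom v"
proof (cases "v > 0")
  case True
  have g: "norm (gauss_rot (v / (4 * \<alpha>\<^sup>2)) x) \<le> 2 * \<alpha> / sqrt v"
    using True by (rule gauss_rot_scaled_le)
  have "vortex_weight v * norm (gauss_rot (v / (4 * \<alpha>\<^sup>2)) x) \<le> (if v < 1 then 1 else 1 / v) * (2 * \<alpha> / sqrt v)"
    using True \<alpha> vortex_weight_bounds[of v] g by (intro mult_mono) auto
  also have "\<dots> = kern_dom v"
    using True by (auto simp: kern_dom_def)
  finally show ?thesis using vortex_weight_bounds[of v] by simp
qed (auto simp: vortex_weight_def kern_dom_def indicator_def)

lemma weighted_measurable: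
  "w \<in> borel_measurable borel \<Longrightarrow> (\<lambda>v. w v *\<^sub>R gauss_rot (v / (4 * \<alpha>\<^sup>2)) x) \<in> borel_measurable lborel"
  using gauss_rot_measurable[of "1 / (4 * \<alpha>\<^sup>2)" x] by (simp add: borel_measurable_scaleR)

lemma kern_integrand_integrable:
  assumes w: "w \<in> borel_measurable borel" "\<And>v. \<bar>w v\<bar> \<le> vortex_weight v"
  shows "integrable lborel (\<lambda>v. w v *\<^sub>R gauss_rot (v / (4 * \<alpha>\<^sup>2)) x)"
proof (rule Bochner_Integration.integrable_bound[OF kern_dom_integrable weighted_measurable[OF w(1)]])
  show "AE v in lborel. norm (w v *\<^sub>R gauss_rot (v / (4 * \<alpha>\<^sup>2)) x) \<le> norm (kern_dom v)"
  proof (rule AE_I2)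
    fix v
    have "norm (w v *\<^sub>R gauss_rot (v / (4 * \<alpha>\<^sup>2)) x) \<le> norm (vortex_weight v *\<^sub>R gauss_rot (v / (4 * \<alpha>\<^sup>2)) x)"
      using w(2)[of v] vortex_weight_bounds[of v] by (simp add: mult_right_mono)
    then show "norm (w v *\<^sub>R gauss_rot (v / (4 * \<alpha>\<^sup>2)) x) \<le> norm (kern_dom v)"
      using kern_integrand_le[of v x] by simp
  qed
qed

lemma kern_at_bounded:
  assumes w: "w \<in> borel_measurable borel" "\<And>v. \<bar>w v\<bar> \<le> vortex_weight v"
  shows "norm (kern_at \<alpha> w x) \<le> (1 / (8 * pi * \<alpha>\<^sup>2)) * (LINT v|lborel. kern_dom v)"
proof -
  have "norm (LINT v|lborel. w v *\<^sub>R gauss_rot (v / (4 * \<alpha>\<^sup>2)) x) \<le> (LINT v|lborel. norm (w v *\<^sub>R gauss_rot (v / (4 * \<alpha>\<^sup>2)) x))"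
    by (rule integral_norm_bound)
  also have "\<dots> \<le> (LINT v|lborel. kern_dom v)"
  proof (intro integral_mono integrable_norm kern_integrand_integrable w kern_dom_integrable)
    fix v
    have "norm (w v *\<^sub>R gauss_rot (v / (4 * \<alpha>\<^sup>2)) x) \<le> norm (vortex_weight v *\<^sub>R gauss_rot (v / (4 * \<alpha>\<^sup>2)) x)"
      using w(2)[of v] vortex_weight_bounds[of v] by (simp add: mult_right_mono)
    then show "norm (w v *\<^sub>R gauss_rot (v / (4 * \<alpha>\<^sup>2)) x) \<le> kern_dom v"
      using kern_integrand_le[of v x] by simp
  qed
  finally show ?thesis
    unfolding kern_at_def by (simp add: divide_right_mono)
qed

lemma cut_weight_le: "\<bar>cut_weight e v\<bar> \<le> vortex_weight v"
  using vortex_weight_bounds[of v] by (auto simp: cut_weight_def indicator_def)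

text \<open>The discarded part is dominated by 2 \<alpha> v^(-3/2) on v \<ge> 1 / e^2, whose
  integral is 4 \<alpha> e.\<close>

lemma kern_cut_diff:
  assumes e: "0 < e"
  shows "norm (kern \<alpha> x - kern_at \<alpha> (cut_weight e) x) \<le> ((1 / (8 * pi * \<alpha>\<^sup>2)) * (4 * \<alpha>)) * e"
proof -
  have p: "1 / e\<^sup>2 > 0" using e by simp
  let ?g = "\<lambda>v. gauss_rot (v / (4 * \<alpha>\<^sup>2)) x"
  have i: "integrable lborel (\<lambda>v. vortex_weight v *\<^sub>R ?g v)" "integrable lborel (\<lambda>v. cut_weight e v *\<^sub>R ?g v)"
    by (auto intro!: kern_integrand_integrable simp: vortex_weight_bounds cut_weight_le)
  have "norm (LINT v|lborel. vortex_weight v *\<^sub>R ?g v - cut_weight e v *\<^sub>R ?g v)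
      \<le> (LINT v|lborel. norm (vortex_weight v *\<^sub>R ?g v - cut_weight e v *\<^sub>R ?g v))"
    by (rule integral_norm_bound)
  also have "\<dots> \<le> (LINT v|lborel. 2 * \<alpha> * (indicator {1 / e\<^sup>2..} v *\<^sub>R (1 / (v * sqrt v))))"
  proof (intro integral_mono integrable_norm Bochner_Integration.integrable_diff i)
    show "integrable lborel (\<lambda>v. 2 * \<alpha> * (indicator {1 / e\<^sup>2..} v *\<^sub>R (1 / (v * sqrt v))))"
      by (rule integrable_mult_right[OF integrable_half_tail(1)[OF p, unfolded set_integrable_def]])
    fix v
    show "norm (vortex_weight v *\<^sub>R ?g v - cut_weight e v *\<^sub>R ?g v) \<le> 2 * \<alpha> * (indicator {1 / e\<^sup>2..} v *\<^sub>R (1 / (v * sqrt v)))"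
    proof (cases "v \<le> 1 / e\<^sup>2")
      case True
      have "0 \<le> 2 * \<alpha> * (indicator {1 / e\<^sup>2..} v *\<^sub>R (1 / (v * sqrt v)))"
      proof (cases "1 / e\<^sup>2 \<le> v")
        case True
        then have "v > 0" using p by linarith
        then show ?thesis using \<alpha> by simp
      qed simp
      then show ?thesis using True by (simp add: cut_weight_def)
    next
      case False
      then have v: "v > 0" using p by (meson less_trans not_le)
      have "vortex_weight v * norm (?g v) \<le> 1 / v * (2 * \<alpha> / sqrt v)"
        using vortex_weight_bounds[of v] gauss_rot_scaled_le[OF v] v \<alpha> by (intro mult_mono) auto
      then show ?thesis using False vortex_weight_bounds[of v] by (simp add: cut_weight_def)
    qed
  qed
  also have "\<dots> = 2 * \<alpha> * (2 / sqrt (1 / e\<^sup>2))"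
    unfolding integral_mult_right_zero integrable_half_tail(2)[OF p, unfolded set_lebesgue_integral_def] ..
  also have "\<dots> = 4 * \<alpha> * e" using e by (simp add: real_sqrt_divide)
  finally have "norm ((LINT v|lborel. vortex_weight v *\<^sub>R ?g v) - (LINT v|lborel. cut_weight e v *\<^sub>R ?g v)) \<le> 4 * \<alpha> * e"
    using i by simp
  then have "(1 / (8 * pi * \<alpha>\<^sup>2)) * norm ((LINT v|lborel. vortex_weight v *\<^sub>R ?g v) - (LINT v|lborel. cut_weight e v *\<^sub>R ?g v)) \<le> (1 / (8 * pi * \<alpha>\<^sup>2)) * (4 * \<alpha> * e)"
    by (rule mult_left_mono) simp
  moreover have "kern \<alpha> x - kern_at \<alpha> (cut_weight e) x
      = (1 / (8 * pi * \<alpha>\<^sup>2)) *\<^sub>R ((LINT v|lborel. vortex_weight v *\<^sub>R ?g v) - (LINT v|lborel. cut_weight e v *\<^sub>R ?g v))"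
    unfolding kern_def kern_at_def by (simp add: scaleR_diff_right)
  ultimately show ?thesis by (simp add: mult.assoc)
qed

text \<open>The origin of the logarithm: the weight is at most 1 up to v = 1 and at most 1 / v up to
  1 / e^2, which contributes 1 - 2 ln e.\<close>

lemma cut_weight_integral:
  assumes e: "0 < e" "e \<le> 1"
  shows "integrable lborel (cut_weight e)" "(LINT v|lborel. cut_weight e v) \<le> 2 * log_mod e"
proof -
  let ?b = "\<lambda>v::real. indicator {0..1} v + indicator {1..1 / e\<^sup>2} v *\<^sub>R (1 / v)"
  have ge: "1 \<le> 1 / e\<^sup>2" using e by (simp add: power_le_one)
  have "((\<lambda>v. 1 / v) has_integral ln (1 / e\<^sup>2) - ln 1) {1..1 / e\<^sup>2}"
    using ge by (intro fundamental_theorem_of_calculus)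
      (auto intro!: derivative_eq_intros simp: has_real_derivative_iff_has_vector_derivative[symmetric])
  then have l: "set_integrable lborel {1..1 / e\<^sup>2} (\<lambda>v. 1 / v)" "(LINT v:{1..1 / e\<^sup>2}|lborel. 1 / v) = - 2 * ln e"
    using nonneg_has_integral_lborel[of "\<lambda>v. 1 / v" "{1..1 / e\<^sup>2}" "- 2 * ln e"] e
    by (auto simp: ln_div ln_realpow)
  have b: "integrable lborel ?b"
    using l(1) unfolding set_integrable_def by (intro Bochner_Integration.integrable_add) auto
  have le: "\<bar>cut_weight e v\<bar> \<le> ?b v" for v
  proof (cases "v \<le> 0")
    case True
    then show ?thesis using ge by (auto simp: cut_weight_def vortex_weight_def indicator_def)
  next
    case False
    then show ?thesis
      using vortex_weight_bounds[of v] ge by (cases "v \<le> 1") (auto simp: cut_weight_def indicator_def)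
  qed
  show i: "integrable lborel (cut_weight e)"
  proof (rule Bochner_Integration.integrable_bound[OF b])
    show "AE v in lborel. norm (cut_weight e v) \<le> norm (?b v)"
      unfolding real_norm_def by (rule AE_I2) (rule order_trans[OF le abs_ge_self])
  qed simp
  have "(LINT v|lborel. cut_weight e v) \<le> (LINT v|lborel. ?b v)"
    using le by (intro integral_mono i b) (auto simp: abs_le_iff)
  also have "\<dots> = 1 - 2 * ln e"
    using l unfolding set_integrable_def set_lebesgue_integral_def by simp
  also have "\<dots> \<le> 2 * log_mod e" by (simp add: log_mod_def)
  finally show "(LINT v|lborel. cut_weight e v) \<le> 2 * log_mod e" .
qed

definition kern_cut_deriv :: "real \<Rightarrow> plane \<Rightarrow> plane \<Rightarrow> plane" where
  "kern_cut_deriv e x h = (1 / (8 * pi * \<alpha>\<^sup>2)) *\<^sub>R (LINT v|lborel. cut_weight e v *\<^sub>R gauss_rot_deriv (v / (4 * \<alpha>\<^sup>2)) x h)"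

lemma cut_weight_nonpos: "v \<le> 0 \<Longrightarrow> cut_weight e v = 0" and cut_weight_nonneg: "0 \<le> cut_weight e v"
  using vortex_weight_bounds[of v] by (auto simp: cut_weight_def vortex_weight_def[of v] indicator_def)

lemma kern_cut_lip_integrand:
  "norm (cut_weight e v *\<^sub>R gauss_rot (v / (4 * \<alpha>\<^sup>2)) x - cut_weight e v *\<^sub>R gauss_rot (v / (4 * \<alpha>\<^sup>2)) y)
    \<le> (2 * cut_weight e v) * norm (x - y)"
proof (cases "v \<le> 0")
  case False
  then have "norm (gauss_rot (v / (4 * \<alpha>\<^sup>2)) x - gauss_rot (v / (4 * \<alpha>\<^sup>2)) y) \<le> 2 * norm (x - y)"
    using \<alpha> by (intro gauss_rot_lipschitz) auto
  from mult_left_mono[OF this cut_weight_nonneg] show ?thesis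
    by (simp add: scaleR_diff_right[symmetric] cut_weight_nonneg mult_ac)
qed (simp add: cut_weight_nonpos)

text \<open>The factor 4 is 2 from the derivative of a Gaussian vortex, uniformly in its parameter,
  times 2 from \<open>cut_weight_integral\<close>. The vanishing trace passes through the
  integral.\<close>

lemma kern_cut:
  assumes e: "0 < e" "e \<le> 1"
  shows "(kern_at \<alpha> (cut_weight e) has_derivative kern_cut_deriv e x) (at x)"
    and "norm (kern_cut_deriv e x h) \<le> ((1 / (8 * pi * \<alpha>\<^sup>2)) * 4 * log_mod e) * norm h"
    and "kern_cut_deriv e x (axis 1 1) $ 1 + kern_cut_deriv e x (axis 2 1) $ 2 = 0"
proof -
  let ?f = "\<lambda>x v. cut_weight e v *\<^sub>R gauss_rot (v / (4 * \<alpha>\<^sup>2)) x"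
  let ?D = "\<lambda>v h. cut_weight e v *\<^sub>R gauss_rot_deriv (v / (4 * \<alpha>\<^sup>2)) x h"
  have der: "((\<lambda>x. ?f x v) has_derivative ?D v) (at x)" for v
    by (intro has_derivative_scaleR_right gauss_rot_has_derivative)
  have int: "integrable lborel (?f x)" for x
    by (intro kern_integrand_integrable) (auto simp: cut_weight_le)
  have B: "integrable lborel (\<lambda>v. 2 * cut_weight e v)" using cut_weight_integral[OF e] by simp
  have lip: "norm (?f y v - ?f x v) \<le> (2 * cut_weight e v) * norm (y - x)" for y v
    by (rule kern_cut_lip_integrand)
  note D = has_derivative_integral[OF zero_less_one der int lip B]
  show "(kern_at \<alpha> (cut_weight e) has_derivative kern_cut_deriv e x) (at x)"
    unfolding kern_at_def[abs_def] kern_cut_deriv_def[abs_def]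
    by (intro has_derivative_scaleR_right D(1))
  have Di: "integrable lborel (\<lambda>v. ?D v h)" for h by (rule D(2))
  have "norm (LINT v|lborel. ?D v h) \<le> (LINT v|lborel. norm (?D v h))" by (rule integral_norm_bound)
  also have "\<dots> \<le> (LINT v|lborel. 2 * cut_weight e v * norm h)"
    using D(3) B by (intro integral_mono integrable_norm Di) auto
  also have "\<dots> = 2 * (LINT v|lborel. cut_weight e v) * norm h" by simp
  also have "\<dots> \<le> 2 * (2 * log_mod e) * norm h"
    using cut_weight_integral[OF e] by (intro mult_right_mono mult_left_mono) auto
  finally have "(1 / (8 * pi * \<alpha>\<^sup>2)) * norm (LINT v|lborel. ?D v h) \<le> (1 / (8 * pi * \<alpha>\<^sup>2)) * (2 * (2 * log_mod e) * norm h)"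
    by (rule mult_left_mono) simp
  then show "norm (kern_cut_deriv e x h) \<le> ((1 / (8 * pi * \<alpha>\<^sup>2)) * 4 * log_mod e) * norm h"
    unfolding kern_cut_deriv_def by (simp add: mult_ac)
  have nth: "kern_cut_deriv e x h $ i = (1 / (8 * pi * \<alpha>\<^sup>2)) * (LINT v|lborel. ?D v h $ i)" for h i
    using integral_bounded_linear[OF bounded_linear_vec_nth[of i] Di[of h]] unfolding kern_cut_deriv_def by simp
  have Dn: "integrable lborel (\<lambda>v. ?D v h $ i)" for h i
    using integrable_bounded_linear[OF bounded_linear_vec_nth[of i] Di[of h]] by simp
  have "(LINT v|lborel. ?D v (axis 1 1) $ 1) + (LINT v|lborel. ?D v (axis 2 1) $ 2)
      = (LINT v|lborel. ?D v (axis 1 1) $ 1 + ?D v (axis 2 1) $ 2)"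
    by (intro Bochner_Integration.integral_add[symmetric] Dn)
  also have "\<dots> = 0"
    by (simp add: distrib_left[symmetric] gauss_rot_deriv_trace)
  finally show "kern_cut_deriv e x (axis 1 1) $ 1 + kern_cut_deriv e x (axis 2 1) $ 2 = 0"
    unfolding nth distrib_left[symmetric] by simp
qed

end

section \<open>Log-Lipschitz differential equations in Banach spaces\<close>

lemma has_vector_derivative_Un_UNIV:
  assumes "(f has_vector_derivative v) (at x within S)" "(f has_vector_derivative v) (at x within T)" "S \<union> T = UNIV"
  shows "(f has_vector_derivative v) (at x)"
proof -
  let ?g = "\<lambda>y. (1 / norm (y - x)) *\<^sub>R (f y - (f x + (y - x) *\<^sub>R v))"
  have "(?g \<longlongrightarrow> 0) (at x)"
    by (rule Lim_Un_univ[OF _ _ assms(3)])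
      (use assms(1,2) in \<open>simp_all add: has_vector_derivative_def has_derivative_within\<close>)
  then show ?thesis
    unfolding has_vector_derivative_def has_derivative_within by (simp add: bounded_linear_scaleR_left)
qed

text \<open>The norm of \<open>y\<close> may fail to be differentiable, so it is majorised by norm
  (y a) plus the integral \<phi> of the growth bound, and \<phi> is differentiated instead. The term
  - B (t - a) in \<open>?w\<close> absorbs the inhomogeneity because exp (- A (t - a)) \<le>
  1.\<close>

lemma gronwall_forward:
  fixes y :: "real \<Rightarrow> 'a::real_normed_vector"
  assumes ab: "a \<le> b" and A: "A \<ge> 0" and B: "B \<ge> 0"
    and der: "\<And>t. t \<in> {a..b} \<Longrightarrow> (y has_vector_derivative y' t) (at t)"
    and bnd: "\<And>t. t \<in> {a..b} \<Longrightarrow> norm (y' t) \<le> A * norm (y t) + B"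
  shows "norm (y b) \<le> exp (A * (b - a)) * (norm (y a) + B * (b - a))"
proof (cases "a = b")
  case False
  then have ab: "a < b" using ab by simp
  have cont: "continuous_on {a..b} y"
    using has_vector_derivative_continuous[OF der] by (blast intro: continuous_at_imp_continuous_on)
  let ?g = "\<lambda>t. A * norm (y t) + B"
  have gc: "continuous_on {a..b} ?g" by (intro continuous_intros cont)
  define \<phi> where "\<phi> t = integral {a..t} ?g" for t
  have \<phi>': "(\<phi> has_real_derivative ?g t) (at t within {a..b})" if "t \<in> {a..b}" for t
    unfolding \<phi>_def using integral_has_real_derivative[OF gc that] .
  have \<phi>'': "(\<phi> has_real_derivative ?g t) (at t)" if "a < t" "t < b" for t
    using \<phi>'[of t] that by (simp add: at_within_Icc_at)
  have \<phi>c: "continuous_on {a..b} \<phi>" using \<phi>' by (rule DERIV_continuous_on)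
  have v: "norm (y t) \<le> norm (y a) + \<phi> t" if t: "t \<in> {a..b}" for t
  proof (cases "t = a")
    case False
    with t have t: "a < t" "t \<le> b" by auto
    have "norm (y t - y a) \<le> \<phi> t - \<phi> a"
    proof (rule differentiable_bound_general[OF t(1), where f = y and \<phi> = \<phi> and f' = y' and \<phi>' = ?g])
      show "continuous_on {a..t} y" "continuous_on {a..t} \<phi>"
        using t cont \<phi>c by (auto intro: continuous_on_subset)
    qed (use t der bnd \<phi>'' in \<open>auto simp: has_real_derivative_iff_has_vector_derivative[symmetric]\<close>)
    moreover have "\<phi> a = 0" by (simp add: \<phi>_def)
    ultimately show ?thesis using norm_triangle_ineq2[of "y t" "y a"] by simp
  qed (simp add: \<phi>_def)
  let ?w = "\<lambda>t. (norm (y a) + \<phi> t) * exp (- A * (t - a)) - B * (t - a)"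
  have "?w b \<le> ?w a"
  proof (rule DERIV_nonpos_imp_decreasing_open[where f = ?w])
    show "continuous_on {a..b} ?w" by (intro continuous_intros \<phi>c)
    fix t assume t: "a < t" "t < b"
    have "(?w has_real_derivative
        (norm (y a) + \<phi> t) * (exp (- A * (t - a)) * (- A)) + ?g t * exp (- A * (t - a)) - B) (at t)"
      by (auto intro!: derivative_eq_intros \<phi>''[OF t] simp: algebra_simps)
    moreover have "(norm (y a) + \<phi> t) * (exp (- A * (t - a)) * (- A)) + ?g t * exp (- A * (t - a)) - B
        = exp (- A * (t - a)) * (A * (norm (y t) - (norm (y a) + \<phi> t))) + B * (exp (- A * (t - a)) - 1)"
      by (simp add: algebra_simps)
    moreover have "\<dots> \<le> 0 + 0"
      using v[of t] t A B by (intro add_mono mult_nonneg_nonpos) auto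
    ultimately show "\<exists>d. (?w has_real_derivative d) (at t) \<and> d \<le> 0" by auto
  qed (use ab in simp)
  then have "(norm (y a) + \<phi> b) * exp (- A * (b - a)) \<le> norm (y a) + B * (b - a)"
    by (simp add: \<phi>_def)
  from mult_right_mono[OF this, of "exp (A * (b - a))"]
  have "(norm (y a) + \<phi> b) * (exp (- A * (b - a)) * exp (A * (b - a))) \<le> exp (A * (b - a)) * (norm (y a) + B * (b - a))"
    by (simp only: mult_ac) simp
  then have "norm (y a) + \<phi> b \<le> exp (A * (b - a)) * (norm (y a) + B * (b - a))"
    by (simp add: exp_add[symmetric])
  then show ?thesis using v[of b] ab by simp
qed simp

lemma gronwall:
  fixes y :: "real \<Rightarrow> 'a::real_normed_vector"
  assumes A: "A \<ge> 0" and B: "B \<ge> 0"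
    and der: "\<And>r. r \<in> closed_segment s t \<Longrightarrow> (y has_vector_derivative y' r) (at r)"
    and bnd: "\<And>r. r \<in> closed_segment s t \<Longrightarrow> norm (y' r) \<le> A * norm (y r) + B"
  shows "norm (y t) \<le> exp (A * \<bar>t - s\<bar>) * (norm (y s) + B * \<bar>t - s\<bar>)"
proof (cases "s \<le> t")
  case True
  then show ?thesis
    using gronwall_forward[OF True A B, of y y'] der bnd by (simp add: closed_segment_eq_real_ivl)
next
  case False
  have "norm (y (- (- t))) \<le> exp (A * (- t - (- s))) * (norm (y (- (- s))) + B * (- t - (- s)))"
  proof (rule gronwall_forward[where y = "\<lambda>r. y (- r)" and y' = "\<lambda>r. - y' (- r)", OF _ A B])
    fix r assume r: "r \<in> {- s..- t}"
    then have r': "- r \<in> closed_segment s t" using False by (auto simp: closed_segment_eq_real_ivl)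
    have "((y \<circ> uminus) has_vector_derivative (- 1) *\<^sub>R y' (- r)) (at r)"
      by (rule vector_diff_chain_at) (use der[OF r'] in \<open>auto intro!: derivative_eq_intros\<close>)
    then show "((\<lambda>r. y (- r)) has_vector_derivative - y' (- r)) (at r)" by (simp add: o_def)
    show "norm (- y' (- r)) \<le> A * norm (y (- r)) + B" using bnd[OF r'] by simp
  qed (use False in auto)
  then show ?thesis using False by simp
qed

section \<open>Euler's method on dyadic grids and Osgood's criterion\<close>

primrec euler :: "(nat \<Rightarrow> 'a::real_normed_vector \<Rightarrow> 'a) \<Rightarrow> nat \<Rightarrow> 'a \<Rightarrow> nat \<Rightarrow> 'a" where
  "euler G j x 0 = x"
| "euler G j x (Suc k) = euler G j x k + (1/2) ^ j *\<^sub>R G j (euler G j x k)"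

definition dyadic_index :: "nat \<Rightarrow> real \<Rightarrow> nat" where
  "dyadic_index j t = nat \<lfloor>t * 2 ^ j\<rfloor>"

lemma dyadic_index_bounds:
  assumes "t \<ge> 0"
  shows "real (dyadic_index j t) * (1/2) ^ j \<le> t" "t - (1/2) ^ j \<le> real (dyadic_index j t) * (1/2) ^ j"
proof -
  have e: "real (dyadic_index j t) = of_int \<lfloor>t * 2 ^ j\<rfloor>"
    using assms by (simp add: dyadic_index_def)
  have p: "(t * 2 ^ j) * (1/2) ^ j = t" "(t * 2 ^ j - 1) * (1/2) ^ j = t - (1/2) ^ j"
    by (simp_all add: power_one_over diff_divide_distrib)
  have 1: "real (dyadic_index j t) \<le> t * 2 ^ j" "t * 2 ^ j - 1 \<le> real (dyadic_index j t)"
    unfolding e using real_of_int_floor_gt_diff_one[of "t * 2 ^ j"] by (auto intro: less_imp_le)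
  have "real (dyadic_index j t) * (1/2) ^ j \<le> (t * 2 ^ j) * (1/2) ^ j"
    using 1 by (intro mult_right_mono) auto
  then show "real (dyadic_index j t) * (1/2) ^ j \<le> t" unfolding p .
  have "(t * 2 ^ j - 1) * (1/2) ^ j \<le> real (dyadic_index j t) * (1/2) ^ j"
    using 1 by (intro mult_right_mono) auto
  then show "t - (1/2) ^ j \<le> real (dyadic_index j t) * (1/2) ^ j"
    unfolding p .
qed

lemma half_power_tendsto: "(\<lambda>j. (1/2::real) ^ j) \<longlonglongrightarrow> 0"
  by (intro LIMSEQ_power_zero) auto

lemma dyadic_index_tendsto:
  assumes "t \<ge> 0" shows "(\<lambda>j. real (dyadic_index j t) * (1/2) ^ j) \<longlonglongrightarrow> t"
proof (rule tendsto_sandwich)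
  show "\<forall>\<^sub>F j in sequentially. t - (1/2) ^ j \<le> real (dyadic_index j t) * (1/2) ^ j"
    "\<forall>\<^sub>F j in sequentially. real (dyadic_index j t) * (1/2) ^ j \<le> t"
    using dyadic_index_bounds[OF assms] by auto
  show "(\<lambda>j. t - (1/2) ^ j) \<longlonglongrightarrow> t" using tendsto_diff[OF tendsto_const half_power_tendsto, of t] by simp
qed simp

lemma dyadic_index_mono: "0 \<le> s \<Longrightarrow> s \<le> t \<Longrightarrow> dyadic_index j s \<le> dyadic_index j t"
  unfolding dyadic_index_def by (intro nat_mono floor_mono mult_right_mono) auto

text \<open>Lets \<open>k\<close> steps of one level be compared with \<open>2 * k\<close> steps of
  the next, at the price of at most one extra step.\<close>

lemma dyadic_index_Suc:
  assumes "t \<ge> 0"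
  shows "dyadic_index (Suc j) t = 2 * dyadic_index j t \<or> dyadic_index (Suc j) t = Suc (2 * dyadic_index j t)"
proof -
  have "t * 2 ^ Suc j = 2 * (t * 2 ^ j)" by simp
  moreover have "\<lfloor>2 * y\<rfloor> = 2 * \<lfloor>y\<rfloor> \<or> \<lfloor>2 * y\<rfloor> = 2 * \<lfloor>y\<rfloor> + 1" for y :: real by linarith
  ultimately have "\<lfloor>t * 2 ^ Suc j\<rfloor> = 2 * \<lfloor>t * 2 ^ j\<rfloor> \<or> \<lfloor>t * 2 ^ Suc j\<rfloor> = 2 * \<lfloor>t * 2 ^ j\<rfloor> + 1"
    by (simp only:)
  moreover have "\<lfloor>t * 2 ^ j\<rfloor> \<ge> 0" using assms by simp
  then obtain n where n: "\<lfloor>t * 2 ^ j\<rfloor> = int n" using zero_le_imp_eq_int by blast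
  ultimately show ?thesis unfolding dyadic_index_def n by (elim disjE) (simp_all add: nat_mult_distrib nat_add_distrib)
qed

text \<open>Log-Lipschitz continuity as a family of affine bounds. Taking \<open>e\<close> equal to
  the distance r recovers the modulus r (1 - ln r) up to a factor, for r \<le> 1; for fixed
  \<open>e\<close> the bound is affine in the distance, so Gronwall's inequality applies and
  \<open>e\<close> is optimised afterwards.\<close>

locale log_lipschitz =
  fixes F :: "'a::banach \<Rightarrow> 'a" and M C :: real
  assumes bound: "norm (F x) \<le> M" and C_nonneg: "C \<ge> 0"
    and modulus: "0 < e \<Longrightarrow> e \<le> 1 \<Longrightarrow> norm (F x - F y) \<le> C * (log_mod e * norm (x - y) + e)"
begin

lemma M_nonneg: "M \<ge> 0"
  using bound[of 0] norm_ge_zero order_trans by blast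

lemma F_tendsto:
  assumes X: "(X \<longlongrightarrow> x) net" shows "((\<lambda>n. F (X n)) \<longlongrightarrow> F x) net"
proof (rule tendstoI)
  fix d :: real assume d: "d > 0"
  define e where "e = min 1 (d / (2 * (C + 1)))"
  have e: "0 < e" "e \<le> 1" using d C_nonneg by (auto simp: e_def)
  have "e * (C + 1) \<le> d / (2 * (C + 1)) * (C + 1)"
    using C_nonneg by (intro mult_right_mono) (auto simp: e_def)
  also have "\<dots> = d / 2"
  proof -
    have "d / (2 * K) * K = d / 2" if "K > 0" for K using that by simp
    from this[of "C + 1"] show ?thesis using C_nonneg by linarith
  qed
  finally have Ce: "C * e < d" using e d by (simp add: distrib_left mult.commute)
  have "((\<lambda>n. C * (log_mod e * norm (X n - x) + e)) \<longlongrightarrow> C * (log_mod e * norm (x - x) + e)) net"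
    by (intro tendsto_intros X)
  then have "((\<lambda>n. C * (log_mod e * norm (X n - x) + e)) \<longlongrightarrow> C * e) net" by simp
  from order_tendstoD(2)[OF this Ce] show "\<forall>\<^sub>F n in net. dist (F (X n)) (F x) < d"
    by (rule eventually_mono) (metis modulus[OF e] dist_norm le_less_trans)
qed

text \<open>Gronwall at scale \<open>e\<close> bounds the difference by e times exp (C |t - s|
  \<open>log_mod e\<close>). For C |t - s| \<le> 1/2 the exponential costs only a multiple of 1 /
  sqrt e, leaving sqrt e, which tends to 0.\<close>

lemma unique_step:
  assumes y: "\<And>t. (y has_vector_derivative F (y t)) (at t)"
    and z: "\<And>t. (z has_vector_derivative F (z t)) (at t)"
    and eq: "y s = z s" and st: "C * \<bar>t - s\<bar> \<le> 1 / 2"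
  shows "y t = z t"
proof -
  have le: "norm (y t - z t) \<le> exp (1/2) * sqrt e" if e: "0 < e" "e \<le> 1" for e
  proof -
    have L: "log_mod e \<ge> 0" using log_mod_ge_1[OF e] by simp
    have "norm (y t - z t) \<le> exp (C * log_mod e * \<bar>t - s\<bar>) * (norm (y s - z s) + C * e * \<bar>t - s\<bar>)"
    proof (rule gronwall[where y = "\<lambda>t. y t - z t" and y' = "\<lambda>t. F (y t) - F (z t)"])
      show "((\<lambda>t. y t - z t) has_vector_derivative F (y r) - F (z r)) (at r)" for r
        by (intro derivative_intros y z)
      show "norm (F (y r) - F (z r)) \<le> C * log_mod e * norm (y r - z r) + C * e" for r
        using modulus[OF e, of "y r" "z r"] by (simp add: algebra_simps)
    qed (use C_nonneg L e in auto)
    also have "\<dots> = exp (C * \<bar>t - s\<bar> * log_mod e) * (C * \<bar>t - s\<bar> * e)" by (simp add: eq mult_ac)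
    also have "\<dots> \<le> exp (1 / 2 * log_mod e) * (1 * e)"
      using st mult_right_mono[OF st L] L e C_nonneg by (intro mult_mono) auto
    also have "\<dots> = exp (1/2) * (exp (- (1/2) * ln e) * e)"
      by (simp add: log_mod_def exp_add[symmetric] mult.assoc[symmetric] right_diff_distrib)
    also have "exp (- (1/2) * ln e) * e = sqrt e"
    proof -
      have s: "sqrt e = exp (ln e / 2)" using e by (simp add: powr_half_sqrt[symmetric] powr_def)
      have "exp (- (1/2) * ln e) = inverse (sqrt e)" unfolding s by (simp add: exp_minus[symmetric])
      then have "exp (- (1/2) * ln e) * e = e / sqrt e" by (simp only: divide_inverse mult.commute)
      then show ?thesis using e by (simp add: real_div_sqrt)
    qed
    finally show ?thesis .
  qed
  have "norm (y t - z t) \<le> 0"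
  proof (rule LIMSEQ_le_const)
    show "(\<lambda>n. exp (1/2) * sqrt ((1/2) ^ n)) \<longlonglongrightarrow> 0"
      using tendsto_mult[OF tendsto_const tendsto_real_sqrt[OF half_power_tendsto], of "exp (1/2)"] by simp
    show "\<exists>N. \<forall>n\<ge>N. norm (y t - z t) \<le> exp (1/2) * sqrt ((1/2) ^ n)"
      using le by (auto simp: power_le_one)
  qed
  then show ?thesis by simp
qed

lemma unique:
  assumes y: "\<And>t. (y has_vector_derivative F (y t)) (at t)"
    and z: "\<And>t. (z has_vector_derivative F (z t)) (at t)"
    and eq: "y 0 = z 0"
  shows "y t = z t"
proof -
  \<comment> \<open>\<open>C + 1\<close> in place of \<open>C\<close> covers the case C = 0.\<close>
  define \<tau> where "\<tau> = 1 / (2 * (C + 1))"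
  have \<tau>: "\<tau> > 0" "C * \<tau> \<le> 1 / 2" using C_nonneg by (auto simp: \<tau>_def field_simps)
  have "\<bar>t\<bar> \<le> real n * \<tau> \<Longrightarrow> y t = z t" for n t
  proof (induction n arbitrary: t)
    case (Suc n)
    define s where "s = t * (real n / real (Suc n))"
    have "\<bar>s\<bar> = \<bar>t\<bar> * (real n / real (Suc n))" by (simp add: s_def abs_mult)
    also have "\<dots> \<le> (real (Suc n) * \<tau>) * (real n / real (Suc n))"
      using Suc.prems by (intro mult_right_mono) auto
    finally have "\<bar>s\<bar> \<le> real n * \<tau>" by (simp add: mult.commute del: of_nat_Suc)
    then have 1: "y s = z s" by (rule Suc.IH)
    have "t - s = t / real (Suc n)" by (simp add: s_def field_simps)
    then have "\<bar>t - s\<bar> = \<bar>t\<bar> / real (Suc n)" by (simp add: abs_divide)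
    also have "\<dots> \<le> \<tau>" using Suc.prems by (simp add: divide_le_eq mult.commute del: of_nat_Suc)
    finally have "C * \<bar>t - s\<bar> \<le> C * \<tau>" by (intro mult_left_mono C_nonneg)
    then have "C * \<bar>t - s\<bar> \<le> 1 / 2" using \<tau> by linarith
    from unique_step[OF y z 1 this] show ?case .
  qed (use eq in auto)
  moreover obtain n where "\<bar>t\<bar> / \<tau> < real n" using reals_Archimedean2 by blast
  moreover have "\<bar>t\<bar> \<le> real n * \<tau>" if "\<bar>t\<bar> / \<tau> < real n" for n
    using that \<tau> by (simp add: divide_less_eq less_imp_le)
  ultimately show ?thesis by blast
qed

context
  fixes G :: "nat \<Rightarrow> 'a \<Rightarrow> 'a" and x0 :: 'a
  assumes G_bound: "\<And>j x. norm (G j x) \<le> M"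
    and G_approx: "\<And>j x. norm (G j x - F x) \<le> C * (1/2) ^ j"
begin

lemma euler_step_le: "norm (euler G j x0 (k + m) - euler G j x0 k) \<le> real m * (1/2) ^ j * M"
proof (induction m)
  case (Suc m)
  have "norm (euler G j x0 (k + Suc m) - euler G j x0 k)
      \<le> norm (euler G j x0 (k + m) - euler G j x0 k) + norm ((1/2) ^ j *\<^sub>R G j (euler G j x0 (k + m)))"
  proof -
    have "euler G j x0 (k + Suc m) - euler G j x0 k
        = (euler G j x0 (k + m) - euler G j x0 k) + (1/2) ^ j *\<^sub>R G j (euler G j x0 (k + m))" by simp
    then show ?thesis by (simp only: norm_triangle_ineq)
  qed
  also have "\<dots> \<le> real m * (1/2) ^ j * M + (1/2) ^ j * M"
    using Suc G_bound by (intro add_mono) (auto intro: mult_left_mono)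
  finally show ?case by (simp add: algebra_simps)
qed simp

text \<open>A discrete Osgood estimate: the exponent \<open>\<beta>\<close> of the step size \<open>h\<close> in the error bound
  \<open>h\<^sup>\<beta>\<close> decays in time, which pays for the logarithm in the modulus of continuity.\<close>

definition osgood_exponent :: "nat \<Rightarrow> nat \<Rightarrow> real" where
  "osgood_exponent j k = exp (- (C * real k * (1/2) ^ j)) / 2"

text \<open>One step of level \<open>j\<close> is compared with two of level \<open>Suc j\<close>.
  With h = (1/2)^j the second factor of the bound is h to the power
  \<open>osgood_exponent j k\<close>, which starts at 1/2; the first factor collects the growth
  without logarithm.\<close>

lemma euler_refine:
  "norm (euler G j x0 k - euler G (Suc j) x0 (2 * k))
    \<le> exp (C * (M + 4) * real k * (1/2) ^ j) * exp (- (osgood_exponent j k * (real j * ln 2)))"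
proof (induction k)
  case 0
  show ?case by simp
next
  case (Suc k)
  define h where "h = (1/2::real) ^ j"
  define l where "l = real j * ln 2"
  define \<beta> where "\<beta> = osgood_exponent j (Suc k)"
  \<comment> \<open>This is h to the power \<beta>, the target after \<open>Suc k\<close> steps, and
    it serves as the scale of the modulus. As \<beta> \<le> 1/2, both \<open>h\<close> and
    \<open>log_mod e * h\<close> are at most \<open>e\<close>, so all consistency errors of a step
    are O(h e).\<close>
  define e where "e = exp (- (\<beta> * l))"
  define A where "A = exp (C * (M + 4) * real k * h)"
  define x where "x = euler G j x0 k"
  define y where "y = euler G (Suc j) x0 (2 * k)"
  define y1 where "y1 = y + (h / 2) *\<^sub>R G (Suc j) y"
  define r where "r = norm (x - y)"
  have h: "0 < h" "h \<le> 1" by (auto simp: h_def power_le_one)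
  have l: "l \<ge> 0" by (simp add: l_def)
  have hl: "h = exp (- l)"
    by (simp add: h_def l_def exp_minus exp_of_nat_mult power_one_over inverse_eq_divide)
  have \<beta>: "0 < \<beta>" "\<beta> \<le> 1 / 2"
    using C_nonneg by (auto simp: \<beta>_def osgood_exponent_def)
  have \<beta>l: "0 \<le> \<beta> * l" "\<beta> * l \<le> l / 2" using mult_right_mono[OF \<beta>(2) l] \<beta> l by auto
  have e: "0 < e" "e \<le> 1" using \<beta>l by (auto simp: e_def)
  have he: "h \<le> e" using \<beta>l l by (simp add: hl e_def)
  have L: "log_mod e = 1 + \<beta> * l" by (simp add: log_mod_def e_def)
  have Lh: "log_mod e * h \<le> e"
  proof -
    have "log_mod e \<le> exp (l / 2)" using exp_ge_add_one_self[of "l / 2"] \<beta>l L by linarith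
    then have "log_mod e * h \<le> exp (l / 2) * h" using h by (intro mult_right_mono) auto
    also have "\<dots> = exp (- (l / 2))" by (simp add: hl exp_add[symmetric])
    also have "\<dots> \<le> e" using \<beta>l by (simp add: e_def)
    finally show ?thesis .
  qed
  have L1: "log_mod e \<ge> 1" using L \<beta>l by simp
  have G1: "norm (G j x - G (Suc j) z) \<le> C * (log_mod e * norm (x - z) + e + 2 * h)" for z
  proof -
    have "norm (G j x - G (Suc j) z) \<le> norm (G j x - F x) + norm (F x - F z) + norm (F z - G (Suc j) z)"
      using norm_triangle_ineq[of "G j x - F x + (F x - F z)" "F z - G (Suc j) z"]
        norm_triangle_ineq[of "G j x - F x" "F x - F z"] by simp
    also have "\<dots> \<le> C * h + C * (log_mod e * norm (x - z) + e) + C * (h / 2)"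
      using G_approx[of j x] modulus[OF e, of x z] G_approx[of "Suc j" z]
      by (intro add_mono) (auto simp: h_def norm_minus_commute)
    also have "\<dots> \<le> C * (log_mod e * norm (x - z) + e + 2 * h)"
      using C_nonneg h by (simp add: algebra_simps mult_right_mono)
    finally show ?thesis .
  qed
  have y1: "norm (x - y1) \<le> r + h * M"
  proof -
    have "norm (x - y1) \<le> r + norm ((h / 2) *\<^sub>R G (Suc j) y)"
      using norm_triangle_ineq4[of "x - y" "(h / 2) *\<^sub>R G (Suc j) y"] by (simp add: y1_def r_def diff_diff_eq)
    also have "norm ((h / 2) *\<^sub>R G (Suc j) y) \<le> (h / 2) * M"
      using h G_bound by (simp add: mult_left_mono)
    also have "(h / 2) * M \<le> h * M" using h M_nonneg by (intro mult_right_mono) auto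
    finally show ?thesis by simp
  qed
  have "norm (euler G j x0 (Suc k) - euler G (Suc j) x0 (2 * Suc k))
      = norm ((x - y) + (h / 2) *\<^sub>R ((G j x - G (Suc j) y) + (G j x - G (Suc j) y1)))"
  proof -
    have hh: "h *\<^sub>R v = (h / 2) *\<^sub>R v + (h / 2) *\<^sub>R v" for v :: 'a
      by (simp add: scaleR_left_distrib[symmetric])
    show ?thesis
      by (simp add: x_def[symmetric] y_def[symmetric] h_def[symmetric] y1_def[symmetric] hh[of "G j x"])
        (simp add: y1_def algebra_simps)
  qed
  also have "\<dots> \<le> r + (h / 2) * (norm (G j x - G (Suc j) y) + norm (G j x - G (Suc j) y1))"
  proof -
    let ?v = "(G j x - G (Suc j) y) + (G j x - G (Suc j) y1)"
    have "norm ((h / 2) *\<^sub>R ?v) = (h / 2) * norm ?v" using h by simp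
    also have "\<dots> \<le> (h / 2) * (norm (G j x - G (Suc j) y) + norm (G j x - G (Suc j) y1))"
      using h by (intro mult_left_mono norm_triangle_ineq) auto
    finally show ?thesis
      using norm_triangle_ineq[of "x - y" "(h / 2) *\<^sub>R ?v"] unfolding r_def by linarith
  qed
  also have "\<dots> \<le> r + (h / 2) * (C * (log_mod e * (r + h * M) + e + 2 * h) + C * (log_mod e * (r + h * M) + e + 2 * h))"
  proof -
    have "C * (log_mod e * norm (x - z) + e + 2 * h) \<le> C * (log_mod e * (r + h * M) + e + 2 * h)"
      if "norm (x - z) \<le> r + h * M" for z
      using that L1 C_nonneg by (intro mult_left_mono add_right_mono) auto
    note * = order_trans[OF G1 this]
    have "norm (x - y) \<le> r + h * M" using h M_nonneg by (simp add: r_def)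
    from *[OF this] *[OF y1] show ?thesis using h by (intro add_left_mono mult_left_mono add_mono) auto
  qed
  also have "\<dots> = r * (1 + h * C * log_mod e) + h * C * (M * (log_mod e * h) + e + 2 * h)"
    by (simp add: algebra_simps)
  also have "\<dots> \<le> r * (1 + h * C * log_mod e) + h * C * (M * e + e + 2 * e)"
    using Lh he h C_nonneg M_nonneg by (intro add_left_mono mult_left_mono add_mono) auto
  also have "\<dots> \<le> A * e * (1 + h * C) + h * C * ((M + 3) * e)"
  proof -
    \<comment> \<open>\<open>?X\<close> is the logarithmic part of the growth in one step. Passing
      from \<open>osgood_exponent j k\<close> to the smaller exponent \<beta> gains a factor exp (-
      \<open>?X\<close>), which cancels it.\<close>
    let ?X = "h * C * (\<beta> * l)"
    have X: "?X \<ge> 0" using h C_nonneg \<beta>l by simp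
    have "osgood_exponent j k = \<beta> * exp (C * h)"
      by (simp add: \<beta>_def osgood_exponent_def h_def exp_add[symmetric] algebra_simps)
    also have "\<dots> \<ge> \<beta> * (1 + C * h)"
      using \<beta> exp_ge_add_one_self[of "C * h"] by (intro mult_left_mono) auto
    finally have "\<beta> * (1 + C * h) * l \<le> osgood_exponent j k * l" using l by (intro mult_right_mono) auto
    then have "exp (- (osgood_exponent j k * l)) \<le> exp (- (\<beta> * l) + - ?X)"
      by (simp add: algebra_simps)
    also have "\<dots> = e * exp (- ?X)" by (simp only: e_def exp_add)
    finally have "A * exp (- (osgood_exponent j k * l)) \<le> A * (e * exp (- ?X))"
      by (rule mult_left_mono) (simp add: A_def)
    moreover have "r \<le> A * exp (- (osgood_exponent j k * l))"
      using Suc unfolding r_def x_def y_def A_def h_def l_def .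
    ultimately have "r \<le> A * (e * exp (- ?X))" by linarith
    moreover have "1 + h * C * log_mod e \<le> (1 + h * C) * exp ?X"
    proof -
      have "1 + h * C * log_mod e = 1 + h * C + ?X" by (simp add: L algebra_simps)
      also have "\<dots> \<le> 1 + h * C + ?X + (h * C) * ?X" using h C_nonneg mult_nonneg_nonneg[OF _ X, of "h * C"] by simp
      also have "\<dots> = (1 + h * C) * (1 + ?X)" by (simp only: distrib_left distrib_right mult_1_left mult_1_right add.assoc)
      also have "\<dots> \<le> (1 + h * C) * exp ?X"
        using h C_nonneg exp_ge_add_one_self[of ?X] by (intro mult_left_mono) auto
      finally show ?thesis .
    qed
    ultimately have "r * (1 + h * C * log_mod e) \<le> (A * (e * exp (- ?X))) * ((1 + h * C) * exp ?X)"
      using e h C_nonneg L1 by (intro mult_mono) (auto simp: A_def r_def)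
    also have "\<dots> = A * e * (1 + h * C) * (exp (- ?X) * exp ?X)" by (simp only: mult_ac)
    also have "\<dots> = A * e * (1 + h * C)" by (simp add: exp_minus)
    finally show ?thesis by (simp add: algebra_simps)
  qed
  also have "\<dots> \<le> A * e * (1 + h * C) + A * (h * C * ((M + 3) * e))"
  proof -
    have "A \<ge> 1" using C_nonneg M_nonneg h by (simp add: A_def)
    then have "1 * (h * C * ((M + 3) * e)) \<le> A * (h * C * ((M + 3) * e))"
      using C_nonneg M_nonneg h e by (intro mult_right_mono) auto
    then show ?thesis by simp
  qed
  \<comment> \<open>In M + 4, the part M + 3 comes from the consistency errors and 1 from the
    summand 1 of \<open>log_mod\<close>.\<close>
  also have "\<dots> = A * e * (1 + C * (M + 4) * h)" by (simp add: algebra_simps)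
  also have "\<dots> \<le> A * e * exp (C * (M + 4) * h)"
    using exp_ge_add_one_self[of "C * (M + 4) * h"] e by (intro mult_left_mono) (auto simp: A_def)
  also have "\<dots> = exp (C * (M + 4) * real (Suc k) * h) * e"
    by (simp add: A_def exp_add[symmetric] algebra_simps)
  finally show ?case by (simp only: e_def \<beta>_def l_def h_def)
qed

text \<open>All intermediate points lie within (m - k) h M of the first one, where h is the step, so
  the modulus is applied to each of them with the same bound; the last term is the error of the
  approximating field.\<close>

lemma euler_increment:
  assumes e: "0 < e" "e \<le> 1" and km: "k \<le> m"
  shows "norm (euler G j x0 m - euler G j x0 k - (real (m - k) * (1/2) ^ j) *\<^sub>R F (euler G j x0 k))
    \<le> (real (m - k) * (1/2) ^ j) * (C * (log_mod e * (real (m - k) * (1/2) ^ j * M) + e) + C * (1/2) ^ j)"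
proof -
  define h where "h = (1/2::real) ^ j"
  define N where "N = real (m - k)"
  have h: "h > 0" by (simp add: h_def)
  have "norm (euler G j x0 (k + i) - euler G j x0 k - (real i * h) *\<^sub>R F (euler G j x0 k))
      \<le> (real i * h) * (C * (log_mod e * (N * h * M) + e) + C * h)" if "i \<le> m - k" for i
    using that
  proof (induction i)
    case (Suc i)
    let ?x = "euler G j x0 k" and ?z = "euler G j x0 (k + i)"
    have L: "log_mod e \<ge> 0" using log_mod_ge_1[OF e] by simp
    have "norm (?z - ?x) \<le> real i * h * M" using euler_step_le[of j k i] by (simp add: h_def)
    also have "\<dots> \<le> N * h * M" using Suc.prems h M_nonneg by (intro mult_right_mono) (auto simp: N_def)
    finally have z: "norm (?z - ?x) \<le> N * h * M" .
    have "norm (G j ?z - F ?x) \<le> norm (F ?z - F ?x) + norm (G j ?z - F ?z)"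
      using norm_triangle_ineq[of "F ?z - F ?x" "G j ?z - F ?z"] by simp
    also have "\<dots> \<le> C * (log_mod e * (N * h * M) + e) + C * h"
    proof (intro add_mono)
      have "norm (F ?z - F ?x) \<le> C * (log_mod e * norm (?z - ?x) + e)" by (rule modulus[OF e])
      also have "\<dots> \<le> C * (log_mod e * (N * h * M) + e)"
        using z L C_nonneg by (intro mult_left_mono add_right_mono) auto
      finally show "norm (F ?z - F ?x) \<le> C * (log_mod e * (N * h * M) + e)" .
    qed (use G_approx[of j ?z] in \<open>simp add: h_def\<close>)
    finally have "h * norm (G j ?z - F ?x) \<le> h * (C * (log_mod e * (N * h * M) + e) + C * h)"
      using h by (intro mult_left_mono) auto
    moreover have eq: "euler G j x0 (k + Suc i) - ?x - (real (Suc i) * h) *\<^sub>R F ?x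
        = (?z - ?x - (real i * h) *\<^sub>R F ?x) + h *\<^sub>R (G j ?z - F ?x)"
      by (simp add: h_def algebra_simps)
    have "norm (euler G j x0 (k + Suc i) - ?x - (real (Suc i) * h) *\<^sub>R F ?x)
        \<le> norm (?z - ?x - (real i * h) *\<^sub>R F ?x) + h * norm (G j ?z - F ?x)"
      unfolding eq using h norm_triangle_ineq[of "?z - ?x - (real i * h) *\<^sub>R F ?x" "h *\<^sub>R (G j ?z - F ?x)"] by simp
    moreover have "(real (Suc i) * h) * V = (real i * h) * V + h * V" for V
      by (simp add: algebra_simps)
    ultimately show ?case using Suc by simp
  qed simp
  from this[of "m - k"] km show ?thesis by (simp add: h_def N_def)
qed

definition euler_limit :: "real \<Rightarrow> 'a" where
  "euler_limit t = lim (\<lambda>j. euler G j x0 (dyadic_index j t))"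

text \<open>Up to time \<open>t\<close> the exponents are at least b = exp (- C t) / 2, so
  consecutive levels differ by a multiple of 2^(- b j), plus M (1/2)^j for the possible extra step.
  Both are geometric.\<close>

lemma euler_tendsto:
  assumes t: "t \<ge> 0"
  shows "(\<lambda>j. euler G j x0 (dyadic_index j t)) \<longlonglongrightarrow> euler_limit t"
proof -
  let ?X = "\<lambda>j. euler G j x0 (dyadic_index j t)"
  define b where "b = exp (- (C * t)) / 2"
  define q where "q = exp (- (b * ln 2))"
  have q: "0 < q" "q < 1" by (auto simp: q_def b_def)
  have step: "norm (?X (Suc j) - ?X j) \<le> exp (C * (M + 4) * t) * q ^ j + M * (1/2) ^ j" for j
  proof -
    define k where "k = dyadic_index j t"
    have kt: "real k * (1/2) ^ j \<le> t" unfolding k_def by (rule dyadic_index_bounds[OF t])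
    have "norm (euler G j x0 k - euler G (Suc j) x0 (2 * k))
        \<le> exp (C * (M + 4) * real k * (1/2) ^ j) * exp (- (osgood_exponent j k * (real j * ln 2)))"
      by (rule euler_refine)
    also have "\<dots> \<le> exp (C * (M + 4) * t) * exp (- (b * (real j * ln 2)))"
    proof (intro mult_mono)
      have "C * (M + 4) * (real k * (1/2) ^ j) \<le> C * (M + 4) * t"
        using kt C_nonneg M_nonneg by (intro mult_left_mono) auto
      then show "exp (C * (M + 4) * real k * (1/2) ^ j) \<le> exp (C * (M + 4) * t)" by (simp add: mult.assoc)
      have "C * (real k * (1/2) ^ j) \<le> C * t" using kt C_nonneg by (rule mult_left_mono)
      then have "b \<le> osgood_exponent j k" by (simp add: b_def osgood_exponent_def mult.assoc)
      then show "exp (- (osgood_exponent j k * (real j * ln 2))) \<le> exp (- (b * (real j * ln 2)))"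
        by (simp add: mult_right_mono)
    qed auto
    also have "exp (- (b * (real j * ln 2))) = q ^ j"
      by (simp add: q_def exp_of_nat_mult[symmetric] algebra_simps)
    finally have 1: "norm (euler G j x0 k - euler G (Suc j) x0 (2 * k)) \<le> exp (C * (M + 4) * t) * q ^ j" .
    have 2: "norm (?X (Suc j) - euler G (Suc j) x0 (2 * k)) \<le> M * (1/2) ^ j"
    proof -
      have "norm ((1/2) ^ Suc j *\<^sub>R G (Suc j) z) \<le> (1/2) ^ j * M" for z
      proof -
        have "norm ((1/2) ^ Suc j *\<^sub>R G (Suc j) z) \<le> (1/2) ^ Suc j * M"
          using G_bound[of "Suc j" z] by (simp add: mult_left_mono)
        also have "\<dots> \<le> (1/2) ^ j * M" using M_nonneg by (intro mult_right_mono) auto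
        finally show ?thesis .
      qed
      then show ?thesis
        using dyadic_index_Suc[OF t, of j] M_nonneg by (auto simp: k_def[symmetric] mult.commute)
    qed
    have "norm (?X (Suc j) - ?X j) \<le> norm (?X (Suc j) - euler G (Suc j) x0 (2 * k)) + norm (euler G j x0 k - euler G (Suc j) x0 (2 * k))"
      using norm_triangle_ineq4[of "?X (Suc j) - euler G (Suc j) x0 (2 * k)" "euler G j x0 k - euler G (Suc j) x0 (2 * k)"]
      by (simp add: k_def)
    with 1 2 show ?thesis by linarith
  qed
  have "summable (\<lambda>j. exp (C * (M + 4) * t) * q ^ j + M * (1/2) ^ j)"
    using q by (intro summable_add summable_mult summable_geometric) auto
  then have "summable (\<lambda>j. ?X (Suc j) - ?X j)"
    by (rule summable_comparison_test'[where N = 0]) (rule step)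
  then have "(\<lambda>n. \<Sum>j<n. ?X (Suc j) - ?X j) \<longlonglongrightarrow> (\<Sum>j. ?X (Suc j) - ?X j)"
    by (rule summable_LIMSEQ)
  then have "(\<lambda>n. ?X n - ?X 0) \<longlonglongrightarrow> (\<Sum>j. ?X (Suc j) - ?X j)"
    by (simp only: sum_lessThan_telescope[of ?X])
  from tendsto_add[OF this tendsto_const[of "?X 0"]] have "convergent ?X"
    by (auto simp: convergent_def)
  then show ?thesis unfolding euler_limit_def by (simp add: convergent_LIMSEQ_iff)
qed

lemma euler_limit_0: "euler_limit 0 = x0"
  using euler_tendsto[of 0] by (simp add: dyadic_index_def LIMSEQ_const_iff)

text \<open>The limit of \<open>euler_increment\<close>, in which the error of the approximating
  fields disappears. The derivative is read off from this estimate, without an integral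
  equation.\<close>

lemma euler_limit_increment:
  assumes e: "0 < e" "e \<le> 1" and st: "0 \<le> s" "s \<le> t"
  shows "norm (euler_limit t - euler_limit s - (t - s) *\<^sub>R F (euler_limit s))
      \<le> (t - s) * (C * (log_mod e * ((t - s) * M) + e))"
    and "norm (euler_limit t - euler_limit s) \<le> (t - s) * M"
proof -
  have t: "0 \<le> t" using st by simp
  let ?d = "\<lambda>j. real (dyadic_index j t - dyadic_index j s) * (1/2) ^ j"
  have le: "dyadic_index j s \<le> dyadic_index j t" for j using st by (rule dyadic_index_mono)
  have "?d = (\<lambda>j. real (dyadic_index j t) * (1/2) ^ j - real (dyadic_index j s) * (1/2) ^ j)"
    using le by (simp add: of_nat_diff left_diff_distrib)
  then have d: "?d \<longlonglongrightarrow> t - s"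
    using tendsto_diff[OF dyadic_index_tendsto[OF t] dyadic_index_tendsto[OF st(1)]] by simp
  note lims = d euler_tendsto[OF t] euler_tendsto[OF st(1)] half_power_tendsto
  show "norm (euler_limit t - euler_limit s - (t - s) *\<^sub>R F (euler_limit s))
      \<le> (t - s) * (C * (log_mod e * ((t - s) * M) + e))"
  proof (rule LIMSEQ_le)
    show "(\<lambda>j. norm (euler G j x0 (dyadic_index j t) - euler G j x0 (dyadic_index j s)
          - ?d j *\<^sub>R F (euler G j x0 (dyadic_index j s))))
        \<longlonglongrightarrow> norm (euler_limit t - euler_limit s - (t - s) *\<^sub>R F (euler_limit s))"
      by (intro tendsto_intros lims F_tendsto)
    have "(\<lambda>j. ?d j * (C * (log_mod e * (?d j * M) + e) + C * (1/2) ^ j))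
        \<longlonglongrightarrow> (t - s) * (C * (log_mod e * ((t - s) * M) + e) + C * 0)"
      by (intro tendsto_intros lims)
    then show "(\<lambda>j. ?d j * (C * (log_mod e * (?d j * M) + e) + C * (1/2) ^ j))
        \<longlonglongrightarrow> (t - s) * (C * (log_mod e * ((t - s) * M) + e))" by simp
  qed (use euler_increment[OF e le] in blast)
  show "norm (euler_limit t - euler_limit s) \<le> (t - s) * M"
  proof (rule LIMSEQ_le)
    show "(\<lambda>j. norm (euler G j x0 (dyadic_index j t) - euler G j x0 (dyadic_index j s)))
        \<longlonglongrightarrow> norm (euler_limit t - euler_limit s)"
      by (intro tendsto_intros lims)
    show "(\<lambda>j. ?d j * M) \<longlonglongrightarrow> (t - s) * M" by (intro tendsto_intros lims)
    show "\<exists>N. \<forall>n\<ge>N. norm (euler G n x0 (dyadic_index n t) - euler G n x0 (dyadic_index n s)) \<le> ?d n * M"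
    proof (intro exI[of _ 0] allI impI)
      fix n
      show "norm (euler G n x0 (dyadic_index n t) - euler G n x0 (dyadic_index n s)) \<le> ?d n * M"
        using euler_step_le[of n "dyadic_index n s" "dyadic_index n t - dyadic_index n s"]
        by (simp only: le_add_diff_inverse[OF le])
    qed
  qed
qed

lemma euler_limit_has_derivative:
  assumes t: "t \<ge> 0"
  shows "(euler_limit has_vector_derivative F (euler_limit t)) (at t within {0..})"
  unfolding has_vector_derivative_def has_derivative_within_alt
proof (intro conjI allI impI)
  show "bounded_linear (\<lambda>x. x *\<^sub>R F (euler_limit t))" by (rule bounded_linear_scaleR_left)
  fix d :: real assume d: "d > 0"
  define e where "e = min 1 (d / (4 * (C + 1)))"
  have e: "0 < e" "e \<le> 1" using d C_nonneg by (auto simp: e_def)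
  have L: "log_mod e \<ge> 0" using log_mod_ge_1[OF e] by simp
  have "C * e \<le> (C + 1) * (d / (4 * (C + 1)))"
    using C_nonneg e by (intro mult_mono) (auto simp: e_def)
  also have "\<dots> = d / 4"
  proof -
    have "K * (d / (4 * K)) = d / 4" if "K > 0" for K using that by simp
    from this[of "C + 1"] show ?thesis using C_nonneg by linarith
  qed
  finally have Ce: "C * e \<le> d / 4" .
  define K where "K = C * (log_mod e * M) + 1"
  have K: "K > 0" "C * (log_mod e * M) \<le> K" using C_nonneg L M_nonneg by (auto simp: K_def add_nonneg_pos)
  define r where "r = d / (4 * K)"
  have r: "r > 0" using d K by (simp add: r_def)
  have small: "C * (log_mod e * (\<bar>s - t\<bar> * M) + e) \<le> d / 2" if "\<bar>s - t\<bar> < r" for s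
  proof -
    have "(C * (log_mod e * M)) * \<bar>s - t\<bar> \<le> K * r" using that K C_nonneg L M_nonneg by (intro mult_mono) auto
    also have "K * r = d / 4" using K by (simp add: r_def)
    finally show ?thesis using Ce by (simp add: algebra_simps)
  qed
  show "\<exists>r>0. \<forall>s\<in>{0..}. norm (s - t) < r \<longrightarrow>
      norm (euler_limit s - euler_limit t - (s - t) *\<^sub>R F (euler_limit t)) \<le> d * norm (s - t)"
  proof (intro exI[of _ r] conjI ballI impI r)
    fix s :: real assume s: "s \<in> {0..}" "norm (s - t) < r"
    let ?w = "C * (log_mod e * (\<bar>s - t\<bar> * M) + e)"
    have w: "?w \<le> d / 2" using s(2) by (intro small) simp
    show "norm (euler_limit s - euler_limit t - (s - t) *\<^sub>R F (euler_limit t)) \<le> d * norm (s - t)"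
    proof (cases "t \<le> s")
      case True
      have "norm (euler_limit s - euler_limit t - (s - t) *\<^sub>R F (euler_limit t)) \<le> \<bar>s - t\<bar> * ?w"
        using euler_limit_increment(1)[OF e t True] True by simp
      also have "\<dots> \<le> \<bar>s - t\<bar> * d" using w d by (intro mult_left_mono) auto
      finally show ?thesis by (simp add: mult.commute)
    next
      case False
      then have st: "0 \<le> s" "s \<le> t" using s by auto
      \<comment> \<open>The increment estimate is based at the left endpoint, here \<open>s\<close>;
        the modulus of \<open>F\<close> moves the base point to \<open>t\<close>.\<close>
      have "norm (F (euler_limit t) - F (euler_limit s)) \<le> C * (log_mod e * norm (euler_limit t - euler_limit s) + e)"
        by (rule modulus[OF e])
      also have "\<dots> \<le> ?w"
        using euler_limit_increment(2)[OF e st] False L C_nonneg by (intro mult_left_mono add_right_mono) auto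
      finally have 2: "(t - s) * norm (F (euler_limit t) - F (euler_limit s)) \<le> (t - s) * ?w"
        using st by (intro mult_left_mono) auto
      have 1: "norm (euler_limit t - euler_limit s - (t - s) *\<^sub>R F (euler_limit s)) \<le> (t - s) * ?w"
        using euler_limit_increment(1)[OF e st] False by simp
      have eq: "euler_limit s - euler_limit t - (s - t) *\<^sub>R F (euler_limit t)
          = (t - s) *\<^sub>R (F (euler_limit t) - F (euler_limit s)) - (euler_limit t - euler_limit s - (t - s) *\<^sub>R F (euler_limit s))"
        by (simp add: algebra_simps)
      have "norm (euler_limit s - euler_limit t - (s - t) *\<^sub>R F (euler_limit t))
          \<le> (t - s) * norm (F (euler_limit t) - F (euler_limit s)) + norm (euler_limit t - euler_limit s - (t - s) *\<^sub>R F (euler_limit s))"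
        unfolding eq using norm_triangle_ineq4[of "(t - s) *\<^sub>R (F (euler_limit t) - F (euler_limit s))"
            "euler_limit t - euler_limit s - (t - s) *\<^sub>R F (euler_limit s)"] st by simp
      also have "\<dots> \<le> (t - s) * ?w + (t - s) * ?w" using 1 2 by (rule add_mono[rotated])
      also have "\<dots> = (t - s) * (2 * ?w)" by simp
      also have "\<dots> \<le> (t - s) * d" using w st by (intro mult_left_mono) auto
      finally show ?thesis using st by (simp add: mult.commute abs_if)
    qed
  qed
qed

end

end

lemma log_lipschitz_uminus:
  assumes "log_lipschitz F M C" shows "log_lipschitz (\<lambda>x. - F x) M C"
proof -
  interpret log_lipschitz F M C by fact
  show ?thesis
  proof
    show "norm (- F x - - F y) \<le> C * (log_mod e * norm (x - y) + e)" if "0 < e" "e \<le> 1" for e x y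
      using modulus[OF that, of y x] by (simp add: norm_minus_commute)
  qed (auto simp: bound C_nonneg)
qed

text \<open>Negative times are reached by running the scheme forwards for \<open>- F\<close> with
  its own approximations \<open>G'\<close>; the one-sided derivatives are glued at 0.\<close>

theorem log_lipschitz_flow_exists:
  fixes F :: "'a::banach \<Rightarrow> 'a"
  assumes F: "log_lipschitz F M C"
    and Gb: "\<And>j x. norm (G j x) \<le> M" "\<And>j x. norm (G' j x) \<le> M"
    and Ga: "\<And>j x. norm (G j x - F x) \<le> C * (1/2) ^ j" "\<And>j x. norm (G' j x - - F x) \<le> C * (1/2) ^ j"
  obtains y where "y 0 = x0" "\<And>t. (y has_vector_derivative F (y t)) (at t)"
    "\<And>t. t \<ge> 0 \<Longrightarrow> (\<lambda>j. euler G j x0 (dyadic_index j t)) \<longlonglongrightarrow> y t"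
    "\<And>t. t \<ge> 0 \<Longrightarrow> (\<lambda>j. euler G' j x0 (dyadic_index j t)) \<longlonglongrightarrow> y (- t)"
proof -
  interpret P: log_lipschitz F M C by (rule F)
  interpret N: log_lipschitz "\<lambda>x. - F x" M C by (rule log_lipschitz_uminus[OF F])
  let ?p = "P.euler_limit G x0" and ?n = "N.euler_limit G' x0"
  define y where "y t = (if t \<ge> 0 then ?p t else ?n (- t))" for t
  have p0: "?p 0 = x0" and n0: "?n 0 = x0"
    using P.euler_limit_0[OF Gb(1) Ga(1)] N.euler_limit_0[OF Gb(2) Ga(2)] by auto
  have yn: "y t = ?n (- t)" if "t \<le> 0" for t using that p0 n0 by (auto simp: y_def)
  have pos: "(y has_vector_derivative F (y t)) (at t within {0..})" if "t \<ge> 0" for t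
    using P.euler_limit_has_derivative[OF Gb(1) Ga(1) that] that
    by (intro has_vector_derivative_transform[where g = y and f = ?p]) (auto simp: y_def)
  have neg: "(y has_vector_derivative F (y t)) (at t within {..0})" if "t \<le> 0" for t
  proof -
    have im: "uminus ` {..0::real} = {0..}" by (auto simp: image_iff intro: exI[of _ "- _"]) 
    have "(uminus has_vector_derivative (-1::real)) (at t within {..0})"
      by (auto intro!: derivative_eq_intros)
    moreover have "(?n has_vector_derivative - F (?n (- t))) (at (- t) within uminus ` {..0})"
      unfolding im using N.euler_limit_has_derivative[OF Gb(2) Ga(2), of "- t"] that by simp
    ultimately have "((?n \<circ> uminus) has_vector_derivative (- 1) *\<^sub>R - F (?n (- t))) (at t within {..0})"
      by (rule vector_diff_chain_within)
    then show ?thesis using that yn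
      by (intro has_vector_derivative_transform[where g = y and f = "?n \<circ> uminus"]) auto
  qed
  have der: "(y has_vector_derivative F (y t)) (at t)" for t
  proof (cases t "0 :: real" rule: linorder_cases)
    case less
    have "(y has_vector_derivative F (y t)) (at t within {..<0})"
      using less by (intro has_vector_derivative_within_subset[OF neg]) auto
    then show ?thesis using less by (simp add: at_within_open[of t "{..<0}"])
  next
    case equal
    then show ?thesis using pos[of 0] neg[of 0] by (intro has_vector_derivative_Un_UNIV[of y _ t "{0..}" "{..0}"]) auto
  next
    case greater
    have "(y has_vector_derivative F (y t)) (at t within {0<..})"
      using greater by (intro has_vector_derivative_within_subset[OF pos]) auto
    then show ?thesis using greater by (simp add: at_within_open[of t "{0<..}"])
  qed
  show ?thesis
  proof (rule that[OF _ der])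
    show "y 0 = x0" by (simp add: y_def p0)
    show "(\<lambda>j. euler G j x0 (dyadic_index j t)) \<longlonglongrightarrow> y t" if "t \<ge> 0" for t
      using P.euler_tendsto[OF Gb(1) Ga(1) that] that by (simp add: y_def)
    show "(\<lambda>j. euler G' j x0 (dyadic_index j t)) \<longlonglongrightarrow> y (- t)" if "t \<ge> 0" for t
      using N.euler_tendsto[OF Gb(2) Ga(2) that] that yn[of "- t"] by simp
  qed
qed

section \<open>The particle flow\<close>

lemma continuous_on_sint:
  fixes f :: "'p::metric_space \<Rightarrow> plane \<Rightarrow> 'b::euclidean_space"
  assumes sm: "is_signed_measure \<mu>"
    and m: "\<And>p. f p \<in> borel_measurable borel" and b: "\<And>p x. norm (f p x) \<le> B"
    and c: "\<And>x. continuous_on UNIV (\<lambda>p. f p x)"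
  shows "continuous_on UNIV (\<lambda>p. sint \<mu> (f p))"
  unfolding continuous_on_sequentially
proof (intro allI ballI impI)
  fix X :: "nat \<Rightarrow> 'p" and p assume "(\<forall>n. X n \<in> UNIV) \<and> X \<longlonglongrightarrow> p"
  then have "(\<lambda>n. f (X n) x) \<longlonglongrightarrow> f p x" for x
    using c[of x] unfolding continuous_on_sequentially by (auto simp: o_def)
  then show "((\<lambda>p. sint \<mu> (f p)) \<circ> X) \<longlonglongrightarrow> sint \<mu> (f p)"
    unfolding o_def by (rule sint_tendsto[OF sm m b])
qed

definition kern_bound :: "real \<Rightarrow> real" where
  "kern_bound \<alpha> = 1 / (8 * pi * \<alpha>\<^sup>2) * (LINT v|lborel. kern_dom \<alpha> v)"

text \<open>One constant for two effects, with the common factor 1 / (8 pi \<alpha>^2): cutting the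
  kernel at both arguments costs 8 \<alpha> times \<open>e\<close>, and the cut kernel has Lipschitz
  constant 4 times \<open>log_mod e\<close>.\<close>

definition kern_const :: "real \<Rightarrow> real" where
  "kern_const \<alpha> = (1 / (8 * pi * \<alpha>\<^sup>2)) * (8 * \<alpha> + 4)"

context
  fixes \<alpha> :: real
  assumes \<alpha>: "\<alpha> > 0"
begin

lemma kern_const_nonneg: "kern_const \<alpha> \<ge> 0"
  using \<alpha> by (simp add: kern_const_def)

lemma kern_le: "norm (kern \<alpha> x) \<le> kern_bound \<alpha>"
  and kern_cut_le: "norm (kern_at \<alpha> (cut_weight e) x) \<le> kern_bound \<alpha>"
proof -
  show "norm (kern \<alpha> x) \<le> kern_bound \<alpha>"
    unfolding kern_def kern_bound_def by (rule kern_at_bounded[OF \<alpha>]) (simp_all add: vortex_weight_bounds)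
  show "norm (kern_at \<alpha> (cut_weight e) x) \<le> kern_bound \<alpha>"
    unfolding kern_bound_def by (rule kern_at_bounded[OF \<alpha>]) (simp_all add: cut_weight_le[OF \<alpha>])
qed

lemma kern_approx: "0 < e \<Longrightarrow> norm (kern_at \<alpha> (cut_weight e) x - kern \<alpha> x) \<le> kern_const \<alpha> * e"
proof -
  assume e: "0 < e"
  have "norm (kern \<alpha> x - kern_at \<alpha> (cut_weight e) x) \<le> (1 / (8 * pi * \<alpha>\<^sup>2) * (4 * \<alpha>)) * e"
    using kern_cut_diff[OF \<alpha> e] .
  also have "\<dots> \<le> kern_const \<alpha> * e"
    unfolding kern_const_def using \<alpha> e by (intro mult_right_mono mult_left_mono) auto
  finally show ?thesis by (simp add: norm_minus_commute)
qed

lemma kern_cut_lipschitz: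
  assumes e: "0 < e" "e \<le> 1"
  shows "norm (kern_at \<alpha> (cut_weight e) x - kern_at \<alpha> (cut_weight e) y) \<le> (1 / (8 * pi * \<alpha>\<^sup>2) * 4 * log_mod e) * norm (x - y)"
proof (rule differentiable_bound[of UNIV])
  show "(kern_at \<alpha> (cut_weight e) has_derivative kern_cut_deriv \<alpha> e x) (at x within UNIV)" for x
    using kern_cut(1)[OF \<alpha> e] by simp
  show "onorm (kern_cut_deriv \<alpha> e x) \<le> 1 / (8 * pi * \<alpha>\<^sup>2) * 4 * log_mod e" for x
    using kern_cut(2)[OF \<alpha> e] log_mod_ge_1[OF e] by (intro onorm_le) auto
qed auto

lemma kern_modulus:
  assumes e: "0 < e" "e \<le> 1"
  shows "norm (kern \<alpha> x - kern \<alpha> y) \<le> kern_const \<alpha> * (log_mod e * norm (x - y) + e)"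
proof -
  let ?k = "kern_at \<alpha> (cut_weight e)" and ?\<kappa> = "1 / (8 * pi * \<alpha>\<^sup>2)"
  have "norm (kern \<alpha> x - kern \<alpha> y) \<le> norm (kern \<alpha> x - ?k x) + norm (?k x - ?k y) + norm (kern \<alpha> y - ?k y)"
    using norm_triangle_ineq4[of "kern \<alpha> x - ?k x + (?k x - ?k y)" "kern \<alpha> y - ?k y"]
      norm_triangle_ineq[of "kern \<alpha> x - ?k x" "?k x - ?k y"] by simp
  also have "\<dots> \<le> (?\<kappa> * (4 * \<alpha>)) * e + (?\<kappa> * 4 * log_mod e) * norm (x - y) + (?\<kappa> * (4 * \<alpha>)) * e"
    by (intro add_mono kern_cut_diff kern_cut_lipschitz \<alpha> e)
  also have "\<dots> = ?\<kappa> * ((8 * \<alpha>) * e + 4 * (log_mod e * norm (x - y)))" by (simp only: algebra_simps)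
  also have "\<dots> \<le> ?\<kappa> * ((8 * \<alpha> + 4) * e + (8 * \<alpha> + 4) * (log_mod e * norm (x - y)))"
    using \<alpha> e log_mod_ge_1[OF e] by (intro mult_left_mono add_mono mult_right_mono) auto
  also have "\<dots> = kern_const \<alpha> * (log_mod e * norm (x - y) + e)"
    unfolding kern_const_def by (simp only: algebra_simps)
  finally show ?thesis .
qed

lemma continuous_kern: "continuous_on UNIV (kern \<alpha>)"
  unfolding continuous_on_def
proof
  fix x show "(kern \<alpha> \<longlongrightarrow> kern \<alpha> x) (at x within UNIV)"
  proof (rule tendstoI)
    fix d :: real assume d: "d > 0"
    define e where "e = min 1 (d / (2 * (kern_const \<alpha> + 1)))"
    have K: "kern_const \<alpha> \<ge> 0" by (rule kern_const_nonneg)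
    have e: "0 < e" "e \<le> 1" using d K by (auto simp: e_def)
    have "(kern_const \<alpha> + 1) * e \<le> (kern_const \<alpha> + 1) * (d / (2 * (kern_const \<alpha> + 1)))"
      using K by (intro mult_left_mono) (auto simp: e_def)
    also have "\<dots> = d / 2"
    proof -
      have "L * (d / (2 * L)) = d / 2" if "L > 0" for L using that by simp
      from this[of "kern_const \<alpha> + 1"] show ?thesis using K by linarith
    qed
    finally have Ke: "kern_const \<alpha> * e < d" using e d by (simp add: distrib_right)
    have "((\<lambda>y. kern_const \<alpha> * (log_mod e * norm (y - x) + e)) \<longlongrightarrow> kern_const \<alpha> * (log_mod e * norm (x - x) + e)) (at x)"
      by (intro tendsto_intros)
    then have "((\<lambda>y. kern_const \<alpha> * (log_mod e * norm (y - x) + e)) \<longlongrightarrow> kern_const \<alpha> * e) (at x)" by simp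
    from order_tendstoD(2)[OF this Ke] have "\<forall>\<^sub>F y in at x. dist (kern \<alpha> y) (kern \<alpha> x) < d"
    proof (rule eventually_mono)
      show "dist (kern \<alpha> y) (kern \<alpha> x) < d" if "kern_const \<alpha> * (log_mod e * norm (y - x) + e) < d" for y
        using le_less_trans[OF kern_modulus[OF e, of y x] that] by (simp add: dist_norm)
    qed
    then show "\<forall>\<^sub>F y in at x within UNIV. dist (kern \<alpha> y) (kern \<alpha> x) < d" by simp
  qed
qed

lemma continuous_kern_cut:
  assumes "0 < e" "e \<le> 1" shows "continuous_on UNIV (kern_at \<alpha> (cut_weight e))"
  using kern_cut(1)[OF \<alpha> assms] by (intro continuous_at_imp_continuous_on) (auto intro: has_derivative_continuous)

end

text \<open>The unknown is the displacement, which is bounded, and not the flow map. The current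
  vorticity is the image of the initial one under x + \<xi> x, so the equation is autonomous and
  involves the initial measure only. \<open>Bcontfun\<close> has its intended value for bounded
  continuous \<open>k\<close>, see \<open>vfield_apply\<close>.\<close>

definition vfield :: "(plane \<Rightarrow> plane) \<Rightarrow> (plane set \<Rightarrow> real) \<Rightarrow> (plane \<Rightarrow>\<^sub>C plane) \<Rightarrow> plane \<Rightarrow>\<^sub>C plane" where
  "vfield k q \<xi> = Bcontfun (\<lambda>x. sint q (\<lambda>y. k ((x + \<xi> x) - (y + \<xi> y))))"

lemma continuous_vfield_integrand:
  fixes \<xi> :: "plane \<Rightarrow>\<^sub>C plane"
  assumes "continuous_on UNIV k"
  shows "continuous_on UNIV (\<lambda>y. k (x - (y + \<xi> y)))" "continuous_on UNIV (\<lambda>x. k ((x + \<xi> x) - y))"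
proof -
  have "continuous_on UNIV (\<lambda>y. x - (y + \<xi> y))" "continuous_on UNIV (\<lambda>x. (x + \<xi> x) - y)"
    by (auto intro!: continuous_intros)
  from this[THEN continuous_on_compose2[OF assms]]
  show "continuous_on UNIV (\<lambda>y. k (x - (y + \<xi> y)))" "continuous_on UNIV (\<lambda>x. k ((x + \<xi> x) - y))"
    by auto
qed

lemma vfield_integrand_bounded_borel:
  fixes \<xi> :: "plane \<Rightarrow>\<^sub>C plane"
  assumes "continuous_on UNIV k" "\<And>x. norm (k x) \<le> (B::real)"
  shows "bounded_borel (\<lambda>y. k (x - (y + \<xi> y)))"
  using assms(2) by (intro bounded_borel_continuous continuous_vfield_integrand assms(1))

lemma vfield_apply:
  assumes sm: "is_signed_measure q" and k: "continuous_on UNIV k" "\<And>x. norm (k x) \<le> B"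
  shows "apply_bcontfun (vfield k q \<xi>) x = sint q (\<lambda>y. k ((x + \<xi> x) - (y + \<xi> y)))"
proof -
  have "(\<lambda>x. sint q (\<lambda>y. k ((x + \<xi> x) - (y + \<xi> y)))) \<in> bcontfun"
  proof (rule bcontfun_normI)
    show "continuous_on UNIV (\<lambda>x. sint q (\<lambda>y. k ((x + \<xi> x) - (y + \<xi> y))))"
      using k by (intro continuous_on_sint[OF sm, of _ B] borel_measurable_continuous_onI continuous_vfield_integrand)
    show "norm (sint q (\<lambda>y. k ((x + \<xi> x) - (y + \<xi> y)))) \<le> tv q * B" for x
      using k by (intro sint_norm_le[OF sm] vfield_integrand_bounded_borel)
  qed
  then show ?thesis unfolding vfield_def by (simp add: Bcontfun_inverse)
qed

lemma vfield_norm_le: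
  assumes "is_signed_measure q" "continuous_on UNIV k" "\<And>x. norm (k x) \<le> B"
  shows "norm (vfield k q \<xi>) \<le> tv q * B"
  by (rule norm_bound)
    (simp add: vfield_apply[OF assms], rule sint_norm_le[OF assms(1) vfield_integrand_bounded_borel[OF assms(2,3)] assms(3)])

lemma vfield_uminus:
  assumes "is_signed_measure q" "continuous_on UNIV k" "\<And>x. norm (k x) \<le> B"
  shows "vfield k (\<lambda>A. - q A) \<xi> = - vfield k q \<xi>"
  by (rule bcontfun_eqI)
    (simp add: vfield_apply[OF assms] vfield_apply[OF signed_measure_uminus[OF assms(1)] assms(2,3)] sint_uminus)

lemma vfield_diff_le:
  fixes \<xi> \<zeta> :: "plane \<Rightarrow>\<^sub>C plane"
  assumes sm: "is_signed_measure q" and k: "continuous_on UNIV k" "\<And>x. norm (k x) \<le> B"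
    and k': "continuous_on UNIV k'" "\<And>x. norm (k' x) \<le> B'"
    and d: "\<And>x y. norm (k ((x + \<xi> x) - (y + \<xi> y)) - k' ((x + \<zeta> x) - (y + \<zeta> y))) \<le> d"
  shows "norm (vfield k q \<xi> - vfield k' q \<zeta>) \<le> tv q * d"
proof (rule norm_bound)
  fix x
  have b: "bounded_borel (\<lambda>y. k ((x + \<xi> x) - (y + \<xi> y)))" "bounded_borel (\<lambda>y. k' ((x + \<zeta> x) - (y + \<zeta> y)))"
    using k k' by (auto intro!: vfield_integrand_bounded_borel)
  have "apply_bcontfun (vfield k q \<xi> - vfield k' q \<zeta>) x
      = sint q (\<lambda>y. k ((x + \<xi> x) - (y + \<xi> y)) - k' ((x + \<zeta> x) - (y + \<zeta> y)))"
    by (simp add: vfield_apply[OF sm k] vfield_apply[OF sm k'] sint_diff[OF sm b])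
  then show "norm (apply_bcontfun (vfield k q \<xi> - vfield k' q \<zeta>) x) \<le> tv q * d"
    using sint_norm_le[OF sm bounded_borel_diff[OF b] d] by simp
qed

instance bcontfun :: (metric_space, banach) banach ..

text \<open>The factor 2 appears because a change of displacement moves both arguments of the
  kernel, the particle and the source.\<close>

lemma vfield_log_lipschitz:
  assumes \<alpha>: "\<alpha> > 0" and sm: "is_signed_measure q"
  shows "log_lipschitz (vfield (kern \<alpha>) q) (tv q * kern_bound \<alpha>) (2 * tv q * kern_const \<alpha>)"
proof
  note k = continuous_kern[OF \<alpha>] kern_le[OF \<alpha>]
  show "norm (vfield (kern \<alpha>) q \<xi>) \<le> tv q * kern_bound \<alpha>" for \<xi> by (rule vfield_norm_le[OF sm k])
  show "0 \<le> 2 * tv q * kern_const \<alpha>" using tv_nonneg kern_const_nonneg[OF \<alpha>] by simp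
  fix e :: real and \<xi> \<zeta> :: "plane \<Rightarrow>\<^sub>C plane" assume e: "0 < e" "e \<le> 1"
  have "norm (kern \<alpha> ((x + \<xi> x) - (y + \<xi> y)) - kern \<alpha> ((x + \<zeta> x) - (y + \<zeta> y)))
      \<le> 2 * kern_const \<alpha> * (log_mod e * norm (\<xi> - \<zeta>) + e)" for x y
  proof -
    have n: "norm (\<xi> z - \<zeta> z) \<le> norm (\<xi> - \<zeta>)" for z using norm_bounded[of "\<xi> - \<zeta>" z] by simp
    have "norm (((x + \<xi> x) - (y + \<xi> y)) - ((x + \<zeta> x) - (y + \<zeta> y))) \<le> norm (\<xi> x - \<zeta> x) + norm (\<xi> y - \<zeta> y)"
      using norm_triangle_ineq4[of "\<xi> x - \<zeta> x" "\<xi> y - \<zeta> y"] by (simp add: algebra_simps)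
    also have "\<dots> \<le> 2 * norm (\<xi> - \<zeta>)" using n[of x] n[of y] by simp
    finally have n2: "norm (((x + \<xi> x) - (y + \<xi> y)) - ((x + \<zeta> x) - (y + \<zeta> y))) \<le> 2 * norm (\<xi> - \<zeta>)" .
    have "norm (kern \<alpha> ((x + \<xi> x) - (y + \<xi> y)) - kern \<alpha> ((x + \<zeta> x) - (y + \<zeta> y)))
        \<le> kern_const \<alpha> * (log_mod e * norm (((x + \<xi> x) - (y + \<xi> y)) - ((x + \<zeta> x) - (y + \<zeta> y))) + e)"
      by (rule kern_modulus[OF \<alpha> e])
    also have "\<dots> \<le> kern_const \<alpha> * (log_mod e * (2 * norm (\<xi> - \<zeta>)) + 2 * e)"
      using n2 log_mod_ge_1[OF e] e kern_const_nonneg[OF \<alpha>] by (intro mult_left_mono add_mono) auto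
    finally show ?thesis by (simp add: algebra_simps)
  qed
  from vfield_diff_le[OF sm k k this]
  show "norm (vfield (kern \<alpha>) q \<xi> - vfield (kern \<alpha>) q \<zeta>)
      \<le> 2 * tv q * kern_const \<alpha> * (log_mod e * norm (\<xi> - \<zeta>) + e)"
    by (simp add: mult_ac)
qed

text \<open>The cut equals the step size that \<open>euler\<close> uses at level \<open>j\<close>,
  so the error of the field is of the order of a step while its derivative grows only linearly in
  \<open>j\<close>.\<close>

definition vortex_step :: "real \<Rightarrow> (plane set \<Rightarrow> real) \<Rightarrow> nat \<Rightarrow> (plane \<Rightarrow>\<^sub>C plane) \<Rightarrow> plane \<Rightarrow>\<^sub>C plane" where
  "vortex_step \<alpha> q j = vfield (kern_at \<alpha> (cut_weight ((1/2) ^ j))) q"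

lemma half_power_bounds: "0 < (1/2::real) ^ j" "(1/2::real) ^ j \<le> 1"
  by (auto simp: power_le_one)

lemma vortex_step_approx:
  assumes \<alpha>: "\<alpha> > 0" and sm: "is_signed_measure q"
  shows "norm (vortex_step \<alpha> q j \<xi>) \<le> tv q * kern_bound \<alpha>"
    and "norm (vortex_step \<alpha> q j \<xi> - vfield (kern \<alpha>) q \<xi>) \<le> 2 * tv q * kern_const \<alpha> * (1/2) ^ j"
proof -
  note k = continuous_kern[OF \<alpha>] kern_le[OF \<alpha>]
  note kj = continuous_kern_cut[OF \<alpha> half_power_bounds[of j]] kern_cut_le[OF \<alpha>, of "(1/2) ^ j"]
  show "norm (vortex_step \<alpha> q j \<xi>) \<le> tv q * kern_bound \<alpha>"
    unfolding vortex_step_def by (rule vfield_norm_le[OF sm kj])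
  have "norm (vortex_step \<alpha> q j \<xi> - vfield (kern \<alpha>) q \<xi>) \<le> tv q * (kern_const \<alpha> * (1/2) ^ j)"
    unfolding vortex_step_def by (intro vfield_diff_le[OF sm kj k] kern_approx \<alpha>) simp
  also have "\<dots> \<le> 2 * (tv q * (kern_const \<alpha> * (1/2) ^ j))"
    using tv_nonneg[of q] kern_const_nonneg[OF \<alpha>] by simp
  finally show "norm (vortex_step \<alpha> q j \<xi> - vfield (kern \<alpha>) q \<xi>) \<le> 2 * tv q * kern_const \<alpha> * (1/2) ^ j"
    by (simp add: mult_ac)
qed

definition vortex_curve :: "real \<Rightarrow> (plane set \<Rightarrow> real) \<Rightarrow> (real \<Rightarrow> plane \<Rightarrow>\<^sub>C plane) \<Rightarrow> bool" where
  "vortex_curve \<alpha> q \<xi> \<longleftrightarrow> (\<forall>t. (\<xi> has_vector_derivative vfield (kern \<alpha>) q (\<xi> t)) (at t))"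

lemma vortex_curve_unique:
  assumes "\<alpha> > 0" "is_signed_measure q" "vortex_curve \<alpha> q \<xi>" "vortex_curve \<alpha> q \<zeta>" "\<xi> 0 = \<zeta> 0"
  shows "\<xi> t = \<zeta> t"
  using log_lipschitz.unique[OF vfield_log_lipschitz[OF assms(1,2)]] assms(3-) unfolding vortex_curve_def by blast

lemma vortex_curve_exists:
  assumes \<alpha>: "\<alpha> > 0" and sm: "is_signed_measure q"
  shows "\<exists>\<xi>. \<xi> 0 = 0 \<and> vortex_curve \<alpha> q \<xi> \<and>
    (\<forall>t\<ge>0. (\<lambda>j. euler (vortex_step \<alpha> q) j 0 (dyadic_index j t)) \<longlonglongrightarrow> \<xi> t \<and>
      (\<lambda>j. euler (vortex_step \<alpha> (\<lambda>A. - q A)) j 0 (dyadic_index j t)) \<longlonglongrightarrow> \<xi> (- t))"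
proof -
  note k = continuous_kern[OF \<alpha>] kern_le[OF \<alpha>]
  note sm' = signed_measure_uminus[OF sm]
  have b: "norm (vortex_step \<alpha> (\<lambda>A. - q A) j \<xi>) \<le> tv q * kern_bound \<alpha>" for j \<xi>
    using vortex_step_approx(1)[OF \<alpha> sm'] by (simp add: tv_uminus)
  have a: "norm (vortex_step \<alpha> (\<lambda>A. - q A) j \<xi> - - vfield (kern \<alpha>) q \<xi>) \<le> 2 * tv q * kern_const \<alpha> * (1/2) ^ j" for j \<xi>
    using vortex_step_approx(2)[OF \<alpha> sm', of j \<xi>] unfolding vfield_uminus[OF sm k] tv_uminus .
  obtain \<xi> where "\<xi> 0 = 0" "\<And>t. (\<xi> has_vector_derivative vfield (kern \<alpha>) q (\<xi> t)) (at t)"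
    "\<And>t. t \<ge> 0 \<Longrightarrow> (\<lambda>j. euler (vortex_step \<alpha> q) j 0 (dyadic_index j t)) \<longlonglongrightarrow> \<xi> t"
    "\<And>t. t \<ge> 0 \<Longrightarrow> (\<lambda>j. euler (vortex_step \<alpha> (\<lambda>A. - q A)) j 0 (dyadic_index j t)) \<longlonglongrightarrow> \<xi> (- t)"
    using log_lipschitz_flow_exists[OF vfield_log_lipschitz[OF \<alpha> sm] vortex_step_approx(1)[OF \<alpha> sm] b
        vortex_step_approx(2)[OF \<alpha> sm] a, of 0] by blast
  then show ?thesis unfolding vortex_curve_def by blast
qed

text \<open>The Euler approximations are part of the choice because the flow inherits the preservation
  of volumes from them; backward in time they belong to the vorticity \<open>- q\<close>.\<close>

definition vdisp :: "real \<Rightarrow> (plane set \<Rightarrow> real) \<Rightarrow> real \<Rightarrow> plane \<Rightarrow>\<^sub>C plane" where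
  "vdisp \<alpha> q = (SOME \<xi>. \<xi> 0 = 0 \<and> vortex_curve \<alpha> q \<xi> \<and>
    (\<forall>t\<ge>0. (\<lambda>j. euler (vortex_step \<alpha> q) j 0 (dyadic_index j t)) \<longlonglongrightarrow> \<xi> t \<and>
      (\<lambda>j. euler (vortex_step \<alpha> (\<lambda>A. - q A)) j 0 (dyadic_index j t)) \<longlonglongrightarrow> \<xi> (- t)))"

definition vflow :: "real \<Rightarrow> (plane set \<Rightarrow> real) \<Rightarrow> real \<Rightarrow> plane \<Rightarrow> plane" where
  "vflow \<alpha> q t x = x + vdisp \<alpha> q t x"

lemma continuous_vflow: "continuous_on UNIV (vflow \<alpha> q t)"
  unfolding vflow_def[abs_def] by (intro continuous_intros) simp

lemma vflow_measurable: "vflow \<alpha> q t \<in> borel_measurable borel"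
  by (intro borel_measurable_continuous_onI continuous_vflow)

text \<open>Composition with a fixed map is a bounded operator, so a curve of displacements may be
  relabelled inside the Banach space and keeps its derivative.\<close>

lemma bcontfun_compose:
  fixes f :: "'b::topological_space \<Rightarrow>\<^sub>C 'c::real_normed_vector"
  assumes "continuous_on UNIV g"
  shows "(\<lambda>x. f (g x)) \<in> bcontfun" "bounded_linear (\<lambda>f::'b \<Rightarrow>\<^sub>C 'c. Bcontfun (\<lambda>x. f (g x)))"
proof -
  show mem: "(\<lambda>x. f (g x)) \<in> bcontfun" for f :: "'b \<Rightarrow>\<^sub>C 'c"
    using norm_bounded[of f]
    by (intro bcontfun_normI[of _ "norm f"] continuous_on_compose2[OF continuous_on_apply_bcontfun[of UNIV] assms]) auto
  show "bounded_linear (\<lambda>f::'b \<Rightarrow>\<^sub>C 'c. Bcontfun (\<lambda>x. f (g x)))"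
  proof (rule bounded_linear_intro[where K = 1])
    show "norm (Bcontfun (\<lambda>x. f (g x))) \<le> norm f * 1" for f :: "'b \<Rightarrow>\<^sub>C 'c"
      using norm_bounded[of f] by (intro norm_bound) (simp add: Bcontfun_inverse[OF mem])
  qed (auto intro!: bcontfun_eqI simp: Bcontfun_inverse[OF mem]
      Bcontfun_inverse[OF plus_cont[OF mem mem]] Bcontfun_inverse[OF scaleR_cont[OF mem]])
qed

lemma pushforward_comp_id:
  assumes "is_signed_measure \<mu>" "\<And>x. \<eta> x = x" shows "pushforward \<eta> \<mu> = \<mu>"
proof -
  have "\<eta> = (\<lambda>x. x)" using assms(2) by auto
  then show ?thesis using pushforward_id[OF assms(1)] by simp
qed

context
  fixes \<alpha> :: real and q :: "plane set \<Rightarrow> real"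
  assumes \<alpha>: "\<alpha> > 0" and sm: "is_signed_measure q"
begin

lemma vdisp: "vdisp \<alpha> q 0 = 0" "vortex_curve \<alpha> q (vdisp \<alpha> q)"
  "t \<ge> 0 \<Longrightarrow> (\<lambda>j. euler (vortex_step \<alpha> q) j 0 (dyadic_index j t)) \<longlonglongrightarrow> vdisp \<alpha> q t"
  "t \<ge> 0 \<Longrightarrow> (\<lambda>j. euler (vortex_step \<alpha> (\<lambda>A. - q A)) j 0 (dyadic_index j t)) \<longlonglongrightarrow> vdisp \<alpha> q (- t)"
  using someI_ex[OF vortex_curve_exists[OF \<alpha> sm]] unfolding vdisp_def[symmetric] by auto

lemma vflow_0: "vflow \<alpha> q 0 x = x"
  by (simp add: vflow_def vdisp(1))

lemma vfield_kern_apply: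
  "apply_bcontfun (vfield (kern \<alpha>) q \<xi>) x = sint q (\<lambda>y. kern \<alpha> ((x + \<xi> x) - (y + \<xi> y)))"
  by (rule vfield_apply[OF sm continuous_kern[OF \<alpha>] kern_le[OF \<alpha>]])

lemma vdisp_has_derivative: "(vdisp \<alpha> q has_vector_derivative vfield (kern \<alpha>) q (vdisp \<alpha> q t)) (at t)"
  using vdisp(2) by (simp add: vortex_curve_def)

text \<open>Started after \<open>vflow \<alpha> q t\<close>, the flow of the transported vorticity
  solves the displacement equation of \<open>q\<close> with initial value
  \<open>vdisp \<alpha> q t\<close>, since pushing forward only relabels the sources. Uniqueness
  identifies the two. The vorticity moves along, hence the two different measures in the composition
  law.\<close>

lemma vflow_group:
  "vflow \<alpha> (pushforward (vflow \<alpha> q t) q) s (vflow \<alpha> q t x) = vflow \<alpha> q (s + t) x"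
proof -
  let ?q = "pushforward (vflow \<alpha> q t) q"
  note sm' = signed_measure_pushforward[OF sm vflow_measurable[of \<alpha> q t]]
  obtain \<xi> where \<xi>: "\<xi> = vdisp \<alpha> ?q" by simp
  have \<xi>': "\<xi> 0 = 0" "\<And>s. (\<xi> has_vector_derivative vfield (kern \<alpha>) ?q (\<xi> s)) (at s)"
  proof -
    obtain \<zeta> where \<zeta>: "\<zeta> 0 = 0 \<and> vortex_curve \<alpha> ?q \<zeta> \<and>
      (\<forall>t\<ge>0. (\<lambda>j. euler (vortex_step \<alpha> ?q) j 0 (dyadic_index j t)) \<longlonglongrightarrow> \<zeta> t \<and>
      (\<lambda>j. euler (vortex_step \<alpha> (\<lambda>A. - ?q A)) j 0 (dyadic_index j t)) \<longlonglongrightarrow> \<zeta> (- t))"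
      using vortex_curve_exists[OF \<alpha> sm'] by blast
    from someI[of "\<lambda>\<xi>. \<xi> 0 = 0 \<and> vortex_curve \<alpha> ?q \<xi> \<and>
      (\<forall>t\<ge>0. (\<lambda>j. euler (vortex_step \<alpha> ?q) j 0 (dyadic_index j t)) \<longlonglongrightarrow> \<xi> t \<and>
      (\<lambda>j. euler (vortex_step \<alpha> (\<lambda>A. - ?q A)) j 0 (dyadic_index j t)) \<longlonglongrightarrow> \<xi> (- t))", OF \<zeta>]
    show "\<xi> 0 = 0" "\<And>s. (\<xi> has_vector_derivative vfield (kern \<alpha>) ?q (\<xi> s)) (at s)"
      unfolding \<xi> vdisp_def[symmetric] by (auto simp: vortex_curve_def)
  qed
  let ?T = "\<lambda>f::plane \<Rightarrow>\<^sub>C plane. Bcontfun (\<lambda>x. f (vflow \<alpha> q t x)) :: plane \<Rightarrow>\<^sub>C plane"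
  have T: "apply_bcontfun (?T f) x = f (vflow \<alpha> q t x)" for f x
    by (simp add: Bcontfun_inverse bcontfun_compose(1)[OF continuous_vflow])
  define \<zeta> where "\<zeta> s = ?T (\<xi> s) + vdisp \<alpha> q t" for s
  have \<zeta>x: "x + \<zeta> s x = vflow \<alpha> q t x + \<xi> s (vflow \<alpha> q t x)" for s x
    by (simp add: \<zeta>_def T) (simp add: vflow_def)
  have vf: "?T (vfield (kern \<alpha>) ?q (\<xi> s)) = vfield (kern \<alpha>) q (\<zeta> s)" for s
  proof (rule bcontfun_eqI)
    fix x
    have "apply_bcontfun (vfield (kern \<alpha>) ?q (\<xi> s)) (vflow \<alpha> q t x)
        = sint ?q (\<lambda>z. kern \<alpha> ((vflow \<alpha> q t x + \<xi> s (vflow \<alpha> q t x)) - (z + \<xi> s z)))"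
      by (rule vfield_apply[OF sm' continuous_kern[OF \<alpha>] kern_le[OF \<alpha>]])
    also have "\<dots> = sint q (\<lambda>y. kern \<alpha> ((x + \<zeta> s x) - (y + \<zeta> s y)))"
      unfolding \<zeta>x by (rule sint_pushforward[OF sm vflow_measurable])
        (rule vfield_integrand_bounded_borel[OF continuous_kern[OF \<alpha>] kern_le[OF \<alpha>]])
    finally show "apply_bcontfun (?T (vfield (kern \<alpha>) ?q (\<xi> s))) x = apply_bcontfun (vfield (kern \<alpha>) q (\<zeta> s)) x"
      unfolding T vfield_kern_apply .
  qed
  have "vortex_curve \<alpha> q \<zeta>"
    unfolding vortex_curve_def
  proof
    fix s
    have "((\<lambda>s. ?T (\<xi> s)) has_vector_derivative ?T (vfield (kern \<alpha>) ?q (\<xi> s))) (at s)"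
      by (rule bounded_linear.has_vector_derivative[OF bcontfun_compose(2)[OF continuous_vflow] \<xi>'(2)])
    then show "(\<zeta> has_vector_derivative vfield (kern \<alpha>) q (\<zeta> s)) (at s)"
      unfolding \<zeta>_def[abs_def] vf[unfolded \<zeta>_def] by (auto intro!: derivative_eq_intros)
  qed
  moreover have "vortex_curve \<alpha> q (\<lambda>s. vdisp \<alpha> q (s + t))"
    unfolding vortex_curve_def
  proof
    fix s
    have "((vdisp \<alpha> q \<circ> (\<lambda>s. s + t)) has_vector_derivative 1 *\<^sub>R vfield (kern \<alpha>) q (vdisp \<alpha> q (s + t))) (at s)"
      by (rule vector_diff_chain_at) (auto intro!: derivative_eq_intros vdisp_has_derivative)
    then show "((\<lambda>s. vdisp \<alpha> q (s + t)) has_vector_derivative vfield (kern \<alpha>) q (vdisp \<alpha> q (s + t))) (at s)"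
      by (simp add: o_def)
  qed
  moreover have "\<zeta> 0 = vdisp \<alpha> q (0 + t)"
    by (rule bcontfun_eqI) (simp add: \<zeta>_def T, simp add: \<xi>'(1))
  ultimately have "\<zeta> s = vdisp \<alpha> q (s + t)"
    by (rule vortex_curve_unique[OF \<alpha> sm])
  then show ?thesis using \<zeta>x[of x s] by (simp add: vflow_def \<xi>)
qed

lemma vflow_pushforward_back:
  "pushforward (vflow \<alpha> (pushforward (vflow \<alpha> q t) q) (- t)) (pushforward (vflow \<alpha> q t) q) = q"
  unfolding pushforward_compose[OF sm vflow_measurable vflow_measurable] vflow_group
  by (rule pushforward_comp_id[OF sm]) (simp add: vflow_0)

lemma vflow_inverse_left: "vflow \<alpha> (pushforward (vflow \<alpha> q t) q) (- t) (vflow \<alpha> q t x) = x"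
  by (simp add: vflow_group vflow_0)

end

text \<open>The left inverse law for the transported vorticity, once pushing it back is known to
  return \<open>q\<close>.\<close>

lemma vflow_inverse_right:
  assumes \<alpha>: "\<alpha> > 0" and sm: "is_signed_measure q"
  shows "vflow \<alpha> q t (vflow \<alpha> (pushforward (vflow \<alpha> q t) q) (- t) z) = z"
proof -
  let ?q = "pushforward (vflow \<alpha> q t) q"
  note sm' = signed_measure_pushforward[OF sm vflow_measurable[of \<alpha> q t]]
  have "vflow \<alpha> (pushforward (vflow \<alpha> ?q (- t)) ?q) (- (- t)) (vflow \<alpha> ?q (- t) z) = z"
    by (rule vflow_inverse_left[OF \<alpha> sm'])
  then show ?thesis unfolding vflow_pushforward_back[OF \<alpha> sm] by simp
qed

lemma vflow_homeomorphism:
  assumes "\<alpha> > 0" "is_signed_measure q"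
  shows "homeomorphism UNIV UNIV (vflow \<alpha> q t) (vflow \<alpha> (pushforward (vflow \<alpha> q t) q) (- t))"
  using vflow_inverse_left[OF assms, of t] vflow_inverse_right[OF assms, of t]
  by (intro homeomorphismI) (auto simp: continuous_vflow)

section \<open>Preservation of Lebesgue measure\<close>

lemma sint_has_derivative:
  fixes f :: "'a::euclidean_space \<Rightarrow> plane \<Rightarrow> 'c::euclidean_space"
  assumes sm: "is_signed_measure q" and r: "r > 0"
    and der: "\<And>y. ((\<lambda>x. f x y) has_derivative D y) (at x0)"
    and b: "\<And>x. x \<in> ball x0 r \<Longrightarrow> bounded_borel (f x)"
    and lip: "\<And>x y. x \<in> ball x0 r \<Longrightarrow> norm (f x y - f x0 y) \<le> B * norm (x - x0)"
  shows "((\<lambda>x. sint q (f x)) has_derivative (\<lambda>h. sint q (\<lambda>y. D y h))) (at x0)"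
    and "norm (D y h) \<le> B * norm h"
    and "bounded_borel (\<lambda>y. D y h)"
proof -
  have fin: "finite_measure (pos_part q)" "finite_measure (neg_part q)"
    by (auto simp: sm finite_pos_part finite_neg_part)
  note p = has_derivative_integral[where M = "pos_part q" and B = "\<lambda>_. B", OF r der integrable_pos_part[OF sm b] lip
      finite_measure.integrable_const[OF fin(1)]]
  note n = has_derivative_integral[where M = "neg_part q" and B = "\<lambda>_. B", OF r der integrable_neg_part[OF sm b] lip
      finite_measure.integrable_const[OF fin(2)]]
  show "((\<lambda>x. sint q (f x)) has_derivative (\<lambda>h. sint q (\<lambda>y. D y h))) (at x0)"
    unfolding sint_def by (intro has_derivative_diff p(1) n(1))
  show le: "norm (D y h) \<le> B * norm h" for y h by (rule p(3))
  have "(\<lambda>y. D y h) \<in> borel_measurable (pos_part q)"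
    using p(2)[of h] by (rule borel_measurable_integrable)
  then have "(\<lambda>y. D y h) \<in> borel_measurable borel"
    using sm by (simp cong: measurable_cong_sets)
  then show "bounded_borel (\<lambda>y. D y h)" using le by (rule bounded_borelI)
qed

text \<open>Change of variables on bounded pieces of the preimage, whose images lie in
  \<open>S\<close>; monotone limits do the rest. A lower bound on the Jacobian yields one inequality
  only; equality is recovered later from the inverse flow.\<close>

lemma emeasure_vimage_le:
  fixes f :: "real^2 \<Rightarrow> real^2"
  assumes der: "\<And>x. (f has_derivative f' x) (at x)" and inj: "inj f"
    and det: "\<And>x. det (matrix (f' x)) \<ge> d" and d: "0 < d" and S: "S \<in> sets borel"
  shows "ennreal d * emeasure lborel (f -` S) \<le> emeasure lborel S"
proof -
  have cont: "continuous_on UNIV f"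
    using der by (intro continuous_at_imp_continuous_on) (auto intro: has_derivative_continuous)
  have fS: "f -` S \<in> sets borel"
    using measurable_sets[OF borel_measurable_continuous_onI[OF cont] S] by simp
  define T where "T n = f -` S \<inter> cball 0 (real n)" for n
  have T: "T n \<in> sets borel" for n unfolding T_def using fS by auto
  have le: "ennreal d * emeasure lborel (T n) \<le> emeasure lborel S" for n
  proof -
    have Tfin: "emeasure lborel (T n) < \<infinity>"
      unfolding T_def by (rule le_less_trans[OF emeasure_mono emeasure_bounded_finite[OF bounded_cball[of 0 "real n"]]]) (auto simp: fS)
    have derT: "(f has_derivative f' x) (at x within T n)" for x
      using der by (rule has_derivative_at_withinI)
    have "f ` T n \<in> sets lebesgue"
    proof (rule differentiable_image_in_sets_lebesgue)
      show "f differentiable_on T n" using derT by (auto simp: differentiable_on_def differentiable_def)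
    qed (use T in auto)
    moreover have "bounded (f ` T n)"
    proof (rule bounded_subset)
      show "bounded (f ` cball 0 (real n))"
        by (intro compact_imp_bounded compact_continuous_image continuous_on_subset[OF cont]) auto
    qed (auto simp: T_def)
    ultimately have im: "f ` T n \<in> lmeasurable" by (rule bounded_set_imp_lmeasurable[rotated])
    have i1: "((\<lambda>x. \<bar>det (matrix (f' x))\<bar>) has_integral measure lebesgue (f ` T n)) (T n)"
      using has_measure_differentiable_image[of "T n" f f' "measure lebesgue (f ` T n)"] derT im T inj
      by (auto intro: inj_on_subset)
    have i2: "((\<lambda>x. d * 1) has_integral d * measure lborel (T n)) (T n)"
      by (intro has_integral_mult_right has_integral_measure_lborel T Tfin)
    have m: "d * measure lborel (T n) \<le> measure lebesgue (f ` T n)"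
      by (rule has_integral_le[OF i2 i1]) (use det in \<open>auto intro: order_trans abs_ge_self\<close>)
    have "ennreal d * emeasure lborel (T n) = ennreal (d * measure lborel (T n))"
      using Tfin d by (simp add: emeasure_eq_ennreal_measure ennreal_mult less_top)
    also have "\<dots> \<le> ennreal (measure lebesgue (f ` T n))" using m by (rule ennreal_leI)
    also have "\<dots> = emeasure lebesgue (f ` T n)" using im by (simp add: emeasure_eq_measure2)
    also have "\<dots> \<le> emeasure lebesgue S" using S by (intro emeasure_mono) (auto simp: T_def)
    also have "\<dots> = emeasure lborel S" using S by simp
    finally show ?thesis .
  qed
  have "(SUP n. emeasure lborel (T n)) = emeasure lborel (\<Union>n. T n)"
    using T by (intro SUP_emeasure_incseq) (auto simp: incseq_def T_def)
  also have "(\<Union>n. T n) = f -` S" by (auto simp: T_def intro: real_arch_simple)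
  finally have sup: "(SUP n. emeasure lborel (T n)) = emeasure lborel (f -` S)" .
  have "ennreal d * emeasure lborel (f -` S) = (SUP n. ennreal d * emeasure lborel (T n))"
    unfolding sup[symmetric] by (rule SUP_mult_left_ennreal)
  also have "\<dots> \<le> emeasure lborel S" using le by (rule SUP_least)
  finally show ?thesis .
qed

text \<open>For 2 by 2 matrices det (1 + s A) = 1 + s tr A + s^2 det A. The linear term vanishes,
  which makes the volume error of a step quadratic in the step size.\<close>

lemma det_perturb_ge:
  assumes lin: "linear A" and tr: "A (axis 1 1) $ 1 + A (axis 2 1) $ 2 = 0" and b: "\<And>h. norm (A h) \<le> B * norm h"
  shows "det (matrix (\<lambda>h. h + s *\<^sub>R A h :: real^2)) \<ge> 1 - 2 * (s * B)\<^sup>2"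
proof -
  let ?a = "A (axis 1 1) $ 1" and ?b = "A (axis 2 1) $ 1" and ?c = "A (axis 1 1) $ 2" and ?d = "A (axis 2 1) $ 2"
  have le: "\<bar>A (axis i 1) $ j\<bar> \<le> B" for i j
    using component_le_norm_cart[of "A (axis i 1)" j] b[of "axis i 1"] by (simp add: norm_axis_1)
  have B: "B \<ge> 0" using le[of 1 1] by linarith
  have d: "?d = - ?a" using tr by simp
  have ne: "(1::2) \<noteq> 2" "(2::2) \<noteq> 1" by auto
  have "det (matrix (\<lambda>h. h + s *\<^sub>R A h)) = (1 + s * ?a) * (1 + s * ?d) - (s * ?b) * (s * ?c)"
    by (simp add: det_2 matrix_def axis_def ne)
  also have "\<dots> = 1 - s\<^sup>2 * (?a * ?a + ?b * ?c)" unfolding d by (simp add: algebra_simps power2_eq_square)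
  also have "\<dots> \<ge> 1 - s\<^sup>2 * (2 * B\<^sup>2)"
  proof -
    have "?a * ?a \<le> \<bar>?a\<bar> * \<bar>?a\<bar>" by simp
    also have "\<dots> \<le> B * B" using le B by (intro mult_mono) auto
    finally have 1: "?a * ?a \<le> B * B" .
    have "?b * ?c \<le> \<bar>?b\<bar> * \<bar>?c\<bar>" by (simp flip: abs_mult)
    also have "\<dots> \<le> B * B" using le B by (intro mult_mono) auto
    finally have "?a * ?a + ?b * ?c \<le> 2 * B\<^sup>2" using 1 by (simp add: power2_eq_square)
    then have "s\<^sup>2 * (?a * ?a + ?b * ?c) \<le> s\<^sup>2 * (2 * B\<^sup>2)" by (intro mult_left_mono) auto
    then show ?thesis by simp
  qed
  finally show ?thesis by (simp add: power_mult_distrib mult_ac)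
qed

definition cut_lip :: "real \<Rightarrow> real \<Rightarrow> real" where
  "cut_lip \<alpha> e = 1 / (8 * pi * \<alpha>\<^sup>2) * 4 * log_mod e"

context
  fixes \<alpha> :: real and q :: "plane set \<Rightarrow> real"
  assumes \<alpha>: "\<alpha> > 0" and sm: "is_signed_measure q"
begin

definition cut_vel :: "real \<Rightarrow> plane \<Rightarrow> plane" where
  "cut_vel e x = sint q (\<lambda>z. kern_at \<alpha> (cut_weight e) (x - z))"

definition cut_vel_deriv :: "real \<Rightarrow> plane \<Rightarrow> plane \<Rightarrow> plane" where
  "cut_vel_deriv e x h = sint q (\<lambda>z. kern_cut_deriv \<alpha> e (x - z) h)"

lemma cut_integrand_bounded_borel:
  assumes e: "0 < e" "e \<le> 1"
  shows "bounded_borel (\<lambda>z. kern_at \<alpha> (cut_weight e) (x - z))"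
  by (intro bounded_borel_continuous[OF _ kern_cut_le[OF \<alpha>]] continuous_on_compose2[OF continuous_kern_cut[OF \<alpha> e]] continuous_intros) auto

lemma cut_vel_le: "0 < e \<Longrightarrow> e \<le> 1 \<Longrightarrow> norm (cut_vel e x) \<le> tv q * kern_bound \<alpha>"
  unfolding cut_vel_def by (intro sint_norm_le[OF sm] cut_integrand_bounded_borel kern_cut_le \<alpha>)

lemma cut_vel:
  assumes e: "0 < e" "e \<le> 1"
  shows "(cut_vel e has_derivative cut_vel_deriv e x) (at x)"
    and "norm (cut_vel_deriv e x h) \<le> tv q * cut_lip \<alpha> e * norm h"
    and "cut_vel_deriv e x (axis 1 1) $ 1 + cut_vel_deriv e x (axis 2 1) $ 2 = 0"
    and "norm (cut_vel e x - cut_vel e y) \<le> tv q * cut_lip \<alpha> e * norm (x - y)"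
proof -
  let ?k = "kern_at \<alpha> (cut_weight e)"
  have lip: "norm (?k (x - z) - ?k (y - z)) \<le> cut_lip \<alpha> e * norm (x - y)" for x y z
    using kern_cut_lipschitz[OF \<alpha> e, of "x - z" "y - z"] by (simp add: cut_lip_def)
  have der: "((\<lambda>x. ?k (x - z)) has_derivative kern_cut_deriv \<alpha> e (x - z)) (at x)" for x z
  proof -
    have "((\<lambda>x. x - z) has_derivative (\<lambda>h. h)) (at x)" by (auto intro!: derivative_eq_intros)
    from diff_chain_at[OF this kern_cut(1)[OF \<alpha> e]] show ?thesis by (simp add: o_def)
  qed
  note D = sint_has_derivative[OF sm zero_less_one der cut_integrand_bounded_borel[OF e] lip]
  show "(cut_vel e has_derivative cut_vel_deriv e x) (at x)"
    unfolding cut_vel_def[abs_def] cut_vel_deriv_def[abs_def] by (rule D(1))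
  show "norm (cut_vel_deriv e x h) \<le> tv q * cut_lip \<alpha> e * norm h"
    unfolding cut_vel_deriv_def using sint_norm_le[OF sm D(3) D(2)] by (simp add: mult.assoc)
  have nth: "cut_vel_deriv e x h $ i = sint q (\<lambda>z. kern_cut_deriv \<alpha> e (x - z) h $ i)" for h i
    unfolding cut_vel_deriv_def by (rule sint_linear[OF sm bounded_linear_vec_nth D(3), symmetric])
  show "cut_vel_deriv e x (axis 1 1) $ 1 + cut_vel_deriv e x (axis 2 1) $ 2 = 0"
    unfolding nth
    by (subst sint_add[OF sm, symmetric])
      (auto intro!: bounded_borel_linear[OF bounded_linear_vec_nth] D(3) simp: kern_cut(3)[OF \<alpha> e] sint_def)
  have "norm (sint q (\<lambda>z. ?k (x - z) - ?k (y - z))) \<le> tv q * (cut_lip \<alpha> e * norm (x - y))"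
    by (intro sint_norm_le[OF sm] bounded_borel_diff cut_integrand_bounded_borel e lip)
  then show "norm (cut_vel e x - cut_vel e y) \<le> tv q * cut_lip \<alpha> e * norm (x - y)"
    unfolding cut_vel_def
    by (simp add: sint_diff[OF sm cut_integrand_bounded_borel[OF e] cut_integrand_bounded_borel[OF e]] mult.assoc)
qed

text \<open>\<open>B\<close> is any bound of the Lipschitz constant of the cut velocity. The
  condition s B \<le> 1/2 makes the perturbed identity injective and keeps its Jacobian at least
  1/2.\<close>

lemma cut_step_volume:
  assumes e: "0 < e" "e \<le> 1" and s: "0 \<le> s" "s * B \<le> 1 / 2" and B: "tv q * cut_lip \<alpha> e \<le> B" and S: "S \<in> sets borel"
  shows "ennreal (1 - 2 * (s * B)\<^sup>2) * emeasure lborel ((\<lambda>x. x + s *\<^sub>R cut_vel e x) -` S) \<le> emeasure lborel S"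
proof (rule emeasure_vimage_le[OF _ _ _ _ S])
  show "((\<lambda>x. x + s *\<^sub>R cut_vel e x) has_derivative (\<lambda>h. h + s *\<^sub>R cut_vel_deriv e x h)) (at x)" for x
    by (intro derivative_intros has_derivative_scaleR_right cut_vel(1) e)
  have cl: "0 \<le> cut_lip \<alpha> e" using log_mod_ge_1[OF e] by (simp add: cut_lip_def)
  then have B0: "B \<ge> 0" using B tv_nonneg[of q] by (meson mult_nonneg_nonneg order_trans)
  have sB: "0 \<le> s * B" using s B0 by simp
  have "(s * B)\<^sup>2 \<le> (1/2)\<^sup>2" using s(2) sB by (rule power_mono)
  then show "0 < 1 - 2 * (s * B)\<^sup>2" by (simp add: power2_eq_square)
  show "1 - 2 * (s * B)\<^sup>2 \<le> det (matrix (\<lambda>h. h + s *\<^sub>R cut_vel_deriv e x h))" for x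
  proof (rule det_perturb_ge)
    show "linear (cut_vel_deriv e x)" using cut_vel(1)[OF e] by (rule has_derivative_linear)
    show "norm (cut_vel_deriv e x h) \<le> B * norm h" for h
      using cut_vel(2)[OF e, of x h] mult_right_mono[OF B, of "norm h"] by simp
  qed (rule cut_vel(3)[OF e])
  show "inj (\<lambda>x. x + s *\<^sub>R cut_vel e x)"
  proof (rule injI)
    fix x y assume "x + s *\<^sub>R cut_vel e x = y + s *\<^sub>R cut_vel e y"
    then have "x - y = - (s *\<^sub>R (cut_vel e x - cut_vel e y))" by (simp add: algebra_simps)
    then have "norm (x - y) = norm (s *\<^sub>R (cut_vel e x - cut_vel e y))" by (metis norm_minus_cancel)
    also have "\<dots> \<le> s * (B * norm (x - y))"
      using cut_vel(4)[OF e, of x y] mult_right_mono[OF B, of "norm (x - y)"] s by (simp add: mult_left_mono)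
    also have "\<dots> = (s * B) * norm (x - y)" by simp
    also have "\<dots> \<le> 1 / 2 * norm (x - y)" using s by (intro mult_right_mono) auto
    finally show "x = y" by simp
  qed
qed

end

text \<open>In terms of positions an Euler step is composition with x + h v(x), where v is the cut
  velocity of the vorticity at its current place. This is the map whose Jacobian is
  controlled.\<close>

lemma vortex_step_apply:
  assumes \<alpha>: "\<alpha> > 0" and sm: "is_signed_measure q"
  shows "apply_bcontfun (vortex_step \<alpha> q j \<xi>) x = cut_vel \<alpha> (pushforward (\<lambda>y. y + \<xi> y) q) ((1/2) ^ j) (x + \<xi> x)"
proof -
  note e = half_power_bounds[of j]
  have m: "(\<lambda>y. y + \<xi> y) \<in> borel_measurable borel"
    by (intro borel_measurable_continuous_onI continuous_intros) simp
  show ?thesis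
    unfolding vortex_step_def cut_vel_def[OF \<alpha> signed_measure_pushforward[OF sm m]] vfield_apply[OF sm continuous_kern_cut[OF \<alpha> e] kern_cut_le[OF \<alpha>]]
    by (rule sint_pushforward[OF sm m cut_integrand_bounded_borel[OF \<alpha> sm e], symmetric])
qed

text \<open>The last step is peeled off, which replaces \<open>S\<close> by a preimage. Its velocity
  belongs to a push-forward of \<open>q\<close>, whose total variation is not larger, so the same
  \<open>B\<close> serves every step.\<close>

lemma euler_volume:
  assumes \<alpha>: "\<alpha> > 0" and sm: "is_signed_measure q" and S: "S \<in> sets borel"
    and B: "tv q * cut_lip \<alpha> ((1/2) ^ j) \<le> B" and s: "(1/2) ^ j * B \<le> 1 / 2"
  shows "ennreal ((1 - 2 * ((1/2) ^ j * B)\<^sup>2) ^ k) * emeasure lborel ((\<lambda>x. x + euler (vortex_step \<alpha> q) j 0 k x) -` S) \<le> emeasure lborel S"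
  using S
proof (induction k arbitrary: S)
  case (Suc k)
  let ?d = "1 - 2 * ((1/2) ^ j * B)\<^sup>2"
  define \<xi> where "\<xi> = euler (vortex_step \<alpha> q) j 0 k"
  let ?q = "pushforward (\<lambda>y. y + \<xi> y) q"
  have m: "(\<lambda>y. y + \<xi> y) \<in> borel_measurable borel"
    by (intro borel_measurable_continuous_onI continuous_intros) simp
  note sm' = signed_measure_pushforward[OF sm m]
  note e = half_power_bounds[of j]
  let ?\<Phi> = "\<lambda>x. x + (1/2) ^ j *\<^sub>R cut_vel \<alpha> ?q ((1/2) ^ j) x"
  have cl: "0 \<le> cut_lip \<alpha> ((1/2) ^ j)" using log_mod_ge_1[OF e] by (simp add: cut_lip_def)
  have "tv ?q * cut_lip \<alpha> ((1/2) ^ j) \<le> tv q * cut_lip \<alpha> ((1/2) ^ j)"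
    using tv_pushforward_le[OF sm m] cl by (rule mult_right_mono)
  then have B': "tv ?q * cut_lip \<alpha> ((1/2) ^ j) \<le> B" using B by simp
  have B0: "B \<ge> 0" using B cl tv_nonneg[of q] by (meson mult_nonneg_nonneg order_trans)
  have d: "?d \<ge> 0"
  proof -
    have "((1/2) ^ j * B)\<^sup>2 \<le> (1/2)\<^sup>2" using s B0 by (intro power_mono) auto
    then show ?thesis by (simp add: power2_eq_square)
  qed
  have "continuous_on UNIV ?\<Phi>"
    using cut_vel(1)[OF \<alpha> sm' e] by (intro continuous_intros continuous_at_imp_continuous_on) (auto intro: has_derivative_continuous)
  then have PS: "?\<Phi> -` S \<in> sets borel"
    using measurable_sets[OF borel_measurable_continuous_onI Suc.prems, of ?\<Phi>] by simp
  have eq: "(\<lambda>x. x + euler (vortex_step \<alpha> q) j 0 (Suc k) x) -` S = (\<lambda>x. x + \<xi> x) -` (?\<Phi> -` S)"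
    by (simp add: vimage_def \<xi>_def[symmetric] vortex_step_apply[OF \<alpha> sm] add.assoc)
  have "ennreal (?d ^ Suc k) * emeasure lborel ((\<lambda>x. x + euler (vortex_step \<alpha> q) j 0 (Suc k) x) -` S)
      = ennreal ?d * (ennreal (?d ^ k) * emeasure lborel ((\<lambda>x. x + \<xi> x) -` (?\<Phi> -` S)))"
    unfolding eq using d by (simp add: ennreal_mult mult.assoc)
  also have "\<dots> \<le> ennreal ?d * emeasure lborel (?\<Phi> -` S)"
    using Suc.IH[OF PS] by (intro mult_left_mono) (auto simp: \<xi>_def)
  also have "\<dots> \<le> emeasure lborel S"
    by (rule cut_step_volume[OF \<alpha> sm' e _ s B' Suc.prems]) simp
  finally show ?case .
qed simp

text \<open>A point that the limit map sends into the open set is eventually sent there by the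
  schemes, so Fatou's lemma applies. About t / h steps accumulate a factor of at least exp (- 4 t h
  B^2), where B grows linearly in \<open>j\<close>; this tends to 1.\<close>

lemma open_vimage_limit_volume:
  fixes \<xi> :: "plane \<Rightarrow>\<^sub>C plane"
  assumes \<alpha>: "\<alpha> > 0" and sm: "is_signed_measure q" and t: "t \<ge> 0" and U: "open U"
    and lim: "(\<lambda>j. euler (vortex_step \<alpha> q) j 0 (dyadic_index j t)) \<longlonglongrightarrow> \<xi>"
  shows "emeasure lborel ((\<lambda>x. x + \<xi> x) -` U) \<le> emeasure lborel U"
proof -
  let ?E = "\<lambda>j x. x + euler (vortex_step \<alpha> q) j 0 (dyadic_index j t) x"
  define B where "B j = tv q * cut_lip \<alpha> ((1/2) ^ j)" for j
  define h where "h j = (1/2::real) ^ j" for j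
  define x where "x j = 2 * (h j * B j)\<^sup>2" for j
  define K where "K = tv q * (1 / (8 * pi * \<alpha>\<^sup>2) * 4)"
  have Bj: "B j = K * (1 + real j * ln 2)" for j
    by (simp add: B_def K_def cut_lip_def log_mod_def ln_realpow ln_div)
  have K: "K \<ge> 0" using tv_nonneg by (simp add: K_def)
  have B0: "B j \<ge> 0" for j unfolding Bj using K by (intro mult_nonneg_nonneg add_nonneg_nonneg) auto
  have "(\<lambda>j. (1/2::real) ^ j * (1 + real j * ln 2)) \<longlonglongrightarrow> 0" "(\<lambda>j. (1/2::real) ^ j * (1 + real j * ln 2)\<^sup>2) \<longlonglongrightarrow> 0"
  proof -
    \<comment> \<open>Writing 1/2 as r * r leaves one decaying factor r^j for each factor 1 + j ln
      2.\<close>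
    define r where "r = sqrt (1/2)"
    have r: "0 \<le> r" "r < 1" "r * r = 1 / 2" by (auto simp: r_def real_sqrt_lt_1_iff)
    have a: "(\<lambda>j. r ^ j + ln 2 * (real j * r ^ j)) \<longlonglongrightarrow> 0 + ln 2 * 0"
      using r by (intro tendsto_intros LIMSEQ_power_zero powser_times_n_limit_0) auto
    have b: "(\<lambda>j. r ^ j) \<longlonglongrightarrow> 0" using r by (intro LIMSEQ_power_zero) auto
    have rr: "(1/2::real) ^ j = r ^ j * r ^ j" for j by (simp add: power_mult_distrib[symmetric] r)
    have "(\<lambda>j. (r ^ j + ln 2 * (real j * r ^ j)) * r ^ j) \<longlonglongrightarrow> 0"
      using tendsto_mult[OF a b] by simp
    then show "(\<lambda>j. (1/2::real) ^ j * (1 + real j * ln 2)) \<longlonglongrightarrow> 0" by (simp add: rr algebra_simps)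
    have "(\<lambda>j. (r ^ j + ln 2 * (real j * r ^ j)) * (r ^ j + ln 2 * (real j * r ^ j))) \<longlonglongrightarrow> 0"
      using tendsto_mult[OF a a] by simp
    then show "(\<lambda>j. (1/2::real) ^ j * (1 + real j * ln 2)\<^sup>2) \<longlonglongrightarrow> 0" by (simp add: rr algebra_simps power2_eq_square)
  qed
  from tendsto_mult_right_zero[OF this(1), of K] tendsto_mult_right_zero[OF this(2), of "K\<^sup>2"]
  have hB: "(\<lambda>j. h j * B j) \<longlonglongrightarrow> 0" and hB2: "(\<lambda>j. h j * (B j)\<^sup>2) \<longlonglongrightarrow> 0"
    by (simp_all add: h_def Bj power_mult_distrib mult_ac)
  have h0: "h j > 0" for j by (simp add: h_def)
  have ev: "eventually (\<lambda>j. h j * B j \<le> 1 / 2) sequentially"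
    using order_tendstoD(2)[OF hB, of "1/2"] by (auto elim: eventually_mono)
  have low: "exp (- (4 * t * (h j * (B j)\<^sup>2))) \<le> (1 - x j) ^ dyadic_index j t" if "h j * B j \<le> 1 / 2" for j
  proof -
    have x: "0 \<le> x j" "x j \<le> 1 / 2"
    proof -
      have "(h j * B j)\<^sup>2 \<le> (1/2)\<^sup>2" using that h0[of j] B0[of j] by (intro power_mono) auto
      then show "x j \<le> 1 / 2" by (simp add: x_def power2_eq_square)
    qed (simp add: x_def)
    have "exp (- (2 * x j)) \<le> 1 - x j"
    proof -
      have "1 \<le> (1 - x j) * (1 + 2 * x j)" using x mult_left_mono[of "x j" "1/2" "x j"] by (simp add: algebra_simps)
      also have "\<dots> \<le> (1 - x j) * exp (2 * x j)" using x exp_ge_add_one_self[of "2 * x j"] by (intro mult_left_mono) auto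
      finally show ?thesis by (simp add: exp_minus field_simps)
    qed
    then have "exp (- (2 * x j)) ^ dyadic_index j t \<le> (1 - x j) ^ dyadic_index j t" by (intro power_mono) auto
    moreover have "exp (- (4 * t * (h j * (B j)\<^sup>2))) \<le> exp (- (2 * x j)) ^ dyadic_index j t"
    proof -
      have "real (dyadic_index j t) * h j * (4 * (h j * (B j)\<^sup>2)) \<le> t * (4 * (h j * (B j)\<^sup>2))"
        using dyadic_index_bounds(1)[OF t, of j] h0[of j] by (intro mult_right_mono) (auto simp: h_def)
      moreover have "real (dyadic_index j t) * h j * (4 * (h j * (B j)\<^sup>2)) = real (dyadic_index j t) * (2 * x j)"
        by (simp add: x_def power2_eq_square)
      ultimately have "real (dyadic_index j t) * (2 * x j) \<le> 4 * t * (h j * (B j)\<^sup>2)" by simp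
      then have "exp (- (4 * t * (h j * (B j)\<^sup>2))) \<le> exp (real (dyadic_index j t) * - (2 * x j))" by simp
      then show ?thesis by (simp only: exp_of_nat_mult)
    qed
    ultimately show ?thesis by linarith
  qed
  have "(\<lambda>j. exp (- (4 * t * (h j * (B j)\<^sup>2)))) \<longlonglongrightarrow> exp (- (4 * t * 0))"
    by (intro tendsto_intros hB2)
  then have e1: "(\<lambda>j. exp (- (4 * t * (h j * (B j)\<^sup>2)))) \<longlonglongrightarrow> 1" by simp
  have contE: "continuous_on UNIV (?E j)" for j by (intro continuous_intros) simp
  have Um: "?E j -` U \<in> sets borel" for j
    using U contE by (intro borel_open) (simp add: continuous_on_open_vimage)
  have \<xi>c: "continuous_on UNIV (\<lambda>x. x + \<xi> x)" by (intro continuous_intros) simp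
  have Ux: "(\<lambda>x. x + \<xi> x) -` U \<in> sets borel"
    using U \<xi>c by (intro borel_open) (simp add: continuous_on_open_vimage)
  have bd: "ennreal (exp (- (4 * t * (h j * (B j)\<^sup>2)))) * emeasure lborel (?E j -` U) \<le> emeasure lborel U"
    if j: "h j * B j \<le> 1 / 2" for j
  proof -
    have "ennreal (exp (- (4 * t * (h j * (B j)\<^sup>2)))) * emeasure lborel (?E j -` U)
        \<le> ennreal ((1 - x j) ^ dyadic_index j t) * emeasure lborel (?E j -` U)"
      using low[OF j] by (intro mult_right_mono ennreal_leI) auto
    also have "\<dots> \<le> emeasure lborel U"
      unfolding x_def h_def using j by (intro euler_volume[OF \<alpha> sm borel_open[OF U]]) (auto simp: B_def h_def)
    finally show ?thesis .
  qed
  have pt: "eventually (\<lambda>j. ?E j y \<in> U) sequentially" if "y + \<xi> y \<in> U" for y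
  proof -
    have "(\<lambda>j. apply_bcontfun (euler (vortex_step \<alpha> q) j 0 (dyadic_index j t)) y) \<longlonglongrightarrow> \<xi> y"
    proof (rule metric_tendsto_imp_tendsto[OF lim])
      show "\<forall>\<^sub>F j in sequentially. dist (apply_bcontfun (euler (vortex_step \<alpha> q) j 0 (dyadic_index j t)) y) (\<xi> y)
          \<le> dist (euler (vortex_step \<alpha> q) j 0 (dyadic_index j t)) \<xi>"
        by (intro always_eventually allI dist_bounded)
    qed
    then have "(\<lambda>j. ?E j y) \<longlonglongrightarrow> y + \<xi> y" by (intro tendsto_intros)
    then show ?thesis using U that by (rule topological_tendstoD)
  qed
  let ?ind = "\<lambda>j y. ennreal (exp (- (4 * t * (h j * (B j)\<^sup>2)))) * indicator (?E j -` U) y :: ennreal"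
  have "emeasure lborel ((\<lambda>x. x + \<xi> x) -` U) = (\<integral>\<^sup>+y. indicator ((\<lambda>x. x + \<xi> x) -` U) y \<partial>lborel)"
    using Ux by simp
  also have "\<dots> \<le> (\<integral>\<^sup>+y. liminf (\<lambda>j. ?ind j y) \<partial>lborel)"
  proof (rule nn_integral_mono)
    fix y :: plane
    show "indicator ((\<lambda>x. x + \<xi> x) -` U) y \<le> liminf (\<lambda>j. ?ind j y)"
    proof (cases "y + \<xi> y \<in> U")
      case True
      have "(\<lambda>j. ennreal (exp (- (4 * t * (h j * (B j)\<^sup>2))))) \<longlonglongrightarrow> ennreal 1"
        using e1 by (rule tendsto_ennrealI)
      then have "(\<lambda>j. ?ind j y) \<longlonglongrightarrow> ennreal 1"
        by (rule Lim_transform_eventually) (use pt[OF True] in \<open>auto elim!: eventually_mono\<close>)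
      then have "liminf (\<lambda>j. ?ind j y) = 1" by (simp add: lim_imp_Liminf)
      then show ?thesis by (simp add: indicator_def)
    qed simp
  qed
  also have "\<dots> \<le> liminf (\<lambda>j. \<integral>\<^sup>+y. ?ind j y \<partial>lborel)"
    using Um by (intro nn_integral_liminf) auto
  also have "\<dots> \<le> emeasure lborel U"
  proof -
    have "eventually (\<lambda>j. (\<integral>\<^sup>+y. ?ind j y \<partial>lborel) \<le> emeasure lborel U) sequentially"
      using ev by (rule eventually_mono) (use bd Um in \<open>simp add: nn_integral_cmult\<close>)
    then have "liminf (\<lambda>j. \<integral>\<^sup>+y. ?ind j y \<partial>lborel) \<le> liminf (\<lambda>j::nat. emeasure lborel U)"
      by (rule Liminf_mono)
    then show ?thesis by (simp add: Liminf_const)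
  qed
  finally show ?thesis .
qed

lemma vflow_open_vimage_volume:
  assumes \<alpha>: "\<alpha> > 0" and sm: "is_signed_measure q" and U: "open U"
  shows "emeasure lborel (vflow \<alpha> q t -` U) \<le> emeasure lborel U"
proof (cases "t \<ge> 0")
  case True
  from open_vimage_limit_volume[OF \<alpha> sm True U vdisp(3)[OF \<alpha> sm True]] show ?thesis
    by (simp add: vflow_def[abs_def])
next
  case False
  then have t: "- t \<ge> 0" by simp
  from open_vimage_limit_volume[OF \<alpha> signed_measure_uminus[OF sm] t U vdisp(4)[OF \<alpha> sm t]] show ?thesis
    by (simp add: vflow_def[abs_def])
qed

text \<open>The reverse inequality is the same one for the inverse map, a flow of the transported
  vorticity. Open sets are enough because boxes determine \<open>lborel\<close>.\<close>

lemma vflow_vol_homeo: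
  assumes \<alpha>: "\<alpha> > 0" and sm: "is_signed_measure q"
  shows "vflow \<alpha> q t \<in> vol_homeos"
  unfolding vol_homeos_def
proof (intro CollectI conjI)
  let ?\<eta> = "vflow \<alpha> q t" and ?\<xi> = "vflow \<alpha> (pushforward (vflow \<alpha> q t) q) (- t)"
  show "\<exists>\<xi>. homeomorphism UNIV UNIV ?\<eta> \<xi>" using vflow_homeomorphism[OF assms] by blast
  have eq: "emeasure lborel (?\<eta> -` U) = emeasure lborel U" if U: "open U" for U
  proof (rule antisym)
    show "emeasure lborel (?\<eta> -` U) \<le> emeasure lborel U" by (rule vflow_open_vimage_volume[OF assms U])
    have eq: "?\<xi> -` (?\<eta> -` U) = U" using vflow_inverse_right[OF assms] by auto
    have "open (?\<eta> -` U)" using U continuous_vflow by (simp add: continuous_on_open_vimage)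
    from vflow_open_vimage_volume[OF \<alpha> signed_measure_pushforward[OF sm vflow_measurable] this]
    have "emeasure lborel (?\<xi> -` (?\<eta> -` U)) \<le> emeasure lborel (?\<eta> -` U)" .
    then show "emeasure lborel U \<le> emeasure lborel (?\<eta> -` U)" unfolding eq .
  qed
  have "emeasure (distr lborel lborel ?\<eta>) (box l u) = emeasure lborel (box l u)" for l u
    using eq[OF open_box[of l u]] by (simp add: emeasure_distr vflow_measurable)
  then show "distr lborel lborel ?\<eta> = lborel"
    by (intro lborel_eqI[symmetric]) (simp_all add: emeasure_lborel_box)
qed

section \<open>Test functions and the velocity field\<close>

lemma C_k_Suc_imp: "C_k (Suc k) f \<Longrightarrow> C_k k f"
proof (induction k arbitrary: f)
  case 0
  then show ?case
    by (auto intro!: continuous_at_imp_continuous_on differentiable_imp_continuous_within)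
next
  case (Suc k)
  from Suc.prems have d: "\<forall>x. f differentiable at x"
    and b: "\<forall>b\<in>Basis. C_k (Suc k) (\<lambda>x. frechet_derivative f (at x) b)"
    unfolding C_k.simps(2)[of "Suc k"] by auto
  from b have "\<forall>b\<in>Basis. C_k k (\<lambda>x. frechet_derivative f (at x) b)" using Suc.IH by blast
  with d show ?case unfolding C_k.simps(2)[of k] by blast
qed

context
  fixes \<phi> :: "'a::euclidean_space \<Rightarrow> real"
  assumes \<phi>: "\<phi> \<in> test_functions"
begin

lemma test_function_has_derivative: "(\<phi> has_derivative frechet_derivative \<phi> (at x)) (at x)"
proof -
  have "C_k (Suc 0) \<phi>" using \<phi> unfolding test_functions_def by blast
  then show ?thesis by (simp add: frechet_derivative_works)
qed

lemma test_function_continuous: "continuous_on UNIV \<phi>"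
  by (intro continuous_at_imp_continuous_on ballI has_derivative_continuous[OF test_function_has_derivative])

lemma test_function_deriv_sum: "frechet_derivative \<phi> (at x) h = (\<Sum>b\<in>Basis. (h \<bullet> b) * frechet_derivative \<phi> (at x) b)"
proof -
  have lin: "linear (frechet_derivative \<phi> (at x))"
    using test_function_has_derivative has_derivative_linear by blast
  have "frechet_derivative \<phi> (at x) h = frechet_derivative \<phi> (at x) (\<Sum>b\<in>Basis. (h \<bullet> b) *\<^sub>R b)"
    by (simp add: euclidean_representation)
  also have "\<dots> = (\<Sum>b\<in>Basis. (h \<bullet> b) * frechet_derivative \<phi> (at x) b)"
    by (simp add: linear_sum[OF lin] linear_scale[OF lin])
  finally show ?thesis .
qed

lemma test_function_deriv_continuous:
  fixes X :: "'p::topological_space \<Rightarrow> 'a"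
  assumes "continuous_on S X" "continuous_on S H"
  shows "continuous_on S (\<lambda>p. frechet_derivative \<phi> (at (X p)) (H p))"
proof -
  have "C_k (Suc 0) \<phi>" using \<phi> unfolding test_functions_def by blast
  then have "continuous_on UNIV (\<lambda>x. frechet_derivative \<phi> (at x) b)" if "b \<in> Basis" for b using that by simp
  then have "continuous_on S (\<lambda>p. frechet_derivative \<phi> (at (X p)) b)" if "b \<in> Basis" for b
    using that by (intro continuous_on_compose2[OF _ assms(1)]) auto
  then show ?thesis
    unfolding test_function_deriv_sum[of _ "H _"] by (intro continuous_intros assms(2)) auto
qed

lemma test_function_support:
  obtains R where "R > 0" "\<And>x. norm x > R \<Longrightarrow> \<phi> x = 0" "\<And>x h. norm x > R \<Longrightarrow> frechet_derivative \<phi> (at x) h = 0"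
proof -
  have "compact (closure {x. \<phi> x \<noteq> 0})" using \<phi> unfolding test_functions_def by blast
  then obtain R where R: "\<And>x. x \<in> closure {x. \<phi> x \<noteq> 0} \<Longrightarrow> norm x \<le> R"
    using compact_imp_bounded bounded_iff by metis
  have z: "\<phi> x = 0" if "norm x > max 1 R" for x
    using R[of x] closure_subset[of "{x. \<phi> x \<noteq> 0}"] that by fastforce
  have "frechet_derivative \<phi> (at x) h = 0" if "norm x > max 1 R" for x h
  proof -
    have "(\<phi> has_derivative (\<lambda>h. 0)) (at x)"
    proof (rule has_derivative_transform_within_open[of "\<lambda>_. 0"])
      show "open {x::'a. norm x > max 1 R}" by (intro open_Collect_less continuous_intros)
    qed (use that z in auto)
    then show ?thesis using frechet_derivative_at by metis
  qed
  with z show ?thesis using that[of "max 1 R"] by auto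
qed

lemma test_function_bounds:
  obtains B where "B \<ge> 0" "\<And>x. \<bar>\<phi> x\<bar> \<le> B" "\<And>x h. \<bar>frechet_derivative \<phi> (at x) h\<bar> \<le> B * norm h"
    "\<And>x y. \<bar>\<phi> x - \<phi> y\<bar> \<le> B * norm (x - y)"
proof -
  obtain R where R: "R > 0" "\<And>x. norm x > R \<Longrightarrow> \<phi> x = 0"
    "\<And>x h. norm x > R \<Longrightarrow> frechet_derivative \<phi> (at x) h = 0" using test_function_support by blast
  have ex: "\<exists>C. \<forall>x. \<bar>g x\<bar> \<le> C" if "continuous_on UNIV g" "\<And>x. norm x > R \<Longrightarrow> g x = 0" for g :: "'a \<Rightarrow> real"
  proof -
    have "compact (g ` cball 0 R)"
      using that(1) by (intro compact_continuous_image) (auto intro: continuous_on_subset)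
    then obtain C where C: "\<And>x. norm x \<le> R \<Longrightarrow> \<bar>g x\<bar> \<le> C"
      by (metis bounded_iff compact_imp_bounded image_eqI mem_cball_0 real_norm_def)
    have "\<bar>g x\<bar> \<le> max C 0" for x using C[of x] that(2)[of x] by (cases "norm x \<le> R") (auto simp: le_max_iff_disj)
    then show ?thesis by blast
  qed
  obtain C where C: "\<And>x. \<bar>\<phi> x\<bar> \<le> C" using ex[OF test_function_continuous R(2)] by blast
  have "\<exists>C. \<forall>x. \<bar>frechet_derivative \<phi> (at x) b\<bar> \<le> C" for b
    by (rule ex) (auto intro!: test_function_deriv_continuous continuous_intros R(3))
  then obtain D where D: "\<And>b x. \<bar>frechet_derivative \<phi> (at x) b\<bar> \<le> D b" by metis
  define B where "B = max C (\<Sum>b\<in>Basis. D b)"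
  have B0: "B \<ge> 0" using order_trans[OF abs_ge_zero C[of 0]] by (simp add: B_def le_max_iff_disj)
  have d: "\<bar>frechet_derivative \<phi> (at x) h\<bar> \<le> B * norm h" for x h
  proof -
    have "\<bar>frechet_derivative \<phi> (at x) h\<bar> \<le> (\<Sum>b\<in>Basis. \<bar>(h \<bullet> b) * frechet_derivative \<phi> (at x) b\<bar>)"
      unfolding test_function_deriv_sum[of x h] by (rule sum_abs)
    also have "\<dots> \<le> (\<Sum>b\<in>Basis. norm h * D b)"
      using D Basis_le_norm by (intro sum_mono) (auto simp: abs_mult intro!: mult_mono)
    also have "\<dots> = (\<Sum>b\<in>Basis. D b) * norm h" by (simp add: sum_distrib_left sum_distrib_right mult.commute)
    also have "\<dots> \<le> B * norm h" by (intro mult_right_mono) (auto simp: B_def)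
    finally show ?thesis .
  qed
  show ?thesis
  proof (rule that[OF B0 _ d])
    show "\<bar>\<phi> x\<bar> \<le> B" for x using C[of x] by (simp add: B_def le_max_iff_disj)
    have "norm (\<phi> x - \<phi> y) \<le> B * norm (x - y)" for x y
    proof (rule differentiable_bound[of UNIV])
      show "(\<phi> has_derivative frechet_derivative \<phi> (at x)) (at x within UNIV)" for x
        using test_function_has_derivative by simp
      show "onorm (frechet_derivative \<phi> (at x)) \<le> B" for x
        using d B0 by (intro onorm_le) auto
    qed auto
    then show "\<bar>\<phi> x - \<phi> y\<bar> \<le> B * norm (x - y)" for x y by simp
  qed
qed

end

lemma inner_grad:
  fixes f :: "plane \<Rightarrow> real"
  assumes "(f has_derivative f') (at x)"
  shows "v \<bullet> grad f x = f' v"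
proof -
  have lin: "linear f'" using assms by (rule has_derivative_linear)
  have p: "partial i f x = f' (axis i 1)" for i
    unfolding partial_def frechet_derivative_at[OF assms, symmetric] ..
  have "v = (v $ 1) *\<^sub>R axis 1 1 + (v $ 2) *\<^sub>R axis 2 1"
    by (simp add: vec_eq_iff forall_2 axis_def)
  then have "f' v = (v $ 1) * f' (axis 1 1) + (v $ 2) * f' (axis 2 1)"
    by (metis linear_add[OF lin] linear_scale[OF lin] real_scaleR_def)
  then show ?thesis by (simp add: grad_def inner_vec_def sum_2 p)
qed

lemma integrable_compact_support:
  fixes f :: "'a::euclidean_space \<Rightarrow> 'b::{banach,second_countable_topology}"
  assumes f: "f \<in> borel_measurable borel" and B: "\<And>x. norm (f x) \<le> B" and R: "\<And>x. norm x > R \<Longrightarrow> f x = 0"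
  shows "integrable lborel f"
proof (rule Bochner_Integration.integrable_bound)
  have "emeasure lborel (cball (0::'a) R) < \<infinity>" by (rule emeasure_bounded_finite[OF bounded_cball])
  then show "integrable lborel (\<lambda>x. indicator (cball (0::'a) R) x * B)" by simp
  have "0 \<le> B" using B[of 0] norm_ge_zero order_trans by blast
  then show "AE x in lborel. norm (f x) \<le> norm (indicator (cball (0::'a) R) x * B)"
    using B R by (intro AE_I2) (auto simp: indicator_def not_le)
qed (use f in simp)

text \<open>Translation invariance of Lebesgue measure, differentiated.\<close>

lemma integral_directional_derivative_eq_0:
  fixes f :: "'a::euclidean_space \<Rightarrow> real"
  assumes der: "\<And>x. (f has_derivative f' x) (at x)"
    and lip: "\<And>x y. \<bar>f x - f y\<bar> \<le> B * norm (x - y)" and K: "\<And>x. \<bar>f x\<bar> \<le> K" and R: "\<And>x. norm x > R \<Longrightarrow> f x = 0"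
  shows "integrable lborel (\<lambda>x. f' x v)" and "(LINT x|lborel. f' x v) = 0"
proof -
  have cont: "continuous_on UNIV f"
    using der by (intro continuous_at_imp_continuous_on) (auto intro: has_derivative_continuous)
  let ?I = "\<lambda>s::real. LINT x|lborel. f (x + s *\<^sub>R v)"
  have const: "?I s = (LINT x|lborel. f x)" for s
  proof -
    have "(LINT x|lborel. f x) = (LINT x|distr lborel borel ((+) (s *\<^sub>R v)). f x)" by (simp add: lborel_distr_plus)
    also have "\<dots> = (LINT x|lborel. f (s *\<^sub>R v + x))"
      using cont by (intro integral_distr) (auto intro: borel_measurable_continuous_onI)
    finally show ?thesis by (simp add: add.commute)
  qed
  let ?b = "\<lambda>x::'a. indicator (cball 0 (R + norm v)) x * (B * norm v)"
  have der': "((\<lambda>s. f (x + s *\<^sub>R v)) has_derivative (\<lambda>s. f' x (s *\<^sub>R v))) (at 0)" for x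
  proof -
    have 1: "((\<lambda>s::real. x + s *\<^sub>R v) has_derivative (\<lambda>s. s *\<^sub>R v)) (at 0)"
      by (auto intro!: derivative_eq_intros)
    have "(f has_derivative f' x) (at (x + 0 *\<^sub>R v))" using der by simp
    from diff_chain_at[OF 1 this] show ?thesis by (simp add: o_def)
  qed
  have int: "integrable lborel (\<lambda>x. f (x + s *\<^sub>R v))" for s
  proof (rule integrable_compact_support[where R = "R + norm (s *\<^sub>R v)"])
    show "(\<lambda>x. f (x + s *\<^sub>R v)) \<in> borel_measurable borel"
      by (intro borel_measurable_continuous_onI continuous_on_compose2[OF cont] continuous_intros) auto
    show "norm (f (x + s *\<^sub>R v)) \<le> K" for x using K by simp
    show "f (x + s *\<^sub>R v) = 0" if "norm x > R + norm (s *\<^sub>R v)" for x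
      using that norm_diff_ineq[of x "s *\<^sub>R v"] by (intro R) linarith
  qed
  have "emeasure lborel (cball (0::'a) (R + norm v)) < \<infinity>" by (rule emeasure_bounded_finite[OF bounded_cball])
  then have b: "integrable lborel ?b" by simp
  have dom: "norm (f (x + s *\<^sub>R v) - f (x + 0 *\<^sub>R v)) \<le> ?b x * norm (s - 0)" if s: "s \<in> ball 0 1" for s x
  proof (cases "norm x \<le> R + norm v")
    case True
    then show ?thesis using lip[of "x + s *\<^sub>R v" x] by (simp add: mult_ac)
  next
    case False
    have "norm (s *\<^sub>R v) \<le> norm v" using s mult_right_mono[of "\<bar>s\<bar>" 1 "norm v"] by simp
    then have "norm (x + s *\<^sub>R v) > R" using False norm_diff_ineq[of x "s *\<^sub>R v"] by linarith
    moreover have "norm x > R" using False norm_ge_zero[of v] by linarith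
    ultimately show ?thesis using R by (simp add: False)
  qed
  note D = has_derivative_integral[where r = 1 and B = ?b, OF zero_less_one der' int dom b]
  show "integrable lborel (\<lambda>x. f' x v)" using D(2)[of 1] by simp
  have "(?I has_derivative (\<lambda>s. 0)) (at 0)" unfolding const by (rule has_derivative_const)
  from has_derivative_unique[OF D(1) this] have "(\<lambda>s. LINT x|lborel. f' x (s *\<^sub>R v)) = (\<lambda>s. 0)" .
  from fun_cong[OF this, of 1] show "(LINT x|lborel. f' x v) = 0" by simp
qed

text \<open>Integration by parts: the derivatives of the products of velocity components with \<phi>
  have integral 0, and the terms that contain derivatives of the velocity add up to its divergence
  times \<phi>.\<close>

lemma cut_vel_divergence_free:
  assumes \<alpha>: "\<alpha> > 0" and sm: "is_signed_measure q" and e: "0 < e" "e \<le> 1" and \<phi>: "\<phi> \<in> test_functions"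
  shows "(LINT x|lborel. cut_vel \<alpha> q e x \<bullet> grad \<phi> x) = 0"
proof -
  let ?v = "cut_vel \<alpha> q e" and ?v' = "cut_vel_deriv \<alpha> q e" and ?\<phi>' = "\<lambda>x. frechet_derivative \<phi> (at x)"
  note v = cut_vel[OF \<alpha> sm e] and vb = cut_vel_le[OF \<alpha> sm e] and d\<phi> = test_function_has_derivative[OF \<phi>]
  obtain R where R: "R > 0" "\<And>x. norm x > R \<Longrightarrow> \<phi> x = 0" "\<And>x h. norm x > R \<Longrightarrow> ?\<phi>' x h = 0"
    using test_function_support[OF \<phi>] by blast
  obtain B where B: "B \<ge> 0" "\<And>x. \<bar>\<phi> x\<bar> \<le> B" "\<And>x h. \<bar>?\<phi>' x h\<bar> \<le> B * norm h" "\<And>x y. \<bar>\<phi> x - \<phi> y\<bar> \<le> B * norm (x - y)"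
    using test_function_bounds[OF \<phi>] by blast
  let ?M = "tv q * kern_bound \<alpha>" and ?L = "tv q * cut_lip \<alpha> e"
  let ?f = "\<lambda>i x. ?v x $ i * \<phi> x" and ?f' = "\<lambda>i x h. ?v x $ i * ?\<phi>' x h + ?v' x h $ i * \<phi> x"
  have der: "(?f i has_derivative ?f' i x) (at x)" for i x
    by (intro has_derivative_mult d\<phi> bounded_linear.has_derivative[OF bounded_linear_vec_nth v(1)])
  have lip: "\<bar>?f i x - ?f i y\<bar> \<le> (?L * B + ?M * B) * norm (x - y)" for i x y
  proof -
    have "?f i x - ?f i y = (?v x - ?v y) $ i * \<phi> x + ?v y $ i * (\<phi> x - \<phi> y)" by (simp add: algebra_simps)
    then have "\<bar>?f i x - ?f i y\<bar> \<le> \<bar>(?v x - ?v y) $ i\<bar> * \<bar>\<phi> x\<bar> + \<bar>?v y $ i\<bar> * \<bar>\<phi> x - \<phi> y\<bar>"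
      by (metis abs_mult abs_triangle_ineq)
    also have "\<dots> \<le> (?L * norm (x - y)) * B + ?M * (B * norm (x - y))"
      using component_le_norm_cart[of "?v x - ?v y" i] component_le_norm_cart[of "?v y" i] v(4)[of x y] vb[of y] B
      by (intro add_mono mult_mono) (auto intro: order_trans)
    finally show ?thesis by (simp add: algebra_simps)
  qed
  have K: "\<bar>?f i x\<bar> \<le> ?M * B" for i x
    using component_le_norm_cart[of "?v x" i] vb[of x] B by (auto simp: abs_mult intro!: mult_mono intro: order_trans)
  have zero: "(LINT x|lborel. ?f' i x (axis i 1)) = 0" "integrable lborel (\<lambda>x. ?f' i x (axis i 1))" for i
    using integral_directional_derivative_eq_0[OF der lip K, of R] R by simp_all
  have "?v x \<bullet> grad \<phi> x = ?f' 1 x (axis 1 1) + ?f' 2 x (axis 2 1)" for x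
  proof -
    have "?v x \<bullet> grad \<phi> x = ?v x $ 1 * ?\<phi>' x (axis 1 1) + ?v x $ 2 * ?\<phi>' x (axis 2 1)"
      by (simp add: grad_def partial_def inner_vec_def sum_2)
    moreover have "?v' x (axis 1 1) $ 1 * \<phi> x + ?v' x (axis 2 1) $ 2 * \<phi> x = 0"
      using v(3)[of x] by (simp only: distrib_right[symmetric] mult_zero_left)
    ultimately show ?thesis by simp
  qed
  then show ?thesis using zero by simp
qed

section \<open>The velocity field of a vorticity\<close>

lemma K_conv_eq: "\<alpha> > 0 \<Longrightarrow> K_conv \<alpha> q x = sint q (\<lambda>y. kern \<alpha> (x - y))"
  by (simp add: K_conv_def K_alpha_eq_kern)

context
  fixes \<alpha> :: real and q :: "plane set \<Rightarrow> real"
  assumes \<alpha>: "\<alpha> > 0" and sm: "is_signed_measure q"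
begin

lemma kern_integrand_bounded_borel: "bounded_borel (\<lambda>y. kern \<alpha> (x - y))"
  by (intro bounded_borel_continuous[OF _ kern_le[OF \<alpha>]] continuous_on_compose2[OF continuous_kern[OF \<alpha>]] continuous_intros) auto

lemma K_conv_le: "norm (K_conv \<alpha> q x) \<le> tv q * kern_bound \<alpha>"
  unfolding K_conv_eq[OF \<alpha>] by (intro sint_norm_le[OF sm] kern_integrand_bounded_borel kern_le \<alpha>)

lemma K_conv_modulus:
  assumes e: "0 < e" "e \<le> 1"
  shows "norm (K_conv \<alpha> q x - K_conv \<alpha> q y) \<le> tv q * kern_const \<alpha> * (log_mod e * norm (x - y) + e)"
proof -
  have "norm (sint q (\<lambda>z. kern \<alpha> (x - z) - kern \<alpha> (y - z))) \<le> tv q * (kern_const \<alpha> * (log_mod e * norm (x - y) + e))"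
  proof (intro sint_norm_le[OF sm] bounded_borel_diff kern_integrand_bounded_borel)
    show "norm (kern \<alpha> (x - z) - kern \<alpha> (y - z)) \<le> kern_const \<alpha> * (log_mod e * norm (x - y) + e)" for z
      using kern_modulus[OF \<alpha> e, of "x - z" "y - z"] by simp
  qed
  then show ?thesis
    unfolding K_conv_eq[OF \<alpha>]
    by (simp add: sint_diff[OF sm kern_integrand_bounded_borel kern_integrand_bounded_borel] mult.assoc)
qed

lemma K_conv_continuous: "continuous_on UNIV (K_conv \<alpha> q)"
  unfolding K_conv_eq[OF \<alpha>, abs_def]
proof (rule continuous_on_sint[OF sm _ kern_le[OF \<alpha>]])
  show "(\<lambda>y. kern \<alpha> (p - y)) \<in> borel_measurable borel" for p
    using kern_integrand_bounded_borel by (simp add: bounded_borel_def)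
  show "continuous_on UNIV (\<lambda>p. kern \<alpha> (p - x))" for x
    by (intro continuous_on_compose2[OF continuous_kern[OF \<alpha>]] continuous_intros) auto
qed

lemma cut_vel_approx: "0 < e \<Longrightarrow> e \<le> 1 \<Longrightarrow> norm (cut_vel \<alpha> q e x - K_conv \<alpha> q x) \<le> tv q * (kern_const \<alpha> * e)"
  unfolding K_conv_eq[OF \<alpha>] cut_vel_def[OF \<alpha> sm]
  by (subst sint_diff[OF sm, symmetric])
    (auto intro!: sint_norm_le[OF sm] bounded_borel_diff kern_approx \<alpha> kern_integrand_bounded_borel cut_integrand_bounded_borel[OF \<alpha> sm])

lemma grad_measurable:
  assumes \<phi>: "\<phi> \<in> test_functions"
  shows "grad \<phi> \<in> borel_measurable borel"
proof (rule borel_measurable_continuous_onI)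
  have "continuous_on UNIV (\<lambda>x. grad \<phi> x $ i)" for i
  proof -
    have "grad \<phi> x $ i = partial i \<phi> x" for x using exhaust_2[of i] by (auto simp: grad_def)
    then show ?thesis
      unfolding partial_def by (simp add: test_function_deriv_continuous[OF \<phi>] continuous_on_id continuous_on_const)
  qed
  from continuous_on_vec_lambda[of UNIV "\<lambda>i x. grad \<phi> x $ i", OF this] show "continuous_on UNIV (grad \<phi>)" by simp
qed

text \<open>The cut velocities are differentiable and divergence-free, and they are uniformly within
  O(e) of the velocity, so the weak condition survives the limit.\<close>

lemma K_conv_C0_div: "K_conv \<alpha> q \<in> C0_div"
  unfolding C0_div_def
proof (intro CollectI conjI ballI K_conv_continuous)
  fix \<phi> :: "plane \<Rightarrow> real" assume \<phi>: "\<phi> \<in> test_functions"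
  obtain R where R: "R > 0" "\<And>x. norm x > R \<Longrightarrow> \<phi> x = 0" "\<And>x h. norm x > R \<Longrightarrow> frechet_derivative \<phi> (at x) h = 0"
    using test_function_support[OF \<phi>] by blast
  obtain B where B: "B \<ge> 0" "\<And>x. \<bar>\<phi> x\<bar> \<le> B" "\<And>x h. \<bar>frechet_derivative \<phi> (at x) h\<bar> \<le> B * norm h"
    "\<And>x y. \<bar>\<phi> x - \<phi> y\<bar> \<le> B * norm (x - y)"
    using test_function_bounds[OF \<phi>] by blast
  have g: "v \<bullet> grad \<phi> x = frechet_derivative \<phi> (at x) v" for v x
    by (rule inner_grad[OF test_function_has_derivative[OF \<phi>]])
  have int: "integrable lborel (\<lambda>x. w x \<bullet> grad \<phi> x)" if "continuous_on UNIV w" "\<And>x. norm (w x) \<le> M" for w and M :: real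
  proof (rule integrable_compact_support[of _ "B * M" R])
    show "norm (w x \<bullet> grad \<phi> x) \<le> B * M" for x
      using B(3)[of x "w x"] mult_left_mono[OF that(2)[of x] B(1)] by (simp add: g)
    show "w x \<bullet> grad \<phi> x = 0" if "norm x > R" for x using R(3)[OF that] by (simp add: g)
    show "(\<lambda>x. w x \<bullet> grad \<phi> x) \<in> borel_measurable borel"
      by (intro borel_measurable_inner borel_measurable_continuous_onI[OF that(1)] grad_measurable[OF \<phi>])
  qed
  have fin: "emeasure lborel (cball (0::plane) R) < \<infinity>" by (rule emeasure_bounded_finite[OF bounded_cball])
  let ?V = "measure lborel (cball (0::plane) R)"
  have le: "\<bar>LINT x|lborel. K_conv \<alpha> q x \<bullet> grad \<phi> x\<bar> \<le> ?V * (B * (tv q * kern_const \<alpha>)) * e" if e: "0 < e" "e \<le> 1" for e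
  proof -
    have vc: "continuous_on UNIV (cut_vel \<alpha> q e)"
      using cut_vel(1)[OF \<alpha> sm e] by (intro continuous_at_imp_continuous_on) (auto intro: has_derivative_continuous)
    note i = int[OF K_conv_continuous K_conv_le] int[OF vc cut_vel_le[OF \<alpha> sm e]]
    have "(LINT x|lborel. K_conv \<alpha> q x \<bullet> grad \<phi> x) = (LINT x|lborel. K_conv \<alpha> q x \<bullet> grad \<phi> x) - (LINT x|lborel. cut_vel \<alpha> q e x \<bullet> grad \<phi> x)"
      by (simp add: cut_vel_divergence_free[OF \<alpha> sm e \<phi>])
    also have "\<dots> = (LINT x|lborel. (K_conv \<alpha> q x - cut_vel \<alpha> q e x) \<bullet> grad \<phi> x)"
      using i by (simp add: inner_diff_left)
    finally have "\<bar>LINT x|lborel. K_conv \<alpha> q x \<bullet> grad \<phi> x\<bar> \<le> (LINT x|lborel. \<bar>(K_conv \<alpha> q x - cut_vel \<alpha> q e x) \<bullet> grad \<phi> x\<bar>)"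
      using integral_norm_bound[of lborel "\<lambda>x. (K_conv \<alpha> q x - cut_vel \<alpha> q e x) \<bullet> grad \<phi> x"] by simp
    also have "\<dots> \<le> (LINT x|lborel. indicator (cball (0::plane) R) x * (B * (tv q * (kern_const \<alpha> * e))))"
    proof (rule integral_mono)
      show "integrable lborel (\<lambda>x. \<bar>(K_conv \<alpha> q x - cut_vel \<alpha> q e x) \<bullet> grad \<phi> x\<bar>)"
        using i by (simp add: inner_diff_left)
      show "integrable lborel (\<lambda>x. indicator (cball (0::plane) R) x * (B * (tv q * (kern_const \<alpha> * e))))" using fin by simp
      fix x
      show "\<bar>(K_conv \<alpha> q x - cut_vel \<alpha> q e x) \<bullet> grad \<phi> x\<bar> \<le> indicator (cball (0::plane) R) x * (B * (tv q * (kern_const \<alpha> * e)))"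
      proof (cases "norm x \<le> R")
        case True
        have "\<bar>(K_conv \<alpha> q x - cut_vel \<alpha> q e x) \<bullet> grad \<phi> x\<bar> \<le> B * norm (K_conv \<alpha> q x - cut_vel \<alpha> q e x)"
          unfolding g by (rule B(3))
        also have "\<dots> \<le> B * (tv q * (kern_const \<alpha> * e))"
          using cut_vel_approx[OF e, of x] B(1) by (intro mult_left_mono) (simp_all add: norm_minus_commute)
        finally show ?thesis using True by simp
      next
        case False
        then have "(K_conv \<alpha> q x - cut_vel \<alpha> q e x) \<bullet> grad \<phi> x = 0" unfolding g by (intro R(3)) simp
        then show ?thesis using False by simp
      qed
    qed
    also have "\<dots> = ?V * (B * (tv q * kern_const \<alpha>)) * e" by simp
    finally show ?thesis .
  qed
  have "\<bar>LINT x|lborel. K_conv \<alpha> q x \<bullet> grad \<phi> x\<bar> \<le> 0"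
  proof (rule LIMSEQ_le_const)
    show "(\<lambda>n. ?V * (B * (tv q * kern_const \<alpha>)) * (1/2) ^ n) \<longlonglongrightarrow> 0"
      using tendsto_mult_right_zero[OF half_power_tendsto] .
  qed (use le half_power_bounds in blast)
  then show "(LINT x|lborel. K_conv \<alpha> q x \<bullet> grad \<phi> x) = 0" by simp
qed

end

section \<open>Existence\<close>

lemma has_vector_derivative_iff_quotient:
  fixes f :: "real \<Rightarrow> 'a::real_normed_vector"
  shows "(f has_vector_derivative v) (at t) \<longleftrightarrow> ((\<lambda>h. (f (t + h) - f t) /\<^sub>R h) \<longlongrightarrow> v) (at 0)"
proof -
  have eq: "norm (f (t + h) - f t - h *\<^sub>R v) / norm h = norm ((f (t + h) - f t) /\<^sub>R h - v)" if "h \<noteq> 0" for h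
  proof -
    have "(f (t + h) - f t) /\<^sub>R h - v = (f (t + h) - f t - h *\<^sub>R v) /\<^sub>R h" using that by (simp add: scaleR_diff_right)
    then show ?thesis by (simp add: divide_inverse mult.commute)
  qed
  have "(f has_vector_derivative v) (at t) \<longleftrightarrow> ((\<lambda>h. norm (f (t + h) - f t - h *\<^sub>R v) / norm h) \<longlongrightarrow> 0) (at 0)"
    by (simp add: has_vector_derivative_def has_derivative_at bounded_linear_scaleR_left)
  also have "\<dots> \<longleftrightarrow> ((\<lambda>h. norm ((f (t + h) - f t) /\<^sub>R h - v)) \<longlongrightarrow> 0) (at 0)"
    by (intro tendsto_cong) (simp add: eventually_at_filter eq[unfolded real_norm_def])
  also have "\<dots> \<longleftrightarrow> ((\<lambda>h. (f (t + h) - f t) /\<^sub>R h) \<longlongrightarrow> v) (at 0)"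
    by (simp only: tendsto_norm_zero_iff LIM_zero_iff)
  finally show ?thesis .
qed

lemma uniform_limit_bcontfun_apply:
  fixes X :: "'p \<Rightarrow> ('a::topological_space \<Rightarrow>\<^sub>C 'b::metric_space)"
  assumes "(X \<longlongrightarrow> L) net"
  shows "uniform_limit UNIV (\<lambda>p. apply_bcontfun (X p)) (apply_bcontfun L) net"
  unfolding uniform_limit_iff
proof (intro allI impI)
  fix e :: real assume "e > 0"
  from tendstoD[OF assms this] show "\<forall>\<^sub>F p in net. \<forall>x\<in>UNIV. dist (apply_bcontfun (X p) x) (apply_bcontfun L x) < e"
    by (rule eventually_mono) (metis dist_bounded le_less_trans)
qed

text \<open>\<open>Ad_star \<eta>\<close> pushes forward by the inverse of \<eta> and so undoes
  \<open>pushforward \<eta>\<close>. The description operator is resolved because functions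
  vanishing at infinity determine the measure.\<close>

lemma Ad_star_pushforward:
  assumes sm: "is_signed_measure q" and hom: "homeomorphism UNIV UNIV \<eta> \<xi>"
  shows "Ad_star \<eta> (pushforward \<eta> q) = q"
proof -
  have c: "continuous_on UNIV \<eta>" "continuous_on UNIV \<xi>" and inv1: "\<And>x. \<xi> (\<eta> x) = x" "\<And>x. \<eta> (\<xi> x) = x"
    using hom by (auto simp: homeomorphism_def)
  have inv: "inv \<eta> = \<xi>" using inv1 by (metis inv_unique_comp comp_apply ext id_apply)
  have m: "\<eta> \<in> borel_measurable borel" "\<xi> \<in> borel_measurable borel"
    using c by (auto intro: borel_measurable_continuous_onI)
  have eq: "sint (pushforward \<eta> q) (\<phi> \<circ> inv \<eta>) = sint q \<phi>" if "\<phi> \<in> C0_vanishing" for \<phi>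
  proof -
    have "bounded_borel (\<lambda>x. \<phi> (\<xi> x))"
      by (rule bounded_borel_compose[OF C0_vanishing_bounded_borel[OF that] m(2)])
    from sint_pushforward[OF sm m(1) this] show ?thesis by (simp add: inv inv1 o_def)
  qed
  show ?thesis
    unfolding Ad_star_def
  proof (rule the_equality)
    show "q \<in> radon_measures \<and> (\<forall>\<phi>\<in>C0_vanishing. sint q \<phi> = sint (pushforward \<eta> q) (\<phi> \<circ> inv \<eta>))"
      using eq sm by (simp add: radon_iff_signed_measure)
    fix \<nu> assume \<nu>: "\<nu> \<in> radon_measures \<and> (\<forall>\<phi>\<in>C0_vanishing. sint \<nu> \<phi> = sint (pushforward \<eta> q) (\<phi> \<circ> inv \<eta>))"
    show "\<nu> = q"
    proof (rule signed_measure_eqI_C0[OF _ sm])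
      show "is_signed_measure \<nu>" using \<nu> by (simp add: radon_iff_signed_measure)
      fix f :: "plane \<Rightarrow> real" and R assume "continuous_on UNIV f" "\<And>x. norm x > R \<Longrightarrow> f x = 0"
      then have "f \<in> C0_vanishing" by (rule C0_vanishingI_compact_support)
      then show "sint \<nu> f = sint q f" using \<nu> eq by simp
    qed
  qed
qed

text \<open>Collects the two terms of the weak formulation into one space-time derivative in the
  direction (1, v), the form that the chain rule along a particle path produces.\<close>

lemma test_function_slices:
  fixes \<phi> :: "real \<times> plane \<Rightarrow> real"
  assumes \<phi>: "\<phi> \<in> test_functions"
  shows "deriv (\<lambda>s. \<phi> (s, x)) t + v \<bullet> grad (\<lambda>y. \<phi> (t, y)) x = frechet_derivative \<phi> (at (t, x)) (1, v)"
proof -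
  let ?D = "frechet_derivative \<phi> (at (t, x))"
  have d: "(\<phi> has_derivative ?D) (at (t, x))" by (rule test_function_has_derivative[OF \<phi>])
  have lin: "linear ?D" using d by (rule has_derivative_linear)
  have "((\<lambda>s. (s, x)) has_derivative (\<lambda>h. (h, 0))) (at t)" by (auto intro!: derivative_eq_intros)
  from diff_chain_at[OF this d] have "((\<lambda>s. \<phi> (s, x)) has_derivative (\<lambda>h. ?D (h, 0))) (at t)" by (simp add: o_def)
  moreover have "(\<lambda>h. ?D (h, 0)) = (*) (?D (1, 0))"
  proof
    show "?D (h, 0) = ?D (1, 0) * h" for h using linear_scale[OF lin, of h "(1, 0)"] by (simp add: mult.commute)
  qed
  ultimately have 1: "deriv (\<lambda>s. \<phi> (s, x)) t = ?D (1, 0)"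
    by (intro DERIV_imp_deriv) (simp only: has_field_derivative_def)
  have "((\<lambda>y. (t, y)) has_derivative (\<lambda>h. (0, h))) (at x)" by (auto intro!: derivative_eq_intros)
  from diff_chain_at[OF this d] have "((\<lambda>y. \<phi> (t, y)) has_derivative (\<lambda>h. ?D (0, h))) (at x)" by (simp add: o_def)
  from inner_grad[OF this] have 2: "v \<bullet> grad (\<lambda>y. \<phi> (t, y)) x = ?D (0, v)" .
  show ?thesis unfolding 1 2 using linear_add[OF lin, of "(1, 0)" "(0, v)"] by simp
qed

context
  fixes \<alpha> :: real and q :: "plane set \<Rightarrow> real"
  assumes \<alpha>: "\<alpha> > 0" and sm: "is_signed_measure q"
begin

lemma vflow_norm_diff_le: "norm (vflow \<alpha> q s x - vflow \<alpha> q t x) \<le> tv q * kern_bound \<alpha> * \<bar>s - t\<bar>"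
proof -
  have "norm (vdisp \<alpha> q s - vdisp \<alpha> q t) \<le> (tv q * kern_bound \<alpha>) * norm (s - t)"
  proof (rule differentiable_bound[of UNIV])
    show "(vdisp \<alpha> q has_derivative (\<lambda>h. h *\<^sub>R vfield (kern \<alpha>) q (vdisp \<alpha> q r))) (at r within UNIV)" for r
      using vdisp_has_derivative[OF \<alpha> sm, of r] by (simp add: has_vector_derivative_def)
    show "onorm (\<lambda>h. h *\<^sub>R vfield (kern \<alpha>) q (vdisp \<alpha> q r)) \<le> tv q * kern_bound \<alpha>" for r
      using log_lipschitz.bound[OF vfield_log_lipschitz[OF \<alpha> sm], of "vdisp \<alpha> q r"]
      by (intro onorm_le) (auto simp: mult.commute intro: mult_left_mono)
  qed auto
  moreover have "norm (vflow \<alpha> q s x - vflow \<alpha> q t x) \<le> norm (vdisp \<alpha> q s - vdisp \<alpha> q t)"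
    using norm_bounded[of "vdisp \<alpha> q s - vdisp \<alpha> q t" x] by (simp add: vflow_def)
  ultimately show ?thesis by simp
qed

abbreviation (input) "flow_q t \<equiv> pushforward (vflow \<alpha> q t) q"
abbreviation (input) "flow_u t \<equiv> K_conv \<alpha> (pushforward (vflow \<alpha> q t) q)"

lemma flow_q_signed: "is_signed_measure (flow_q t)"
  by (rule signed_measure_pushforward[OF sm vflow_measurable])

lemma flow_u_eq: "flow_u t x = sint q (\<lambda>y. kern \<alpha> (x - vflow \<alpha> q t y))"
  unfolding K_conv_eq[OF \<alpha>] by (rule sint_pushforward[OF sm vflow_measurable kern_integrand_bounded_borel[OF \<alpha> sm]])

lemma flow_u_vflow: "flow_u t (vflow \<alpha> q t x) = apply_bcontfun (vfield (kern \<alpha>) q (vdisp \<alpha> q t)) x"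
  unfolding flow_u_eq vfield_kern_apply[OF \<alpha> sm] vflow_def ..

lemma vflow_has_vector_derivative: "((\<lambda>s. vflow \<alpha> q s x) has_vector_derivative flow_u t (vflow \<alpha> q t x)) (at t)"
proof -
  have bl: "bounded_linear (\<lambda>f::plane \<Rightarrow>\<^sub>C plane. f x)"
    by (rule bounded_linear_intro[where K = 1]) (auto simp: norm_bounded)
  from bounded_linear.has_vector_derivative[OF this vdisp_has_derivative[OF \<alpha> sm]]
  have "((\<lambda>s. x + vdisp \<alpha> q s x) has_vector_derivative apply_bcontfun (vfield (kern \<alpha>) q (vdisp \<alpha> q t)) x) (at t)"
    by (auto intro!: derivative_eq_intros)
  then show ?thesis unfolding flow_u_vflow by (simp add: vflow_def)
qed

lemma vdisp_tendsto: "(vdisp \<alpha> q \<longlongrightarrow> vdisp \<alpha> q t) (at t)"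
  using has_vector_derivative_continuous[OF vdisp_has_derivative[OF \<alpha> sm]] by (simp add: continuous_at)

text \<open>Uniform differentiability is contained in the displacement equation, which holds in the
  supremum norm.\<close>

lemma vflow_C1_curve: "C1_curve_homeos (vflow \<alpha> q)"
  unfolding C1_curve_homeos_def
proof (intro conjI allI exI)
  show "vflow \<alpha> q t \<in> vol_homeos" for t by (rule vflow_vol_homeo[OF \<alpha> sm])
  let ?V = "\<lambda>t. vfield (kern \<alpha>) q (vdisp \<alpha> q t)"
  fix t
  have "((\<lambda>h. (vdisp \<alpha> q (t + h) - vdisp \<alpha> q t) /\<^sub>R h) \<longlongrightarrow> ?V t) (at 0)"
    using vdisp_has_derivative[OF \<alpha> sm, of t] by (simp only: has_vector_derivative_iff_quotient)
  from uniform_limit_bcontfun_apply[OF this]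
  show "uniform_limit UNIV (\<lambda>h x. (vflow \<alpha> q (t + h) x - vflow \<alpha> q t x) /\<^sub>R h) (apply_bcontfun (?V t)) (at 0)"
    by (simp add: vflow_def)
  show "uniform_limit UNIV (\<lambda>t. apply_bcontfun (?V t)) (apply_bcontfun (?V t)) (at t)"
    by (intro uniform_limit_bcontfun_apply log_lipschitz.F_tendsto[OF vfield_log_lipschitz[OF \<alpha> sm]] vdisp_tendsto)
qed

text \<open>All particles move at bounded speed, so the modulus of the kernel at scale
  \<open>e\<close> bounds the change of velocity uniformly in \<open>x\<close>; \<open>e\<close> is
  fixed first, the time distance afterwards.\<close>

lemma flow_u_C0_curve: "C0_curve_div (\<lambda>t. flow_u t)"
  unfolding C0_curve_div_def
proof (intro conjI allI)
  show "flow_u t \<in> C0_div" for t by (rule K_conv_C0_div[OF \<alpha> flow_q_signed])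
  fix t
  have K: "tv q * kern_const \<alpha> \<ge> 0" using tv_nonneg kern_const_nonneg[OF \<alpha>] by simp
  have le: "norm (flow_u s x - flow_u t x) \<le> tv q * kern_const \<alpha> * (log_mod e * (tv q * kern_bound \<alpha> * \<bar>s - t\<bar>) + e)"
    if e: "0 < e" "e \<le> 1" for s x e
  proof -
    have m: "bounded_borel (\<lambda>y. kern \<alpha> (x - vflow \<alpha> q s y))" for s
      by (rule bounded_borel_compose[OF kern_integrand_bounded_borel[OF \<alpha> sm] vflow_measurable])
    have "norm (sint q (\<lambda>y. kern \<alpha> (x - vflow \<alpha> q s y) - kern \<alpha> (x - vflow \<alpha> q t y)))
        \<le> tv q * (kern_const \<alpha> * (log_mod e * (tv q * kern_bound \<alpha> * \<bar>s - t\<bar>) + e))"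
    proof (intro sint_norm_le[OF sm] bounded_borel_diff m)
      fix y
      have "norm (kern \<alpha> (x - vflow \<alpha> q s y) - kern \<alpha> (x - vflow \<alpha> q t y))
          \<le> kern_const \<alpha> * (log_mod e * norm ((x - vflow \<alpha> q s y) - (x - vflow \<alpha> q t y)) + e)"
        by (rule kern_modulus[OF \<alpha> e])
      also have "\<dots> \<le> kern_const \<alpha> * (log_mod e * (tv q * kern_bound \<alpha> * \<bar>s - t\<bar>) + e)"
        using vflow_norm_diff_le[of t y s] log_mod_ge_1[OF e] kern_const_nonneg[OF \<alpha>]
        by (intro mult_left_mono add_right_mono) (auto simp: abs_minus_commute)
      finally show "norm (kern \<alpha> (x - vflow \<alpha> q s y) - kern \<alpha> (x - vflow \<alpha> q t y))
          \<le> kern_const \<alpha> * (log_mod e * (tv q * kern_bound \<alpha> * \<bar>s - t\<bar>) + e)" .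
    qed
    then show ?thesis by (simp add: flow_u_eq sint_diff[OF sm m m] mult.assoc)
  qed
  show "uniform_limit UNIV (\<lambda>t. flow_u t) (flow_u t) (at t)"
    unfolding uniform_limit_iff
  proof (intro allI impI)
    fix d :: real assume d: "d > 0"
    let ?K = "tv q * kern_const \<alpha>"
    define e where "e = min 1 (d / (2 * (?K + 1)))"
    have e: "0 < e" "e \<le> 1" using d K by (auto simp: e_def)
    have "(?K + 1) * e \<le> (?K + 1) * (d / (2 * (?K + 1)))"
      using K by (intro mult_left_mono) (auto simp: e_def)
    also have "\<dots> = d / 2"
    proof -
      have "L * (d / (2 * L)) = d / 2" if "L > 0" for L using that by simp
      from this[of "?K + 1"] show ?thesis using K by linarith
    qed
    finally have Ke: "?K * e < d" using e d by (simp add: distrib_right)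
    have "((\<lambda>s. ?K * (log_mod e * (tv q * kern_bound \<alpha> * \<bar>s - t\<bar>) + e)) \<longlongrightarrow> ?K * (log_mod e * (tv q * kern_bound \<alpha> * \<bar>t - t\<bar>) + e)) (at t)"
      by (intro tendsto_intros)
    then have "((\<lambda>s. ?K * (log_mod e * (tv q * kern_bound \<alpha> * \<bar>s - t\<bar>) + e)) \<longlongrightarrow> ?K * e) (at t)" by simp
    from order_tendstoD(2)[OF this Ke] show "\<forall>\<^sub>F s in at t. \<forall>x\<in>UNIV. dist (flow_u s x) (flow_u t x) < d"
    proof (rule eventually_mono, intro ballI)
      fix s x assume "?K * (log_mod e * (tv q * kern_bound \<alpha> * \<bar>s - t\<bar>) + e) < d"
      from le_less_trans[OF le[OF e, where s = s and x = x] this] show "dist (flow_u s x) (flow_u t x) < d" by (simp add: dist_norm)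
    qed
  qed
qed

lemma flow_q_weakly_continuous: "weakly_continuous_curve (\<lambda>t. flow_q t)"
  unfolding weakly_continuous_curve_def
proof (intro conjI allI ballI)
  show "flow_q t \<in> radon_measures" for t by (rule signed_measure_radon[OF flow_q_signed])
  fix \<phi> assume \<phi>: "\<phi> \<in> C0_vanishing"
  note b = C0_vanishing_bounded_borel[OF \<phi>]
  obtain B where B: "\<And>x. norm (\<phi> x) \<le> B" using b unfolding bounded_borel_def by blast
  have c: "continuous_on UNIV \<phi>" using \<phi> by (simp add: C0_vanishing_def)
  have "continuous_on UNIV (\<lambda>t. sint q (\<lambda>y. \<phi> (vflow \<alpha> q t y)))"
  proof (rule continuous_on_sint[OF sm _ B])
    show "(\<lambda>y. \<phi> (vflow \<alpha> q t y)) \<in> borel_measurable borel" for t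
      using bounded_borel_compose[OF b vflow_measurable] by (simp add: bounded_borel_def)
    have "continuous_on UNIV (\<lambda>t. vflow \<alpha> q t y)" for y
      by (intro continuous_at_imp_continuous_on ballI has_vector_derivative_continuous[OF vflow_has_vector_derivative])
    then show "continuous_on UNIV (\<lambda>t. \<phi> (vflow \<alpha> q t y))" for y
      by (intro continuous_on_compose2[OF c]) auto
  qed
  then show "continuous_on UNIV (\<lambda>t. sint (flow_q t) \<phi>)"
    by (simp add: sint_pushforward[OF sm vflow_measurable b])
qed

text \<open>Pulled back to the initial measure, the inner integral is the time derivative of the
  integral of \<phi> along the particle paths. That function of time is Lipschitz with compact
  support, so its derivative integrates to 0.\<close>

lemma vflow_weak_solution: "weak_solution \<alpha> q (vflow \<alpha> q) (\<lambda>t. flow_u t) (\<lambda>t. flow_q t)"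
  unfolding weak_solution_def
proof (intro conjI allI ballI)
  show "flow_q t \<in> radon_measures" for t by (rule signed_measure_radon[OF flow_q_signed])
  show "flow_q 0 = q" by (rule pushforward_comp_id[OF sm vflow_0[OF \<alpha> sm]])
  show "flow_map (\<lambda>t. flow_u t) (vflow \<alpha> q)"
    unfolding flow_map_def using vflow_0[OF \<alpha> sm] vflow_has_vector_derivative by blast
  fix \<phi> :: "real \<times> plane \<Rightarrow> real" assume \<phi>: "\<phi> \<in> test_functions"
  let ?D = "\<lambda>p. frechet_derivative \<phi> (at p)" and ?\<eta> = "vflow \<alpha> q"
  obtain R where R: "R > 0" "\<And>x. norm x > R \<Longrightarrow> \<phi> x = 0" "\<And>x h. norm x > R \<Longrightarrow> ?D x h = 0"
    using test_function_support[OF \<phi>] by blast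
  obtain B where B: "B \<ge> 0" "\<And>x. \<bar>\<phi> x\<bar> \<le> B" "\<And>x h. \<bar>?D x h\<bar> \<le> B * norm h" "\<And>x y. \<bar>\<phi> x - \<phi> y\<bar> \<le> B * norm (x - y)"
    using test_function_bounds[OF \<phi>] by blast
  have \<phi>c: "continuous_on UNIV \<phi>" by (rule test_function_continuous[OF \<phi>])
  let ?M = "tv q * kern_bound \<alpha>"
  have M0: "?M \<ge> 0" using log_lipschitz.M_nonneg[OF vfield_log_lipschitz[OF \<alpha> sm]] .
  have lip: "norm (\<phi> (s, ?\<eta> s y) - \<phi> (t, ?\<eta> t y)) \<le> (B * (1 + ?M)) * norm (s - t)" for s t y
  proof -
    have "\<bar>\<phi> (s, ?\<eta> s y) - \<phi> (t, ?\<eta> t y)\<bar> \<le> B * norm ((s, ?\<eta> s y) - (t, ?\<eta> t y))" by (rule B(4))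
    also have "\<dots> \<le> B * (\<bar>s - t\<bar> + ?M * \<bar>s - t\<bar>)"
      using norm_Pair_le[of "s - t" "?\<eta> s y - ?\<eta> t y"] vflow_norm_diff_le[of s y t] B(1) by (intro mult_left_mono) auto
    finally show ?thesis by (simp add: algebra_simps)
  qed
  have bb: "bounded_borel (\<lambda>y. \<phi> (s, ?\<eta> s y))" for s
    using B(2) by (intro bounded_borel_continuous[of _ B] continuous_on_compose2[OF \<phi>c] continuous_intros continuous_vflow) auto
  have der: "((\<lambda>s. \<phi> (s, ?\<eta> s y)) has_derivative (\<lambda>h. h * ?D (t, ?\<eta> t y) (1, flow_u t (?\<eta> t y)))) (at t)" for y t
  proof -
    have "((\<lambda>s. (s, ?\<eta> s y)) has_derivative (\<lambda>h. (h, h *\<^sub>R flow_u t (?\<eta> t y)))) (at t)"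
      using vflow_has_vector_derivative[of y t] unfolding has_vector_derivative_def
      by (intro has_derivative_Pair has_derivative_ident)
    from diff_chain_at[OF this test_function_has_derivative[OF \<phi>]]
    have "((\<lambda>s. \<phi> (s, ?\<eta> s y)) has_derivative (\<lambda>h. ?D (t, ?\<eta> t y) (h, h *\<^sub>R flow_u t (?\<eta> t y)))) (at t)"
      by (simp add: o_def)
    moreover have "?D p (h, h *\<^sub>R v) = h * ?D p (1, v)" for p h v
      using linear_scale[OF has_derivative_linear[OF test_function_has_derivative[OF \<phi>]], of p h "(1, v)"] by simp
    ultimately show ?thesis by simp
  qed
  note A = sint_has_derivative[OF sm zero_less_one der bb lip]
  let ?A' = "\<lambda>t h. sint q (\<lambda>y. h * ?D (t, ?\<eta> t y) (1, flow_u t (?\<eta> t y)))"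
  have zero: "(LINT t|lborel. ?A' t 1) = 0"
  proof (rule integral_directional_derivative_eq_0(2)[where f' = ?A' and v = 1])
    show "((\<lambda>s. sint q (\<lambda>y. \<phi> (s, ?\<eta> s y))) has_derivative ?A' t) (at t)" for t by (rule A(1))
    show "\<bar>sint q (\<lambda>y. \<phi> (s, ?\<eta> s y)) - sint q (\<lambda>y. \<phi> (t, ?\<eta> t y))\<bar> \<le> (tv q * (B * (1 + ?M))) * norm (s - t)" for s t
      using sint_norm_le[OF sm bounded_borel_diff[OF bb bb] lip, of s t] by (simp add: sint_diff[OF sm bb bb] mult.assoc)
    show "\<bar>sint q (\<lambda>y. \<phi> (s, ?\<eta> s y))\<bar> \<le> tv q * B" for s
      using sint_norm_le[OF sm bb, of s B] B(2) by simp
    fix s :: real assume s: "norm s > R"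
    have "\<phi> (s, ?\<eta> s y) = 0" for y
      using s norm_fst_le[of s "?\<eta> s y"] by (intro R(2)) simp
    then show "sint q (\<lambda>y. \<phi> (s, ?\<eta> s y)) = 0" by (simp add: sint_def)
  qed
  have "sint (flow_q t) (\<lambda>x. deriv (\<lambda>s. \<phi> (s, x)) t + flow_u t x \<bullet> grad (\<lambda>y. \<phi> (t, y)) x) = ?A' t 1" for t
  proof -
    have "bounded_borel (\<lambda>x. ?D (t, x) (1, flow_u t x))"
    proof (rule bounded_borel_continuous)
      show "continuous_on UNIV (\<lambda>x. ?D (t, x) (1, flow_u t x))"
        by (intro test_function_deriv_continuous[OF \<phi>] continuous_intros K_conv_continuous[OF \<alpha> flow_q_signed])
      show "norm (?D (t, x) (1, flow_u t x)) \<le> B * (1 + tv (flow_q t) * kern_bound \<alpha>)" for x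
      proof -
        have "\<bar>?D (t, x) (1, flow_u t x)\<bar> \<le> B * norm (1::real, flow_u t x)" by (rule B(3))
        also have "\<dots> \<le> B * (1 + tv (flow_q t) * kern_bound \<alpha>)"
          using norm_Pair_le[of "1::real" "flow_u t x"] K_conv_le[OF \<alpha> flow_q_signed, of t x] B(1)
          by (intro mult_left_mono) auto
        finally show ?thesis by simp
      qed
    qed
    from sint_pushforward[OF sm vflow_measurable[of \<alpha> q t] this] show ?thesis
      by (simp add: test_function_slices[OF \<phi>])
  qed
  then show "(LINT t|lborel. sint (flow_q t) (\<lambda>x. deriv (\<lambda>s. \<phi> (s, x)) t + flow_u t x \<bullet> grad (\<lambda>y. \<phi> (t, y)) x)) = 0"
    using zero by simp
qed simp

end

section \<open>Smooth bumps\<close>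

lemma frechet_derivative_eqI: "(f has_derivative f') (at x) \<Longrightarrow> frechet_derivative f (at x) = f'"
  by (rule frechet_derivative_at[symmetric])

lemma C_k_Suc_I:
  assumes "\<And>x. (f has_derivative f' x) (at x)" "\<And>b. b \<in> Basis \<Longrightarrow> C_k k (\<lambda>x. f' x b)"
  shows "C_k (Suc k) f"
  using assms by (auto simp: frechet_derivative_eqI[OF assms(1)] differentiable_def)

lemma C_k_Suc_D:
  assumes "C_k (Suc k) f"
  shows "(f has_derivative frechet_derivative f (at x)) (at x)" "b \<in> Basis \<Longrightarrow> C_k k (\<lambda>x. frechet_derivative f (at x) b)"
  using assms by (auto simp: frechet_derivative_works)

lemma C_k_const: "C_k k (\<lambda>x::'a::euclidean_space. c)" for c :: real
proof (induction k arbitrary: c)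
  case (Suc k)
  show ?case by (rule C_k_Suc_I[OF has_derivative_const]) (rule Suc.IH)
qed simp

lemma C_k_add:
  fixes f g :: "'a::euclidean_space \<Rightarrow> real"
  shows "C_k k f \<Longrightarrow> C_k k g \<Longrightarrow> C_k k (\<lambda>x. f x + g x)"
proof (induction k arbitrary: f g)
  case (Suc k)
  note f = C_k_Suc_D[OF Suc.prems(1)] and g = C_k_Suc_D[OF Suc.prems(2)]
  show ?case by (rule C_k_Suc_I[OF has_derivative_add[OF f(1) g(1)]]) (intro Suc.IH f(2) g(2))
qed (auto intro: continuous_on_add)

lemma C_k_mult:
  fixes f g :: "'a::euclidean_space \<Rightarrow> real"
  shows "C_k k f \<Longrightarrow> C_k k g \<Longrightarrow> C_k k (\<lambda>x. f x * g x)"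
proof (induction k arbitrary: f g)
  case (Suc k)
  note f = C_k_Suc_D[OF Suc.prems(1)] and g = C_k_Suc_D[OF Suc.prems(2)]
  show ?case
    by (rule C_k_Suc_I[OF has_derivative_mult[OF f(1) g(1)]])
      (intro C_k_add Suc.IH f(2) g(2) C_k_Suc_imp[OF Suc.prems(1)] C_k_Suc_imp[OF Suc.prems(2)])
qed (auto intro: continuous_on_mult)

text \<open>Together with products and sums, functions of a single affine coordinate supply the
  smooth functions used below.\<close>

lemma C_k_ridge:
  fixes f :: "real \<Rightarrow> real" and c :: "'a::euclidean_space"
  shows "C_k k f \<Longrightarrow> C_k k (\<lambda>x. f (a + c \<bullet> x))"
proof (induction k arbitrary: f)
  case 0
  then show ?case by (auto intro!: continuous_on_compose2[of UNIV f] continuous_intros)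
next
  case (Suc k)
  note f = C_k_Suc_D[OF Suc.prems]
  have der: "((\<lambda>x. f (a + c \<bullet> x)) has_derivative (\<lambda>h. frechet_derivative f (at (a + c \<bullet> x)) 1 * (c \<bullet> h))) (at x)" for x
  proof -
    have "((\<lambda>x. a + c \<bullet> x) has_derivative (\<lambda>h. c \<bullet> h)) (at x)" by (auto intro!: derivative_eq_intros)
    from diff_chain_at[OF this f(1)]
    have "((\<lambda>x. f (a + c \<bullet> x)) has_derivative (\<lambda>h. frechet_derivative f (at (a + c \<bullet> x)) (c \<bullet> h))) (at x)"
      by (simp add: o_def)
    moreover have "frechet_derivative f (at (a + c \<bullet> x)) (c \<bullet> h) = frechet_derivative f (at (a + c \<bullet> x)) 1 * (c \<bullet> h)" for h
      using linear_scale[OF has_derivative_linear[OF f(1)], of "a + c \<bullet> x" "c \<bullet> h" 1] by (simp add: mult.commute)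
    ultimately show ?thesis by simp
  qed
  show ?case
    by (rule C_k_Suc_I[OF der]) (intro C_k_mult C_k_const Suc.IH f(2), simp)
qed

lemma C_k_real_Suc_I:
  fixes f :: "real \<Rightarrow> real"
  assumes "\<And>x. (f has_real_derivative f' x) (at x)" "C_k k f'"
  shows "C_k (Suc k) f"
  using assms by (intro C_k_Suc_I[of f "\<lambda>x h. f' x * h"]) (auto simp: has_field_derivative_def)

text \<open>The n-th derivative of exp (- 1 / x) for x > 0 is P (1 / x) exp (- 1 / x) with P the
  n-th polynomial: since y = 1 / x has derivative - y^2, differentiating P(y) exp (- y) gives y^2 (P
  - P')(y) exp (- y).\<close>

fun flat_poly :: "nat \<Rightarrow> real poly" where
  "flat_poly 0 = 1"
| "flat_poly (Suc n) = [:0, 0, 1:] * (flat_poly n - pderiv (flat_poly n))"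

definition flat :: "nat \<Rightarrow> real \<Rightarrow> real" where
  "flat n x = (if x > 0 then poly (flat_poly n) (1 / x) * exp (- (1 / x)) else 0)"

lemma poly_exp_tendsto_0: "((\<lambda>y. poly p y * exp (- y)) \<longlongrightarrow> (0::real)) at_top"
proof -
  have "((\<lambda>y. \<Sum>i\<le>degree p. coeff p i * (y ^ i / exp y)) \<longlongrightarrow> (\<Sum>i\<le>degree p. coeff p i * 0)) at_top"
    by (intro tendsto_intros tendsto_power_div_exp_0)
  then show ?thesis
    by (simp add: poly_altdef exp_minus sum_distrib_right divide_inverse mult.assoc)
qed

lemma flat_has_derivative: "(flat n has_real_derivative flat (Suc n) x) (at x)"
proof (cases x "0::real" rule: linorder_cases)
  case less
  have "((\<lambda>x. 0) has_real_derivative 0) (at x)" by simp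
  then have "(flat n has_real_derivative 0) (at x)"
    by (rule has_field_derivative_transform_within_open[of _ _ _ "{..<0}"]) (use less in \<open>auto simp: flat_def\<close>)
  then show ?thesis using less by (simp add: flat_def)
next
  case greater
  let ?p = "flat_poly n"
  have "((\<lambda>x. poly ?p (1 / x) * exp (- (1 / x))) has_real_derivative
      poly (pderiv ?p) (1 / x) * (- 1 / x\<^sup>2) * exp (- (1 / x)) + exp (- (1 / x)) * (1 / x\<^sup>2) * poly ?p (1 / x)) (at x)"
  proof (rule DERIV_mult)
    have i: "((\<lambda>x. 1 / x) has_real_derivative - 1 / x\<^sup>2) (at x)"
      using greater by (auto intro!: derivative_eq_intros simp: power2_eq_square)
    show "((\<lambda>x. poly ?p (1 / x)) has_real_derivative poly (pderiv ?p) (1 / x) * (- 1 / x\<^sup>2)) (at x)"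
      by (rule DERIV_chain2[OF poly_DERIV i])
    have "((\<lambda>x. - (1 / x)) has_real_derivative 1 / x\<^sup>2) (at x)"
      using DERIV_minus[OF i] by simp
    from DERIV_chain2[OF DERIV_exp this]
    show "((\<lambda>x. exp (- (1 / x))) has_real_derivative exp (- (1 / x)) * (1 / x\<^sup>2)) (at x)" .
  qed
  then have "(flat n has_real_derivative
      poly (pderiv ?p) (1 / x) * (- 1 / x\<^sup>2) * exp (- (1 / x)) + exp (- (1 / x)) * (1 / x\<^sup>2) * poly ?p (1 / x)) (at x)"
    by (rule has_field_derivative_transform_within_open[of _ _ _ "{0<..}"]) (use greater in \<open>auto simp: flat_def\<close>)
  moreover have "poly (pderiv ?p) (1 / x) * (- 1 / x\<^sup>2) * exp (- (1 / x)) + exp (- (1 / x)) * (1 / x\<^sup>2) * poly ?p (1 / x) = flat (Suc n) x"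
    using greater by (simp add: flat_def algebra_simps power2_eq_square)
  ultimately show ?thesis by simp
next
  case equal
  \<comment> \<open>The right difference quotient at 0: division by \<open>h\<close> is
    multiplication by the argument 1 / h of the polynomial, hence the factor
    \<open>[:0, 1:]\<close>.\<close>
  have "((\<lambda>h. poly ([:0, 1:] * flat_poly n) (inverse h) * exp (- inverse h)) \<longlongrightarrow> 0) (at_right 0)"
    by (rule filterlim_compose[OF poly_exp_tendsto_0 filterlim_inverse_at_top_right])
  then have "((\<lambda>h. (flat n (0 + h) - flat n 0) / h) \<longlongrightarrow> 0) (at_right 0)"
  proof (rule Lim_transform_eventually)
    show "\<forall>\<^sub>F h in at_right 0. poly ([:0, 1:] * flat_poly n) (inverse h) * exp (- inverse h) = (flat n (0 + h) - flat n 0) / h"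
      by (auto simp: eventually_at_filter flat_def divide_inverse)
  qed
  moreover have "((\<lambda>h. (flat n (0 + h) - flat n 0) / h) \<longlongrightarrow> 0) (at_left 0)"
    by (rule tendsto_eventually) (auto simp: eventually_at_filter flat_def)
  ultimately have "((\<lambda>h. (flat n (0 + h) - flat n 0) / h) \<longlongrightarrow> 0) (at 0)"
    by (rule filterlim_split_at[rotated])
  then show ?thesis using equal by (simp add: DERIV_def flat_def[of "Suc n"])
qed

lemma C_k_flat: "C_k k (flat n)"
proof (induction k arbitrary: n)
  case 0
  show ?case
    using DERIV_isCont[OF flat_has_derivative] by (auto intro: continuous_at_imp_continuous_on)
next
  case (Suc k)
  show ?case by (rule C_k_real_Suc_I[OF flat_has_derivative Suc.IH])
qed

definition bump :: "real \<Rightarrow> real" where "bump x = flat 0 (1 + x) * flat 0 (1 - x)"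

lemma flat_0: "flat 0 x = (if x > 0 then exp (- (1 / x)) else 0)"
  by (simp add: flat_def)

lemma bump_nonneg: "bump x \<ge> 0"
  and bump_pos: "\<bar>x\<bar> < 1 \<Longrightarrow> bump x > 0"
  and bump_zero: "\<bar>x\<bar> \<ge> 1 \<Longrightarrow> bump x = 0"
  by (auto simp: bump_def flat_0)

lemma bump_le: "bump x \<le> 1"
proof -
  have "0 \<le> flat 0 y \<and> flat 0 y \<le> 1" for y by (simp add: flat_0)
  then show ?thesis unfolding bump_def by (intro mult_le_one) auto
qed

lemma bump_half: "\<bar>x\<bar> \<le> 1 / 2 \<Longrightarrow> bump x \<ge> exp (- 4)"
proof -
  assume x: "\<bar>x\<bar> \<le> 1 / 2"
  have "exp (- 2) \<le> flat 0 y" if "y \<ge> 1 / 2" for y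
    using that by (simp add: flat_0 field_simps)
  then have "exp (- 2) * exp (- 2) \<le> flat 0 (1 + x) * flat 0 (1 - x)"
    using x by (intro mult_mono) (auto simp: flat_0)
  then show ?thesis by (simp add: bump_def exp_add[symmetric])
qed

lemma C_k_bump: "C_k k bump"
proof -
  have "C_k k (\<lambda>x. flat 0 (1 + 1 \<bullet> x) * flat 0 (1 + (- 1) \<bullet> x))"
    by (rule C_k_mult[OF C_k_ridge[OF C_k_flat] C_k_ridge[OF C_k_flat]])
  moreover have "(\<lambda>x. flat 0 (1 + 1 \<bullet> x) * flat 0 (1 + (- 1) \<bullet> x)) = bump"
    by (rule ext) (simp add: bump_def inner_real_def)
  ultimately show ?thesis by metis
qed

lemma continuous_bump: "continuous_on UNIV bump"
  using C_k_bump[of 0] by simp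

text \<open>An antiderivative of \<open>bump\<close>. It is left unnormalised; its height, the
  integral of \<open>bump\<close>, is carried along as a constant.\<close>

lemma smooth_step_exists:
  obtains F :: "real \<Rightarrow> real" where "\<And>x. (F has_real_derivative bump x) (at x)"
    "\<And>x. x \<le> -1 \<Longrightarrow> F x = F (-1)" "\<And>x. x \<ge> 1 \<Longrightarrow> F x = F 1" "F (-1) < F 1" "\<And>k. C_k k F"
    "(LINT x|lborel. bump x) = F 1 - F (-1)"
proof -
  obtain F where F: "\<And>x. (F has_vector_derivative bump x) (at x)"
    using einterval_antiderivative[of "-\<infinity>" "\<infinity>" bump] continuous_bump
    by (auto simp: continuous_on_eq_continuous_at)
  then have der: "(F has_real_derivative bump x) (at x)" for x
    by (simp add: has_real_derivative_iff_has_vector_derivative)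
  have cont: "continuous_on S F" for S
    using DERIV_isCont[OF der] by (auto intro: continuous_at_imp_continuous_on)
  have left: "F x = F (-1)" if "x \<le> -1" for x
  proof (cases "x = -1")
    case False
    show ?thesis
    proof (rule DERIV_isconst_end[symmetric, OF _ cont])
      show "x < -1" using that False by simp
      show "(F has_real_derivative 0) (at y)" if "x < y" "y < -1" for y
        using der[of y] bump_zero[of y] that by simp
    qed
  qed simp
  have right: "F x = F 1" if "x \<ge> 1" for x
  proof (cases "x = 1")
    case False
    show ?thesis
    proof (rule DERIV_isconst_end[OF _ cont])
      show "1 < x" using that False by simp
      show "(F has_real_derivative 0) (at y)" if "1 < y" "y < x" for y
        using der[of y] bump_zero[of y] that by simp
    qed
  qed simp
  have "F (-1) < F 1"
  proof (rule DERIV_pos_imp_increasing_open[OF _ _ cont])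
    show "\<exists>d. (F has_real_derivative d) (at x) \<and> d > 0" if "-1 < x" "x < 1" for x
      using der[of x] bump_pos[of x] that by auto
  qed simp
  moreover have "C_k k F" for k
  proof (cases k)
    case (Suc j)
    then show ?thesis using C_k_real_Suc_I[OF der C_k_bump] by simp
  qed (simp add: cont)
  moreover have "(LINT x|lborel. bump x) = F 1 - F (-1)"
  proof -
    have "(bump has_integral F 1 - F (-1)) {-1..1}"
      using der by (intro fundamental_theorem_of_calculus)
        (auto simp: has_real_derivative_iff_has_vector_derivative intro: has_vector_derivative_at_within)
    then have "(LINT x:{-1..1}|lborel. bump x) = F 1 - F (-1)"
      by (intro nonneg_has_integral_lborel borel_measurable_continuous_onI continuous_bump) (auto simp: bump_nonneg)
    moreover have "(\<lambda>x. indicator {-1..1} x *\<^sub>R bump x) = bump"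
    proof
      fix x :: real
      show "indicator {-1..1} x *\<^sub>R bump x = bump x"
        using bump_zero[of x] by (cases "\<bar>x\<bar> \<ge> 1") (auto simp: indicator_def)
    qed
    ultimately show ?thesis unfolding set_lebesgue_integral_def by simp
  qed
  ultimately show ?thesis using that[OF der left right] by blast
qed

text \<open>The product form reduces smoothness to one variable. The bump is not normalised: it is
  at most 1, and its mass is bounded below by a multiple of e^2 in
  \<open>plane_bump_integral_ge\<close>.\<close>

definition plane_bump :: "real \<Rightarrow> plane \<Rightarrow> real" where
  "plane_bump e x = bump (x $ 1 / e) * bump (x $ 2 / e)"

lemma plane_bump_zero:
  assumes "e > 0" "norm x \<ge> 2 * e" shows "plane_bump e x = 0"
proof (rule ccontr)
  assume "plane_bump e x \<noteq> 0"
  then have "bump (x $ 1 / e) \<noteq> 0" "bump (x $ 2 / e) \<noteq> 0" by (auto simp: plane_bump_def)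
  then have "\<bar>x $ 1 / e\<bar> < 1" "\<bar>x $ 2 / e\<bar> < 1" 
    using bump_zero[of "x $ 1 / e"] bump_zero[of "x $ 2 / e"] not_less by (blast, blast)
  then have "\<bar>x $ 1\<bar> < e" "\<bar>x $ 2\<bar> < e" using assms(1) by (auto simp: abs_divide divide_less_eq)
  moreover have "norm x \<le> \<bar>x $ 1\<bar> + \<bar>x $ 2\<bar>" using norm_le_l1_cart[of x] by (simp add: sum_2)
  ultimately show False using assms(2) by simp
qed

lemma C_k_bump_coordinate:
  fixes c :: "'a::euclidean_space"
  shows "C_k k (\<lambda>x. bump ((c \<bullet> x - a) / e))"
proof -
  have "C_k k (\<lambda>x. bump (- a / e + (c /\<^sub>R e) \<bullet> x))" by (rule C_k_ridge[OF C_k_bump])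
  moreover have "- a / e + (c /\<^sub>R e) \<bullet> x = (c \<bullet> x - a) / e" for x
    by (simp add: divide_inverse algebra_simps)
  ultimately show ?thesis by simp
qed

lemma plane_bump_coordinates:
  "plane_bump e (x - z) = bump ((axis 1 1 \<bullet> x - z $ 1) / e) * bump ((axis 2 1 \<bullet> x - z $ 2) / e)"
  by (simp add: plane_bump_def inner_axis' inner_real_def)

lemma plane_bump_test:
  assumes "e > 0" shows "(\<lambda>x. plane_bump e (x - z)) \<in> test_functions"
  unfolding test_functions_def
proof (intro CollectI conjI allI)
  show "C_k k (\<lambda>x. plane_bump e (x - z))" for k
    unfolding plane_bump_coordinates by (rule C_k_mult[OF C_k_bump_coordinate C_k_bump_coordinate])
  have "{x. plane_bump e (x - z) \<noteq> 0} \<subseteq> cball z (2 * e)"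
  proof
    fix x assume "x \<in> {x. plane_bump e (x - z) \<noteq> 0}"
    then show "x \<in> cball z (2 * e)"
      using plane_bump_zero[OF assms, of "x - z"] by (cases "2 * e \<le> norm (x - z)") (auto simp: dist_norm norm_minus_commute)
  qed
  then have "bounded {x. plane_bump e (x - z) \<noteq> 0}" by (rule bounded_subset[OF bounded_cball])
  then show "compact (closure {x. plane_bump e (x - z) \<noteq> 0})" by (simp add: compact_closure)
qed

lemma product_test_function:
  assumes \<theta>: "\<And>k. C_k k \<theta>" "\<And>t. \<bar>t\<bar> > r \<Longrightarrow> \<theta> t = 0" and e: "e > 0"
  shows "(\<lambda>p. \<theta> (fst p) * plane_bump e (snd p - z)) \<in> (test_functions :: (real \<times> plane \<Rightarrow> real) set)"
  unfolding test_functions_def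
proof (intro CollectI conjI allI)
  let ?\<phi> = "\<lambda>p::real \<times> plane. \<theta> (fst p) * plane_bump e (snd p - z)"
  have "C_k k (\<lambda>p::real \<times> plane. \<theta> (0 + (1, 0) \<bullet> p) * (bump (((0, axis 1 1) \<bullet> p - z $ 1) / e) * bump (((0, axis 2 1) \<bullet> p - z $ 2) / e)))" for k
    by (rule C_k_mult[OF C_k_ridge[OF \<theta>(1)] C_k_mult[OF C_k_bump_coordinate C_k_bump_coordinate]])
  moreover have "?\<phi> = (\<lambda>p. \<theta> (0 + (1, 0) \<bullet> p) * (bump (((0, axis 1 1) \<bullet> p - z $ 1) / e) * bump (((0, axis 2 1) \<bullet> p - z $ 2) / e)))"
    by (intro ext) (simp only: plane_bump_coordinates inner_prod_def fst_conv snd_conv inner_zero_left inner_real_def mult_zero_left add_0 mult_1 add_0_right)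
  ultimately show "C_k k ?\<phi>" for k by simp
  have "{p. ?\<phi> p \<noteq> 0} \<subseteq> {-r..r} \<times> cball z (2 * e)"
  proof
    fix p assume "p \<in> {p. ?\<phi> p \<noteq> 0}"
    then have "\<theta> (fst p) \<noteq> 0" "plane_bump e (snd p - z) \<noteq> 0" by auto
    then have "\<bar>fst p\<bar> \<le> r" "norm (snd p - z) \<le> 2 * e"
      using \<theta>(2)[of "fst p"] plane_bump_zero[OF e, of "snd p - z"] by (meson not_less, meson less_imp_le not_less)
    then show "p \<in> {-r..r} \<times> cball z (2 * e)" by (auto simp: mem_Times_iff dist_norm norm_minus_commute abs_le_iff)
  qed
  then have "bounded {p. ?\<phi> p \<noteq> 0}" by (rule bounded_subset[rotated]) (intro bounded_Times bounded_cball bounded_closed_interval)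
  then show "compact (closure {p. ?\<phi> p \<noteq> 0})" by (simp add: compact_closure)
qed

section \<open>Consequences of the weak formulation\<close>

lemma sint_curve_tendsto:
  fixes f :: "real \<Rightarrow> plane \<Rightarrow> 'b::euclidean_space"
  assumes wc: "weakly_continuous_curve q"
    and C0: "\<And>b. b \<in> Basis \<Longrightarrow> (\<lambda>x. f t x \<bullet> b) \<in> C0_vanishing" and bb: "\<And>s. bounded_borel (f s)"
    and lim: "uniform_limit UNIV f (f t) (at t)"
  shows "((\<lambda>s. sint (q s) (f s)) \<longlongrightarrow> sint (q t) (f t)) (at t)"
proof -
  have sm: "is_signed_measure (q s)" for s
    using wc by (auto simp: weakly_continuous_curve_def radon_iff_signed_measure)
  obtain Q where Q: "\<And>s. s \<in> {t - 1..t + 1} \<Longrightarrow> tv (q s) \<le> Q"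
    using weakly_continuous_curve_tv_bounded[OF wc] by blast
  have Q0: "Q \<ge> 0" using Q[of t] tv_nonneg[of "q t"] by simp
  have "((\<lambda>s. sint (q s) (f s) - sint (q s) (f t)) \<longlongrightarrow> 0) (at t)"
  proof (rule tendstoI)
    fix d :: real assume d: "d > 0"
    then have "d / (2 * (Q + 1)) > 0" using Q0 by simp
    with lim have "\<forall>\<^sub>F s in at t. \<forall>x\<in>UNIV. dist (f s x) (f t x) < d / (2 * (Q + 1))"
      unfolding uniform_limit_iff by blast
    moreover have "\<forall>\<^sub>F s in at t. s \<in> {t - 1..t + 1}"
      unfolding eventually_at by (intro exI[of _ 1]) (auto simp: dist_real_def abs_le_iff)
    ultimately show "\<forall>\<^sub>F s in at t. dist (sint (q s) (f s) - sint (q s) (f t)) 0 < d"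
    proof eventually_elim
      case (elim s)
      have "norm (sint (q s) (\<lambda>x. f s x - f t x)) \<le> tv (q s) * (d / (2 * (Q + 1)))"
        using elim(1) by (intro sint_norm_le[OF sm] bounded_borel_diff bb) (auto simp: dist_norm less_imp_le)
      also have "\<dots> \<le> (Q + 1) * (d / (2 * (Q + 1)))"
        using Q[OF elim(2)] d Q0 by (intro mult_right_mono) auto
      also have "\<dots> < d"
      proof -
        have "L * (d / (2 * L)) = d / 2" if "L > 0" for L using that by simp
        from this[of "Q + 1"] show ?thesis using Q0 d by linarith
      qed
      finally show ?case by (simp add: sint_diff[OF sm bb bb])
    qed
  qed
  moreover have "((\<lambda>s. sint (q s) (f t)) \<longlongrightarrow> sint (q t) (f t)) (at t)"
  proof (subst tendsto_componentwise_iff, intro ballI)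
    fix b :: 'b assume b: "b \<in> Basis"
    have "continuous_on UNIV (\<lambda>s. sint (q s) (\<lambda>x. f t x \<bullet> b))"
      using wc C0[OF b] by (simp add: weakly_continuous_curve_def)
    then have "((\<lambda>s. sint (q s) (\<lambda>x. f t x \<bullet> b)) \<longlongrightarrow> sint (q t) (\<lambda>x. f t x \<bullet> b)) (at t)"
      by (simp add: continuous_on_def)
    then show "((\<lambda>s. sint (q s) (f t) \<bullet> b) \<longlongrightarrow> sint (q t) (f t) \<bullet> b) (at t)"
      by (simp add: sint_linear[OF sm bounded_linear_inner_left bb])
  qed
  ultimately have "((\<lambda>s. (sint (q s) (f s) - sint (q s) (f t)) + sint (q s) (f t)) \<longlongrightarrow> 0 + sint (q t) (f t)) (at t)"
    by (rule tendsto_add)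
  then show ?thesis by simp
qed

lemma has_derivative_of_increments:
  fixes A B :: "real \<Rightarrow> real"
  assumes B: "continuous_on UNIV B" and inc: "\<And>a b. a < b \<Longrightarrow> A b - A a = integral {a..b} B"
  shows "(A has_real_derivative B t) (at t)"
proof -
  have "((\<lambda>x. A (t - 1) + integral {t - 1..x} B) has_real_derivative 0 + B t) (at t within {t - 1..t + 1})"
    by (intro DERIV_add DERIV_const integral_has_real_derivative continuous_on_subset[OF B]) auto
  then have "((\<lambda>x. A (t - 1) + integral {t - 1..x} B) has_real_derivative B t) (at t)"
    by (simp add: at_within_Icc_at)
  then show ?thesis
  proof (rule has_field_derivative_transform_within_open[of _ _ _ "{t - 1<..<t + 1}"])
    show "A (t - 1) + integral {t - 1..x} B = A x" if "x \<in> {t - 1<..<t + 1}" for x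
      using inc[of "t - 1" x] that by simp
  qed auto
qed

text \<open>Testing the weak identity \<open>\<integral> \<theta>' A + \<theta> B = 0\<close> with smoothed indicators of \<open>[a, b]\<close>.\<close>

lemma weak_derivative_increments:
  fixes A B :: "real \<Rightarrow> real"
  assumes A: "continuous_on UNIV A" and B: "continuous_on UNIV B"
    and weak: "\<And>\<theta> \<theta>' r. (\<And>k. C_k k \<theta>) \<Longrightarrow> (\<And>t. (\<theta> has_real_derivative \<theta>' t) (at t)) \<Longrightarrow>
      (\<And>t. \<bar>t\<bar> > r \<Longrightarrow> \<theta> t = 0) \<Longrightarrow> (LINT t|lborel. \<theta>' t * A t + \<theta> t * B t) = 0"
    and ab: "a < b"
  shows "A b - A a = integral {a..b} B"
proof -
  obtain F :: "real \<Rightarrow> real" where F: "\<And>x. (F has_real_derivative bump x) (at x)"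
    "\<And>x. x \<le> -1 \<Longrightarrow> F x = F (-1)" "\<And>x. x \<ge> 1 \<Longrightarrow> F x = F 1" "F (-1) < F 1" "\<And>k. C_k k F"
    "(LINT x|lborel. bump x) = F 1 - F (-1)" using smooth_step_exists by blast
  define N where "N = F 1 - F (-1)"
  have N: "N > 0" using F(4) by (simp add: N_def)
  have Fmono: "F x \<le> F y" if "x \<le> y" for x y
    by (rule DERIV_nonneg_imp_nondecreasing[OF that]) (use F(1) bump_nonneg in blast)
  have Fbd: "F (-1) \<le> F x \<and> F x \<le> F 1" for x
  proof -
    consider "x \<le> -1" | "-1 \<le> x" "x \<le> 1" | "x \<ge> 1" by linarith
    then show ?thesis
    proof cases
      case 1 then show ?thesis using F(2)[OF 1] F(4) by simp
    next
      case 2 then show ?thesis using Fmono[OF 2(1)] Fmono[OF 2(2)] by simp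
    next
      case 3 then show ?thesis using F(3)[OF 3] F(4) by simp
    qed
  qed
  have Fc: "continuous_on UNIV F" using F(5)[of 0] by simp
  define m where "m n = real (Suc n)" for n
  have m: "m n \<ge> 1" "m n > 0" for n by (auto simp: m_def)
  \<comment> \<open>The limit is N times the indicator of [a, b], and the derivative tends to N
    times the point mass at \<open>a\<close> minus the one at \<open>b\<close>. As m n \<ge> 1,
    everything is supported in [a - 1, b + 1].\<close>
  define \<theta> where "\<theta> n t = F (m n * (t - a)) - F (m n * (t - b))" for n t
  define \<theta>' where "\<theta>' n t = m n * bump (m n * (t - a)) - m n * bump (m n * (t - b))" for n t
  define r where "r = \<bar>a\<bar> + \<bar>b\<bar> + 1"
  have big: "\<theta> n t = 0 \<and> bump (m n * (t - a)) = 0 \<and> bump (m n * (t - b)) = 0" if t: "t < a - 1 \<or> t > b + 1" for n t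
    using t
  proof
    assume "t < a - 1"
    then have "m n * (t - a) \<le> 1 * (-1)" "m n * (t - b) \<le> 1 * (-1)"
      using m(1)[of n] ab mult_mono[of 1 "m n" 1 "a - t"] mult_mono[of 1 "m n" 1 "b - t"] by (simp_all add: algebra_simps)
    then show ?thesis using F(2)[of "m n * (t - a)"] F(2)[of "m n * (t - b)"] by (simp add: \<theta>_def bump_zero)
  next
    assume "t > b + 1"
    then have "m n * (t - a) \<ge> 1 * 1" "m n * (t - b) \<ge> 1 * 1"
      using m(1)[of n] ab mult_mono[of 1 "m n" 1 "t - a"] mult_mono[of 1 "m n" 1 "t - b"] by simp_all
    then show ?thesis using F(3)[of "m n * (t - a)"] F(3)[of "m n * (t - b)"] by (simp add: \<theta>_def bump_zero)
  qed
  have der: "(\<theta> n has_real_derivative \<theta>' n t) (at t)" for n t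
  proof -
    have "((\<lambda>t. F (m n * (t - c))) has_real_derivative bump (m n * (t - c)) * m n) (at t)" for c
      by (rule DERIV_chain2[OF F(1)]) (auto intro!: derivative_eq_intros)
    from DERIV_diff[OF this[of a] this[of b]] show ?thesis unfolding \<theta>_def[abs_def] \<theta>'_def by (simp add: mult.commute)
  qed
  have Ck: "C_k k (\<theta> n)" for k n
  proof -
    have "C_k k (\<lambda>t. F (- (m n * a) + m n \<bullet> t) + (-1) * F (- (m n * b) + m n \<bullet> t))"
      by (rule C_k_add[OF C_k_ridge[OF F(5)] C_k_mult[OF C_k_const C_k_ridge[OF F(5)]]])
    then show ?thesis by (simp add: \<theta>_def[abs_def] algebra_simps)
  qed
  obtain K where K: "\<And>t. t \<in> {a - 1..b + 1} \<Longrightarrow> \<bar>A t\<bar> \<le> K \<and> \<bar>B t\<bar> \<le> K"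
  proof -
    have "bounded (A ` {a - 1..b + 1})"
      using A by (auto intro!: compact_imp_bounded compact_continuous_image intro: continuous_on_subset)
    then obtain K1 where K1: "\<forall>x\<in>A ` {a - 1..b + 1}. norm x \<le> K1" unfolding bounded_iff by blast
    have "bounded (B ` {a - 1..b + 1})"
      using B by (auto intro!: compact_imp_bounded compact_continuous_image intro: continuous_on_subset)
    then obtain K2 where K2: "\<forall>x\<in>B ` {a - 1..b + 1}. norm x \<le> K2" unfolding bounded_iff by blast
    show ?thesis
    proof (rule that[of "max K1 K2"])
      fix t assume "t \<in> {a - 1..b + 1}"
      then have "\<bar>A t\<bar> \<le> K1" "\<bar>B t\<bar> \<le> K2" using K1 K2 by simp_all
      then show "\<bar>A t\<bar> \<le> max K1 K2 \<and> \<bar>B t\<bar> \<le> max K1 K2" by linarith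
    qed
  qed
  have K0: "K \<ge> 0" using K[of a] ab abs_ge_zero[of "A a"] by fastforce
  have bint: "integrable lborel (\<lambda>s. bump s * C)" for C :: real
    by (rule integrable_compact_support[of _ "\<bar>C\<bar>" 1])
      (auto simp: abs_mult bump_nonneg bump_zero intro!: borel_measurable_continuous_onI continuous_intros continuous_bump mult_left_le_one_le bump_le)
  have affine: "(LINT t|lborel. m n * bump (m n * (t - c)) * A t) = (LINT s|lborel. bump s * A (c + s / m n))" for n c
    using lborel_integral_real_affine[of "1 / m n" "\<lambda>t. m n * bump (m n * (t - c)) * A t" c] m(2)[of n]
    by (simp add: mult.assoc)
  have Aint: "integrable lborel (\<lambda>t. m n * bump (m n * (t - c)) * A t)" if c: "c = a \<or> c = b" for n c
  proof (rule integrable_compact_support[of _ "m n * K" r])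
    show "(\<lambda>t. m n * bump (m n * (t - c)) * A t) \<in> borel_measurable borel"
      by (intro borel_measurable_continuous_onI continuous_intros A continuous_on_compose2[OF continuous_bump]) auto
    have z: "bump (m n * (t - c)) = 0" if "t < a - 1 \<or> t > b + 1" for t using big[OF that, of n] c by auto
    show "norm (m n * bump (m n * (t - c)) * A t) \<le> m n * K" for t
    proof (cases "t < a - 1 \<or> t > b + 1")
      case False
      then have "\<bar>bump (m n * (t - c))\<bar> * \<bar>A t\<bar> \<le> 1 * K"
        using K[of t] bump_le bump_nonneg by (intro mult_mono) auto
      then show ?thesis using m(2)[of n] by (simp add: abs_mult mult.assoc)
    qed (use z m(2)[of n] K0 in simp)
    show "m n * bump (m n * (t - c)) * A t = 0" if "norm t > r" for t
      using z[of t] that by (auto simp: r_def abs_if split: if_splits)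
  qed
  have Alim: "(\<lambda>n. LINT s|lborel. bump s * A (c + s / m n)) \<longlonglongrightarrow> N * A c" if c: "c = a \<or> c = b" for c
  proof -
    have "(\<lambda>n. LINT s|lborel. bump s * A (c + s / m n)) \<longlonglongrightarrow> (LINT s|lborel. bump s * A c)"
    proof (rule integral_dominated_convergence[where w = "\<lambda>s. bump s * K"])
      show "integrable lborel (\<lambda>s. bump s * K)" by (rule bint)
      show "AE s in lborel. (\<lambda>n. bump s * A (c + s / m n)) \<longlonglongrightarrow> bump s * A c"
      proof (rule AE_I2)
        fix s
        have "(\<lambda>n. c + s * (1 / m n)) \<longlonglongrightarrow> c + s * 0"
          unfolding m_def by (intro tendsto_intros LIMSEQ_Suc[OF lim_1_over_n])
        then have "(\<lambda>n. c + s / m n) \<longlonglongrightarrow> c" by simp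
        moreover have "isCont A c" using A by (simp add: continuous_on_eq_continuous_at)
        ultimately show "(\<lambda>n. bump s * A (c + s / m n)) \<longlonglongrightarrow> bump s * A c"
          by (intro tendsto_mult tendsto_const isCont_tendsto_compose[of c A])
      qed
      show "AE s in lborel. norm (bump s * A (c + s / m n)) \<le> bump s * K" for n
      proof (rule AE_I2)
        fix s
        show "norm (bump s * A (c + s / m n)) \<le> bump s * K"
        proof (cases "\<bar>s\<bar> < 1")
          case True
          have "\<bar>s / m n\<bar> \<le> \<bar>s\<bar>"
            using m(1)[of n] mult_left_mono[of 1 "m n" "\<bar>s\<bar>"] by (simp add: abs_divide divide_le_eq)
          then have "-1 \<le> s / m n" "s / m n \<le> 1" using True by (linarith, linarith)
          then have "c + s / m n \<in> {a - 1..b + 1}" using c ab by auto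
          then show ?thesis using K bump_nonneg[of s] by (auto simp: abs_mult intro: mult_left_mono)
        qed (simp add: bump_zero)
      qed
    qed (auto intro!: borel_measurable_continuous_onI continuous_intros continuous_bump continuous_on_compose2[OF A] simp: m_def)
    also have "(LINT s|lborel. bump s * A c) = N * A c" using F(6) by (simp add: N_def)
    finally show ?thesis .
  qed
  have \<theta>B: "integrable lborel (\<lambda>t. \<theta> n t * B t)" for n
  proof (rule integrable_compact_support[of _ "N * K" r])
    show "(\<lambda>t. \<theta> n t * B t) \<in> borel_measurable borel"
      unfolding \<theta>_def by (intro borel_measurable_continuous_onI continuous_intros B continuous_on_compose2[OF Fc]) auto
    show "norm (\<theta> n t * B t) \<le> N * K" for t
    proof (cases "t < a - 1 \<or> t > b + 1")
      case False
      then have "\<bar>\<theta> n t\<bar> * \<bar>B t\<bar> \<le> N * K"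
        using K[of t] Fbd[of "m n * (t - a)"] Fbd[of "m n * (t - b)"] N by (intro mult_mono) (auto simp: \<theta>_def N_def)
      then show ?thesis by (simp add: abs_mult)
    qed (use big N K0 in simp)
    show "\<theta> n t * B t = 0" if "norm t > r" for t
      using big[of t n] that by (auto simp: r_def abs_if split: if_splits)
  qed
  have "(\<lambda>n. LINT t|lborel. \<theta> n t * B t) \<longlonglongrightarrow> (LINT t|lborel. (N * indicator {a..b} t) * B t)"
  proof (rule integral_dominated_convergence[where w = "\<lambda>t. indicator {a - 1..b + 1} t * (N * K)"])
    show "(\<lambda>t. N * indicator {a..b} t * B t) \<in> borel_measurable lborel"
      using borel_measurable_continuous_onI[OF B] by simp
    show "(\<lambda>t. \<theta> n t * B t) \<in> borel_measurable lborel" for n using \<theta>B by (rule borel_measurable_integrable)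
    show "integrable lborel (\<lambda>t. indicator {a - 1..b + 1} t * (N * K))"
      using emeasure_bounded_finite[of "{a - 1..b + 1}"] by (intro integrable_mult_left integrable_real_indicator) auto
    show "AE t in lborel. norm (\<theta> n t * B t) \<le> indicator {a - 1..b + 1} t * (N * K)" for n
    proof (rule AE_I2)
      fix t
      show "norm (\<theta> n t * B t) \<le> indicator {a - 1..b + 1} t * (N * K)"
      proof (cases "t < a - 1 \<or> t > b + 1")
        case False
        then have "\<bar>\<theta> n t\<bar> * \<bar>B t\<bar> \<le> N * K"
          using K[of t] Fbd[of "m n * (t - a)"] Fbd[of "m n * (t - b)"] N by (intro mult_mono) (auto simp: \<theta>_def N_def)
        then show ?thesis using False by (simp add: abs_mult)
      qed (use big in auto)
    qed
    \<comment> \<open>At \<open>a\<close> and \<open>b\<close> themselves one of the arguments of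
      \<open>F\<close> stays 0 for all \<open>n\<close>, so the endpoints are left out of the
      pointwise limit.\<close>
    have "AE t in lborel. t \<noteq> a \<and> t \<noteq> b"
      using AE_lborel_singleton[of a] AE_lborel_singleton[of b] by eventually_elim auto
    then show "AE t in lborel. (\<lambda>n. \<theta> n t * B t) \<longlonglongrightarrow> N * indicator {a..b} t * B t"
    proof eventually_elim
      case (elim t)
      have Flim: "eventually (\<lambda>n. F (m n * (t - c)) = (if t > c then F 1 else F (-1))) sequentially" if "t \<noteq> c" for c
      proof -
        obtain M :: nat where M: "1 / \<bar>t - c\<bar> < real M" using reals_Archimedean2 by blast
        have ge: "m n * \<bar>t - c\<bar> \<ge> 1" if "n \<ge> M" for n
        proof -
          have "1 < real M * \<bar>t - c\<bar>" using M \<open>t \<noteq> c\<close> by (simp add: divide_less_eq)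
          also have "\<dots> \<le> m n * \<bar>t - c\<bar>" using that by (intro mult_right_mono) (auto simp: m_def)
          finally show ?thesis by simp
        qed
        show ?thesis
          unfolding eventually_sequentially
        proof (intro exI[of _ M] allI impI)
          fix n assume "M \<le> n"
          from ge[OF this] show "F (m n * (t - c)) = (if t > c then F 1 else F (-1))"
            using F(2)[of "m n * (t - c)"] F(3)[of "m n * (t - c)"] \<open>t \<noteq> c\<close>
            by (cases "t > c") (auto simp: abs_if algebra_simps)
        qed
      qed
      have "eventually (\<lambda>n. \<theta> n t * B t = N * indicator {a..b} t * B t) sequentially"
        using Flim[OF conjunct1[OF elim]] Flim[OF conjunct2[OF elim]]
      proof eventually_elim
        case (elim n)
        then show ?case using \<open>t \<noteq> a \<and> t \<noteq> b\<close> ab by (auto simp: \<theta>_def N_def indicator_def)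
      qed
      then show ?case by (rule tendsto_eventually)
    qed
  qed
  also have "(LINT t|lborel. (N * indicator {a..b} t) * B t) = N * integral {a..b} B"
  proof -
    have "set_integrable lborel {a..b} B"
      unfolding set_integrable_def
      by (intro borel_integrable_compact continuous_on_subset[OF B]) auto
    from set_borel_integral_eq_integral(2)[OF this] show ?thesis
      by (simp add: set_lebesgue_integral_def mult.assoc)
  qed
  finally have Blim: "(\<lambda>n. LINT t|lborel. \<theta> n t * B t) \<longlonglongrightarrow> N * integral {a..b} B" .
  have "(LINT s|lborel. bump s * A (a + s / m n)) - (LINT s|lborel. bump s * A (b + s / m n)) + (LINT t|lborel. \<theta> n t * B t) = 0" for n
  proof -
    have z: "(LINT t|lborel. \<theta>' n t * A t + \<theta> n t * B t) = 0"
    proof (rule weak[OF Ck der])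
      show "\<theta> n t = 0" if "\<bar>t\<bar> > r" for t using big[of t n] that by (auto simp: r_def abs_if split: if_splits)
    qed
    have i: "integrable lborel (\<lambda>t. m n * bump (m n * (t - a)) * A t)" "integrable lborel (\<lambda>t. m n * bump (m n * (t - b)) * A t)"
      using Aint[of a n] Aint[of b n] by simp_all
    have e: "(\<lambda>t. \<theta>' n t * A t) = (\<lambda>t. m n * bump (m n * (t - a)) * A t - m n * bump (m n * (t - b)) * A t)"
      by (simp add: \<theta>'_def left_diff_distrib)
    have i': "integrable lborel (\<lambda>t. \<theta>' n t * A t)" unfolding e using i by (rule Bochner_Integration.integrable_diff)
    have "(LINT t|lborel. \<theta>' n t * A t) = (LINT s|lborel. bump s * A (a + s / m n)) - (LINT s|lborel. bump s * A (b + s / m n))"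
      unfolding e Bochner_Integration.integral_diff[OF i] affine ..
    then show ?thesis using z unfolding Bochner_Integration.integral_add[OF i' \<theta>B] by simp
  qed
  moreover have "(\<lambda>n. (LINT s|lborel. bump s * A (a + s / m n)) - (LINT s|lborel. bump s * A (b + s / m n)) + (LINT t|lborel. \<theta> n t * B t))
      \<longlonglongrightarrow> N * A a - N * A b + N * integral {a..b} B"
    by (intro tendsto_intros Alim Blim) auto
  ultimately have "N * A a - N * A b + N * integral {a..b} B = 0" by (simp add: LIMSEQ_const_iff)
  then have "N * (A b - A a - integral {a..b} B) = 0" by (simp add: algebra_simps)
  then show ?thesis using N by simp
qed

section \<open>Second-order bounds for test functions; derivative and mass of the mollifier\<close>

lemma test_function_partial:
  assumes \<phi>: "\<phi> \<in> test_functions" and b: "b \<in> Basis"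
  shows "(\<lambda>x. frechet_derivative \<phi> (at x) b) \<in> test_functions"
proof -
  have "C_k k (\<lambda>x. frechet_derivative \<phi> (at x) b)" for k
    using \<phi> C_k_Suc_D(2)[of k \<phi> b] b by (simp add: test_functions_def)
  moreover obtain R where R: "\<And>x h. norm x > R \<Longrightarrow> frechet_derivative \<phi> (at x) h = 0"
    using test_function_support[OF \<phi>] by metis
  have "{x. frechet_derivative \<phi> (at x) b \<noteq> 0} \<subseteq> cball 0 R" using R by (auto simp: not_less[symmetric])
  then have "bounded {x. frechet_derivative \<phi> (at x) b \<noteq> 0}" by (rule bounded_subset[OF bounded_cball])
  ultimately show ?thesis by (simp add: test_functions_def compact_closure)
qed

lemma test_function_deriv_lipschitz:
  fixes \<phi> :: "'a::euclidean_space \<Rightarrow> real"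
  assumes \<phi>: "\<phi> \<in> test_functions"
  obtains C where "C \<ge> 0"
    "\<And>x y h. \<bar>frechet_derivative \<phi> (at x) h - frechet_derivative \<phi> (at y) h\<bar> \<le> C * norm (x - y) * norm h"
proof -
  let ?D = "\<lambda>x. frechet_derivative \<phi> (at x)"
  have "\<forall>b\<in>Basis. \<exists>C\<ge>0. \<forall>x y. \<bar>?D x b - ?D y b\<bar> \<le> C * norm (x - y)"
  proof
    fix b :: 'a assume "b \<in> Basis"
    from test_function_partial[OF \<phi> this] show "\<exists>C\<ge>0. \<forall>x y. \<bar>?D x b - ?D y b\<bar> \<le> C * norm (x - y)"
      by (rule test_function_bounds) blast
  qed
  from bchoice[OF this] obtain C where C: "\<And>b. b \<in> Basis \<Longrightarrow> C b \<ge> 0"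
    "\<And>b x y. b \<in> Basis \<Longrightarrow> \<bar>?D x b - ?D y b\<bar> \<le> C b * norm (x - y)" by blast
  show ?thesis
  proof (rule that[of "sum C Basis"])
    show "sum C Basis \<ge> 0" by (intro sum_nonneg C(1))
    fix x y h
    have "?D x h - ?D y h = (\<Sum>b\<in>Basis. (h \<bullet> b) * (?D x b - ?D y b))"
      unfolding test_function_deriv_sum[OF \<phi>, of x h] test_function_deriv_sum[OF \<phi>, of y h]
      by (simp add: sum_subtractf right_diff_distrib)
    also have "\<bar>\<dots>\<bar> \<le> (\<Sum>b\<in>Basis. norm h * (C b * norm (x - y)))"
    proof (rule order_trans[OF sum_abs sum_mono])
      fix b :: 'a assume b: "b \<in> Basis"
      show "\<bar>(h \<bullet> b) * (?D x b - ?D y b)\<bar> \<le> norm h * (C b * norm (x - y))"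
        unfolding abs_mult using C(2)[OF b] Basis_le_norm[OF b] by (intro mult_mono) auto
    qed
    also have "\<dots> = sum C Basis * norm (x - y) * norm h"
      by (simp add: sum_distrib_left sum_distrib_right mult_ac)
    finally show "\<bar>?D x h - ?D y h\<bar> \<le> sum C Basis * norm (x - y) * norm h" .
  qed
qed

lemma test_function_taylor:
  fixes \<phi> :: "'a::euclidean_space \<Rightarrow> real"
  assumes \<phi>: "\<phi> \<in> test_functions"
  obtains C where "C \<ge> 0" "\<And>x h. \<bar>\<phi> (x + h) - \<phi> x - frechet_derivative \<phi> (at x) h\<bar> \<le> C * norm h * norm h"
proof -
  let ?D = "\<lambda>x. frechet_derivative \<phi> (at x)"
  obtain C where C: "C \<ge> 0" "\<And>x y h. \<bar>?D x h - ?D y h\<bar> \<le> C * norm (x - y) * norm h"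
    using test_function_deriv_lipschitz[OF \<phi>] by blast
  show ?thesis
  proof (rule that[OF C(1)])
    fix x h :: 'a
    have "norm (\<phi> (x + h) - \<phi> x - ?D x ((x + h) - x)) \<le> norm ((x + h) - x) * (C * norm h)"
    proof (rule differentiable_bound_linearization[where S = "closed_segment x (x + h)"])
      show "x + t *\<^sub>R ((x + h) - x) \<in> closed_segment x (x + h)" if "t \<in> {0..1}" for t
        using that by (auto simp: closed_segment_def algebra_simps intro!: exI[of _ t])
      show "(\<phi> has_derivative ?D y) (at y within closed_segment x (x + h))" for y
        by (rule has_derivative_at_withinI[OF test_function_has_derivative[OF \<phi>]])
    next
      fix y assume y: "y \<in> closed_segment x (x + h)"
      show "onorm (?D y - ?D x) \<le> C * norm h"
      proof (rule onorm_le)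
        fix v
        have "\<bar>?D y v - ?D x v\<bar> \<le> C * norm (y - x) * norm v" by (rule C(2))
        also have "\<dots> \<le> C * norm h * norm v"
          using segment_bound1[OF y] C(1) by (intro mult_right_mono mult_left_mono) auto
        finally show "norm ((?D y - ?D x) v) \<le> C * norm h * norm v" by simp
      qed
    qed auto
    then show "\<bar>\<phi> (x + h) - \<phi> x - ?D x h\<bar> \<le> C * norm h * norm h" by (simp add: mult_ac)
  qed
qed

lemma plane_bump_even: "plane_bump e (- x) = plane_bump e x"
  by (simp add: plane_bump_def bump_def)

lemma plane_bump_test_0: "e > 0 \<Longrightarrow> plane_bump e \<in> test_functions"
  using plane_bump_test[of e 0] by simp

lemma plane_bump_shift_derivative:
  assumes "e > 0"
  shows "((\<lambda>x. plane_bump e (x - z)) has_derivative frechet_derivative (plane_bump e) (at (x - z))) (at x)"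
proof -
  have "((\<lambda>x. x - z) has_derivative (\<lambda>h. h)) (at x)" by (auto intro!: derivative_eq_intros)
  from diff_chain_at[OF this test_function_has_derivative[OF plane_bump_test_0[OF assms]]]
  show ?thesis by (simp add: o_def)
qed

lemma plane_bump_reflect_derivative:
  assumes "e > 0"
  shows "((\<lambda>z. plane_bump e (x - z)) has_derivative (\<lambda>h. - frechet_derivative (plane_bump e) (at (x - z)) h)) (at z)"
proof -
  note d = test_function_has_derivative[OF plane_bump_test_0[OF assms]]
  have "((\<lambda>z. x - z) has_derivative (\<lambda>h. - h)) (at z)" by (auto intro!: derivative_eq_intros)
  from diff_chain_at[OF this d]
  show ?thesis by (simp add: o_def linear_neg[OF has_derivative_linear[OF d]])
qed

lemma plane_bump_bounds: "plane_bump e x \<ge> 0" "plane_bump e x \<le> 1"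
  unfolding plane_bump_def by (auto intro!: mult_nonneg_nonneg mult_le_one bump_nonneg bump_le)

lemma plane_bump_deriv_zero:
  assumes "e > 0" "norm x > 2 * e" shows "frechet_derivative (plane_bump e) (at x) h = 0"
proof -
  have "((\<lambda>x. 0) has_derivative (\<lambda>h. 0)) (at x)" by simp
  then have "(plane_bump e has_derivative (\<lambda>h. 0)) (at x)"
  proof (rule has_derivative_transform_within_open[of _ _ _ _ "- cball 0 (2 * e)"])
    show "x \<in> - cball 0 (2 * e)" using assms by simp
    show "0 = plane_bump e y" if "y \<in> - cball 0 (2 * e)" for y
      using plane_bump_zero[OF assms(1), of y] that by simp
  qed auto
  then show ?thesis by (simp add: frechet_derivative_eqI)
qed

text \<open>By scaling, \<open>plane_bump e\<close> at x is \<open>plane_bump 1\<close> at x / e, so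
  one constant serves all \<open>e\<close>.\<close>

lemma plane_bump_deriv_bound:
  obtains c where "c \<ge> 0" "\<And>e x h. e > 0 \<Longrightarrow> \<bar>frechet_derivative (plane_bump e) (at x) h\<bar> \<le> c / e * norm h"
proof -
  let ?D = "\<lambda>x. frechet_derivative (plane_bump 1) (at x)"
  obtain c where c: "c \<ge> 0" "\<And>x h. \<bar>?D x h\<bar> \<le> c * norm h"
    using test_function_bounds[OF plane_bump_test_0[OF zero_less_one]] by metis
  show ?thesis
  proof (rule that[OF c(1)])
    fix e :: real and x h :: plane assume e: "e > 0"
    have "((\<lambda>x. x /\<^sub>R e) has_derivative (\<lambda>h. h /\<^sub>R e)) (at x)" by (auto intro!: derivative_eq_intros)
    from diff_chain_at[OF this test_function_has_derivative[OF plane_bump_test_0[OF zero_less_one]]]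
    have "((\<lambda>x. plane_bump 1 (x /\<^sub>R e)) has_derivative (\<lambda>h. ?D (x /\<^sub>R e) (h /\<^sub>R e))) (at x)" by (simp add: o_def)
    moreover have "(\<lambda>x. plane_bump 1 (x /\<^sub>R e)) = plane_bump e"
      by (rule ext) (simp add: plane_bump_def divide_inverse mult.commute)
    ultimately have "frechet_derivative (plane_bump e) (at x) h = ?D (x /\<^sub>R e) (h /\<^sub>R e)"
      by (simp add: frechet_derivative_eqI)
    then show "\<bar>frechet_derivative (plane_bump e) (at x) h\<bar> \<le> c / e * norm h"
      using c(2)[of "x /\<^sub>R e" "h /\<^sub>R e"] e by (simp add: divide_inverse mult_ac)
  qed
qed

lemma measure_plane_cball: "d \<ge> 0 \<Longrightarrow> measure lborel (cball (x::plane) d) = pi * d\<^sup>2"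
  using content_cball[of d x] by (simp add: unit_ball_vol_2)

text \<open>exp (- 8) is the square of the bound exp (- 4) of a single bump at half its radius. What
  counts later is the order e^2.\<close>

lemma plane_bump_integral_ge:
  assumes e: "e > 0"
  shows "(LINT x|lborel. plane_bump e x) \<ge> exp (- 8) * (pi * (e / 2)\<^sup>2)"
proof -
  have "(LINT x|lborel. exp (- 8) * indicator (cball (0::plane) (e / 2)) x) \<le> (LINT x|lborel. plane_bump e x)"
  proof (rule Bochner_Integration.integral_mono)
    show "integrable lborel (\<lambda>x::plane. exp (- 8) * indicator (cball 0 (e / 2)) x :: real)"
      using emeasure_bounded_finite[of "cball (0::plane) (e / 2)"] by (intro integrable_mult_right integrable_real_indicator) auto
    show "integrable lborel (plane_bump e)"
      using plane_bump_bounds[of e] plane_bump_zero[OF e]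
      by (intro integrable_compact_support[of _ 1 "2 * e"] borel_measurable_continuous_onI
          test_function_continuous[OF plane_bump_test_0[OF e]]) auto
    show "exp (- 8) * indicator (cball 0 (e / 2)) x \<le> plane_bump e x" for x :: plane
    proof (cases "x \<in> cball 0 (e / 2)")
      case True
      have b: "bump (x $ i / e) \<ge> exp (- 4)" for i
      proof (rule bump_half)
        have "\<bar>x $ i\<bar> \<le> e / 2" using component_le_norm_cart[of x i] True by simp
        then show "\<bar>x $ i / e\<bar> \<le> 1 / 2" using e by (simp add: abs_divide divide_le_eq)
      qed
      have "exp (- 4) * exp (- 4) \<le> plane_bump e x"
        unfolding plane_bump_def by (intro mult_mono b) (auto simp: bump_nonneg)
      then show ?thesis using True by (simp add: exp_add[symmetric])
    qed (simp add: plane_bump_bounds)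
  qed
  then show ?thesis using e by (simp add: measure_plane_cball)
qed

section \<open>Fubini's theorem for signed measures and commutators with mollification\<close>

lemma sint_Fubini:
  fixes k :: "plane \<Rightarrow> plane \<Rightarrow> real"
  assumes sm: "is_signed_measure \<mu>" and k: "continuous_on UNIV (\<lambda>p. k (fst p) (snd p))"
    and B: "\<And>x z. \<bar>k x z\<bar> \<le> B" and R: "\<And>x z. norm z > R \<Longrightarrow> k x z = 0"
  shows "(LINT z|lborel. sint \<mu> (\<lambda>x. k x z)) = sint \<mu> (\<lambda>x. LINT z|lborel. k x z)"
    and "integrable lborel (\<lambda>z. sint \<mu> (\<lambda>x. k x z))"
    and "bounded_borel (\<lambda>x. LINT z|lborel. k x z)"
proof -
  have B0: "B \<ge> 0" using B[of 0 0] by linarith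
  have fub: "(LINT z|lborel. LINT x|P. k x z) = (LINT x|P. LINT z|lborel. k x z)"
    "integrable lborel (\<lambda>z. LINT x|P. k x z)"
    "(\<lambda>x. LINT z|lborel. k x z) \<in> borel_measurable P"
    if P: "finite_measure P" "sets P = sets borel" for P :: "plane measure"
  proof -
    interpret P: finite_measure P by (rule P)
    interpret pair_sigma_finite P "lborel :: plane measure" ..
    have sp: "space P = UNIV" using sets_eq_imp_space_eq[OF P(2)] by simp
    have sets: "sets (P \<Otimes>\<^sub>M (lborel :: plane measure)) = sets borel"
      by (subst sets_pair_measure_cong[OF P(2) sets_lborel]) (rule arg_cong[OF borel_prod])
    have int: "integrable (P \<Otimes>\<^sub>M (lborel :: plane measure)) (case_prod k)"
    proof (rule Bochner_Integration.integrable_bound)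
      have "emeasure (P \<Otimes>\<^sub>M (lborel :: plane measure)) (UNIV \<times> cball 0 R) = emeasure P UNIV * emeasure lborel (cball (0::plane) R)"
        by (rule lborel.emeasure_pair_measure_Times) (auto simp: P(2))
      also have "\<dots> < \<infinity>"
        using P.emeasure_finite[of UNIV] emeasure_bounded_finite[of "cball (0::plane) R"]
        by (simp add: ennreal_mult_less_top ennreal_mult_eq_top_iff less_top[symmetric])
      finally show "integrable (P \<Otimes>\<^sub>M (lborel :: plane measure)) (\<lambda>p. B * indicator (UNIV \<times> cball 0 R) p)"
        by (intro integrable_mult_right integrable_real_indicator) (auto simp: P(2))
      show "case_prod k \<in> borel_measurable (P \<Otimes>\<^sub>M (lborel :: plane measure))"
        using borel_measurable_continuous_onI[OF k]
        by (simp add: case_prod_beta' measurable_cong_sets[OF sets refl])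
      show "AE p in P \<Otimes>\<^sub>M lborel. norm (case_prod k p) \<le> norm (B * indicator (UNIV \<times> cball 0 R) p)"
      proof (rule AE_I2)
        fix p :: "plane \<times> plane"
        show "norm (case_prod k p) \<le> norm (B * indicator (UNIV \<times> cball 0 R) p)"
          using B[of "fst p" "snd p"] R[of "snd p" "fst p"] B0
          by (cases p; cases "norm (snd p) \<le> R") (auto simp: indicator_def abs_mult)
      qed
    qed
    show "(LINT z|lborel. LINT x|P. k x z) = (LINT x|P. LINT z|lborel. k x z)" by (rule Fubini_integral[OF int])
    show "integrable lborel (\<lambda>z. LINT x|P. k x z)" using integrable_snd[OF int] by simp
    show "(\<lambda>x. LINT z|lborel. k x z) \<in> borel_measurable P" using integrable_fst[OF int] by (auto dest: borel_measurable_integrable)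
  qed
  note p = fub[OF finite_pos_part[OF sm] sets_pos_part[OF sm]] and n = fub[OF finite_neg_part[OF sm] sets_neg_part[OF sm]]
  show "bounded_borel (\<lambda>x. LINT z|lborel. k x z)"
    unfolding bounded_borel_def
  proof (intro conjI exI allI)
    show "(\<lambda>x. LINT z|lborel. k x z) \<in> borel_measurable borel"
      using p(3) measurable_cong_sets[OF sets_pos_part[OF sm] refl] by blast
    fix x
    have "norm (LINT z|lborel. k x z) \<le> (LINT z|lborel. B * indicator (cball (0::plane) R) z)"
    proof (rule Bochner_Integration.integral_norm_bound_integral)
      have c: "continuous_on UNIV (k x)"
        using continuous_on_compose2[OF k, of UNIV "\<lambda>z. (x, z)"] by (simp add: continuous_on_Pair continuous_on_const continuous_on_id)
      show "integrable lborel (k x)"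
        by (rule integrable_compact_support[OF borel_measurable_continuous_onI[OF c], of B R]) (use B R in auto)
      show "integrable lborel (\<lambda>z::plane. B * indicator (cball 0 R) z)"
        using emeasure_bounded_finite[of "cball (0::plane) R"] by (intro integrable_mult_right integrable_real_indicator) auto
      show "norm (k x z) \<le> B * indicator (cball 0 R) z" for z
        using B[of x z] R[of z x] by (cases "norm z \<le> R") auto
    qed
    then show "norm (LINT z|lborel. k x z) \<le> (LINT z|lborel. B * indicator (cball (0::plane) R) z)" .
  qed
  show "integrable lborel (\<lambda>z. sint \<mu> (\<lambda>x. k x z))"
    unfolding sint_def by (intro Bochner_Integration.integrable_diff p(2) n(2))
  show "(LINT z|lborel. sint \<mu> (\<lambda>x. k x z)) = sint \<mu> (\<lambda>x. LINT z|lborel. k x z)"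
    unfolding sint_def Bochner_Integration.integral_diff[OF p(2) n(2)] by (simp only: p(1) n(1))
qed

text \<open>Moving a multiplier with modulus of continuity \<open>\<omega>\<close> through a kernel supported near the diagonal.\<close>

lemma commutator_bound:
  fixes k :: "plane \<Rightarrow> plane \<Rightarrow> real"
  assumes sm: "is_signed_measure \<mu>" and k: "continuous_on UNIV (\<lambda>p. k (fst p) (snd p))"
    and B: "\<And>x z. \<bar>k x z\<bar> \<le> B" and d: "d > 0" and kd: "\<And>x z. norm (x - z) > d \<Longrightarrow> k x z = 0"
    and N: "\<And>x. (LINT z|lborel. k x z) = N"
    and \<psi>: "continuous_on UNIV \<psi>" "\<And>z. norm z > R \<Longrightarrow> \<psi> z = 0"
    and \<omega>: "\<And>x z. norm (x - z) \<le> d \<Longrightarrow> \<bar>\<psi> z - \<psi> x\<bar> \<le> \<omega>"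
  shows "\<bar>(LINT z|lborel. \<psi> z * sint \<mu> (\<lambda>x. k x z)) - N * sint \<mu> \<psi>\<bar> \<le> tv \<mu> * (\<omega> * B * (pi * d\<^sup>2))"
proof -
  have \<psi>b: "bounded_borel \<psi>" by (rule C0_vanishing_bounded_borel[OF C0_vanishingI_compact_support[OF \<psi>]])
  then obtain K where K: "\<And>x. \<bar>\<psi> x\<bar> \<le> K" by (auto simp: bounded_borel_def)
  have B0: "B \<ge> 0" using B[of 0 0] by linarith
  have K0: "K \<ge> 0" using K[of 0] by linarith
  have \<omega>0: "\<omega> \<ge> 0" using \<omega>[of 0 0] d by simp
  have kx: "continuous_on UNIV (k x)" for x
    using continuous_on_compose2[OF k, of UNIV "\<lambda>z. (x, z)"] by (simp add: continuous_on_Pair continuous_on_const continuous_on_id)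
  have kz: "continuous_on UNIV (\<lambda>x. k x z)" for z
    using continuous_on_compose2[OF k, of UNIV "\<lambda>x. (x, z)"] by (simp add: continuous_on_Pair continuous_on_const continuous_on_id)
  have kzb: "bounded_borel (\<lambda>x. k x z)" for z
    by (rule bounded_borel_continuous[OF kz, where B = B]) (use B in simp)
  have kint: "integrable lborel (k x)" for x
  proof (rule integrable_compact_support[OF borel_measurable_continuous_onI[OF kx]])
    show "norm (k x z) \<le> B" for z using B by simp
    show "k x z = 0" if "norm z > norm x + d" for z
      using that norm_triangle_ineq2[of z x] by (intro kd) (simp add: norm_minus_commute)
  qed
  have fub: "continuous_on UNIV (\<lambda>p. \<psi> (snd p) * k (fst p) (snd p))"
    by (intro continuous_on_mult k continuous_on_compose2[OF \<psi>(1)] continuous_on_snd continuous_on_id) auto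
  have fub2: "\<bar>\<psi> z * k x z\<bar> \<le> K * B" for x z
    unfolding abs_mult by (intro mult_mono K B K0) auto
  note F = sint_Fubini[OF sm fub fub2, of R]
  have \<psi>kint: "integrable lborel (\<lambda>z. \<psi> z * k x z)" for x
    by (rule integrable_compact_support[of _ "K * B" R])
      (auto intro!: borel_measurable_continuous_onI continuous_on_mult \<psi> kx simp: fub2)
  have "(LINT z|lborel. \<psi> z * sint \<mu> (\<lambda>x. k x z)) = (LINT z|lborel. sint \<mu> (\<lambda>x. \<psi> z * k x z))"
    by (simp add: sint_linear[OF sm bounded_linear_mult_right kzb])
  also have "\<dots> = sint \<mu> (\<lambda>x. LINT z|lborel. \<psi> z * k x z)"
    by (rule F(1)) (simp add: \<psi>(2))
  finally have 1: "(LINT z|lborel. \<psi> z * sint \<mu> (\<lambda>x. k x z)) = sint \<mu> (\<lambda>x. LINT z|lborel. \<psi> z * k x z)" .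
  have bb: "bounded_borel (\<lambda>x. LINT z|lborel. \<psi> z * k x z)" by (rule F(3)) (simp add: \<psi>(2))
  have bb2: "bounded_borel (\<lambda>x. N * \<psi> x)" by (rule bounded_borel_linear[OF bounded_linear_mult_right \<psi>b])
  have "N * sint \<mu> \<psi> = sint \<mu> (\<lambda>x. N * \<psi> x)" by (rule sint_linear[OF sm bounded_linear_mult_right \<psi>b, symmetric])
  then have 2: "(LINT z|lborel. \<psi> z * sint \<mu> (\<lambda>x. k x z)) - N * sint \<mu> \<psi> =
      sint \<mu> (\<lambda>x. (LINT z|lborel. \<psi> z * k x z) - N * \<psi> x)"
    unfolding 1 by (simp add: sint_diff[OF sm bb bb2])
  have "norm (sint \<mu> (\<lambda>x. (LINT z|lborel. \<psi> z * k x z) - N * \<psi> x)) \<le> tv \<mu> * (\<omega> * B * (pi * d\<^sup>2))"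
  proof (rule sint_norm_le[OF sm bounded_borel_diff[OF bb bb2]])
    fix x
    have i2: "integrable lborel (\<lambda>z. \<psi> x * k x z)" by (intro integrable_mult_right kint)
    have "(LINT z|lborel. \<psi> z * k x z) - N * \<psi> x = (LINT z|lborel. \<psi> z * k x z - \<psi> x * k x z)"
      unfolding Bochner_Integration.integral_diff[OF \<psi>kint i2] by (simp add: N)
    also have "norm \<dots> \<le> (LINT z|lborel. (\<omega> * B) * indicator (cball x d) z)"
    proof (rule Bochner_Integration.integral_norm_bound_integral)
      show "integrable lborel (\<lambda>z. \<psi> z * k x z - \<psi> x * k x z)" by (intro Bochner_Integration.integrable_diff \<psi>kint i2)
      show "integrable lborel (\<lambda>z::plane. (\<omega> * B) * indicator (cball x d) z)"
        using emeasure_bounded_finite[of "cball x d"] by (intro integrable_mult_right integrable_real_indicator) auto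
      show "norm (\<psi> z * k x z - \<psi> x * k x z) \<le> (\<omega> * B) * indicator (cball x d) z" for z
      proof (cases "norm (x - z) \<le> d")
        case True
        have "\<bar>\<psi> z - \<psi> x\<bar> * \<bar>k x z\<bar> \<le> \<omega> * B" by (intro mult_mono \<omega>[OF True] B \<omega>0) auto
        then show ?thesis using True by (simp add: left_diff_distrib[symmetric] abs_mult dist_norm)
      qed (use kd[of x z] in \<open>simp add: dist_norm\<close>)
    qed
    also have "\<dots> = \<omega> * B * (pi * d\<^sup>2)" using d by (simp add: measure_plane_cball)
    finally show "norm ((LINT z|lborel. \<psi> z * k x z) - N * \<psi> x) \<le> \<omega> * B * (pi * d\<^sup>2)" .
  qed
  then show ?thesis unfolding 2 by simp
qed

text \<open>Passes between particle labels \<open>w\<close> and positions z = \<eta> w.\<close>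

lemma integral_volume_preserving:
  fixes F G :: "plane \<Rightarrow> real"
  assumes \<eta>: "\<eta> \<in> borel_measurable borel" "distr lborel lborel \<eta> = lborel" and \<xi>: "\<xi> \<in> borel_measurable borel" "\<And>x. \<xi> (\<eta> x) = x"
    and F: "F \<in> borel_measurable borel" and G: "G \<in> borel_measurable borel"
  shows "(LINT w|lborel. F w * G (\<eta> w)) = (LINT z|lborel. F (\<xi> z) * G z)"
proof -
  have "(LINT z|lborel. F (\<xi> z) * G z) = (LINT z|distr lborel lborel \<eta>. F (\<xi> z) * G z)" by (simp add: \<eta>(2))
  also have "\<dots> = (LINT w|lborel. F (\<xi> (\<eta> w)) * G (\<eta> w))"
    using \<eta>(1) \<xi>(1) F G by (intro integral_distr) (auto intro!: borel_measurable_times measurable_compose[OF \<xi>(1) F])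
  finally show ?thesis by (simp add: \<xi>(2))
qed

section \<open>Transport of the vorticity by the flow of a weak solution\<close>

locale weak_vortex_flow =
  fixes \<alpha> :: real and q0 :: "plane set \<Rightarrow> real" and \<eta> u :: "real \<Rightarrow> plane \<Rightarrow> plane" and q :: "real \<Rightarrow> plane set \<Rightarrow> real"
  assumes \<alpha>: "\<alpha> > 0" and weak: "weak_solution \<alpha> q0 \<eta> u q" and homeos: "C1_curve_homeos \<eta>"
    and u_curve: "C0_curve_div u" and wc: "weakly_continuous_curve q"
begin

lemma q_signed: "is_signed_measure (q t)"
  using weak by (simp add: weak_solution_def radon_iff_signed_measure)

lemma u_eq: "u t = K_conv \<alpha> (q t)"
  using weak by (simp add: weak_solution_def)

lemma q_0: "q 0 = q0"
  using weak by (simp add: weak_solution_def)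

lemma \<eta>_0: "\<eta> 0 x = x" and \<eta>_deriv: "((\<lambda>s. \<eta> s x) has_vector_derivative u t (\<eta> t x)) (at t)"
  using weak by (auto simp: weak_solution_def flow_map_def)

lemma u_continuous: "continuous_on S (u t)"
  unfolding u_eq using K_conv_continuous[OF \<alpha> q_signed] continuous_on_subset by blast

lemma u_uniform_limit: "uniform_limit UNIV u (u t) (at t)"
  using u_curve by (simp add: C0_curve_div_def)

lemma \<eta>_inverse: "\<eta> t (inv (\<eta> t) x) = x" "inv (\<eta> t) (\<eta> t x) = x"
  and continuous_\<eta>: "continuous_on UNIV (\<eta> t)" "continuous_on UNIV (inv (\<eta> t))"
  and \<eta>_volume: "distr lborel lborel (\<eta> t) = lborel"
proof -
  have "\<eta> t \<in> vol_homeos" using homeos by (simp add: C1_curve_homeos_def)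
  then obtain \<xi> where h: "homeomorphism UNIV UNIV (\<eta> t) \<xi>" and v: "distr lborel lborel (\<eta> t) = lborel"
    by (auto simp: vol_homeos_def)
  then have b: "\<eta> t (\<xi> x) = x" "\<xi> (\<eta> t x) = x" for x by (auto simp: homeomorphism_def)
  then have e: "inv (\<eta> t) = \<xi>" by (intro inv_equality) auto
  show "\<eta> t (inv (\<eta> t) x) = x" "inv (\<eta> t) (\<eta> t x) = x" by (auto simp: e b)
  show "continuous_on UNIV (\<eta> t)" "continuous_on UNIV (inv (\<eta> t))" using h by (auto simp: e homeomorphism_def)
  show "distr lborel lborel (\<eta> t) = lborel" by (rule v)
qed

text \<open>Testing with a function of time times a bump turns the weak equation into a weak
  derivative identity for the pairing. The pairing and the candidate for its derivative are
  continuous in time, so the derivative is classical.\<close>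

lemma pairing_has_derivative:
  assumes e: "e > 0"
  shows "((\<lambda>t. sint (q t) (\<lambda>x. plane_bump e (x - z))) has_real_derivative
    sint (q t) (\<lambda>x. frechet_derivative (plane_bump e) (at (x - z)) (u t x))) (at t)"
proof -
  define \<phi> where "\<phi> = (\<lambda>x. plane_bump e (x - z))"
  have \<phi>: "\<phi> \<in> test_functions" unfolding \<phi>_def by (rule plane_bump_test[OF e])
  let ?D = "\<lambda>x. frechet_derivative \<phi> (at x)"
  note der = test_function_has_derivative[OF \<phi>]
  obtain R where R: "R > 0" "\<And>x. norm x > R \<Longrightarrow> \<phi> x = 0" "\<And>x h. norm x > R \<Longrightarrow> ?D x h = 0"
    using test_function_support[OF \<phi>] by blast
  obtain B where B: "B \<ge> 0" "\<And>x. \<bar>\<phi> x\<bar> \<le> B" "\<And>x h. \<bar>?D x h\<bar> \<le> B * norm h" "\<And>x y. \<bar>\<phi> x - \<phi> y\<bar> \<le> B * norm (x - y)"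
    using test_function_bounds[OF \<phi>] by blast
  have \<phi>0: "\<phi> \<in> C0_vanishing" by (rule C0_vanishingI_compact_support[OF test_function_continuous[OF \<phi>] R(2)])
  note \<phi>b = C0_vanishing_bounded_borel[OF \<phi>0]
  have D0: "(\<lambda>x. ?D x (u t x)) \<in> C0_vanishing" for t
    by (rule C0_vanishingI_compact_support[OF test_function_deriv_continuous[OF \<phi> continuous_on_id u_continuous] R(3)])
  note Db = C0_vanishing_bounded_borel[OF D0]
  let ?A = "\<lambda>t. sint (q t) \<phi>" and ?B = "\<lambda>t. sint (q t) (\<lambda>x. ?D x (u t x))"
  have A: "continuous_on UNIV ?A" using wc \<phi>0 by (simp add: weakly_continuous_curve_def)
  have lim: "uniform_limit UNIV (\<lambda>t x. ?D x (u t x)) (\<lambda>x. ?D x (u t x)) (at t)" for t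
    unfolding uniform_limit_iff
  proof (intro allI impI)
    fix d :: real assume d: "d > 0"
    then have "d / (B + 1) > 0" using B(1) by simp
    with u_uniform_limit[of t] have "\<forall>\<^sub>F s in at t. \<forall>x\<in>UNIV. dist (u s x) (u t x) < d / (B + 1)"
      unfolding uniform_limit_iff by blast
    then show "\<forall>\<^sub>F s in at t. \<forall>x\<in>UNIV. dist (?D x (u s x)) (?D x (u t x)) < d"
    proof eventually_elim
      case (elim s)
      show ?case
      proof
        fix x
        have "dist (?D x (u s x)) (?D x (u t x)) = \<bar>?D x (u s x - u t x)\<bar>"
          by (simp add: dist_real_def linear_diff[OF has_derivative_linear[OF der]])
        also have "\<dots> \<le> B * norm (u s x - u t x)" by (rule B(3))
        also have "\<dots> \<le> (B + 1) * norm (u s x - u t x)" by (intro mult_right_mono) auto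
        also have "\<dots> < d"
          using elim[rule_format, of x] B(1) by (simp add: dist_norm pos_less_divide_eq mult.commute)
        finally show "dist (?D x (u s x)) (?D x (u t x)) < d" .
      qed
    qed
  qed
  have B': "continuous_on UNIV ?B"
    unfolding continuous_on_def
    by (intro ballI sint_curve_tendsto[OF wc _ Db lim]) (simp add: D0)
  have "(?A has_real_derivative ?B t) (at t)"
  proof (rule has_derivative_of_increments[OF B'], rule weak_derivative_increments[OF A B'])
    fix \<theta> \<theta>' :: "real \<Rightarrow> real" and r
    assume \<theta>: "\<And>k. C_k k \<theta>" "\<And>t. (\<theta> has_real_derivative \<theta>' t) (at t)" "\<And>t. \<bar>t\<bar> > r \<Longrightarrow> \<theta> t = 0"
    let ?\<Phi> = "\<lambda>p. \<theta> (fst p) * plane_bump e (snd p - z)"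
    have W: "\<forall>\<phi>\<in>test_functions. (LINT t|lborel. sint (q t)
        (\<lambda>x. deriv (\<lambda>s. \<phi> (s, x)) t + u t x \<bullet> grad (\<lambda>y. \<phi> (t, y)) x)) = 0"
      using weak unfolding weak_solution_def by blast
    have "(LINT t|lborel. sint (q t)
        (\<lambda>x. deriv (\<lambda>s. ?\<Phi> (s, x)) t + u t x \<bullet> grad (\<lambda>y. ?\<Phi> (t, y)) x)) = 0"
      by (rule bspec[OF W product_test_function[OF \<theta>(1,3) e]])
    moreover have "sint (q t) (\<lambda>x. deriv (\<lambda>s. ?\<Phi> (s, x)) t + u t x \<bullet> grad (\<lambda>y. ?\<Phi> (t, y)) x) = \<theta>' t * ?A t + \<theta> t * ?B t" for t
    proof -
      have "deriv (\<lambda>s. ?\<Phi> (s, x)) t = \<theta>' t * \<phi> x" for x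
        using DERIV_cmult_right[OF \<theta>(2)[of t], of "\<phi> x"] by (simp add: \<phi>_def DERIV_imp_deriv)
      moreover have "u t x \<bullet> grad (\<lambda>y. ?\<Phi> (t, y)) x = \<theta> t * ?D x (u t x)" for x
        using inner_grad[OF has_derivative_mult_right[OF der[of x]], of "u t x" "\<theta> t"] by (simp add: \<phi>_def)
      ultimately show ?thesis
        using sint_add[OF q_signed[of t] bounded_borel_linear[OF bounded_linear_mult_right \<phi>b] bounded_borel_linear[OF bounded_linear_mult_right Db], of "\<theta>' t" "\<theta> t" t]
        by (simp add: sint_linear[OF q_signed bounded_linear_mult_right \<phi>b] sint_linear[OF q_signed bounded_linear_mult_right Db])
    qed
    ultimately show "(LINT t|lborel. \<theta>' t * ?A t + \<theta> t * ?B t) = 0" by simp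
  qed
  moreover have "?D x = frechet_derivative (plane_bump e) (at (x - z))" for x
    unfolding \<phi>_def by (rule frechet_derivative_eqI[OF plane_bump_shift_derivative[OF e]])
  ultimately show ?thesis by (simp add: \<phi>_def)
qed

lemma moving_pairing_has_derivative:
  fixes Z :: "real \<Rightarrow> plane"
  assumes e: "e > 0" and Z: "(Z has_vector_derivative v) (at t)"
  shows "((\<lambda>s. sint (q s) (\<lambda>x. plane_bump e (x - Z s))) has_real_derivative
    sint (q t) (\<lambda>x. frechet_derivative (plane_bump e) (at (x - Z t)) (u t x - v))) (at t)"
proof -
  let ?\<rho> = "plane_bump e" and ?D = "\<lambda>x. frechet_derivative (plane_bump e) (at x)"
  note \<rho> = plane_bump_test_0[OF e]
  note der = test_function_has_derivative[OF \<rho>]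
  have \<rho>c: "continuous_on UNIV ?\<rho>" by (rule test_function_continuous[OF \<rho>])
  obtain B where B: "B \<ge> 0" "\<And>x. \<bar>?\<rho> x\<bar> \<le> B" "\<And>x h. \<bar>?D x h\<bar> \<le> B * norm h" "\<And>x y. \<bar>?\<rho> x - ?\<rho> y\<bar> \<le> B * norm (x - y)"
    using test_function_bounds[OF \<rho>] by blast
  obtain C where C: "C \<ge> 0" "\<And>x h. \<bar>?\<rho> (x + h) - ?\<rho> x - ?D x h\<bar> \<le> C * norm h * norm h"
    using test_function_taylor[OF \<rho>] by blast
  define w where "w s = (Z s - Z t) /\<^sub>R (s - t)" for s
  have wlim: "(w \<longlongrightarrow> v) (at t)"
  proof -
    have "((\<lambda>s. norm ((Z s - Z t - (s - t) *\<^sub>R v) /\<^sub>R norm (s - t))) \<longlongrightarrow> 0) (at t)"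
      using Z unfolding has_vector_derivative_def has_derivative_at_within by (intro tendsto_norm_zero) simp
    then have "((\<lambda>s. norm (w s - v)) \<longlongrightarrow> 0) (at t)"
    proof (rule Lim_transform_eventually)
      have "norm ((Z s - Z t - (s - t) *\<^sub>R v) /\<^sub>R norm (s - t)) = norm (w s - v)" if "s \<noteq> t" for s
      proof -
        have "w s - v = (Z s - Z t - (s - t) *\<^sub>R v) /\<^sub>R (s - t)"
          using that by (simp add: w_def scaleR_diff_right)
        then show ?thesis by simp
      qed
      then show "\<forall>\<^sub>F s in at t. norm ((Z s - Z t - (s - t) *\<^sub>R v) /\<^sub>R norm (s - t)) = norm (w s - v)"
        by (simp add: eventually_at_filter)
    qed
    then show ?thesis by (simp add: LIM_zero_cancel tendsto_norm_zero_iff)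
  qed
  have Zlim: "(Z \<longlongrightarrow> Z t) (at t)"
    using has_vector_derivative_continuous[OF Z] by (simp add: continuous_at)
  \<comment> \<open>The quotient that comes from moving the centre alone, completed at s = t by its
    limit so that \<open>sint_curve_tendsto\<close> applies.\<close>
  define f where "f s x = (if s = t then - ?D (x - Z t) v else (?\<rho> (x - Z s) - ?\<rho> (x - Z t)) / (s - t))" for s x
  have far: "?\<rho> (x - Z s) = 0 \<and> ?D (x - Z s) h = 0" if "norm x > norm (Z s) + norm (Z t) + 2 * e" for x s h
  proof -
    have "norm (x - Z s) \<ge> norm x - norm (Z s)" by (rule norm_triangle_ineq2)
    then have "norm (x - Z s) > 2 * e" using that norm_ge_zero[of "Z t"] by linarith
    then show ?thesis using plane_bump_zero[OF e] plane_bump_deriv_zero[OF e] by auto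
  qed
  have f0: "f s \<in> C0_vanishing" for s
  proof (rule C0_vanishingI_compact_support)
    have "continuous_on UNIV (\<lambda>x. - ?D (x - Z t) v)"
      by (intro continuous_on_minus test_function_deriv_continuous[OF \<rho>] continuous_intros)
    moreover have "continuous_on UNIV (\<lambda>x. (?\<rho> (x - Z s) - ?\<rho> (x - Z t)) / (s - t))" if "s \<noteq> t"
      using that by (intro continuous_intros continuous_on_compose2[OF \<rho>c]) auto
    ultimately show "continuous_on UNIV (f s)" by (cases "s = t") (simp_all add: f_def[abs_def])
    show "f s x = 0" if "norm x > norm (Z s) + norm (Z t) + 2 * e" for x
    proof -
      have "norm (x - Z t) \<ge> norm x - norm (Z t)" by (rule norm_triangle_ineq2)
      then have "norm (x - Z t) > 2 * e" using that norm_ge_zero[of "Z s"] by linarith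
      then have "?\<rho> (x - Z t) = 0" "?D (x - Z t) v = 0" using plane_bump_zero[OF e] plane_bump_deriv_zero[OF e] by auto
      then show ?thesis using far[OF that] by (simp add: f_def)
    qed
  qed
  note fb = C0_vanishing_bounded_borel[OF f0]
  have est: "\<bar>f s x - f t x\<bar> \<le> C * norm (w s) * norm (Z s - Z t) + B * norm (w s - v)" if s: "s \<noteq> t" for s x
  proof -
    let ?h = "- (Z s - Z t)"
    have "f s x - f t x = (?\<rho> ((x - Z t) + ?h) - ?\<rho> (x - Z t) - ?D (x - Z t) ?h) / (s - t) + (?D (x - Z t) ?h / (s - t) + ?D (x - Z t) v)"
      using s by (simp add: f_def diff_divide_distrib)
    also have "?D (x - Z t) ?h / (s - t) + ?D (x - Z t) v = ?D (x - Z t) (- (w s - v))"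
    proof -
      note lin = has_derivative_linear[OF der[of "x - Z t"]]
      have "?D (x - Z t) ?h / (s - t) = ?D (x - Z t) (?h /\<^sub>R (s - t))"
        by (simp only: linear_scale[OF lin] divide_inverse mult.commute real_scaleR_def)
      moreover have "?h /\<^sub>R (s - t) + v = - (w s - v)" by (simp add: w_def scaleR_diff_right)
      ultimately show ?thesis by (metis linear_add[OF lin])
    qed
    finally have "\<bar>f s x - f t x\<bar> \<le> \<bar>?\<rho> ((x - Z t) + ?h) - ?\<rho> (x - Z t) - ?D (x - Z t) ?h\<bar> / \<bar>s - t\<bar> + \<bar>?D (x - Z t) (- (w s - v))\<bar>"
      by (metis abs_divide abs_triangle_ineq)
    also have "\<dots> \<le> (C * norm ?h * norm ?h) / \<bar>s - t\<bar> + B * norm (- (w s - v))"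
      by (intro add_mono divide_right_mono C(2) B(3)) auto
    also have "(C * norm ?h * norm ?h) / \<bar>s - t\<bar> = C * norm (w s) * norm (Z s - Z t)"
      by (simp add: w_def divide_inverse norm_minus_commute)
    finally show ?thesis by (simp add: norm_minus_commute)
  qed
  have flim: "uniform_limit UNIV f (f t) (at t)"
    unfolding uniform_limit_iff
  proof (intro allI impI)
    fix d :: real assume d: "d > 0"
    have "((\<lambda>s. C * norm (w s) * norm (Z s - Z t) + B * norm (w s - v)) \<longlongrightarrow> C * norm v * norm (Z t - Z t) + B * norm (v - v)) (at t)"
      by (intro tendsto_intros wlim Zlim)
    then have "((\<lambda>s. C * norm (w s) * norm (Z s - Z t) + B * norm (w s - v)) \<longlongrightarrow> 0) (at t)" by simp
    from order_tendstoD(2)[OF this d] have "\<forall>\<^sub>F s in at t. C * norm (w s) * norm (Z s - Z t) + B * norm (w s - v) < d" .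
    moreover have "\<forall>\<^sub>F s in at t. s \<noteq> t" by (simp add: eventually_at_filter)
    ultimately show "\<forall>\<^sub>F s in at t. \<forall>x\<in>UNIV. dist (f s x) (f t x) < d"
    proof eventually_elim
      case (elim s)
      show ?case using est[OF elim(2)] elim(1) by (auto simp: dist_real_def intro: le_less_trans)
    qed
  qed
  let ?P = "\<lambda>s z. sint (q s) (\<lambda>x. ?\<rho> (x - z))"
  have \<rho>b: "bounded_borel (\<lambda>x. ?\<rho> (x - z))" for z
    using B(2) by (intro bounded_borel_continuous[of _ B] continuous_on_compose2[OF \<rho>c] continuous_intros) auto
  have Db: "bounded_borel (\<lambda>x. ?D (x - Z t) (h x))" if "continuous_on UNIV h" "\<And>x. norm (h x) \<le> K" for h :: "plane \<Rightarrow> plane" and K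
  proof (rule bounded_borel_continuous)
    show "continuous_on UNIV (\<lambda>x. ?D (x - Z t) (h x))"
      by (intro test_function_deriv_continuous[OF \<rho>] continuous_intros that)
    show "norm (?D (x - Z t) (h x)) \<le> B * K" for x
      using B(3)[of "x - Z t" "h x"] mult_left_mono[OF that(2)[of x] B(1)] by simp
  qed
  have Du: "bounded_borel (\<lambda>x. ?D (x - Z t) (u t x))"
    by (rule Db[OF u_continuous]) (unfold u_eq, rule K_conv_le[OF \<alpha> q_signed])
  have Dv: "bounded_borel (\<lambda>x. ?D (x - Z t) v)" by (rule Db[of _ "norm v"]) auto
  have "((\<lambda>s. sint (q s) (f s)) \<longlongrightarrow> sint (q t) (f t)) (at t)"
    by (rule sint_curve_tendsto[OF wc _ fb flim]) (simp add: f0)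
  moreover have "((\<lambda>s. (?P s (Z t) - ?P t (Z t)) / (s - t)) \<longlongrightarrow> sint (q t) (\<lambda>x. ?D (x - Z t) (u t x))) (at t)"
    using pairing_has_derivative[OF e, of "Z t" t] by (simp add: has_field_derivative_iff)
  ultimately have "((\<lambda>s. sint (q s) (f s) + (?P s (Z t) - ?P t (Z t)) / (s - t)) \<longlongrightarrow>
      sint (q t) (f t) + sint (q t) (\<lambda>x. ?D (x - Z t) (u t x))) (at t)"
    by (rule tendsto_add)
  moreover have "\<forall>\<^sub>F s in at t. sint (q s) (f s) + (?P s (Z t) - ?P t (Z t)) / (s - t) = (?P s (Z s) - ?P t (Z t)) / (s - t)"
  proof -
    have "sint (q s) (f s) + (?P s (Z t) - ?P t (Z t)) / (s - t) = (?P s (Z s) - ?P t (Z t)) / (s - t)" if "s \<noteq> t" for s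
    proof -
      have "sint (q s) (f s) = sint (q s) (\<lambda>x. (?\<rho> (x - Z s) - ?\<rho> (x - Z t)) / (s - t))"
        using that by (simp add: f_def[abs_def])
      also have "\<dots> = (?P s (Z s) - ?P s (Z t)) / (s - t)"
        by (simp add: sint_linear[OF q_signed bounded_linear_divide bounded_borel_diff[OF \<rho>b \<rho>b]] sint_diff[OF q_signed \<rho>b \<rho>b])
      finally show ?thesis by (simp add: diff_divide_distrib)
    qed
    then show ?thesis by (simp add: eventually_at_filter)
  qed
  moreover have "sint (q t) (f t) + sint (q t) (\<lambda>x. ?D (x - Z t) (u t x)) = sint (q t) (\<lambda>x. ?D (x - Z t) (u t x - v))"
  proof -
    have "sint (q t) (f t) = - sint (q t) (\<lambda>x. ?D (x - Z t) v)"
      using sint_linear[OF q_signed bounded_linear_minus[OF bounded_linear_ident] Dv, of t] by (simp add: f_def[abs_def])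
    moreover have "sint (q t) (\<lambda>x. ?D (x - Z t) (u t x - v)) = sint (q t) (\<lambda>x. ?D (x - Z t) (u t x)) - sint (q t) (\<lambda>x. ?D (x - Z t) v)"
      by (simp add: linear_diff[OF has_derivative_linear[OF der]] sint_diff[OF q_signed Du Dv])
    ultimately show ?thesis by simp
  qed
  ultimately have "((\<lambda>s. (?P s (Z s) - ?P t (Z t)) / (s - t)) \<longlongrightarrow> sint (q t) (\<lambda>x. ?D (x - Z t) (u t x - v))) (at t)"
    using Lim_transform_eventually by fastforce
  then show ?thesis by (simp add: has_field_derivative_iff)
qed

end

context weak_vortex_flow
begin

text \<open>The bound on total variations reaches one unit of time beyond \<open>T\<close>, so that
  derivatives at times up to \<open>T\<close> have a full neighbourhood in which it holds.\<close>

context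
  fixes T Q :: real
  assumes T: "T \<ge> 0" and Q: "\<And>t. \<bar>t\<bar> \<le> T + 1 \<Longrightarrow> tv (q t) \<le> Q"
begin

lemma Q_nonneg: "Q \<ge> 0"
  using Q[of 0] tv_nonneg[of "q 0"] T by simp

lemma u_le: "\<bar>t\<bar> \<le> T + 1 \<Longrightarrow> norm (u t x) \<le> Q * kern_bound \<alpha>"
proof -
  assume t: "\<bar>t\<bar> \<le> T + 1"
  have "0 \<le> kern_bound \<alpha>" using kern_le[OF \<alpha>, of 0] norm_ge_zero order_trans by blast
  then show ?thesis
    using K_conv_le[OF \<alpha> q_signed, of t x] mult_right_mono[OF Q[OF t]] unfolding u_eq by fastforce
qed

lemma speed_nonneg: "Q * kern_bound \<alpha> \<ge> 0"
  using u_le[of 0 0] T norm_ge_zero[of "u 0 0"] by linarith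

lemma u_modulus:
  assumes "\<bar>t\<bar> \<le> T + 1" "0 < d" "d \<le> 1"
  shows "norm (u t x - u t y) \<le> Q * kern_const \<alpha> * (log_mod d * norm (x - y) + d)"
proof -
  have "norm (u t x - u t y) \<le> tv (q t) * kern_const \<alpha> * (log_mod d * norm (x - y) + d)"
    unfolding u_eq by (rule K_conv_modulus[OF \<alpha> q_signed assms(2,3)])
  also have "\<dots> \<le> Q * kern_const \<alpha> * (log_mod d * norm (x - y) + d)"
    using log_mod_ge_1[OF assms(2,3)] assms(2)
    by (intro mult_right_mono Q assms(1) kern_const_nonneg[OF \<alpha>] add_nonneg_nonneg mult_nonneg_nonneg) auto
  finally show ?thesis .
qed

lemma displacement_le:
  assumes t: "\<bar>t\<bar> \<le> T + 1"
  shows "norm (\<eta> t x - x) \<le> Q * kern_bound \<alpha> * (T + 1)"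
proof -
  let ?M = "Q * kern_bound \<alpha>"
  \<comment> \<open>With growth rate 0 Gronwall's inequality is a bound by speed times time.\<close>
  have "norm (\<eta> t x - x) \<le> exp (0 * \<bar>t - 0\<bar>) * (norm (\<eta> 0 x - x) + ?M * \<bar>t - 0\<bar>)"
  proof (rule gronwall[where y' = "\<lambda>r. u r (\<eta> r x)"])
    fix r assume r: "r \<in> closed_segment 0 t"
    show "((\<lambda>r. \<eta> r x - x) has_vector_derivative u r (\<eta> r x)) (at r)"
      using has_vector_derivative_diff[OF \<eta>_deriv has_vector_derivative_const] by simp
    have "\<bar>r\<bar> \<le> T + 1" using segment_bound1[OF r] t by simp
    from u_le[OF this] show "norm (u r (\<eta> r x)) \<le> 0 * norm (\<eta> r x - x) + ?M" by simp
  qed (use speed_nonneg in auto)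
  also have "\<dots> \<le> ?M * (T + 1)"
    using mult_left_mono[OF t speed_nonneg] by (simp add: \<eta>_0)
  finally show ?thesis .
qed

text \<open>Gronwall at scale \<open>h\<^sup>2\<close>: over a short time the logarithm costs at most a factor
  \<open>exp (log_mod h\<^sup>2 / 2)\<close>, a multiple of \<open>1 / h\<close>.\<close>

lemma flow_hoelder:
  assumes r: "\<bar>r\<bar> \<le> T" and s: "\<bar>s\<bar> \<le> T" and short: "Q * kern_const \<alpha> * \<bar>s - r\<bar> \<le> 1 / 2"
    and h: "0 < h" "h \<le> 1" and d: "norm (\<eta> r a - \<eta> r b) \<le> h\<^sup>2"
  shows "norm (\<eta> s a - \<eta> s b) \<le> 3 * h"
proof -
  let ?L = "Q * kern_const \<alpha>"
  have d1: "0 < h\<^sup>2" "h\<^sup>2 \<le> 1" using h by (auto intro: power_le_one)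
  have lm: "log_mod (h\<^sup>2) \<ge> 1" by (rule log_mod_ge_1[OF d1])
  have L0: "?L \<ge> 0" by (intro mult_nonneg_nonneg Q_nonneg kern_const_nonneg[OF \<alpha>])
  have "norm (\<eta> s a - \<eta> s b) \<le> exp (?L * log_mod (h\<^sup>2) * \<bar>s - r\<bar>) * (norm (\<eta> r a - \<eta> r b) + ?L * h\<^sup>2 * \<bar>s - r\<bar>)"
  proof (rule gronwall[where y' = "\<lambda>r. u r (\<eta> r a) - u r (\<eta> r b)"])
    fix p assume p: "p \<in> closed_segment r s"
    show "((\<lambda>r. \<eta> r a - \<eta> r b) has_vector_derivative u p (\<eta> p a) - u p (\<eta> p b)) (at p)"
      by (intro has_vector_derivative_diff \<eta>_deriv)
    have "closed_segment r s \<subseteq> cball 0 T" using r s by (intro closed_segment_subset) auto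
    then have "\<bar>p\<bar> \<le> T + 1" using p by auto
    from u_modulus[OF this d1] show "norm (u p (\<eta> p a) - u p (\<eta> p b)) \<le> ?L * log_mod (h\<^sup>2) * norm (\<eta> p a - \<eta> p b) + ?L * h\<^sup>2"
      by (simp add: distrib_left mult.assoc)
  qed (use L0 lm in auto)
  also have "\<dots> \<le> exp (1 / 2 * log_mod (h\<^sup>2)) * (h\<^sup>2 + 1 / 2 * h\<^sup>2)"
  proof (rule mult_mono[OF _ add_mono[OF d]])
    have "(?L * \<bar>s - r\<bar>) * log_mod (h\<^sup>2) \<le> 1 / 2 * log_mod (h\<^sup>2)" using short lm by (intro mult_right_mono) auto
    then show "exp (?L * log_mod (h\<^sup>2) * \<bar>s - r\<bar>) \<le> exp (1 / 2 * log_mod (h\<^sup>2))" by (simp add: mult_ac)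
    have "(?L * \<bar>s - r\<bar>) * h\<^sup>2 \<le> 1 / 2 * h\<^sup>2" using short by (intro mult_right_mono) auto
    then show "?L * h\<^sup>2 * \<bar>s - r\<bar> \<le> 1 / 2 * h\<^sup>2" by (simp add: mult_ac)
  qed (use L0 in auto)
  also have "exp (1 / 2 * log_mod (h\<^sup>2)) = exp (1 / 2) * (1 / h)"
  proof -
    have "1 / 2 * log_mod (h\<^sup>2) = 1 / 2 + - ln h"
      using h ln_realpow[of h 2] by (simp add: log_mod_def)
    then show ?thesis using h by (simp only: exp_add exp_minus exp_ln divide_inverse mult_1)
  qed
  also have "exp (1 / 2) * (1 / h) * (h\<^sup>2 + 1 / 2 * h\<^sup>2) = exp (1 / 2) * (3 / 2 * h)"
    using h by (simp add: power2_eq_square field_simps)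
  also have "\<dots> \<le> 2 * (3 / 2 * h)" using h exp_half_le2 by (intro mult_right_mono) auto
  finally show ?thesis by simp
qed

text \<open>The mollification radius is tied to \<open>h\<^sup>2\<close>; the right-hand side vanishes as \<open>h \<rightarrow> 0\<close> because
  \<open>\<psi>\<close> oscillates by \<open>O(h)\<close> on that scale, which beats the factor \<open>log_mod h\<^sup>2\<close>.\<close>

lemma transport_estimate:
  assumes s: "\<bar>s\<bar> \<le> T" and t: "\<bar>t\<bar> \<le> T" and short: "Q * kern_const \<alpha> * \<bar>t - s\<bar> \<le> 1 / 2"
    and f: "continuous_on UNIV f" "\<And>x. norm x > R \<Longrightarrow> f x = 0" "\<And>x y. \<bar>f x - f y\<bar> \<le> Bf * norm (x - y)"
    and c: "c \<ge> 0" "\<And>e x h. e > 0 \<Longrightarrow> \<bar>frechet_derivative (plane_bump e) (at x) h\<bar> \<le> c / e * norm h"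
    and h: "0 < h" "h \<le> 1"
  shows "\<bar>sint (q t) (\<lambda>x. f (\<eta> s (inv (\<eta> t) x))) - sint (q s) f\<bar> \<le>
    16 * exp 8 * (Q * (3 * Bf * h)) * (2 + 4 * c * (Q * kern_const \<alpha>) * log_mod (h\<^sup>2) * \<bar>t - s\<bar>)"
proof -
  define d where "d = h\<^sup>2"
  \<comment> \<open>\<open>plane_bump e\<close> vanishes outside the ball of radius 2 e = d, the
    scale on which \<open>flow_hoelder\<close> controls \<psi>.\<close>
  define e where "e = d / 2"
  have d: "0 < d" "d \<le> 1" using h by (auto simp: d_def intro: power_le_one)
  have e: "e > 0" "2 * e = d" using d by (auto simp: e_def)
  let ?L = "Q * kern_const \<alpha>" and ?M = "Q * kern_bound \<alpha>"
  let ?\<rho> = "plane_bump e" and ?D = "\<lambda>x. frechet_derivative (plane_bump e) (at x)"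
  note \<rho> = plane_bump_test_0[OF e(1)]
  note der = test_function_has_derivative[OF \<rho>]
  have \<rho>c: "continuous_on UNIV ?\<rho>" by (rule test_function_continuous[OF \<rho>])
  have \<rho>sub: "continuous_on S (\<lambda>p. ?\<rho> (X p - Y p))" if "continuous_on S X" "continuous_on S Y" for S and X Y :: "'p::topological_space \<Rightarrow> plane"
    using that by (intro continuous_on_compose2[OF \<rho>c] continuous_intros) auto
  have L0: "?L \<ge> 0" by (intro mult_nonneg_nonneg Q_nonneg kern_const_nonneg[OF \<alpha>])
  have lm: "log_mod d \<ge> 1" by (rule log_mod_ge_1[OF d])
  have Bf0: "Bf \<ge> 0" using f(3)[of "axis 1 1" 0] by (simp add: norm_axis_1)
  \<comment> \<open>In the label \<open>w\<close> the multiplier is \<open>F\<close>, independent of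
    time; as a function of the position at time \<open>r\<close> it is \<open>\<psi> r\<close>,
    constant along particle paths.\<close>
  define F where "F w = f (\<eta> s w)" for w
  define \<psi> where "\<psi> r z = F (inv (\<eta> r) z)" for r z
  define RF where "RF = R + ?M * (T + 1)"
  have Fc: "continuous_on UNIV F" unfolding F_def by (intro continuous_on_compose2[OF f(1)] continuous_\<eta>) auto
  have F0: "F w = 0" if "norm w > RF" for w
  proof -
    have "norm w - norm (\<eta> s w) \<le> ?M * (T + 1)"
      using displacement_le[of s w] s norm_triangle_ineq2[of w "\<eta> s w"] by (simp add: norm_minus_commute)
    then have "norm (\<eta> s w) > R" using that unfolding RF_def by linarith
    then show ?thesis by (simp add: F_def f(2))
  qed
  obtain K where K: "\<And>w. \<bar>F w\<bar> \<le> K"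
    using C0_vanishing_bounded_borel[OF C0_vanishingI_compact_support[OF Fc F0]] by (auto simp: bounded_borel_def)
  have K0: "K \<ge> 0" using K[of 0] by linarith
  have Fm: "F \<in> borel_measurable borel" by (rule borel_measurable_continuous_onI[OF Fc])
  have \<psi>c: "continuous_on UNIV (\<psi> r)" for r
    unfolding \<psi>_def by (intro continuous_on_compose2[OF Fc] continuous_\<eta>) auto
  define \<omega> where "\<omega> = 3 * Bf * h"
  have \<omega>0: "\<omega> \<ge> 0" using Bf0 h by (simp add: \<omega>_def)
  have seg: "\<bar>r\<bar> \<le> T" "?L * \<bar>s - r\<bar> \<le> 1 / 2" if "r \<in> closed_segment s t" for r
  proof -
    have "closed_segment s t \<subseteq> cball 0 T" using s t by (intro closed_segment_subset) auto
    then show "\<bar>r\<bar> \<le> T" using that by auto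
    have "?L * \<bar>s - r\<bar> \<le> ?L * \<bar>t - s\<bar>" using segment_bound1[OF that] L0 by (intro mult_left_mono) auto
    then show "?L * \<bar>s - r\<bar> \<le> 1 / 2" using short by linarith
  qed
  have \<psi>0: "\<psi> r z = 0" if r: "r \<in> closed_segment s t" and "norm z > RF + ?M * (T + 1)" for r z
  proof -
    have "norm z - norm (inv (\<eta> r) z) \<le> ?M * (T + 1)"
      using displacement_le[of r "inv (\<eta> r) z"] seg(1)[OF r] norm_triangle_ineq2[of z "inv (\<eta> r) z"] by (simp add: \<eta>_inverse)
    then have "norm (inv (\<eta> r) z) > RF" using that by linarith
    then show ?thesis by (simp add: \<psi>_def F0)
  qed
  have \<psi>\<omega>: "\<bar>\<psi> r z - \<psi> r x\<bar> \<le> \<omega>" if r: "r \<in> closed_segment s t" and xz: "norm (x - z) \<le> d" for r x z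
  proof -
    have "norm (\<eta> s (inv (\<eta> r) z) - \<eta> s (inv (\<eta> r) x)) \<le> 3 * h"
      using xz by (intro flow_hoelder[OF seg(1)[OF r] s seg(2)[OF r] h]) (simp add: \<eta>_inverse d_def norm_minus_commute)
    then have "Bf * norm (\<eta> s (inv (\<eta> r) z) - \<eta> s (inv (\<eta> r) x)) \<le> Bf * (3 * h)" by (intro mult_left_mono Bf0)
    then show ?thesis
      using f(3)[of "\<eta> s (inv (\<eta> r) z)" "\<eta> s (inv (\<eta> r) x)"] by (simp add: \<psi>_def F_def \<omega>_def)
  qed
  have cov: "(LINT w|lborel. F w * G (\<eta> r w)) = (LINT z|lborel. \<psi> r z * G z)" if "continuous_on UNIV G" for r G
    unfolding \<psi>_def
    by (intro integral_volume_preserving[OF borel_measurable_continuous_onI[OF continuous_\<eta>(1)] \<eta>_volume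
          borel_measurable_continuous_onI[OF continuous_\<eta>(2)] \<eta>_inverse(2) Fm] borel_measurable_continuous_onI that)
  define N where "N = (LINT x|lborel. ?\<rho> x)"
  define P where "P r z = sint (q r) (\<lambda>x. ?\<rho> (x - z))" for r z
  define P' where "P' r z = sint (q r) (\<lambda>x. ?D (x - z) (u r x - u r z))" for r z
  \<comment> \<open>The integral of \<open>\<psi> r\<close> against the mollified vorticity, written
    in labels by volume preservation (\<open>cov\<close>). Only the pairing with the bump along a
    particle path has to be differentiated.\<close>
  define H where "H r = (LINT w|lborel. F w * P r (\<eta> r w))" for r
  define H' where "H' r = (LINT w|lborel. F w * P' r (\<eta> r w))" for r
  have Dc: "continuous_on UNIV (\<lambda>p. ?D (X p - Y p) (u r (X p) - u r (Y p)))"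
    if "continuous_on UNIV X" "continuous_on UNIV Y" for r and X Y :: "'p::topological_space \<Rightarrow> plane"
    using that by (intro test_function_deriv_continuous[OF \<rho>] continuous_intros continuous_on_compose2[OF u_continuous]) auto
  have Dbd: "\<bar>?D (x - z) (u r x - u r z)\<bar> \<le> c / e * (2 * ?M)" if "\<bar>r\<bar> \<le> T + 1" for r x z
  proof -
    have "\<bar>?D (x - z) (u r x - u r z)\<bar> \<le> c / e * norm (u r x - u r z)" by (rule c(2)[OF e(1)])
    also have "\<dots> \<le> c / e * (2 * ?M)"
      using norm_triangle_ineq4[of "u r x" "u r z"] u_le[OF that, of x] u_le[OF that, of z] c(1) e(1) by (intro mult_left_mono) auto
    finally show ?thesis .
  qed
  have Pc: "continuous_on UNIV (P r)" for r
    unfolding P_def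
  proof (rule continuous_on_sint[OF q_signed])
    show "norm (?\<rho> (x - z)) \<le> 1" for x z using plane_bump_bounds[of e "x - z"] by simp
  qed (auto intro!: borel_measurable_continuous_onI \<rho>sub continuous_intros)
  have P'c: "continuous_on UNIV (P' r)" if "\<bar>r\<bar> \<le> T + 1" for r
    unfolding P'_def
  proof (rule continuous_on_sint[OF q_signed])
    show "norm (?D (x - z) (u r x - u r z)) \<le> c / e * (2 * ?M)" for x z using Dbd[OF that] by simp
  qed (auto intro!: borel_measurable_continuous_onI Dc continuous_intros)
  have P1: "\<bar>P r z\<bar> \<le> Q" if "\<bar>r\<bar> \<le> T + 1" for r z
  proof -
    have "norm (P r z) \<le> tv (q r) * 1"
      unfolding P_def using plane_bump_bounds[of e]
      by (intro sint_norm_le[OF q_signed] bounded_borel_continuous[of _ 1] \<rho>sub continuous_intros) auto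
    then show ?thesis using Q[OF that] by simp
  qed
  have P'1: "\<bar>P' r z\<bar> \<le> Q * (c / e * (2 * ?M))" if "\<bar>r\<bar> \<le> T + 1" for r z
  proof -
    have "norm (P' r z) \<le> tv (q r) * (c / e * (2 * ?M))"
      unfolding P'_def using Dbd[OF that]
      by (intro sint_norm_le[OF q_signed] bounded_borel_continuous[of _ "c / e * (2 * ?M)"] Dc continuous_intros) auto
    also have "\<dots> \<le> Q * (c / e * (2 * ?M))"
      using Q[OF that] c(1) e(1) speed_nonneg by (intro mult_right_mono) auto
    finally show ?thesis by simp
  qed
  have Pder: "((\<lambda>r. P r (\<eta> r w)) has_real_derivative P' r (\<eta> r w)) (at r)" for r w
    unfolding P_def P'_def by (rule moving_pairing_has_derivative[OF e(1) \<eta>_deriv])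
  have Hder: "(H has_real_derivative H' r) (at r)" if r: "\<bar>r\<bar> \<le> T" for r
  proof -
    have near: "\<bar>r'\<bar> \<le> T + 1" if "r' \<in> ball r 1" for r' using that r by (auto simp: dist_real_def abs_if split: if_splits)
    let ?C = "Q * (c / e * (2 * ?M))"
    have "(H has_derivative (\<lambda>v. LINT w|lborel. (F w * P' r (\<eta> r w)) * v)) (at r)"
      unfolding H_def
    proof (rule has_derivative_integral(1)[OF zero_less_one, where B = "\<lambda>w. \<bar>F w\<bar> * ?C"])
      show "((\<lambda>r. F w * P r (\<eta> r w)) has_derivative (*) (F w * P' r (\<eta> r w))) (at r)" for w
        using DERIV_cmult[OF Pder[of w r], of "F w"] by (simp add: has_field_derivative_def)
      show "integrable lborel (\<lambda>w. F w * P r' (\<eta> r' w))" if "r' \<in> ball r 1" for r'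
      proof (rule integrable_compact_support[of _ "K * Q" RF])
        show "(\<lambda>w. F w * P r' (\<eta> r' w)) \<in> borel_measurable borel"
          by (intro borel_measurable_continuous_onI continuous_on_mult Fc continuous_on_compose2[OF Pc] continuous_\<eta>) auto
        show "norm (F w * P r' (\<eta> r' w)) \<le> K * Q" for w
          unfolding real_norm_def abs_mult by (intro mult_mono K P1 near[OF that] K0) auto
      qed (simp add: F0)
      show "integrable lborel (\<lambda>w. \<bar>F w\<bar> * ?C)"
        using K Fm F0 by (intro integrable_mult_left integrable_abs integrable_compact_support[of F K RF]) auto
      show "norm (F w * P r' (\<eta> r' w) - F w * P r (\<eta> r w)) \<le> \<bar>F w\<bar> * ?C * norm (r' - r)" if r': "r' \<in> ball r 1" for r' w
      proof -
        have "norm (P r' (\<eta> r' w) - P r (\<eta> r w)) \<le> ?C * norm (r' - r)"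
        proof (rule field_differentiable_bound[OF convex_ball[of r 1]])
          show "((\<lambda>r. P r (\<eta> r w)) has_field_derivative P' p (\<eta> p w)) (at p within ball r 1)" for p
            by (rule has_field_derivative_at_within[OF Pder])
          show "norm (P' p (\<eta> p w)) \<le> ?C" if "p \<in> ball r 1" for p using P'1[OF near[OF that]] by simp
        qed (use r' in auto)
        then have "\<bar>F w\<bar> * norm (P r' (\<eta> r' w) - P r (\<eta> r w)) \<le> \<bar>F w\<bar> * (?C * norm (r' - r))" by (intro mult_left_mono) auto
        then show ?thesis by (simp only: right_diff_distrib[symmetric] real_norm_def abs_mult mult.assoc)
      qed
    qed
    then show ?thesis by (simp add: has_field_derivative_def H'_def mult_commute_abs)
  qed
  \<comment> \<open>Within distance d velocities differ by at most 2 d times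
    \<open>?L * log_mod d\<close>, and the derivative of the bump is at most c / e = 2 c / d. The
    powers of d cancel and the logarithm remains.\<close>
  define B2 where "B2 = 4 * c * ?L * log_mod d"
  have B20: "B2 \<ge> 0" unfolding B2_def using c(1) L0 lm by simp
  have H'le: "\<bar>H' r\<bar> \<le> Q * (\<omega> * B2 * (pi * d\<^sup>2))" if r: "r \<in> closed_segment s t" for r
  proof -
    have r1: "\<bar>r\<bar> \<le> T + 1" using seg(1)[OF r] by simp
    let ?k = "\<lambda>x z. ?D (x - z) (u r x - u r z)"
    have zero: "?k x z = 0" if "norm (x - z) > d" for x z using plane_bump_deriv_zero[OF e(1)] that e(2) by simp
    have bound: "\<bar>?k x z\<bar> \<le> B2" for x z
    proof (cases "norm (x - z) > d")
      case False
      have "norm (u r x - u r z) \<le> ?L * (log_mod d * norm (x - z) + d)" by (rule u_modulus[OF r1 d])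
      also have "\<dots> \<le> ?L * (log_mod d * d + log_mod d * d)"
        using False lm d L0 by (intro mult_left_mono add_mono) auto
      finally have "\<bar>?k x z\<bar> \<le> c / e * (?L * (log_mod d * d + log_mod d * d))"
        using c e(1) by (intro order_trans[OF c(2)[OF e(1)]] mult_left_mono) auto
      also have "\<dots> = B2" using d by (simp add: e_def B2_def field_simps)
      finally show ?thesis .
    qed (use zero B20 in simp)
    \<comment> \<open>The part with the fixed vector \<open>u r x\<close> is a directional
      derivative of a compactly supported function; the part with \<open>u r z\<close> is the
      divergence condition tested with the bump centred at \<open>x\<close>.\<close>
    have int0: "(LINT z|lborel. ?k x z) = 0" for x
    proof -
      let ?g = "\<lambda>z. ?\<rho> (x - z)"
      have gder: "(?g has_derivative (\<lambda>v. - ?D (x - z) v)) (at z)" for z by (rule plane_bump_reflect_derivative[OF e(1)])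
      obtain B where B: "B \<ge> 0" "\<And>x. \<bar>?\<rho> x\<bar> \<le> B" "\<And>x h. \<bar>?D x h\<bar> \<le> B * norm h" "\<And>x y. \<bar>?\<rho> x - ?\<rho> y\<bar> \<le> B * norm (x - y)"
        using test_function_bounds[OF \<rho>] by blast
      have far: "norm (x - z) > 2 * e" if "norm z > norm x + 2 * e" for z
        using that norm_triangle_ineq2[of z x] by (simp add: norm_minus_commute)
      note d0 = integral_directional_derivative_eq_0[OF gder, of B B "norm x + 2 * e" "u r x"]
      have d1: "integrable lborel (\<lambda>z. - ?D (x - z) (u r x))" "(LINT z|lborel. - ?D (x - z) (u r x)) = 0"
      proof -
        have 1: "\<bar>?g y - ?g z\<bar> \<le> B * norm (y - z)" for y z using B(4)[of "x - y" "x - z"] by (simp add: norm_minus_commute)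
        have 2: "?g z = 0" if "norm z > norm x + 2 * e" for z using plane_bump_zero[OF e(1)] far[OF that] by simp
        show "integrable lborel (\<lambda>z. - ?D (x - z) (u r x))" "(LINT z|lborel. - ?D (x - z) (u r x)) = 0"
          using d0[OF 1 B(2) 2] by auto
      qed
      have "?g = (\<lambda>z. ?\<rho> (z - x))" using plane_bump_even[of e "x - _"] by (simp add: fun_eq_iff)
      then have "?g \<in> test_functions" using plane_bump_test[OF e(1), of x] by simp
      then have "(LINT z|lborel. u r z \<bullet> grad ?g z) = 0"
        using u_curve unfolding C0_curve_div_def C0_div_def by blast
      then have d2: "(LINT z|lborel. - ?D (x - z) (u r z)) = 0" by (simp add: inner_grad[OF gder])
      have d3: "integrable lborel (\<lambda>z. - ?D (x - z) (u r z))"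
      proof (rule integrable_compact_support[of _ "c / e * ?M" "norm x + 2 * e"])
        show "(\<lambda>z. - ?D (x - z) (u r z)) \<in> borel_measurable borel"
          by (intro borel_measurable_continuous_onI continuous_on_minus test_function_deriv_continuous[OF \<rho>] continuous_intros u_continuous)
        show "norm (- ?D (x - z) (u r z)) \<le> c / e * ?M" for z
        proof -
          have "\<bar>?D (x - z) (u r z)\<bar> \<le> c / e * norm (u r z)" by (rule c(2)[OF e(1)])
          also have "\<dots> \<le> c / e * ?M" using c(1) e(1) by (intro mult_left_mono u_le[OF r1]) auto
          finally show ?thesis by simp
        qed
        show "- ?D (x - z) (u r z) = 0" if "norm z > norm x + 2 * e" for z
          using plane_bump_deriv_zero[OF e(1) far[OF that]] by simp
      qed
      have "?k x z = - ?D (x - z) (u r z) - - ?D (x - z) (u r x)" for z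
        by (simp add: linear_diff[OF has_derivative_linear[OF der]])
      then show ?thesis using Bochner_Integration.integral_diff[OF d3 d1(1)] d1(2) d2 by simp
    qed
    \<comment> \<open>The factor 0 is the mean of the kernel just computed, in the role of
      \<open>N\<close> in \<open>commutator_bound\<close>.\<close>
    have "\<bar>(LINT z|lborel. \<psi> r z * P' r z) - 0 * sint (q r) (\<psi> r)\<bar> \<le> tv (q r) * (\<omega> * B2 * (pi * d\<^sup>2))"
      unfolding P'_def
      by (rule commutator_bound[OF q_signed Dc bound d(1) zero int0 \<psi>c \<psi>0[OF r] \<psi>\<omega>[OF r]]) (auto intro: continuous_intros)
    also have "\<dots> \<le> Q * (\<omega> * B2 * (pi * d\<^sup>2))" using Q[OF r1] \<omega>0 B20 by (intro mult_right_mono) auto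
    finally show ?thesis unfolding H'_def cov[OF P'c[OF r1]] by simp
  qed
  have Hest: "\<bar>H r - N * sint (q r) (\<psi> r)\<bar> \<le> Q * (\<omega> * (pi * d\<^sup>2))" if r: "r \<in> closed_segment s t" for r
  proof -
    have r1: "\<bar>r\<bar> \<le> T + 1" using seg(1)[OF r] by simp
    let ?k = "\<lambda>x z. ?\<rho> (x - z)"
    have zero: "?k x z = 0" if "norm (x - z) > d" for x z using plane_bump_zero[OF e(1)] that e(2) by simp
    have bound: "\<bar>?k x z\<bar> \<le> 1" for x z using plane_bump_bounds[of e "x - z"] by simp
    have int: "(LINT z|lborel. ?k x z) = N" for x
    proof -
      have "N = (LINT z|distr lborel borel ((+) (- x)). ?\<rho> z)" by (simp add: N_def lborel_distr_plus)
      also have "\<dots> = (LINT z|lborel. ?\<rho> (- x + z))"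
        by (intro integral_distr borel_measurable_continuous_onI \<rho>c) auto
      also have "\<dots> = (LINT z|lborel. ?k x z)" using plane_bump_even[of e "x - _"] by simp
      finally show ?thesis by simp
    qed
    have "\<bar>(LINT z|lborel. \<psi> r z * P r z) - N * sint (q r) (\<psi> r)\<bar> \<le> tv (q r) * (\<omega> * 1 * (pi * d\<^sup>2))"
      unfolding P_def
      by (rule commutator_bound[OF q_signed \<rho>sub bound d(1) zero int \<psi>c \<psi>0[OF r] \<psi>\<omega>[OF r]]) (auto intro: continuous_intros)
    also have "\<dots> \<le> Q * (\<omega> * 1 * (pi * d\<^sup>2))" using Q[OF r1] \<omega>0 by (intro mult_right_mono) auto
    finally show ?thesis unfolding H_def cov[OF Pc] by simp
  qed
  have "norm (H t - H s) \<le> Q * (\<omega> * B2 * (pi * d\<^sup>2)) * norm (t - s)"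
  proof (rule field_differentiable_bound[OF convex_closed_segment[of s t]])
    show "(H has_field_derivative H' r) (at r within closed_segment s t)" if "r \<in> closed_segment s t" for r
      by (rule has_field_derivative_at_within[OF Hder[OF seg(1)[OF that]]])
  qed (use H'le in auto)
  then have "\<bar>N * sint (q t) (\<psi> t) - N * sint (q s) (\<psi> s)\<bar> \<le>
      Q * (\<omega> * (pi * d\<^sup>2)) + Q * (\<omega> * B2 * (pi * d\<^sup>2)) * \<bar>t - s\<bar> + Q * (\<omega> * (pi * d\<^sup>2))"
    using Hest[OF ends_in_segment(2)] Hest[OF ends_in_segment(1)] unfolding real_norm_def by linarith
  also have "\<dots> = (pi * d\<^sup>2) * ((Q * \<omega>) * (2 + B2 * \<bar>t - s\<bar>))" by (simp add: algebra_simps)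
  finally have main: "\<bar>N * (sint (q t) (\<psi> t) - sint (q s) (\<psi> s))\<bar> \<le> (pi * d\<^sup>2) * ((Q * \<omega>) * (2 + B2 * \<bar>t - s\<bar>))"
    by (simp add: right_diff_distrib)
  let ?X = "\<bar>sint (q t) (\<psi> t) - sint (q s) (\<psi> s)\<bar>"
  \<comment> \<open>Here e / 2 = d / 4. The area factor pi d^2 cancels against the one in
    \<open>main\<close>, so the estimate does not degenerate as d tends to 0.\<close>
  have "N \<ge> exp (- 8) * (pi * d\<^sup>2) / 16"
    using plane_bump_integral_ge[OF e(1)] by (simp add: N_def e_def power_divide)
  moreover have "exp (- 8) * (pi * d\<^sup>2) / 16 \<ge> 0" by simp
  ultimately have "exp (- 8) * (pi * d\<^sup>2) / 16 * ?X \<le> \<bar>N\<bar> * ?X" by (intro mult_right_mono abs_ge_zero) linarith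
  also have "\<dots> \<le> (pi * d\<^sup>2) * ((Q * \<omega>) * (2 + B2 * \<bar>t - s\<bar>))" using main by (simp add: abs_mult)
  finally have "(pi * d\<^sup>2) * (exp (- 8) / 16 * ?X) \<le> (pi * d\<^sup>2) * ((Q * \<omega>) * (2 + B2 * \<bar>t - s\<bar>))" by (simp add: mult_ac)
  then have "exp (- 8) / 16 * ?X \<le> (Q * \<omega>) * (2 + B2 * \<bar>t - s\<bar>)"
    by (rule mult_left_le_imp_le) (use d in simp)
  then have "(16 * exp 8) * (exp (- 8) / 16 * ?X) \<le> (16 * exp 8) * ((Q * \<omega>) * (2 + B2 * \<bar>t - s\<bar>))" by (intro mult_left_mono) auto
  also have "(16 * exp 8) * (exp (- 8) / 16 * ?X) = ?X" by (simp add: exp_minus)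
  finally have "?X \<le> 16 * exp 8 * (Q * \<omega>) * (2 + B2 * \<bar>t - s\<bar>)" by (simp only: mult.assoc)
  moreover have "\<psi> s = f" by (simp add: fun_eq_iff \<psi>_def F_def \<eta>_inverse)
  moreover have "\<psi> t = (\<lambda>x. f (\<eta> s (inv (\<eta> t) x)))" by (simp add: fun_eq_iff \<psi>_def F_def)
  ultimately show ?thesis unfolding B2_def \<omega>_def d_def by simp
qed

end

end

context weak_vortex_flow
begin

context
  fixes T Q :: real
  assumes T: "T \<ge> 0" and Q: "\<And>t. \<bar>t\<bar> \<le> T + 1 \<Longrightarrow> tv (q t) \<le> Q"
begin

text \<open>The bound of \<open>transport_estimate\<close> is O(h \<open>log_mod\<close> (h^2)) with
  \<open>h\<close> arbitrarily small, so the pairings agree for every compactly supported Lipschitz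
  function, and these determine the measure.\<close>

lemma transport_short:
  assumes s: "\<bar>s\<bar> \<le> T" and t: "\<bar>t\<bar> \<le> T" and short: "Q * kern_const \<alpha> * \<bar>t - s\<bar> \<le> 1 / 2"
  shows "pushforward (\<lambda>x. \<eta> s (inv (\<eta> t) x)) (q t) = q s"
proof (rule signed_measure_eqI_C0)
  have c: "continuous_on UNIV (\<lambda>x. \<eta> s (inv (\<eta> t) x))"
    by (intro continuous_on_compose2[OF continuous_\<eta>(1)] continuous_\<eta>) auto
  then have m: "(\<lambda>x. \<eta> s (inv (\<eta> t) x)) \<in> borel_measurable borel" by (rule borel_measurable_continuous_onI)
  show "is_signed_measure (pushforward (\<lambda>x. \<eta> s (inv (\<eta> t) x)) (q t))" by (rule signed_measure_pushforward[OF q_signed m])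
  fix f :: "plane \<Rightarrow> real" and R B
  assume f: "continuous_on UNIV f" "\<And>x. norm x > R \<Longrightarrow> f x = 0" "\<And>x y. \<bar>f x - f y\<bar> \<le> B * norm (x - y)"
  obtain c where c: "c \<ge> 0" "\<And>e x h. e > 0 \<Longrightarrow> \<bar>frechet_derivative (plane_bump e) (at x) h\<bar> \<le> c / e * norm h"
    using plane_bump_deriv_bound by blast
  let ?X = "\<bar>sint (q t) (\<lambda>x. f (\<eta> s (inv (\<eta> t) x))) - sint (q s) f\<bar>"
  define C where "C = 4 * c * (Q * kern_const \<alpha>) * \<bar>t - s\<bar>"
  define h where "h n = 1 / real (Suc n)" for n
  have le: "?X \<le> 16 * exp 8 * (Q * (3 * B)) * (h n * 2 + C * (h n * log_mod ((h n)\<^sup>2)))" for n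
  proof -
    have "0 < h n" "h n \<le> 1" by (auto simp: h_def)
    from transport_estimate[OF T Q s t short f c this]
    have "?X \<le> 16 * exp 8 * (Q * (3 * B * h n)) * (2 + 4 * c * (Q * kern_const \<alpha>) * log_mod ((h n)\<^sup>2) * \<bar>t - s\<bar>)" .
    also have "\<dots> = 16 * exp 8 * (Q * (3 * B)) * (h n * 2 + C * (h n * log_mod ((h n)\<^sup>2)))"
      by (simp add: C_def algebra_simps)
    finally show ?thesis .
  qed
  have h0: "h \<longlonglongrightarrow> 0" unfolding h_def by (rule LIMSEQ_Suc[OF lim_1_over_n])
  have "h n * log_mod ((h n)\<^sup>2) = h n + 2 * (ln (real (Suc n)) / real (Suc n))" for n
    by (simp add: h_def log_mod_def ln_realpow ln_inverse power_divide divide_inverse algebra_simps)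
  moreover have "(\<lambda>n. h n + 2 * (ln (real (Suc n)) / real (Suc n))) \<longlonglongrightarrow> 0 + 2 * 0"
    by (intro tendsto_intros h0 LIMSEQ_Suc[OF lim_ln_over_n])
  ultimately have "(\<lambda>n. h n * log_mod ((h n)\<^sup>2)) \<longlonglongrightarrow> 0" by simp
  then have "(\<lambda>n. 16 * exp 8 * (Q * (3 * B)) * (h n * 2 + C * (h n * log_mod ((h n)\<^sup>2)))) \<longlonglongrightarrow>
      16 * exp 8 * (Q * (3 * B)) * (0 * 2 + C * 0)"
    by (intro tendsto_intros h0)
  then have "?X \<le> 16 * exp 8 * (Q * (3 * B)) * (0 * 2 + C * 0)"
    by (rule LIMSEQ_le_const) (use le in blast)
  then have "sint (q t) (\<lambda>x. f (\<eta> s (inv (\<eta> t) x))) = sint (q s) f" by simp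
  then show "sint (pushforward (\<lambda>x. \<eta> s (inv (\<eta> t) x)) (q t)) f = sint (q s) f"
    using sint_pushforward[OF q_signed m C0_vanishing_bounded_borel[OF C0_vanishingI_compact_support[OF f(1,2)]]] by simp
qed (rule q_signed)

text \<open>Chains \<open>n\<close> equal intervals, where \<open>n\<close> exceeds 2 Q
  \<open>kern_const \<alpha>\<close> |t|, so that each is short enough for
  \<open>transport_short\<close>.\<close>

lemma transport_bounded:
  assumes t: "\<bar>t\<bar> \<le> T"
  shows "q t = pushforward (\<eta> t) q0"
proof -
  have L0: "Q * kern_const \<alpha> \<ge> 0" by (intro mult_nonneg_nonneg Q_nonneg[OF T Q] kern_const_nonneg[OF \<alpha>])
  obtain n :: nat where n: "2 * (Q * kern_const \<alpha> * \<bar>t\<bar>) < real n" using reals_Archimedean2 by blast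
  then have n0: "real n > 0" using mult_nonneg_nonneg[OF L0 abs_ge_zero[of t]] by linarith
  define p where "p k = t * (real k / real n)" for k
  have pT: "\<bar>p k\<bar> \<le> T" if "k \<le> n" for k
  proof -
    have "\<bar>t\<bar> * (real k / real n) \<le> \<bar>t\<bar> * 1" using that n0 by (intro mult_left_mono) auto
    then show ?thesis using t by (simp add: p_def abs_mult)
  qed
  have "q (p k) = pushforward (\<eta> (p k)) q0" if "k \<le> n" for k
    using that
  proof (induction k)
    case 0
    show ?case using pushforward_comp_id[OF q_signed[of 0], of "\<eta> 0"] pushforward_id[OF q_signed[of 0]] by (simp add: p_def \<eta>_0 q_0)
  next
    case (Suc k)
    have m: "\<eta> s \<in> borel_measurable borel" "inv (\<eta> s) \<in> borel_measurable borel" for s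
      by (auto intro: borel_measurable_continuous_onI continuous_\<eta>)
    have diff: "\<bar>p k - p (Suc k)\<bar> = \<bar>t\<bar> / real n"
      using n0 by (simp add: p_def add_divide_distrib distrib_left abs_mult)
    have "Q * kern_const \<alpha> * (\<bar>t\<bar> / real n) \<le> 1 / 2" using n n0 by (simp add: divide_le_eq)
    then have "Q * kern_const \<alpha> * \<bar>p k - p (Suc k)\<bar> \<le> 1 / 2" unfolding diff .
    \<comment> \<open>Here \<open>t\<close> is the known time \<open>p k\<close> and
      \<open>s\<close> the next one, \<open>p (Suc k)\<close>.\<close>
    from transport_short[OF pT pT this] Suc.prems
    have "q (p (Suc k)) = pushforward (\<lambda>x. \<eta> (p (Suc k)) (inv (\<eta> (p k)) x)) (q (p k))" by simp
    also have "\<dots> = pushforward (\<lambda>x. \<eta> (p (Suc k)) (inv (\<eta> (p k)) x)) (pushforward (\<eta> (p k)) q0)"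
      using Suc by simp
    also have "\<dots> = pushforward (\<lambda>x. \<eta> (p (Suc k)) (inv (\<eta> (p k)) (\<eta> (p k) x))) q0"
      using q_signed[of 0] m by (intro pushforward_compose measurable_compose[OF m(2) m(1)]) (simp_all add: q_0)
    also have "\<dots> = pushforward (\<eta> (p (Suc k))) q0" by (simp add: \<eta>_inverse)
    finally show ?case .
  qed
  from this[of n] show ?thesis using n0 by (simp add: p_def)
qed

end

lemma q_transported: "q t = pushforward (\<eta> t) q0"
proof -
  obtain Q where Q: "\<And>s. s \<in> {- (\<bar>t\<bar> + 1)..\<bar>t\<bar> + 1} \<Longrightarrow> tv (q s) \<le> Q"
    using weakly_continuous_curve_tv_bounded[OF wc] by blast
  show ?thesis
    by (rule transport_bounded[of "\<bar>t\<bar>" Q]) (auto intro!: Q simp: abs_le_iff)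
qed

lemma q0_signed: "is_signed_measure q0"
  using q_signed[of 0] by (simp add: q_0)

lemma \<eta>_measurable: "\<eta> t \<in> borel_measurable borel"
  by (rule borel_measurable_continuous_onI[OF continuous_\<eta>(1)])

lemma displacement_bounded: "\<exists>B. \<forall>x. norm (\<eta> t x - x) \<le> B"
proof -
  obtain Q where Q: "\<And>s. s \<in> {- (\<bar>t\<bar> + 1)..\<bar>t\<bar> + 1} \<Longrightarrow> tv (q s) \<le> Q"
    using weakly_continuous_curve_tv_bounded[OF wc] by blast
  have "norm (\<eta> t x - x) \<le> Q * kern_bound \<alpha> * (\<bar>t\<bar> + 1)" for x
    by (rule displacement_le) (auto intro!: Q simp: abs_le_iff)
  then show ?thesis by blast
qed

text \<open>\<open>C1_curve_homeos\<close> provides a uniform time derivative of \<eta>. Pointwise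
  it must be the velocity at the particle, which by transport of the vorticity is the vector field
  at the displacement; so the equation holds in the supremum norm, where uniqueness is
  known.\<close>

lemma displacement_vortex_curve:
  defines "\<xi> \<equiv> \<lambda>t. Bcontfun (\<lambda>x. \<eta> t x - x)"
  shows "apply_bcontfun (\<xi> t) x = \<eta> t x - x" and "vortex_curve \<alpha> q0 \<xi>"
proof -
  have ap: "apply_bcontfun (\<xi> t) = (\<lambda>x. \<eta> t x - x)" for t
    unfolding \<xi>_def
  proof (rule Bcontfun_inverse)
    show "(\<lambda>x. \<eta> t x - x) \<in> bcontfun"
      using displacement_bounded[of t] by (auto intro!: bcontfun_normI continuous_intros continuous_\<eta>)
  qed
  then show "apply_bcontfun (\<xi> t) x = \<eta> t x - x" by simp
  have V: "apply_bcontfun (vfield (kern \<alpha>) q0 (\<xi> t)) x = u t (\<eta> t x)" for t x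
  proof -
    have b: "bounded_borel (\<lambda>y. kern \<alpha> (\<eta> t x - y))" using kern_integrand_bounded_borel[OF \<alpha> q_signed] .
    have "u t (\<eta> t x) = sint (pushforward (\<eta> t) q0) (\<lambda>y. kern \<alpha> (\<eta> t x - y))"
      unfolding u_eq K_conv_eq[OF \<alpha>] by (simp add: q_transported)
    also have "\<dots> = sint q0 (\<lambda>y. kern \<alpha> (\<eta> t x - \<eta> t y))" by (rule sint_pushforward[OF q0_signed \<eta>_measurable b])
    finally show ?thesis by (simp add: vfield_kern_apply[OF \<alpha> q0_signed] ap)
  qed
  show "vortex_curve \<alpha> q0 \<xi>"
    unfolding vortex_curve_def
  proof
    fix t
    obtain \<eta>' where \<eta>': "uniform_limit UNIV (\<lambda>h x. (\<eta> (t + h) x - \<eta> t x) /\<^sub>R h) (\<eta>' t) (at 0)"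
      using homeos by (auto simp: C1_curve_homeos_def)
    have "\<eta>' t = (\<lambda>x. u t (\<eta> t x))"
    proof
      fix x
      have "((\<lambda>h. (\<eta> (t + h) x - \<eta> t x) /\<^sub>R h) \<longlongrightarrow> \<eta>' t x) (at 0)" by (rule tendsto_uniform_limitI[OF \<eta>']) simp
      then have "((\<lambda>s. \<eta> s x) has_vector_derivative \<eta>' t x) (at t)"
        by (simp add: has_vector_derivative_iff_quotient)
      then show "\<eta>' t x = u t (\<eta> t x)" using \<eta>_deriv vector_derivative_unique_at by blast
    qed
    then have lim: "uniform_limit UNIV (\<lambda>h x. (\<eta> (t + h) x - \<eta> t x) /\<^sub>R h) (\<lambda>x. u t (\<eta> t x)) (at 0)"
      using \<eta>' by metis
    let ?V = "vfield (kern \<alpha>) q0 (\<xi> t)"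
    have "((\<lambda>h. (\<xi> (t + h) - \<xi> t) /\<^sub>R h) \<longlongrightarrow> ?V) (at 0)"
    proof (rule tendstoI)
      fix d :: real assume d: "d > 0"
      then have "\<forall>\<^sub>F h in at 0. \<forall>x\<in>UNIV. dist ((\<eta> (t + h) x - \<eta> t x) /\<^sub>R h) (u t (\<eta> t x)) < d / 2"
        using lim unfolding uniform_limit_iff by (meson half_gt_zero)
      then show "\<forall>\<^sub>F h in at 0. dist ((\<xi> (t + h) - \<xi> t) /\<^sub>R h) ?V < d"
      proof eventually_elim
        case (elim h)
        have "dist ((\<xi> (t + h) - \<xi> t) /\<^sub>R h) ?V \<le> d / 2"
        proof (rule dist_bound)
          fix x
          have eq: "apply_bcontfun ((\<xi> (t + h) - \<xi> t) /\<^sub>R h) x = (\<eta> (t + h) x - \<eta> t x) /\<^sub>R h"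
            by (simp only: ap scaleR_bcontfun.rep_eq minus_bcontfun.rep_eq) simp
          show "dist (apply_bcontfun ((\<xi> (t + h) - \<xi> t) /\<^sub>R h) x) (apply_bcontfun ?V x) \<le> d / 2"
            unfolding eq V using elim[rule_format, of x] by simp
        qed
        then show ?case using d by simp
      qed
    qed
    then show "(\<xi> has_vector_derivative ?V) (at t)"
      by (simp add: has_vector_derivative_iff_quotient)
  qed
qed

end

lemma weak_vortex_flow_unique:
  assumes "weak_vortex_flow \<alpha> q0 \<eta> u q"
  shows "\<eta> = vflow \<alpha> q0" "u = (\<lambda>t. K_conv \<alpha> (pushforward (vflow \<alpha> q0 t) q0))" "q = (\<lambda>t. pushforward (vflow \<alpha> q0 t) q0)"
proof -
  interpret weak_vortex_flow \<alpha> q0 \<eta> u q by (rule assms)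
  let ?\<xi> = "\<lambda>t. Bcontfun (\<lambda>x. \<eta> t x - x)"
  have "?\<xi> 0 = vdisp \<alpha> q0 0"
    using displacement_vortex_curve(1)[of 0] by (intro bcontfun_eqI) (simp add: \<eta>_0 vdisp(1)[OF \<alpha> q0_signed])
  then have "?\<xi> t = vdisp \<alpha> q0 t" for t
    by (rule vortex_curve_unique[OF \<alpha> q0_signed displacement_vortex_curve(2) vdisp(2)[OF \<alpha> q0_signed]])
  then have "\<eta> t x = vflow \<alpha> q0 t x" for t x
    using displacement_vortex_curve(1)[of t x] by (simp add: vflow_def)
  then show \<eta>: "\<eta> = vflow \<alpha> q0" by (simp add: fun_eq_iff)
  show "q = (\<lambda>t. pushforward (vflow \<alpha> q0 t) q0)" by (rule ext) (simp add: q_transported \<eta>)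
  then show "u = (\<lambda>t. K_conv \<alpha> (pushforward (vflow \<alpha> q0 t) q0))" by (intro ext) (simp add: u_eq)
qed

theorem theorem1:
  fixes \<alpha> :: real and q0 :: "plane set \<Rightarrow> real"
  assumes "\<alpha> > 0" and "q0 \<in> radon_measures"
  shows "(\<exists>!(\<eta>, u, q). weak_solution \<alpha> q0 \<eta> u q \<and>
            C1_curve_homeos \<eta> \<and> C0_curve_div u \<and> weakly_continuous_curve q) \<and>
         (\<forall>\<eta> u q. weak_solution \<alpha> q0 \<eta> u q \<and>
            C1_curve_homeos \<eta> \<and> C0_curve_div u \<and> weakly_continuous_curve q \<longrightarrow>
            (\<forall>t. Ad_star (\<eta> t) (q t) = q0) \<and>
            (\<forall>\<phi>\<in>test_functions. w_ad_star u q \<phi> = 0))"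
proof -
  note \<alpha> = assms(1)
  have sm: "is_signed_measure q0" using assms(2) by (simp add: radon_iff_signed_measure)
  let ?S = "\<lambda>\<eta> u q. weak_solution \<alpha> q0 \<eta> u q \<and> C1_curve_homeos \<eta> \<and> C0_curve_div u \<and> weakly_continuous_curve q"
  let ?q = "\<lambda>t. pushforward (vflow \<alpha> q0 t) q0"
  have ex: "?S (vflow \<alpha> q0) (\<lambda>t. K_conv \<alpha> (?q t)) ?q"
    by (intro conjI vflow_weak_solution[OF \<alpha> sm] vflow_C1_curve[OF \<alpha> sm] flow_u_C0_curve[OF \<alpha> sm] flow_q_weakly_continuous[OF \<alpha> sm])
  have un: "\<eta> = vflow \<alpha> q0 \<and> u = (\<lambda>t. K_conv \<alpha> (?q t)) \<and> q = ?q" if "?S \<eta> u q" for \<eta> u q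
    using weak_vortex_flow_unique[of \<alpha> q0 \<eta> u q] that \<alpha> by (simp add: weak_vortex_flow_def)
  show ?thesis
  proof (intro conjI allI impI ballI)
    show "\<exists>!(\<eta>, u, q). ?S \<eta> u q"
    proof (rule ex1I[of _ "(vflow \<alpha> q0, \<lambda>t. K_conv \<alpha> (?q t), ?q)"])
      show "case (vflow \<alpha> q0, \<lambda>t. K_conv \<alpha> (?q t), ?q) of (\<eta>, u, q) \<Rightarrow> ?S \<eta> u q" using ex by simp
      show "x = (vflow \<alpha> q0, \<lambda>t. K_conv \<alpha> (?q t), ?q)" if "case x of (\<eta>, u, q) \<Rightarrow> ?S \<eta> u q" for x
        using that un by (cases x) auto
    qed
  next
    fix \<eta> u q t assume "?S \<eta> u q"
    \<comment> \<open>By uniqueness the solution is the constructed one, whose vorticity is the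
      push-forward of \<open>q0\<close> by its flow.\<close>
    from un[OF this] show "Ad_star (\<eta> t) (q t) = q0"
      using Ad_star_pushforward[OF sm vflow_homeomorphism[OF \<alpha> sm]] by simp
  next
    fix \<eta> u q and \<phi> :: "real \<times> plane \<Rightarrow> real" assume "?S \<eta> u q" "\<phi> \<in> test_functions"
    then show "w_ad_star u q \<phi> = 0" unfolding weak_solution_def w_ad_star_def by blast
  qed
qed

end
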